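(* Let $\Omega\subset\mathbb{R}^n$ be a bounded domain with $C^2$ boundary, and for $p\in(1,\infty)$ let $H_p$ be the $L^p$ Hardy constant of $\Omega$. Then the function $p\mapsto H_p$ is continuous on $(1,\infty)$.
   Context: A domain is a nonempty open connected set. $d(x)=\mathrm{dist}(x,\partial\Omega)$ for $x\in\Omega$. For $p\in(1,\infty)$, $W^{1,p}_0(\Omega)$ is the closure of $C^\infty_c(\Omega)$ in the Sobolev space $W^{1,p}(\Omega)$. The $L^p$ Hardy constant is $$H_p=\inf_{u\in W^{1,p}_0(\Omega),\,u\neq0}\frac{\int_\Omega|\nabla u|^p\,dx}{\int_\Omega \frac{|u|^p}{d^p}\,dx}.$$ *)

theory Defs
  imports "HOL-Analysis.Analysis"
begin

text \<open>\<open>C_on k S f\<close> says that \<open>f\<close> is of class \<open>C\<^sup>k\<close>; it is meant for open \<open>S\<close> only.\<close>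

fun C_on :: "nat \<Rightarrow> 'a::euclidean_space set \<Rightarrow> ('a \<Rightarrow> real) \<Rightarrow> bool" where
  "C_on 0 S f \<longleftrightarrow> continuous_on S f"
| "C_on (Suc k) S f \<longleftrightarrow>
     (\<forall>x\<in>S. f differentiable (at x)) \<and> (\<forall>v. C_on k S (\<lambda>x. frechet_derivative f (at x) v))"

text \<open>
  Near each boundary point, \<open>\<Omega>\<close> is the strict epigraph of a \<open>C\<^sup>2\<close> function over the
  hyperplane orthogonal to some unit vector \<open>\<nu>\<close>, the last coordinate axis after a rotation.
  Only the values of \<open>\<gamma>\<close> on that hyperplane matter, and a function on the hyperplane is
  \<open>C\<^sup>2\<close> iff it is the restriction of a \<open>C\<^sup>2\<close> function on the whole space (compose with the
  orthogonal projection).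
\<close>

definition C2_boundary :: "'a::euclidean_space set \<Rightarrow> bool" where
  "C2_boundary \<Omega> \<longleftrightarrow>
     (\<forall>x\<in>frontier \<Omega>. \<exists>r>0. \<exists>\<nu> \<gamma>. norm \<nu> = 1 \<and> C_on 2 UNIV \<gamma> \<and>
        \<Omega> \<inter> ball x r = {y \<in> ball x r. \<gamma> (y - (y \<bullet> \<nu>) *\<^sub>R \<nu>) < y \<bullet> \<nu>})"

text \<open>Elements of \<open>C\<^sub>c\<^sup>\<infinity>(\<Omega>)\<close> are represented by their extension by zero to the whole space.\<close>

definition test_functions :: "'a::euclidean_space set \<Rightarrow> ('a \<Rightarrow> real) set" where
  "test_functions \<Omega> =
     {\<phi>. (\<forall>k. C_on k UNIV \<phi>) \<and> compact (closure {x. \<phi> x \<noteq> 0}) \<and> closure {x. \<phi> x \<noteq> 0} \<subseteq> \<Omega>}"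

definition locally_integrable ::
    "'a::euclidean_space set \<Rightarrow> ('a \<Rightarrow> 'b::euclidean_space) \<Rightarrow> bool" where
  "locally_integrable \<Omega> f \<longleftrightarrow> (\<forall>K. compact K \<and> K \<subseteq> \<Omega> \<longrightarrow> integrable (lebesgue_on K) f)"

definition Lp_space :: "real \<Rightarrow> 'a::euclidean_space set \<Rightarrow> ('a \<Rightarrow> 'b::euclidean_space) set" where
  "Lp_space p \<Omega> =
     {f \<in> borel_measurable (lebesgue_on \<Omega>). integrable (lebesgue_on \<Omega>) (\<lambda>x. norm (f x) powr p)}"

definition has_weak_gradient ::
    "'a::euclidean_space set \<Rightarrow> ('a \<Rightarrow> real) \<Rightarrow> ('a \<Rightarrow> 'a) \<Rightarrow> bool" where
  "has_weak_gradient \<Omega> u g \<longleftrightarrow> locally_integrable \<Omega> u \<and> locally_integrable \<Omega> g \<and>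
     (\<forall>\<phi>\<in>test_functions \<Omega>. \<forall>i\<in>Basis.
        (\<integral>x. u x * frechet_derivative \<phi> (at x) i \<partial>lebesgue_on \<Omega>) =
        - (\<integral>x. (g x \<bullet> i) * \<phi> x \<partial>lebesgue_on \<Omega>))"

text \<open>
  Functions are not identified when they agree almost everywhere. The weak gradient is unique
  up to a null set, so the choice of representative below affects none of the integrals.
\<close>

definition weak_gradient :: "'a::euclidean_space set \<Rightarrow> ('a \<Rightarrow> real) \<Rightarrow> 'a \<Rightarrow> 'a" where
  "weak_gradient \<Omega> u = (SOME g. has_weak_gradient \<Omega> u g)"

definition sobolev :: "real \<Rightarrow> 'a::euclidean_space set \<Rightarrow> ('a \<Rightarrow> real) set" where
  "sobolev p \<Omega> =
     {u \<in> Lp_space p \<Omega>. (\<exists>g. has_weak_gradient \<Omega> u g) \<and> weak_gradient \<Omega> u \<in> Lp_space p \<Omega>}"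

definition sobolev_norm :: "real \<Rightarrow> 'a::euclidean_space set \<Rightarrow> ('a \<Rightarrow> real) \<Rightarrow> real" where
  "sobolev_norm p \<Omega> u =
     ((\<integral>x. \<bar>u x\<bar> powr p \<partial>lebesgue_on \<Omega>) +
      (\<integral>x. norm (weak_gradient \<Omega> u x) powr p \<partial>lebesgue_on \<Omega>)) powr (1 / p)"

definition sobolev_zero :: "real \<Rightarrow> 'a::euclidean_space set \<Rightarrow> ('a \<Rightarrow> real) set" where
  "sobolev_zero p \<Omega> =
     {u \<in> sobolev p \<Omega>. \<forall>\<epsilon>>0. \<exists>\<phi>\<in>test_functions \<Omega>. sobolev_norm p \<Omega> (\<lambda>x. u x - \<phi> x) < \<epsilon>}"

text \<open>
  The quotients are formed in \<open>[0,\<infinity>]\<close>, so that \<open>u\<close> with \<open>\<integral> \<bar>u\<bar>\<^sup>p / d\<^sup>p = \<infinity>\<close> contributes \<open>0\<close>.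
  For \<open>u \<noteq> 0\<close> the numerator is finite and the denominator is positive, hence for a nonempty
  bounded open \<open>\<Omega>\<close> the infimum is finite and \<^const>\<open>enn2real\<close> loses nothing.
\<close>

definition hardy_constant :: "'a::euclidean_space set \<Rightarrow> real \<Rightarrow> real" where
  "hardy_constant \<Omega> p =
     enn2real (INF u \<in> {u \<in> sobolev_zero p \<Omega>. \<not> (AE x in lebesgue_on \<Omega>. u x = 0)}.
       (\<integral>\<^sup>+x. ennreal (norm (weak_gradient \<Omega> u x) powr p) \<partial>lebesgue_on \<Omega>) /
       (\<integral>\<^sup>+x. ennreal (\<bar>u x\<bar> powr p / infdist x (frontier \<Omega>) powr p) \<partial>lebesgue_on \<Omega>))"

end

theory Submission
imports Defs
begin

text \<open>
  \<open>H p\<close> is the infimum of \<open>energy p \<phi> / mass p \<phi>\<close> over test functions \<open>\<phi>\<close>, and every such quotient is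
  continuous in \<open>p\<close>, so \<open>H\<close> is upper semicontinuous. An exponent \<open>s > p\<close> is compared with \<open>p\<close> through
  the competitor \<open>\<bar>\<phi>\<bar> powr (s/p) * d powr (1 - s/p)\<close>, whose \<open>p\<close>-mass is the \<open>s\<close>-mass of \<open>\<phi>\<close>; this needs
  no regularity of the boundary. For \<open>s < p\<close> the danger is that almost minimisers for \<open>s\<close> concentrate
  at the boundary. There the \<open>C\<^sup>1\<close> boundary gives \<open>d (x + h N) \<ge> d x + (1 - \<epsilon>) h\<close> for a local inward
  normal \<open>N\<close>, and integrating a translated negative power of \<open>d\<close> yields the Hardy inequality with a
  constant close to that of the half-line, \<open>((s - 1)/s) powr s\<close>. As \<open>H p \<le> ((p - 1)/p) powr p\<close>,
  concentration at the boundary cannot lower the quotient below \<open>H p\<close>. Away from the boundary, a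
  mollification at a fixed scale is uniformly bounded with its gradient, so that the exponents \<open>s\<close>
  and \<open>p\<close> become interchangeable.
\<close>

section \<open>Smooth functions\<close>

text \<open>The asymmetry between the two sides comes from integrability. For s > p the competitor's
  gradient carries |\<nabla>\<phi>| to the power p only, which Young's inequality bounds by s-th
  powers. For s < p the same substitution would need a power of |\<nabla>\<phi>| above s, and
  |\<phi>| powr (s/p) is not differentiable at zeros of \<phi>; hence the regularisation. Its error
  in mass is a power of the scale times the energy, so the scale can be fixed before s tends to p,
  uniformly over functions of bounded energy: no minimiser and no compactness in function spaces is
  involved. Separating interior and boundary by a cutoff at depth b costs a gradient of size 1/b,
  comparable to 1/d on its shell, so the cost is a multiple of the mass of the shell; among many
  disjoint shells one has little mass. The half-line constant is the maximum over \<mu> of \<mu>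
  powr (s - 1) * (s - 1) * (1 - \<mu>), reached at \<mu> = (s - 1)/s. As d is only Lipschitz,
  competitors built from it are handled through pointwise upper gradients and mollified back into
  test functions.\<close>

definition smooth :: "('a::euclidean_space \<Rightarrow> real) \<Rightarrow> bool" where
  "smooth f \<longleftrightarrow> (\<forall>k. C_on k UNIV f)"

text \<open>Induction on the order k over all members of the class at once, since
  \<open>C_on\<close> peels off one derivative at a time. It replaces formulas for higher
  derivatives: smoothness follows from a class closed under directional derivatives.\<close>

lemma smooth_coinduct:
  assumes "P f"
    and "\<And>f x. P f \<Longrightarrow> f differentiable (at x)"
    and "\<And>f v. P f \<Longrightarrow> P (\<lambda>x. frechet_derivative f (at x) v)"
  shows "smooth f"
proof -
  have "C_on k UNIV f" if "P f" for k f
    using that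
  proof (induction k arbitrary: f)
    case 0
    then show ?case
      using assms(2) by (auto simp: continuous_on_eq_continuous_at intro: differentiable_imp_continuous_within)
  next
    case (Suc k)
    then show ?case using assms(2,3) by auto
  qed
  then show ?thesis using assms(1) by (auto simp: smooth_def)
qed

lemma smooth_differentiable: "smooth f \<Longrightarrow> f differentiable (at x)"
  unfolding smooth_def by (metis C_on.simps(2) UNIV_I)

lemma smooth_frechet_derivative: "smooth f \<Longrightarrow> smooth (\<lambda>x. frechet_derivative f (at x) v)"
  unfolding smooth_def by (metis C_on.simps(2))

lemma smooth_continuous_on: "smooth f \<Longrightarrow> continuous_on A f"
  unfolding smooth_def by (metis C_on.simps(1) continuous_on_subset subset_UNIV)

lemma frechet_derivative_eqI:
  "(f has_derivative f') (at x) \<Longrightarrow> frechet_derivative f (at x) v = f' v"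
  using frechet_derivative_at by fastforce

lemma smooth_has_derivative:
  "smooth f \<Longrightarrow> (f has_derivative frechet_derivative f (at x)) (at x)"
  using smooth_differentiable frechet_derivative_works by blast

lemma smooth_const: "smooth (\<lambda>x. c)"
  by (rule smooth_coinduct[of "\<lambda>f. \<exists>c. f = (\<lambda>x. c)"]) (auto simp: frechet_derivative_eqI)

lemma smooth_inner: "smooth (\<lambda>x. x \<bullet> a)"
proof (rule smooth_coinduct[of "\<lambda>f. smooth f \<or> f = (\<lambda>x. x \<bullet> a)"])
  fix f :: "'a \<Rightarrow> real" and v
  assume "smooth f \<or> f = (\<lambda>x. x \<bullet> a)"
  moreover have "(\<lambda>x. frechet_derivative (\<lambda>x. x \<bullet> a) (at x) v) = (\<lambda>x. v \<bullet> a)"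
    by (intro ext frechet_derivative_eqI) (auto intro!: derivative_eq_intros)
  ultimately show "smooth (\<lambda>x. frechet_derivative f (at x) v) \<or>
      (\<lambda>x. frechet_derivative f (at x) v) = (\<lambda>x. x \<bullet> a)"
    using smooth_frechet_derivative smooth_const by (metis (no_types))
qed (auto intro: smooth_differentiable)

text \<open>The flat function exp(-1/t), multiplied by a power of 1/t. The powers are carried along
  because differentiation only shifts the exponent m, so the family is closed under derivatives up
  to linear combinations.\<close>

definition flat_exp :: "nat \<Rightarrow> real \<Rightarrow> real" where
  "flat_exp m t = (if t > 0 then exp (- inverse t) * inverse t ^ m else 0)"

lemma flat_exp_has_derivative:
  "(flat_exp m has_real_derivative flat_exp (m + 2) t - real m * flat_exp (m + 1) t) (at t)"
proof -
  consider "t > 0" | "t < 0" | "t = 0" by linarith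
  then show ?thesis
  proof cases
    case 1
    have "((\<lambda>t. exp (- inverse t) * inverse t ^ m) has_real_derivative
        exp (- inverse t) * (inverse t)\<^sup>2 * inverse t ^ m +
        exp (- inverse t) * (real m * inverse t ^ (m - 1) * (- (inverse t)\<^sup>2))) (at t)"
      using 1 by (auto intro!: derivative_eq_intros simp: power2_eq_square)
    also have "exp (- inverse t) * (inverse t)\<^sup>2 * inverse t ^ m +
        exp (- inverse t) * (real m * inverse t ^ (m - 1) * (- (inverse t)\<^sup>2)) =
        flat_exp (m + 2) t - real m * flat_exp (m + 1) t"
      using 1 by (cases m) (simp_all add: flat_exp_def power2_eq_square algebra_simps)
    finally show ?thesis
      by (rule has_field_derivative_transform_within_open[where S = "{0<..}"])
        (use 1 in \<open>auto simp: flat_exp_def\<close>)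
  next
    case 2
    have "((\<lambda>t. 0) has_real_derivative flat_exp (m + 2) t - real m * flat_exp (m + 1) t) (at t)"
      using 2 by (auto simp: flat_exp_def)
    then show ?thesis
      by (rule has_field_derivative_transform_within_open[where S = "{..<0}"])
        (use 2 in \<open>auto simp: flat_exp_def\<close>)
  next
    case 3
    \<comment> \<open>At 0 the difference quotient from the right is s^(m+1) e^(-s) with s = 1/h,
      which tends to 0 at infinity; from the left it is identically 0.\<close>
    have "((\<lambda>s. s ^ (m + 1) * exp (- s)) \<longlongrightarrow> (0::real)) at_top"
      using tendsto_power_div_exp_0[of "m + 1"] by (simp add: exp_minus divide_inverse)
    then have "((\<lambda>s. inverse s ^ (m + 1) * exp (- inverse s)) \<longlongrightarrow> (0::real)) (at_right 0)"
      by (rule filterlim_compose) (rule filterlim_inverse_at_top_right)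
    then have R: "((\<lambda>h. flat_exp m h / h) \<longlongrightarrow> 0) (at_right 0)"
      by (rule Lim_transform_eventually)
        (auto simp: eventually_at_filter flat_exp_def divide_inverse mult_ac)
    have "((\<lambda>h. flat_exp m h / h) \<longlongrightarrow> 0) (at_left 0)"
      by (rule Lim_transform_eventually[OF tendsto_const])
        (auto simp: eventually_at_filter flat_exp_def)
    with R have "((\<lambda>h. flat_exp m h / h) \<longlongrightarrow> 0) (at 0)"
      by (simp add: filterlim_at_split)
    then show ?thesis using 3
      by (simp add: DERIV_def flat_exp_def)
  qed
qed

text \<open>The algebra generated by the smooth functions and composition with \<^const>\<open>flat_exp\<close>: its members
  are smooth because it is closed under directional derivatives.\<close>

inductive bump_alg :: "('a::euclidean_space \<Rightarrow> real) \<Rightarrow> bool" where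
  base: "smooth f \<Longrightarrow> bump_alg f"
| add: "bump_alg f \<Longrightarrow> bump_alg g \<Longrightarrow> bump_alg (\<lambda>x. f x + g x)"
| mult: "bump_alg f \<Longrightarrow> bump_alg g \<Longrightarrow> bump_alg (\<lambda>x. f x * g x)"
| flat: "bump_alg f \<Longrightarrow> bump_alg (\<lambda>x. flat_exp m (f x))"

lemma flat_exp_compose_has_derivative:
  "(f has_derivative f') (at x) \<Longrightarrow> ((\<lambda>x. flat_exp m (f x)) has_derivative
     (\<lambda>v. (flat_exp (m + 2) (f x) - real m * flat_exp (m + 1) (f x)) * f' v)) (at x)"
  using has_derivative_compose[OF _ flat_exp_has_derivative[unfolded has_field_derivative_def]]
  by fastforce

lemma bump_alg_differentiable: "bump_alg f \<Longrightarrow> f differentiable (at x)"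
proof (induction rule: bump_alg.induct)
  case (flat f m)
  then show ?case using flat_exp_compose_has_derivative unfolding differentiable_def by blast
qed (auto intro: smooth_differentiable differentiable_add differentiable_mult)

lemma bump_alg_smooth: "bump_alg f \<Longrightarrow> smooth f"
proof (rule smooth_coinduct[of bump_alg])
  show "bump_alg (\<lambda>x. frechet_derivative f (at x) v)" if "bump_alg f" for f :: "'a \<Rightarrow> real" and v
    using that
  proof (induction rule: bump_alg.induct)
    case (base f)
    then show ?case by (intro bump_alg.base smooth_frechet_derivative)
  next
    case (add f g)
    have "(\<lambda>x. frechet_derivative (\<lambda>x. f x + g x) (at x) v) =
      (\<lambda>x. frechet_derivative f (at x) v + frechet_derivative g (at x) v)"
      using add.hyps bump_alg_differentiable
      by (intro ext frechet_derivative_eqI has_derivative_add) (auto simp: frechet_derivative_works)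
    then show ?case using add by (simp add: bump_alg.add)
  next
    case (mult f g)
    have "(\<lambda>x. frechet_derivative (\<lambda>x. f x * g x) (at x) v) =
      (\<lambda>x. f x * frechet_derivative g (at x) v + frechet_derivative f (at x) v * g x)"
      using mult.hyps bump_alg_differentiable
      by (intro ext frechet_derivative_eqI has_derivative_mult) (auto simp: frechet_derivative_works)
    then show ?case using mult by (simp add: bump_alg.add bump_alg.mult)
  next
    case (flat f m)
    have eq: "(\<lambda>x. frechet_derivative (\<lambda>x. flat_exp m (f x)) (at x) v) =
      (\<lambda>x. (flat_exp (m + 2) (f x) + (- real m) * flat_exp (m + 1) (f x)) * frechet_derivative f (at x) v)"
      using flat.hyps bump_alg_differentiable
      by (intro ext frechet_derivative_eqI has_derivative_eq_rhs[OF flat_exp_compose_has_derivative])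
        (auto simp: frechet_derivative_works)
    show ?case unfolding eq
      by (intro bump_alg.add bump_alg.mult bump_alg.flat bump_alg.base[OF smooth_const] flat)
  qed
qed (auto intro: bump_alg_differentiable)

lemma smooth_add: "smooth f \<Longrightarrow> smooth g \<Longrightarrow> smooth (\<lambda>x. f x + g x)"
  by (rule bump_alg_smooth, rule bump_alg.add; erule bump_alg.base)

lemma smooth_mult: "smooth f \<Longrightarrow> smooth g \<Longrightarrow> smooth (\<lambda>x. f x * g x)"
  by (rule bump_alg_smooth, rule bump_alg.mult; erule bump_alg.base)

lemma smooth_flat_exp: "smooth f \<Longrightarrow> smooth (\<lambda>x. flat_exp m (f x))"
  by (rule bump_alg_smooth, rule bump_alg.flat; erule bump_alg.base)

lemma smooth_prod: "(\<And>i. i \<in> I \<Longrightarrow> smooth (f i)) \<Longrightarrow> smooth (\<lambda>x. \<Prod>i\<in>I. f i x)"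
  by (induction I rule: infinite_finite_induct) (auto intro: smooth_const smooth_mult)

lemma smooth_cmult: "smooth f \<Longrightarrow> smooth (\<lambda>x. c * f x)"
  by (intro smooth_mult smooth_const)

lemma smooth_diff: "smooth f \<Longrightarrow> smooth g \<Longrightarrow> smooth (\<lambda>x. f x - g x)"
  using smooth_add[of f "\<lambda>x. (-1) * g x"] smooth_cmult[of g "-1"] by simp

lemma flat_exp_nonneg: "flat_exp m t \<ge> 0"
  by (auto simp: flat_exp_def)

lemma flat_exp_pos_iff: "flat_exp m t > 0 \<longleftrightarrow> t > 0"
  by (auto simp: flat_exp_def)

lemma flat_exp_0_le_1: "flat_exp 0 t \<le> 1"
  by (auto simp: flat_exp_def)

lemma flat_exp_eq_0_iff: "flat_exp m t = 0 \<longleftrightarrow> t \<le> 0"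
  by (auto simp: flat_exp_def)

text \<open>A product over the coordinates with one factor for each of the two faces; every factor
  is positive exactly on the inner side of its face.\<close>

lemma box_bump:
  fixes a b :: "'a::euclidean_space"
  obtains \<beta> where "smooth \<beta>" "\<And>x. \<beta> x \<ge> 0" "\<And>x. \<beta> x > 0 \<longleftrightarrow> x \<in> box a b"
proof
  let ?\<beta> = "\<lambda>x. \<Prod>i\<in>Basis. flat_exp 0 (x \<bullet> i - a \<bullet> i) * flat_exp 0 (b \<bullet> i - x \<bullet> i)"
  show "smooth ?\<beta>"
  by (rule smooth_prod, rule smooth_mult; rule smooth_flat_exp, rule smooth_diff, (rule smooth_inner smooth_const)+)
  show "?\<beta> x \<ge> 0" for x
    by (intro prod_nonneg) (auto simp: flat_exp_nonneg)
  show "?\<beta> x > 0 \<longleftrightarrow> x \<in> box a b" for x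
  proof
    assume "?\<beta> x > 0"
    then have "flat_exp 0 (x \<bullet> i - a \<bullet> i) * flat_exp 0 (b \<bullet> i - x \<bullet> i) \<noteq> 0" if "i \<in> Basis" for i
      using that by (metis (mono_tags, lifting) finite_Basis less_irrefl prod_zero)
    then show "x \<in> box a b"
      by (fastforce simp: mem_box flat_exp_eq_0_iff)
  qed (auto intro!: prod_pos mult_pos_pos simp: flat_exp_pos_iff mem_box)
qed

text \<open>Smooth approximations of the indicator of a box: compose a bump with \<open>t \<mapsto> exp (-1/(nt))\<close>.\<close>

lemma box_indicator_approx:
  fixes a b :: "'a::euclidean_space"
  obtains \<phi> :: "nat \<Rightarrow> 'a \<Rightarrow> real" where "\<And>n. smooth (\<phi> n)" "\<And>n x. 0 \<le> \<phi> n x" "\<And>n x. \<phi> n x \<le> 1"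
    "\<And>n x. x \<notin> box a b \<Longrightarrow> \<phi> n x = 0" "\<And>x. (\<lambda>n. \<phi> n x) \<longlonglongrightarrow> indicator (box a b) x"
proof -
  obtain \<beta> where \<beta>: "smooth \<beta>" "\<And>x. \<beta> x \<ge> 0" "\<And>x. \<beta> x > 0 \<longleftrightarrow> x \<in> box a b"
    using box_bump[of a b] by blast
  show ?thesis
  proof
    fix x and n :: nat
    show "smooth (\<lambda>x. flat_exp 0 (real n * \<beta> x))"
      by (intro smooth_flat_exp smooth_cmult \<beta>)
    show "x \<notin> box a b \<Longrightarrow> flat_exp 0 (real n * \<beta> x) = 0"
      using \<beta>(2,3)[of x] by (auto simp: flat_exp_def zero_less_mult_iff)
    have "(\<lambda>n. flat_exp 0 (real n * \<beta> x)) \<longlonglongrightarrow> 1" if "x \<in> box a b"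
    proof -
      have pos: "\<beta> x > 0" using that \<beta>(3) by blast
      have "(\<lambda>n. exp (- (inverse (real n) * inverse (\<beta> x)))) \<longlonglongrightarrow> exp (- (0 * inverse (\<beta> x)))"
        by (intro tendsto_intros lim_inverse_n)
      then have "(\<lambda>n. exp (- (inverse (real n) * inverse (\<beta> x)))) \<longlonglongrightarrow> 1" by simp
      then show ?thesis
        by (rule Lim_transform_eventually)
          (use pos in \<open>auto simp: flat_exp_def eventually_at_top_linorder intro!: exI[of _ 1]\<close>)
    qed
    moreover have "flat_exp 0 (real n * \<beta> x) = 0" if "x \<notin> box a b" for n
      using \<beta>(2,3)[of x] that by (auto simp: flat_exp_def zero_less_mult_iff)
    ultimately show "(\<lambda>n. flat_exp 0 (real n * \<beta> x)) \<longlonglongrightarrow> indicator (box a b) x"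
      by (auto simp: indicator_def)
  qed (auto simp: flat_exp_nonneg flat_exp_0_le_1)
qed

section \<open>Gradients of test functions\<close>

definition grad :: "('a::euclidean_space \<Rightarrow> real) \<Rightarrow> 'a \<Rightarrow> 'a" where
  "grad f x = (\<Sum>i\<in>Basis. frechet_derivative f (at x) i *\<^sub>R i)"

lemma grad_inner:
  assumes "f differentiable (at x)"
  shows "frechet_derivative f (at x) v = grad f x \<bullet> v"
proof -
  have lin: "linear (frechet_derivative f (at x))"
    using assms by (rule linear_frechet_derivative)
  have "frechet_derivative f (at x) v = frechet_derivative f (at x) (\<Sum>i\<in>Basis. (v \<bullet> i) *\<^sub>R i)"
    by (simp add: euclidean_representation)
  also have "\<dots> = (\<Sum>i\<in>Basis. (v \<bullet> i) * frechet_derivative f (at x) i)"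
    using lin by (simp add: linear_sum linear_cmul)
  also have "\<dots> = grad f x \<bullet> v"
    unfolding grad_def inner_sum_left by (intro sum.cong) (simp_all add: inner_commute)
  finally show ?thesis .
qed

lemma norm_grad_le:
  assumes "f differentiable (at x)" "\<And>v. \<bar>frechet_derivative f (at x) v\<bar> \<le> C * norm v"
  shows "norm (grad f x) \<le> C"
proof (cases "grad f x = 0")
  case True
  \<comment> \<open>If the gradient vanishes, the claim is that C is nonnegative, which the bound at
    a unit vector gives.\<close>
  obtain i :: 'a where "i \<in> Basis" using nonempty_Basis by blast
  then show ?thesis using True assms(2)[of i] by simp
next
  case False
  have "norm (grad f x) * norm (grad f x) \<le> C * norm (grad f x)"
    using assms(2)[of "grad f x"] by (simp add: grad_inner[OF assms(1)] power2_norm_eq_inner[symmetric] power2_eq_square)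
  then show ?thesis using False by simp
qed

lemma grad_eqI:
  assumes "(f has_derivative (\<lambda>v. g \<bullet> v)) (at x)"
  shows "grad f x = g"
  unfolding grad_def frechet_derivative_eqI[OF assms]
  by (simp add: euclidean_representation)

text \<open>Bounded Borel functions of bounded support.\<close>

definition bbs :: "('a::euclidean_space \<Rightarrow> real) \<Rightarrow> bool" where
  "bbs f \<longleftrightarrow> f \<in> borel_measurable borel \<and> (\<exists>B. \<forall>x. \<bar>f x\<bar> \<le> B) \<and> bounded {x. f x \<noteq> 0}"

lemma bbs_measurable [measurable_dest]: "bbs f \<Longrightarrow> f \<in> borel_measurable borel"
  by (simp add: bbs_def)

lemma bbs_dominated:
  assumes "bbs f" "g \<in> borel_measurable borel" "\<And>x. \<bar>g x\<bar> \<le> C * \<bar>f x\<bar>"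
  shows "bbs g"
proof -
  obtain B where "\<And>x. \<bar>f x\<bar> \<le> B" using assms(1) by (auto simp: bbs_def)
  then have "C * \<bar>f x\<bar> \<le> \<bar>C\<bar> * B" for x
    by (intro mult_mono) auto
  then have "\<bar>g x\<bar> \<le> \<bar>C\<bar> * B" for x
    using assms(3) order_trans by blast
  moreover have "g x = 0" if "f x = 0" for x
    using assms(3)[of x] that by simp
  then have "{x. g x \<noteq> 0} \<subseteq> {x. f x \<noteq> 0}"
    by auto
  ultimately show ?thesis
    using assms bounded_subset by (auto simp: bbs_def)
qed

lemma bbs_integrable:
  assumes "bbs f"
  shows "integrable lborel f"
proof -
  obtain B where B: "\<And>x. \<bar>f x\<bar> \<le> B" using assms by (auto simp: bbs_def)
  obtain a where a: "{x. f x \<noteq> 0} \<subseteq> cbox (- a) a"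
    using assms bounded_subset_cbox_symmetric by (auto simp: bbs_def)
  show ?thesis
    by (rule integrableI_bounded_set[where A = "cbox (- a) a" and B = B])
      (use assms a B in \<open>auto simp: bbs_def emeasure_lborel_cbox_eq\<close>)
qed

lemma bbs_mult:
  assumes "bbs f" "g \<in> borel_measurable borel" "\<And>x. f x \<noteq> 0 \<Longrightarrow> \<bar>g x\<bar> \<le> C"
  shows "bbs (\<lambda>x. f x * g x)"
proof (rule bbs_dominated[where C = C, OF assms(1)])
  show "(\<lambda>x. f x * g x) \<in> borel_measurable borel"
    using assms by (auto simp: bbs_def)
  show "\<bar>f x * g x\<bar> \<le> C * \<bar>f x\<bar>" for x
    using assms(3)[of x] mult_right_mono[of "\<bar>g x\<bar>" C "\<bar>f x\<bar>"]
    by (cases "f x = 0") (simp_all add: abs_mult mult.commute)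
qed

lemma bbs_mult_bbs: "bbs f \<Longrightarrow> bbs g \<Longrightarrow> bbs (\<lambda>x. f x * g x)"
  using bbs_mult by (metis bbs_def)

lemma bbs_add:
  assumes "bbs f" "bbs g"
  shows "bbs (\<lambda>x. f x + g x)"
proof -
  obtain B C where "\<And>x. \<bar>f x\<bar> \<le> B" "\<And>x. \<bar>g x\<bar> \<le> C" using assms by (auto simp: bbs_def)
  then have "\<bar>f x + g x\<bar> \<le> B + C" for x
    by (meson abs_triangle_ineq add_mono order_trans)
  moreover have "bounded {x. f x + g x \<noteq> 0}"
    by (rule bounded_subset[of "{x. f x \<noteq> 0} \<union> {x. g x \<noteq> 0}"]) (use assms in \<open>auto simp: bbs_def\<close>)
  ultimately show ?thesis using assms by (auto simp: bbs_def)
qed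

lemma bbs_cmult: "bbs f \<Longrightarrow> bbs (\<lambda>x. c * f x)"
  by (rule bbs_dominated[where C = "\<bar>c\<bar>"]) (auto simp: abs_mult bbs_def)

lemma bbs_diff: "bbs f \<Longrightarrow> bbs g \<Longrightarrow> bbs (\<lambda>x. f x - g x)"
  using bbs_add[of f "\<lambda>x. (-1) * g x"] bbs_cmult[of g "-1"] by simp

lemma bbs_abs: "bbs f \<Longrightarrow> bbs (\<lambda>x. \<bar>f x\<bar>)"
  by (rule bbs_dominated[where C = 1]) (auto simp: bbs_def)

lemma bbs_powr:
  assumes "bbs f" "s > 0"
  shows "bbs (\<lambda>x. \<bar>f x\<bar> powr s)"
proof -
  obtain B where "\<And>x. \<bar>f x\<bar> \<le> B" using assms by (auto simp: bbs_def)
  then have "\<bar>f x\<bar> powr s \<le> B powr s" for x using assms by (simp add: powr_mono2)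
  moreover have "{x. \<bar>f x\<bar> powr s \<noteq> 0} = {x. f x \<noteq> 0}" by auto
  ultimately show ?thesis using assms by (auto simp: bbs_def)
qed

lemma bbs_powr': "bbs f \<Longrightarrow> (\<And>x. f x \<ge> 0) \<Longrightarrow> s > 0 \<Longrightarrow> bbs (\<lambda>x. f x powr s)"
  using bbs_powr[of f s] by simp

lemma bbs_translate:
  assumes "bbs f"
  shows "bbs (\<lambda>x. f (a + x))"
proof -
  have "{x. f (a + x) \<noteq> 0} \<subseteq> (\<lambda>x. - a + x) ` {x. f x \<noteq> 0}"
  proof
    fix x assume "x \<in> {x. f (a + x) \<noteq> 0}"
    then show "x \<in> (\<lambda>x. - a + x) ` {x. f x \<noteq> 0}"
      by (intro image_eqI[where x = "a + x"]) auto
  qed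
  moreover have "bounded ((\<lambda>x. - a + x) ` {x. f x \<noteq> 0})"
    by (rule bounded_translation) (use assms in \<open>auto simp: bbs_def\<close>)
  ultimately have "bounded {x. f (a + x) \<noteq> 0}"
    by (rule bounded_subset[rotated])
  moreover have "(\<lambda>x. f (a + x)) \<in> borel_measurable borel"
    by (rule measurable_compose[where g = f]) (use assms in \<open>auto simp: bbs_def\<close>)
  ultimately show ?thesis using assms by (auto simp: bbs_def)
qed

lemma bbs_continuous:
  assumes "continuous_on UNIV f" "bounded {x. f x \<noteq> 0}"
  shows "bbs f"
proof -
  have "compact (f ` closure {x. f x \<noteq> 0})"
    using assms by (intro compact_continuous_image) (auto intro: continuous_on_subset simp: compact_closure)
  then obtain B where B: "\<And>x. x \<in> closure {x. f x \<noteq> 0} \<Longrightarrow> \<bar>f x\<bar> \<le> B"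
    by (metis bounded_iff compact_imp_bounded image_eqI real_norm_def)
  have "\<bar>f x\<bar> \<le> max B 0" for x
    using B[of x] closure_subset[of "{x. f x \<noteq> 0}"] by (cases "f x = 0") auto
  then show ?thesis using assms by (auto simp: bbs_def borel_measurable_continuous_onI)
qed

lemma integral_translate:
  fixes f :: "'a::euclidean_space \<Rightarrow> real"
  assumes [measurable]: "f \<in> borel_measurable borel"
  shows "(\<integral>x. f (a + x) \<partial>lborel) = (\<integral>x. f x \<partial>lborel)"
proof -
  have "(\<integral>x. f x \<partial>lborel) = (\<integral>x. f x \<partial>distr lborel borel ((+) a))"
    by (simp add: lborel_distr_plus)
  also have "\<dots> = (\<integral>x. f (a + x) \<partial>lborel)"
    by (rule integral_distr) auto
  finally show ?thesis by simp
qed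

lemma test_functions_smooth: "\<phi> \<in> test_functions \<Omega> \<Longrightarrow> smooth \<phi>"
  by (simp add: test_functions_def smooth_def)

lemma test_functionsI:
  assumes "smooth \<phi>" "{x. \<phi> x \<noteq> 0} \<subseteq> K" "compact K" "K \<subseteq> \<Omega>"
  shows "\<phi> \<in> test_functions \<Omega>"
proof -
  have "closure {x. \<phi> x \<noteq> 0} \<subseteq> K"
    using assms by (simp add: closure_minimal compact_imp_closed)
  moreover have "compact (closure {x. \<phi> x \<noteq> 0})"
    using assms by (meson bounded_subset compact_closure compact_imp_bounded)
  ultimately show ?thesis
    using assms by (auto simp: test_functions_def smooth_def)
qed

lemma test_functions_UNIV: "\<phi> \<in> test_functions \<Omega> \<Longrightarrow> \<phi> \<in> test_functions UNIV"
  by (simp add: test_functions_def)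

lemma test_functions_bounded_support:
  "\<phi> \<in> test_functions \<Omega> \<Longrightarrow> bounded (closure {x. \<phi> x \<noteq> 0})"
  by (simp add: test_functions_def compact_imp_bounded)

lemma test_functions_bbs: "\<phi> \<in> test_functions \<Omega> \<Longrightarrow> bbs \<phi>"
  by (meson bbs_continuous bounded_subset closure_subset smooth_continuous_on
      test_functions_bounded_support test_functions_smooth)

lemma frechet_derivative_outside_support:
  assumes "x \<notin> closure {x. \<phi> x \<noteq> 0}"
  shows "frechet_derivative \<phi> (at x) v = 0"
proof -
  have "((\<lambda>x. 0) has_derivative (\<lambda>v. 0)) (at x)" by simp
  then have "(\<phi> has_derivative (\<lambda>v. 0)) (at x)"
    by (rule has_derivative_transform_within_open[of _ _ _ _ "- closure {x. \<phi> x \<noteq> 0}"])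
      (use assms closure_subset[of "{x. \<phi> x \<noteq> 0}"] in auto)
  then show ?thesis by (rule frechet_derivative_eqI)
qed

lemma grad_outside_support: "x \<notin> closure {x. \<phi> x \<noteq> 0} \<Longrightarrow> grad \<phi> x = 0"
  by (simp add: grad_def frechet_derivative_outside_support)

lemma test_functions_frechet_derivative:
  assumes "\<phi> \<in> test_functions \<Omega>"
  shows "(\<lambda>x. frechet_derivative \<phi> (at x) v) \<in> test_functions \<Omega>"
proof (rule test_functionsI)
  show "{x. frechet_derivative \<phi> (at x) v \<noteq> 0} \<subseteq> closure {x. \<phi> x \<noteq> 0}"
    using frechet_derivative_outside_support by blast
  show "smooth (\<lambda>x. frechet_derivative \<phi> (at x) v)"
    by (rule smooth_frechet_derivative[OF test_functions_smooth[OF assms]])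
qed (use assms in \<open>auto simp: test_functions_def\<close>)

lemma smooth_continuous_grad: "smooth \<phi> \<Longrightarrow> continuous_on A (grad \<phi>)"
  unfolding grad_def by (intro continuous_intros smooth_continuous_on smooth_frechet_derivative)

lemma test_functions_grad_bbs:
  assumes "\<phi> \<in> test_functions \<Omega>"
  shows "bbs (\<lambda>x. norm (grad \<phi> x))"
proof (rule bbs_continuous)
  show "continuous_on UNIV (\<lambda>x. norm (grad \<phi> x))"
    by (intro continuous_intros smooth_continuous_grad[OF test_functions_smooth[OF assms]])
  show "bounded {x. norm (grad \<phi> x) \<noteq> 0}"
    by (rule bounded_subset[OF test_functions_bounded_support[OF assms]])
      (use grad_outside_support[of _ \<phi>] in auto)
qed

lemma smooth_has_derivative_grad: "smooth \<phi> \<Longrightarrow> (\<phi> has_derivative (\<lambda>v. grad \<phi> x \<bullet> v)) (at x within A)"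
proof -
  assume "smooth \<phi>"
  then have "frechet_derivative \<phi> (at x) = (\<lambda>v. grad \<phi> x \<bullet> v)"
    by (auto simp: grad_inner smooth_differentiable)
  then show ?thesis
    using smooth_has_derivative[OF \<open>smooth \<phi>\<close>, of x] by (simp add: has_derivative_at_withinI)
qed

lemma test_functions_lipschitz:
  assumes "\<phi> \<in> test_functions \<Omega>"
  obtains L where "L \<ge> 0" "\<And>x y. \<bar>\<phi> x - \<phi> y\<bar> \<le> L * norm (x - y)"
proof -
  obtain B where B: "\<And>x. norm (grad \<phi> x) \<le> B"
    using test_functions_grad_bbs[OF assms] by (auto simp: bbs_def)
  have "norm (\<phi> x - \<phi> y) \<le> B * norm (x - y)" for x y
  proof (rule differentiable_bound[where S = UNIV])
    show "(\<phi> has_derivative (\<lambda>v. grad \<phi> x \<bullet> v)) (at x within UNIV)" for x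
      by (rule smooth_has_derivative_grad[OF test_functions_smooth[OF assms]])
    show "onorm (\<lambda>v. grad \<phi> x \<bullet> v) \<le> B" for x
    proof (rule onorm_le)
      show "norm (grad \<phi> x \<bullet> v) \<le> B * norm v" for v
        using Cauchy_Schwarz_ineq2[of "grad \<phi> x" v] mult_right_mono[OF B[of x] norm_ge_zero[of v]] by simp
    qed
  qed auto
  moreover have "B \<ge> 0"
    using B norm_ge_zero order_trans by blast
  ultimately show ?thesis using that[of B] by simp
qed

section \<open>Convolution\<close>

lemma uniformly_continuous_bounded_support:
  fixes g :: "'a::euclidean_space \<Rightarrow> 'b::real_normed_vector"
  assumes "continuous_on UNIV g" "bounded {x. g x \<noteq> 0}" "e > 0"
  obtains d where "d > 0" "\<And>x y. dist x y < d \<Longrightarrow> dist (g x) (g y) < e"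
proof -
  obtain R where R: "\<And>x. g x \<noteq> 0 \<Longrightarrow> norm x \<le> R"
    using assms(2) by (auto simp: bounded_iff)
  have "uniformly_continuous_on (cball 0 (R + 1)) g"
    using assms(1) by (intro compact_uniformly_continuous) (auto intro: continuous_on_subset)
  then obtain d where d: "d > 0"
    "\<And>x y. x \<in> cball 0 (R + 1) \<Longrightarrow> y \<in> cball 0 (R + 1) \<Longrightarrow> dist y x < d \<Longrightarrow> dist (g y) (g x) < e"
    using assms(3) unfolding uniformly_continuous_on_def by metis
  show ?thesis
  proof
    \<comment> \<open>Capping the modulus at 1 forces both points into the ball of radius R + 1 as
      soon as one lies within R; if neither does, both values are 0.\<close>
    show "min d 1 > 0" using d by simp
    fix x y :: 'a assume xy: "dist x y < min d 1"
    show "dist (g x) (g y) < e"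
    proof (cases "norm x \<le> R \<or> norm y \<le> R")
      case True
      have "norm x \<le> norm y + dist x y" "norm y \<le> norm x + dist x y"
        by (metis dist_norm norm_triangle_sub add.commute)
          (metis dist_norm dist_commute norm_triangle_sub add.commute)
      then show ?thesis using True xy by (intro d(2)) auto
    next
      case False
      then show ?thesis using R[of x] R[of y] assms(3) by fastforce
    qed
  qed
qed

text \<open>A first-order Taylor expansion with an error uniform in the base point, from uniform
  continuity of the gradient. Uniformity is what allows differentiation under the integral sign in
  \<open>conv_has_derivative\<close>.\<close>

lemma test_functions_uniform_derivative:
  assumes "\<eta> \<in> test_functions UNIV" "e > 0"
  obtains d where "d > 0"
    "\<And>y k. norm k < d \<Longrightarrow> \<bar>\<eta> (y + k) - \<eta> y - grad \<eta> y \<bullet> k\<bar> \<le> e * norm k"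
proof -
  note sm = test_functions_smooth[OF assms(1)]
  have "bounded {x. grad \<eta> x \<noteq> 0}"
    by (rule bounded_subset[OF test_functions_bounded_support[OF assms(1)]])
      (use grad_outside_support[of _ \<eta>] in auto)
  then obtain d where d: "d > 0" "\<And>x y. dist x y < d \<Longrightarrow> dist (grad \<eta> x) (grad \<eta> y) < e"
    using uniformly_continuous_bounded_support[OF smooth_continuous_grad[OF sm] _ assms(2)] by blast
  have "\<bar>\<eta> (y + k) - \<eta> y - grad \<eta> y \<bullet> k\<bar> \<le> e * norm k" if k: "norm k < d" for y k
  proof -
    have "norm (\<eta> (y + k) - \<eta> y - grad \<eta> y \<bullet> (y + k - y)) \<le> norm (y + k - y) * e"
    proof (rule differentiable_bound_linearization[where S = "ball y d" and f' = "\<lambda>x v. grad \<eta> x \<bullet> v"])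
      show "y + t *\<^sub>R (y + k - y) \<in> ball y d" if "t \<in> {0..1}" for t
      proof -
        have "\<bar>t\<bar> * norm k \<le> 1 * norm k"
          using that by (intro mult_right_mono) auto
        then show ?thesis using k by (simp add: dist_norm)
      qed
      show "(\<eta> has_derivative (\<lambda>v. grad \<eta> x \<bullet> v)) (at x within ball y d)" for x
        by (rule smooth_has_derivative_grad[OF sm])
      show "onorm ((\<lambda>v. grad \<eta> x \<bullet> v) - (\<lambda>v. grad \<eta> y \<bullet> v)) \<le> e" if "x \<in> ball y d" for x
      proof (rule onorm_le)
        fix v
        have "\<bar>(grad \<eta> x - grad \<eta> y) \<bullet> v\<bar> \<le> norm (grad \<eta> x - grad \<eta> y) * norm v"
          by (rule Cauchy_Schwarz_ineq2)
        also have "\<dots> \<le> e * norm v"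
          using d(2)[of x y] that by (intro mult_right_mono) (auto simp: dist_norm norm_minus_commute)
        finally show "norm (((\<lambda>v. grad \<eta> x \<bullet> v) - (\<lambda>v. grad \<eta> y \<bullet> v)) v) \<le> e * norm v"
          by (simp add: inner_diff_left)
      qed
    qed (use d in auto)
    then show ?thesis by (simp add: mult.commute)
  qed
  then show ?thesis using that d by blast
qed

text \<open>Convolution with the reflected kernel: every value is an average of translates of f. The
  reflection is the origin of the minus sign in front of the derivative of the kernel.\<close>

definition conv :: "('a::euclidean_space \<Rightarrow> real) \<Rightarrow> ('a \<Rightarrow> real) \<Rightarrow> 'a \<Rightarrow> real" where
  "conv \<eta> f x = (\<integral>z. \<eta> z * f (x + z) \<partial>lborel)"

lemma conv_eq:
  assumes "bbs \<eta>" "bbs f"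
  shows "conv \<eta> f x = (\<integral>z. \<eta> (z - x) * f z \<partial>lborel)"
proof -
  have "(\<lambda>z. \<eta> (z - x) * f z) \<in> borel_measurable borel"
    using bbs_translate[OF assms(1), of "- x"] assms(2) by (auto simp: bbs_def)
  from integral_translate[OF this, of x] show ?thesis by (simp add: conv_def)
qed

lemma bbs_conv_integrand: "bbs \<eta> \<Longrightarrow> bbs f \<Longrightarrow> bbs (\<lambda>z. \<eta> z * f (x + z))"
  by (intro bbs_mult_bbs bbs_translate)

lemma bbs_conv_integrand': "bbs \<eta> \<Longrightarrow> bbs f \<Longrightarrow> bbs (\<lambda>z. \<eta> (z - x) * f z)"
  using bbs_mult_bbs[OF bbs_translate[of \<eta> "- x"]] by simp

text \<open>After a change of variables x occurs in the kernel only, so f need only be Borel and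
  bounded with bounded support. The uniform Taylor error of \<eta>, integrated against |f|, is a
  small multiple of |y - x|.\<close>

lemma conv_has_derivative:
  assumes \<eta>: "\<eta> \<in> test_functions UNIV" and f: "bbs f"
  shows "(conv \<eta> f has_derivative (\<lambda>v. conv (\<lambda>z. - frechet_derivative \<eta> (at z) v) f x)) (at x)"
proof -
  note sm = test_functions_smooth[OF \<eta>]
  have bbs1: "bbs (\<lambda>z. frechet_derivative \<eta> (at z) v)" for v
    by (rule test_functions_bbs[OF test_functions_frechet_derivative[OF \<eta>]])
  have bbs2: "bbs (\<lambda>z. - frechet_derivative \<eta> (at z) v)" for v
    using bbs_cmult[OF bbs1, of "-1"] by simp
  let ?D = "\<lambda>v. conv (\<lambda>z. - frechet_derivative \<eta> (at z) v) f x"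
  have D: "?D v = (\<integral>z. - (grad \<eta> (z - x) \<bullet> v) * f z \<partial>lborel)" for v
    using conv_eq[OF bbs2[of v] f] by (simp add: grad_inner[OF smooth_differentiable[OF sm]])
  have ID: "integrable lborel (\<lambda>z. - (grad \<eta> (z - x) \<bullet> v) * f z)" for v
    using bbs_integrable[OF bbs_conv_integrand'[OF bbs2[of v] f, of x]]
    by (simp add: grad_inner[OF smooth_differentiable[OF sm]])
  have "linear ?D"
  proof (rule linearI)
    show "?D (v + w) = ?D v + ?D w" for v w
    proof -
      have "(\<lambda>z. - (grad \<eta> (z - x) \<bullet> (v + w)) * f z) =
        (\<lambda>z. - (grad \<eta> (z - x) \<bullet> v) * f z + - (grad \<eta> (z - x) \<bullet> w) * f z)"
        by (auto simp: algebra_simps inner_add_right)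
      then show ?thesis
        unfolding D using Bochner_Integration.integral_add[OF ID[of v] ID[of w]] by simp
    qed
    show "?D (c *\<^sub>R v) = c *\<^sub>R ?D v" for c v
    proof -
      have "(\<lambda>z. - (grad \<eta> (z - x) \<bullet> (c *\<^sub>R v)) * f z) =
        (\<lambda>z. c * (- (grad \<eta> (z - x) \<bullet> v) * f z))"
        by (auto simp: algebra_simps)
      then show ?thesis
        unfolding D using integral_mult_right_zero[of lborel c] by simp
    qed
  qed
  then have lin: "bounded_linear ?D"
    by (simp add: linear_conv_bounded_linear)
  have "\<exists>d>0. \<forall>y. norm (y - x) < d \<longrightarrow>
      norm (conv \<eta> f y - conv \<eta> f x - ?D (y - x)) \<le> e * norm (y - x)" if e: "e > 0" for e
  proof -
    let ?I = "\<integral>z. \<bar>f z\<bar> \<partial>lborel"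
    have I0: "?I \<ge> 0" by simp
    \<comment> \<open>The summand 1 covers the case that f vanishes almost everywhere.\<close>
    then have "e / (?I + 1) > 0" using e by (simp add: add_nonneg_pos)
    then obtain d where d: "d > 0"
      "\<And>y k. norm k < d \<Longrightarrow> \<bar>\<eta> (y + k) - \<eta> y - grad \<eta> y \<bullet> k\<bar> \<le> e / (?I + 1) * norm k"
      using test_functions_uniform_derivative[OF \<eta>] by blast
    have "norm (conv \<eta> f y - conv \<eta> f x - ?D (y - x)) \<le> e * norm (y - x)"
      if y: "norm (y - x) < d" for y
    proof -
      note I = bbs_integrable[OF bbs_conv_integrand'[OF test_functions_bbs[OF \<eta>] f]]
      have "conv \<eta> f y - conv \<eta> f x - ?D (y - x) =
          (\<integral>z. \<eta> (z - y) * f z - \<eta> (z - x) * f z - - (grad \<eta> (z - x) \<bullet> (y - x)) * f z \<partial>lborel)"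
        unfolding conv_eq[OF test_functions_bbs[OF \<eta>] f] D
        using I[of y] I[of x] ID[of "y - x"]
        by (simp add: Bochner_Integration.integral_diff)
      also have "norm \<dots> \<le> (\<integral>z. e / (?I + 1) * norm (y - x) * \<bar>f z\<bar> \<partial>lborel)"
      proof (rule Bochner_Integration.integral_norm_bound_integral)
        show "integrable lborel (\<lambda>z. \<eta> (z - y) * f z - \<eta> (z - x) * f z - - (grad \<eta> (z - x) \<bullet> (y - x)) * f z)"
          using I[of y] I[of x] ID[of "y - x"] by (intro Bochner_Integration.integrable_diff)
        show "integrable lborel (\<lambda>z. e / (?I + 1) * norm (y - x) * \<bar>f z\<bar>)"
          by (intro integrable_mult_right bbs_integrable bbs_abs f)
        fix z
        have "\<bar>\<eta> ((z - x) + (x - y)) - \<eta> (z - x) - grad \<eta> (z - x) \<bullet> (x - y)\<bar> \<le> e / (?I + 1) * norm (x - y)"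
          using y by (intro d(2)) (simp add: norm_minus_commute)
        then have "\<bar>\<eta> (z - y) - \<eta> (z - x) + grad \<eta> (z - x) \<bullet> (y - x)\<bar> \<le> e / (?I + 1) * norm (y - x)"
          by (simp add: norm_minus_commute inner_diff_right algebra_simps)
        from mult_right_mono[OF this abs_ge_zero[of "f z"]]
        show "norm (\<eta> (z - y) * f z - \<eta> (z - x) * f z - - (grad \<eta> (z - x) \<bullet> (y - x)) * f z)
            \<le> e / (?I + 1) * norm (y - x) * \<bar>f z\<bar>"
          unfolding real_norm_def by (simp add: abs_mult[symmetric] algebra_simps)
      qed
      also have "\<dots> = e * norm (y - x) * (?I / (?I + 1))"
        by simp
      also have "\<dots> \<le> e * norm (y - x) * 1"
      proof (rule mult_left_mono)
        show "?I / (?I + 1) \<le> 1"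
          by (subst divide_le_eq_1_pos) (auto intro: add_nonneg_pos)
      qed (use e in auto)
      finally show ?thesis by simp
    qed
    then show ?thesis using d(1) by blast
  qed
  then show ?thesis using lin by (simp add: has_derivative_at_alt)
qed

lemma test_functions_uminus: "\<eta> \<in> test_functions \<Omega> \<Longrightarrow> (\<lambda>x. - \<eta> x) \<in> test_functions \<Omega>"
  using test_functionsI[of "\<lambda>x. - \<eta> x" "closure {x. \<eta> x \<noteq> 0}" \<Omega>] smooth_cmult[of \<eta> "-1"]
    closure_subset[of "{x. \<eta> x \<noteq> 0}"] test_functions_smooth[of \<eta> \<Omega>]
  by (auto simp: test_functions_def)

text \<open>For fixed f the convolutions with arbitrary test kernels form a class closed under
  directional derivatives, since each derivative falls on the kernel; \<open>smooth_coinduct\<close>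
  applies.\<close>

lemma smooth_conv:
  assumes "\<eta> \<in> test_functions UNIV" "bbs f"
  shows "smooth (conv \<eta> f)"
proof (rule smooth_coinduct[of "\<lambda>h. \<exists>\<eta>\<in>test_functions UNIV. h = conv \<eta> f"])
  show "h differentiable at x" if "\<exists>\<eta>\<in>test_functions UNIV. h = conv \<eta> f" for h x
    using that conv_has_derivative[OF _ assms(2)] by (auto simp: differentiable_def)
  show "\<exists>\<eta>\<in>test_functions UNIV. (\<lambda>x. frechet_derivative h (at x) v) = conv \<eta> f"
    if ex: "\<exists>\<eta>\<in>test_functions UNIV. h = conv \<eta> f" for h v
  proof -
    obtain \<eta> where \<eta>: "\<eta> \<in> test_functions UNIV" and h: "h = conv \<eta> f" using ex by blast
    show ?thesis
    proof
      show "(\<lambda>x. frechet_derivative h (at x) v) = conv (\<lambda>z. - frechet_derivative \<eta> (at z) v) f"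
        unfolding h using frechet_derivative_eqI[OF conv_has_derivative[OF \<eta> assms(2)]] by auto
      show "(\<lambda>z. - frechet_derivative \<eta> (at z) v) \<in> test_functions UNIV"
        by (intro test_functions_uminus test_functions_frechet_derivative \<eta>)
    qed
  qed
qed (use assms in auto)

lemma conv_test_functions:
  assumes "\<eta> \<in> test_functions UNIV" "bbs f" "compact K" "K \<subseteq> \<Omega>"
    and "\<And>x z. \<eta> z \<noteq> 0 \<Longrightarrow> f (x + z) \<noteq> 0 \<Longrightarrow> x \<in> K"
  shows "conv \<eta> f \<in> test_functions \<Omega>"
proof (rule test_functionsI[OF smooth_conv])
  have "conv \<eta> f x = 0" if "x \<notin> K" for x
  proof -
    have "\<eta> z * f (x + z) = 0" for z
      using assms(5)[of z x] that by auto
    then have "(\<lambda>z. \<eta> z * f (x + z)) = (\<lambda>z. 0)" by blast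
    then show ?thesis by (simp add: conv_def)
  qed
  then show "{x. conv \<eta> f x \<noteq> 0} \<subseteq> K" by auto
qed (use assms in auto)

lemma conv_nonneg: "(\<And>z. \<eta> z \<ge> 0) \<Longrightarrow> (\<And>z. f z \<ge> 0) \<Longrightarrow> conv \<eta> f x \<ge> 0"
  by (simp add: conv_def)

lemma bbs_conv:
  assumes "\<eta> \<in> test_functions UNIV" "bbs f"
  shows "bbs (conv \<eta> f)"
proof (rule test_functions_bbs[OF conv_test_functions[OF assms]])
  let ?K = "{x - y | x y. x \<in> closure {x. f x \<noteq> 0} \<and> y \<in> closure {x. \<eta> x \<noteq> 0}}"
  have "compact (closure {x. f x \<noteq> 0})" "compact (closure {x. \<eta> x \<noteq> 0})"
    using assms test_functions_bbs by (auto simp: bbs_def test_functions_def compact_closure)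
  then show "compact ?K" by (rule compact_differences)
  fix x z assume "\<eta> z \<noteq> 0" "f (x + z) \<noteq> 0"
  then have "z \<in> closure {x. \<eta> x \<noteq> 0}" "x + z \<in> closure {x. f x \<noteq> 0}"
    using closure_subset[of "{x. \<eta> x \<noteq> 0}"] closure_subset[of "{x. f x \<noteq> 0}"] by auto
  then show "x \<in> ?K" by (intro CollectI exI[of _ "x + z"] exI[of _ z]) simp
qed auto

lemma bbs_Fubini:
  fixes F :: "'a::euclidean_space \<times> 'b::euclidean_space \<Rightarrow> real"
  assumes "bbs F"
  shows "(\<integral>x. (\<integral>z. F (x, z) \<partial>lborel) \<partial>lborel) = (\<integral>z. (\<integral>x. F (x, z) \<partial>lborel) \<partial>lborel)"
proof -
  have "integrable (lborel \<Otimes>\<^sub>M lborel) (\<lambda>(x, z). F (x, z))"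
    using bbs_integrable[OF assms] by (simp add: lborel_prod)
  from lborel_pair.Fubini_integral[OF this] show ?thesis by simp
qed

lemma bbs_conv_pair:
  assumes "bbs \<eta>" "bbs (f :: 'a::euclidean_space \<Rightarrow> real)"
  shows "bbs (\<lambda>(x, z). \<eta> z * f (x + z))"
proof -
  have [measurable]: "\<eta> \<in> borel_measurable borel" "f \<in> borel_measurable borel"
    using assms by (auto simp: bbs_def)
  obtain B C where BC: "\<And>x. \<bar>\<eta> x\<bar> \<le> B" "\<And>x. \<bar>f x\<bar> \<le> C" using assms by (auto simp: bbs_def)
  obtain R S where RS: "\<And>x. \<eta> x \<noteq> 0 \<Longrightarrow> norm x \<le> R" "\<And>x. f x \<noteq> 0 \<Longrightarrow> norm x \<le> S"
    using assms by (auto simp: bbs_def bounded_iff)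
  have "(\<lambda>(x, z). \<eta> z * f (x + z)) \<in> borel_measurable (borel \<Otimes>\<^sub>M borel)"
    by measurable
  moreover have "\<bar>\<eta> z * f (x + z)\<bar> \<le> B * C" for x z
    using BC(1)[of z] BC(2)[of "x + z"] by (simp add: abs_mult mult_mono)
  moreover have "bounded {p. (\<lambda>(x, z). \<eta> z * f (x + z)) p \<noteq> 0}"
  proof (rule boundedI)
    fix p assume p: "p \<in> {p. (\<lambda>(x, z). \<eta> z * f (x + z)) p \<noteq> 0}"
    obtain x z where [simp]: "p = (x, z)" by force
    have "norm z \<le> R" "norm (x + z) \<le> S" using p RS by auto
    moreover have "norm x \<le> norm (x + z) + norm z"
      by (metis add_diff_cancel_right' norm_triangle_ineq4)
    ultimately show "norm p \<le> (S + R) + R"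
      using norm_Pair_le[of x z] by simp
  qed
  ultimately show ?thesis
    by (auto simp: bbs_def borel_prod)
qed

lemma integral_conv:
  assumes "bbs \<eta>" "bbs f"
  shows "(\<integral>x. conv \<eta> f x \<partial>lborel) = (\<integral>z. \<eta> z \<partial>lborel) * (\<integral>x. f x \<partial>lborel)"
proof -
  have "(\<integral>x. conv \<eta> f x \<partial>lborel) = (\<integral>z. (\<integral>x. \<eta> z * f (x + z) \<partial>lborel) \<partial>lborel)"
    unfolding conv_def using bbs_Fubini[OF bbs_conv_pair[OF assms]] by simp
  also have "\<dots> = (\<integral>z. \<eta> z * (\<integral>x. f x \<partial>lborel) \<partial>lborel)"
    using integral_translate[of f] assms(2) by (simp add: bbs_def add.commute)
  finally show ?thesis by simp
qed

text \<open>The tangent inequality for the convex power, obtained from Young's inequality for t and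
  a^(s - 1) with the conjugate exponents s and s/(s - 1). It is the source of the Jensen
  inequalities and of \<open>powr_split\<close>.\<close>

lemma powr_tangent:
  fixes t a s :: real
  assumes "t \<ge> 0" "a \<ge> 0" "s > 1"
  shows "a powr s + s * a powr (s - 1) * (t - a) \<le> t powr s"
proof (cases "a = 0")
  case False
  have "1 / s + 1 / (s / (s - 1)) = 1" "s / (s - 1) > 1" using assms by (auto simp: field_simps)
  then have "t * a powr (s - 1) \<le> t powr s / s + (a powr (s - 1)) powr (s / (s - 1)) / (s / (s - 1))"
    using assms by (intro Youngs_inequality) auto
  also have "(a powr (s - 1)) powr (s / (s - 1)) = a powr s"
    using assms by (simp add: powr_powr)
  finally have "s * (t * a powr (s - 1)) \<le> t powr s + a powr s * (s - 1)"
    using assms by (simp add: field_simps)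
  moreover have "a powr (s - 1) * a = a powr s"
    using False assms by (simp add: powr_mult_base mult.commute)
  ultimately show ?thesis by (simp add: algebra_simps)
qed (use assms in auto)

text \<open>Jensen's inequality: the tangent inequality at the mean is integrated against the
  probability density z \<mapsto> \<eta> z, and its linear term integrates to 0.\<close>

lemma conv_jensen:
  assumes "bbs \<eta>" "\<And>z. \<eta> z \<ge> 0" "(\<integral>z. \<eta> z \<partial>lborel) = 1" "bbs g" "\<And>z. g z \<ge> 0" "s > 1"
  shows "conv \<eta> g x powr s \<le> conv \<eta> (\<lambda>z. g z powr s) x"
proof -
  let ?a = "conv \<eta> g x"
  have a: "?a \<ge> 0" using assms by (intro conv_nonneg)
  note I1 = bbs_integrable[OF assms(1)] and I2 = bbs_integrable[OF bbs_conv_integrand[OF assms(1,4), of x]]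
  note I3 = bbs_integrable[OF bbs_conv_integrand[OF assms(1) bbs_powr'[OF assms(4,5)], of s x]]
  have "?a powr s = ?a powr s * 1 + s * ?a powr (s - 1) * (?a - ?a * 1)" by simp
  also have "\<dots> = (\<integral>z. ?a powr s * \<eta> z + s * ?a powr (s - 1) * (\<eta> z * g (x + z) - ?a * \<eta> z) \<partial>lborel)"
    unfolding assms(3)[symmetric] using I1 I2 by (simp add: conv_def)
  also have "\<dots> \<le> (\<integral>z. \<eta> z * g (x + z) powr s \<partial>lborel)"
  proof (rule integral_mono)
    show "integrable lborel (\<lambda>z. ?a powr s * \<eta> z + s * ?a powr (s - 1) * (\<eta> z * g (x + z) - ?a * \<eta> z))"
      using I1 I2 by auto
    show "integrable lborel (\<lambda>z. \<eta> z * g (x + z) powr s)" using I3 assms by simp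
    fix z
    have "\<eta> z * (?a powr s + s * ?a powr (s - 1) * (g (x + z) - ?a)) \<le> \<eta> z * g (x + z) powr s"
      using powr_tangent[OF assms(5) a assms(6)] assms(2) by (intro mult_left_mono) auto
    then show "?a powr s * \<eta> z + s * ?a powr (s - 1) * (\<eta> z * g (x + z) - ?a * \<eta> z) \<le> \<eta> z * g (x + z) powr s"
      by (simp add: algebra_simps)
  qed
  finally show ?thesis by (simp add: conv_def)
qed

section \<open>Upper gradients\<close>

text \<open>The function g bounds the pointwise Lipschitz constant, the limes superior of |f y - f
  x| / |y - x|; the tolerance e expresses that limit without quotients. Unlike a gradient it makes
  sense for expressions in d, which is only Lipschitz.\<close>

definition upper_grad :: "('a::euclidean_space \<Rightarrow> real) \<Rightarrow> ('a \<Rightarrow> real) \<Rightarrow> bool" where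
  "upper_grad f g \<longleftrightarrow> (\<forall>x. \<forall>e>0. \<forall>\<^sub>F y in nhds x. \<bar>f y - f x\<bar> \<le> (g x + e) * norm (y - x))"

text \<open>A reverse Fatou lemma for difference quotients: the maximum turns a bound on the upper limit
  into convergence.\<close>

lemma upper_grad_tendsto:
  fixes f :: "'a::euclidean_space \<Rightarrow> real" and h :: "nat \<Rightarrow> real"
  assumes ug: "upper_grad f g" and lip: "\<And>x y. \<bar>f x - f y\<bar> \<le> L * norm (x - y)"
    and fm: "f \<in> borel_measurable borel" and g: "bbs g" "\<And>x. g x \<ge> 0" and W: "bbs W" 
    and h: "\<And>n. h n > 0" "h \<longlonglongrightarrow> 0"
  shows "(\<lambda>n. \<integral>x. W x * max (\<bar>f (x + h n *\<^sub>R v) - f x\<bar> / h n) (g x * norm v) \<partial>lborel)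
    \<longlonglongrightarrow> (\<integral>x. W x * (g x * norm v) \<partial>lborel)" (is "(\<lambda>n. \<integral>x. ?F n x \<partial>lborel) \<longlonglongrightarrow> _")
    and "integrable lborel (\<lambda>x. W x * max (\<bar>f (x + h n *\<^sub>R v) - f x\<bar> / h n) (g x * norm v))"
proof -
  have [measurable]: "W \<in> borel_measurable borel" "g \<in> borel_measurable borel" "f \<in> borel_measurable borel"
    using assms by (auto simp: bbs_def)
  obtain C where C: "\<And>x. \<bar>g x\<bar> \<le> C" using g by (auto simp: bbs_def)
  have bound: "\<bar>max (\<bar>f (x + h n *\<^sub>R v) - f x\<bar> / h n) (g x * norm v)\<bar> \<le> max L C * norm v" for n x
  proof -
    have "\<bar>f (x + h n *\<^sub>R v) - f x\<bar> \<le> L * (h n * norm v)"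
      using lip[of "x + h n *\<^sub>R v" x] h(1)[of n] by simp
    then have "\<bar>f (x + h n *\<^sub>R v) - f x\<bar> / h n \<le> L * norm v"
      using h(1)[of n] by (simp add: field_simps)
    also have "\<dots> \<le> max L C * norm v" by (intro mult_right_mono) auto
    finally have 1: "\<bar>f (x + h n *\<^sub>R v) - f x\<bar> / h n \<le> max L C * norm v" .
    have 2: "g x * norm v \<le> max L C * norm v"
      using C[of x] by (intro mult_right_mono) auto
    show ?thesis using 1 2 g(2)[of x] h(1)[of n] by (auto simp: max_def)
  qed
  have dom: "norm (?F n x) \<le> \<bar>W x\<bar> * (max L C * norm v)" for n x
    using bound[of x n] by (simp only: real_norm_def abs_mult) (intro mult_left_mono, auto)
  have I: "integrable lborel (\<lambda>x. \<bar>W x\<bar> * (max L C * norm v))"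
    by (intro integrable_mult_left bbs_integrable bbs_abs W)
  have meas: "?F n \<in> borel_measurable lborel" for n by measurable
  show "integrable lborel (?F n)"
    by (rule Bochner_Integration.integrable_bound[OF I meas], rule AE_I2, rule order_trans[OF dom]) simp
  show "(\<lambda>n. \<integral>x. ?F n x \<partial>lborel) \<longlonglongrightarrow> (\<integral>x. W x * (g x * norm v) \<partial>lborel)"
  proof (rule integral_dominated_convergence[OF _ meas I])
    show "AE x in lborel. (\<lambda>n. ?F n x) \<longlonglongrightarrow> W x * (g x * norm v)"
    proof (rule AE_I2, rule tendsto_mult[OF tendsto_const])
      fix x
      have "(\<lambda>n. x + h n *\<^sub>R v) \<longlonglongrightarrow> x + 0 *\<^sub>R v" by (intro tendsto_intros h)
      then have lim: "filterlim (\<lambda>n. x + h n *\<^sub>R v) (nhds x) sequentially" by simp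
      show "(\<lambda>n. max (\<bar>f (x + h n *\<^sub>R v) - f x\<bar> / h n) (g x * norm v)) \<longlonglongrightarrow> g x * norm v"
      proof (rule LIMSEQ_I)
        fix e :: real assume e: "e > 0"
        \<comment> \<open>The summand 1 gives e' * norm v < e also for v = 0.\<close>
        define e' where "e' = e / (norm v + 1)"
        have v1: "norm v + 1 > 0" by (simp add: add_nonneg_pos)
        then have e': "e' > 0" and "e' * (norm v + 1) = e"
          using e by (auto simp: e'_def)
        then have e'2: "e' * norm v < e" by (simp add: algebra_simps)
        have "\<forall>\<^sub>F y in nhds x. \<bar>f y - f x\<bar> \<le> (g x + e') * norm (y - x)"
          using ug e' by (auto simp: upper_grad_def)
        from eventually_compose_filterlim[OF this lim]
        have "\<forall>\<^sub>F n in sequentially. \<bar>f (x + h n *\<^sub>R v) - f x\<bar> \<le> (g x + e') * norm (x + h n *\<^sub>R v - x)" .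
        then have "\<forall>\<^sub>F n in sequentially. norm (max (\<bar>f (x + h n *\<^sub>R v) - f x\<bar> / h n) (g x * norm v) - g x * norm v) < e"
        proof eventually_elim
          case (elim n)
          then have "\<bar>f (x + h n *\<^sub>R v) - f x\<bar> / h n \<le> (g x + e') * norm v"
            using h(1)[of n] by (simp add: field_simps)
          then show ?case using e'2 e by (auto simp: max_def algebra_simps)
        qed
        then show "\<exists>no. \<forall>n\<ge>no. norm (max (\<bar>f (x + h n *\<^sub>R v) - f x\<bar> / h n) (g x * norm v) - g x * norm v) < e"
          by (simp add: eventually_sequentially)
      qed
    qed
    show "AE x in lborel. norm (?F n x) \<le> \<bar>W x\<bar> * (max L C * norm v)" for n
      using dom by auto
  qed simp
qed

lemma directional_limit:
  fixes f :: "'a::euclidean_space \<Rightarrow> real"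
  assumes "f differentiable (at x)"
  shows "((\<lambda>t. (f (x + t *\<^sub>R v) - f x) / t) \<longlongrightarrow> frechet_derivative f (at x) v) (at 0)"
proof -
  have "((\<lambda>t. x + t *\<^sub>R v) has_derivative (\<lambda>t. t *\<^sub>R v)) (at 0)"
    by (auto intro!: derivative_eq_intros)
  moreover have "(f has_derivative (\<lambda>v. grad f x \<bullet> v)) (at (x + 0 *\<^sub>R v))"
    using assms frechet_derivative_works[of f "at x"] grad_inner[OF assms]
    by (metis (no_types, lifting) add.right_neutral ext scale_zero_left)
  ultimately have "((\<lambda>t. f (x + t *\<^sub>R v)) has_derivative (\<lambda>t. grad f x \<bullet> (t *\<^sub>R v))) (at 0)"
    by (rule has_derivative_compose)
  then have "((\<lambda>t. f (x + t *\<^sub>R v)) has_real_derivative grad f x \<bullet> v) (at 0)"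
    by (simp add: has_field_derivative_def mult_commute_abs)
  then show ?thesis
    by (simp add: DERIV_def grad_inner[OF assms])
qed

text \<open>Difference quotients of the convolution are averages of those of f, and
  \<open>upper_grad_tendsto\<close> passes to the limit under the integral. No derivative of f is
  involved, only its upper gradient.\<close>

lemma norm_grad_conv_le:
  assumes \<eta>: "\<eta> \<in> test_functions UNIV" "\<And>z. \<eta> z \<ge> 0" and f: "bbs f"
    and ug: "upper_grad f g" and lip: "\<And>x y. \<bar>f x - f y\<bar> \<le> L * norm (x - y)"
    and g: "bbs g" "\<And>x. g x \<ge> 0"
  shows "norm (grad (conv \<eta> f) x) \<le> conv \<eta> g x"
proof (rule norm_grad_le)
  show diff: "conv \<eta> f differentiable at x"
    by (rule smooth_differentiable[OF smooth_conv[OF \<eta>(1) f]])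
  fix v
  define h where "h n = inverse (real (Suc n))" for n
  have h: "\<And>n. h n > 0" "h \<longlonglongrightarrow> 0"
    using LIMSEQ_inverse_real_of_nat unfolding h_def by auto
  let ?W = "\<lambda>z. \<eta> (z - x)"
  have W: "bbs ?W" using bbs_translate[OF test_functions_bbs[OF \<eta>(1)], of "- x"] by simp
  have fm: "f \<in> borel_measurable borel" using f by (simp add: bbs_def)
  have lim: "(\<lambda>n. (conv \<eta> f (x + h n *\<^sub>R v) - conv \<eta> f x) / h n) \<longlonglongrightarrow> frechet_derivative (conv \<eta> f) (at x) v"
    by (rule filterlim_compose[OF directional_limit[OF diff]]) (use h in \<open>auto simp: filterlim_at less_imp_neq[THEN not_sym]\<close>)
  have "\<bar>frechet_derivative (conv \<eta> f) (at x) v\<bar> \<le> (\<integral>z. ?W z * (g z * norm v) \<partial>lborel)"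
  proof (rule LIMSEQ_le[OF tendsto_rabs[OF lim] upper_grad_tendsto(1)[OF ug lip fm g W h]], intro exI allI impI)
    fix n
    let ?q = "\<lambda>z. \<bar>f (z + h n *\<^sub>R v) - f z\<bar> / h n"
    have 1: "conv \<eta> f (x + h n *\<^sub>R v) = (\<integral>z. ?W z * f (z + h n *\<^sub>R v) \<partial>lborel)"
      using conv_eq[OF test_functions_bbs[OF \<eta>(1)] bbs_translate[OF f, of "h n *\<^sub>R v"], of x]
      by (simp add: conv_def add_ac)
    have 2: "conv \<eta> f x = (\<integral>z. ?W z * f z \<partial>lborel)"
      by (rule conv_eq[OF test_functions_bbs[OF \<eta>(1)] f])
    have I: "integrable lborel (\<lambda>z. ?W z * f (z + h n *\<^sub>R v))" "integrable lborel (\<lambda>z. ?W z * f z)"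
      using bbs_integrable[OF bbs_mult_bbs[OF W bbs_translate[OF f, of "h n *\<^sub>R v"]]]
        bbs_integrable[OF bbs_mult_bbs[OF W f]] by (simp_all add: add.commute)
    have "(conv \<eta> f (x + h n *\<^sub>R v) - conv \<eta> f x) / h n =
        (\<integral>z. (?W z * f (z + h n *\<^sub>R v) - ?W z * f z) / h n \<partial>lborel)"
      unfolding 1 2 using I by simp
    also have "\<bar>\<dots>\<bar> \<le> (\<integral>z. ?W z * max (?q z) (g z * norm v) \<partial>lborel)"
    proof (rule Bochner_Integration.integral_abs_bound_integral)
      show "integrable lborel (\<lambda>z. (?W z * f (z + h n *\<^sub>R v) - ?W z * f z) / h n)"
        using I by auto
      show "integrable lborel (\<lambda>z. ?W z * max (?q z) (g z * norm v))"
        by (rule upper_grad_tendsto(2)[OF ug lip fm g W h])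
      fix z
      have "\<bar>(?W z * f (z + h n *\<^sub>R v) - ?W z * f z) / h n\<bar> = ?W z * ?q z"
        using \<eta>(2)[of "z - x"] h(1)[of n] by (simp add: abs_mult right_diff_distrib[symmetric])
      also have "\<dots> \<le> ?W z * max (?q z) (g z * norm v)"
        using \<eta>(2) by (intro mult_left_mono) auto
      finally show "\<bar>(?W z * f (z + h n *\<^sub>R v) - ?W z * f z) / h n\<bar> \<le> ?W z * max (?q z) (g z * norm v)" .
    qed
    finally show "\<bar>(conv \<eta> f (x + h n *\<^sub>R v) - conv \<eta> f x) / h n\<bar> \<le> (\<integral>z. ?W z * max (?q z) (g z * norm v) \<partial>lborel)" .
  qed
  also have "\<dots> = conv \<eta> g x * norm v"
    unfolding conv_eq[OF test_functions_bbs[OF \<eta>(1)] g(1)] by (simp flip: mult.assoc)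
  finally show "\<bar>frechet_derivative (conv \<eta> f) (at x) v\<bar> \<le> conv \<eta> g x * norm v" .
qed

section \<open>Weak gradients\<close>

text \<open>The total integral is written as a convolution evaluated near the origin;
  differentiating it there gives the claim up to sign, with no iterated integration along coordinate
  lines.\<close>

lemma integral_frechet_derivative_test:
  assumes F: "F \<in> test_functions UNIV"
  shows "(\<integral>x. frechet_derivative F (at x) v \<partial>lborel) = 0"
proof -
  obtain R where R: "\<And>x. x \<in> closure {x. F x \<noteq> 0} \<Longrightarrow> norm x \<le> R"
    using test_functions_bounded_support[OF F] by (auto simp: bounded_iff)
  define f :: "'a \<Rightarrow> real" where "f = indicator (ball 0 (R + 1))"
  have f: "bbs f"
    unfolding bbs_def
  proof (intro conjI)
    show "\<exists>B. \<forall>x. \<bar>f x\<bar> \<le> B" by (rule exI[of _ 1]) (simp add: f_def indicator_def)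
    show "bounded {x. f x \<noteq> 0}"
      by (rule bounded_subset[OF bounded_ball[of 0 "R + 1"]]) (auto simp: f_def indicator_def)
    show "f \<in> borel_measurable borel" unfolding f_def by (rule borel_measurable_indicator) simp
  qed
  have loc: "f (x + z) = 1" if "norm x < 1" "norm z \<le> R" for x z
    using norm_triangle_ineq[of x z] that by (auto simp: f_def indicator_def)
  have supp: "norm z \<le> R" if "F z \<noteq> 0" for z
    using R[of z] that closure_subset[of "{x. F x \<noteq> 0}"] by auto
  \<comment> \<open>The convolution of \<open>F\<close> with the indicator of a large ball is constant near the origin.\<close>
  have "conv F f x = (\<integral>z. F z \<partial>lborel)" if "norm x < 1" for x
  proof -
    have "F z * f (x + z) = F z" for z
      using loc[OF that, of z] supp[of z] by (cases "F z = 0") auto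
    then have "(\<lambda>z. F z * f (x + z)) = F" by blast
    then show ?thesis by (simp add: conv_def)
  qed
  then have const: "(\<integral>z. F z \<partial>lborel) = conv F f x" if "x \<in> ball 0 1" for x
    using that by simp
  have "(conv F f has_derivative (\<lambda>v. 0)) (at 0)"
    by (rule has_derivative_transform_within_open[OF has_derivative_const open_ball[of 0 1] _ const]) auto
  from fun_cong[OF has_derivative_unique[OF conv_has_derivative[OF F f] this]]
  have "conv (\<lambda>z. - frechet_derivative F (at z) v) f 0 = 0" .
  moreover have "frechet_derivative F (at z) v * f z = frechet_derivative F (at z) v" for z
    using loc[of 0 z] R[of z] frechet_derivative_outside_support[of z F v]
    by (cases "z \<in> closure {x. F x \<noteq> 0}") auto
  then have "(\<integral>z. frechet_derivative F (at z) v * f z \<partial>lborel) = (\<integral>z. frechet_derivative F (at z) v \<partial>lborel)"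
    by (intro Bochner_Integration.integral_cong refl)
  ultimately show ?thesis by (simp add: conv_def)
qed

lemma test_functions_mult:
  assumes "smooth u" "\<phi> \<in> test_functions \<Omega>"
  shows "(\<lambda>x. u x * \<phi> x) \<in> test_functions \<Omega>"
proof (rule test_functionsI)
  show "smooth (\<lambda>x. u x * \<phi> x)"
    by (rule smooth_mult[OF assms(1) test_functions_smooth[OF assms(2)]])
  show "{x. u x * \<phi> x \<noteq> 0} \<subseteq> closure {x. \<phi> x \<noteq> 0}"
    using closure_subset[of "{x. \<phi> x \<noteq> 0}"] by auto
qed (use assms in \<open>auto simp: test_functions_def\<close>)

lemma frechet_derivative_mult:
  fixes u v :: "'a::euclidean_space \<Rightarrow> real"
  assumes "u differentiable (at x)" "v differentiable (at x)"
  shows "frechet_derivative (\<lambda>x. u x * v x) (at x) w =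
    u x * frechet_derivative v (at x) w + frechet_derivative u (at x) w * v x"
  using assms by (intro frechet_derivative_eqI has_derivative_mult) (auto simp: frechet_derivative_works)

lemma integration_by_parts_test:
  assumes u: "smooth u" and \<phi>: "\<phi> \<in> test_functions UNIV"
  shows "(\<integral>x. u x * frechet_derivative \<phi> (at x) v \<partial>lborel) =
    - (\<integral>x. frechet_derivative u (at x) v * \<phi> x \<partial>lborel)"
proof -
  have "bbs (\<lambda>x. u x * frechet_derivative \<phi> (at x) v)"
    by (rule test_functions_bbs[OF test_functions_mult[OF u test_functions_frechet_derivative[OF \<phi>]]])
  moreover have "bbs (\<lambda>x. frechet_derivative u (at x) v * \<phi> x)"
    by (intro test_functions_bbs[OF test_functions_mult[OF smooth_frechet_derivative[OF u] \<phi>]])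
  ultimately have "(\<integral>x. u x * frechet_derivative \<phi> (at x) v \<partial>lborel) +
      (\<integral>x. frechet_derivative u (at x) v * \<phi> x \<partial>lborel) =
    (\<integral>x. frechet_derivative (\<lambda>x. u x * \<phi> x) (at x) v \<partial>lborel)"
    using u test_functions_smooth[OF \<phi>]
    by (simp add: frechet_derivative_mult smooth_differentiable bbs_integrable)
  also have "\<dots> = 0"
    by (intro integral_frechet_derivative_test test_functions_mult u \<phi>)
  finally show ?thesis by simp
qed

section \<open>Integrals over an open set and over the whole space\<close>

lemma integral_lebesgue_on:
  fixes f :: "'a::euclidean_space \<Rightarrow> real"
  assumes "open \<Omega>" "f \<in> borel_measurable borel" "\<And>x. x \<notin> \<Omega> \<Longrightarrow> f x = 0"
  shows "(\<integral>x. f x \<partial>lebesgue_on \<Omega>) = (\<integral>x. f x \<partial>lborel)"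
proof -
  have "(\<integral>x. f x \<partial>lebesgue_on \<Omega>) = (\<integral>x. indicator \<Omega> x *\<^sub>R f x \<partial>lebesgue)"
    using assms by (intro integral_restrict_space) auto
  also have "(\<lambda>x. indicator \<Omega> x *\<^sub>R f x) = f"
    using assms by (auto simp: indicator_def fun_eq_iff)
  finally show ?thesis
    using assms by (simp add: integral_completion)
qed

lemma nn_integral_lebesgue_on:
  fixes f :: "'a::euclidean_space \<Rightarrow> ennreal"
  assumes "open \<Omega>" "\<And>x. x \<notin> \<Omega> \<Longrightarrow> f x = 0"
  shows "(\<integral>\<^sup>+x. f x \<partial>lebesgue_on \<Omega>) = (\<integral>\<^sup>+x. f x \<partial>lborel)"
proof -
  have "(\<integral>\<^sup>+x. f x \<partial>lebesgue_on \<Omega>) = (\<integral>\<^sup>+x. f x * indicator \<Omega> x \<partial>lebesgue)"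
    using assms by (intro nn_integral_restrict_space) auto
  also have "(\<lambda>x. f x * indicator \<Omega> x) = f"
    using assms by (auto simp: indicator_def fun_eq_iff)
  finally show ?thesis by (simp add: nn_integral_completion)
qed

lemma integrable_lebesgue_on_of_lborel:
  fixes f :: "'a::euclidean_space \<Rightarrow> 'b::euclidean_space"
  assumes "integrable lborel f" "S \<in> sets lebesgue"
  shows "integrable (lebesgue_on S) f"
proof -
  have "integrable lebesgue f" using assms by (simp add: integrable_completion)
  then show ?thesis using assms by (simp add: integrable_restrict_space integrable_mult_indicator)
qed

lemma test_functions_grad_integrable:
  assumes "\<phi> \<in> test_functions \<Omega>"
  shows "integrable lborel (grad \<phi>)"
  unfolding grad_def
  by (intro Bochner_Integration.integrable_sum integrable_scaleR_left bbs_integrable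
      test_functions_bbs[OF test_functions_frechet_derivative[OF assms]])

lemma has_weak_gradient_grad:
  assumes "open \<Omega>" "u \<in> test_functions UNIV"
  shows "has_weak_gradient \<Omega> u (grad u)"
  unfolding has_weak_gradient_def locally_integrable_def
proof (intro conjI allI impI ballI)
  fix K :: "'a set" assume "compact K \<and> K \<subseteq> \<Omega>"
  then have "K \<in> sets lebesgue" by (simp add: compact_imp_closed)
  then show "integrable (lebesgue_on K) u" "integrable (lebesgue_on K) (grad u)"
    using integrable_lebesgue_on_of_lborel[OF bbs_integrable[OF test_functions_bbs[OF assms(2)]]]
      integrable_lebesgue_on_of_lborel[OF test_functions_grad_integrable[OF assms(2)]] by auto
next
  fix \<phi> and i :: 'a assume \<phi>: "\<phi> \<in> test_functions \<Omega>" and i: "i \<in> Basis"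
  have sm: "smooth u" "smooth \<phi>" using assms(2) \<phi> by (auto dest: test_functions_smooth)
  have D: "grad u x \<bullet> i = frechet_derivative u (at x) i" for x
    by (simp add: grad_inner smooth_differentiable sm)
  have z: "\<phi> x = 0" "frechet_derivative \<phi> (at x) i = 0" if "x \<notin> \<Omega>" for x
  proof -
    have "x \<notin> closure {x. \<phi> x \<noteq> 0}" using that \<phi> by (auto simp: test_functions_def)
    then show "\<phi> x = 0" "frechet_derivative \<phi> (at x) i = 0"
      using frechet_derivative_outside_support closure_subset[of "{x. \<phi> x \<noteq> 0}"] by auto
  qed
  have "(\<integral>x. u x * frechet_derivative \<phi> (at x) i \<partial>lebesgue_on \<Omega>) = (\<integral>x. u x * frechet_derivative \<phi> (at x) i \<partial>lborel)"
    using assms z by (intro integral_lebesgue_on bbs_measurable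
      test_functions_bbs[OF test_functions_mult[OF sm(1) test_functions_frechet_derivative[OF \<phi>]]]) auto
  also have "\<dots> = - (\<integral>x. frechet_derivative u (at x) i * \<phi> x \<partial>lborel)"
    by (rule integration_by_parts_test[OF sm(1) test_functions_UNIV[OF \<phi>]])
  also have "(\<integral>x. frechet_derivative u (at x) i * \<phi> x \<partial>lborel) = (\<integral>x. frechet_derivative u (at x) i * \<phi> x \<partial>lebesgue_on \<Omega>)"
    using assms z by (intro integral_lebesgue_on[symmetric] bbs_measurable
      test_functions_bbs[OF test_functions_mult[OF smooth_frechet_derivative[OF sm(1)] \<phi>]]) auto
  finally show "(\<integral>x. u x * frechet_derivative \<phi> (at x) i \<partial>lebesgue_on \<Omega>) = - (\<integral>x. grad u x \<bullet> i * \<phi> x \<partial>lebesgue_on \<Omega>)"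
    by (simp add: D)
qed

section \<open>The fundamental lemma of the calculus of variations\<close>

lemma locally_integrable_mult_integrable:
  fixes h \<psi> :: "'a::euclidean_space \<Rightarrow> real"
  assumes \<Omega>: "open \<Omega>" and h: "locally_integrable \<Omega> h"
    and \<psi>: "\<psi> \<in> borel_measurable borel" "\<And>x. \<bar>\<psi> x\<bar> \<le> B" "{x. \<psi> x \<noteq> 0} \<subseteq> K" "compact K" "K \<subseteq> \<Omega>"
  shows "integrable (lebesgue_on \<Omega>) (\<lambda>x. h x * \<psi> x)"
proof -
  have K: "K \<in> sets lebesgue" using \<psi> by (simp add: compact_imp_closed)
  have "integrable (lebesgue_on K) h" using h \<psi> by (auto simp: locally_integrable_def)
  then have I: "integrable lebesgue (\<lambda>x. indicator K x *\<^sub>R h x)"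
    using K by (simp add: integrable_restrict_space)
  have [measurable]: "\<psi> \<in> borel_measurable lebesgue"
    using \<psi>(1) by (simp add: measurable_completion)
  have "integrable lebesgue (\<lambda>x. (B * (indicator K x *\<^sub>R h x)))"
    using I by (rule integrable_mult_right)
  then have "integrable lebesgue (\<lambda>x. (indicator K x *\<^sub>R h x) * \<psi> x)"
  proof (rule Bochner_Integration.integrable_bound)
    show "(\<lambda>x. indicator K x *\<^sub>R h x * \<psi> x) \<in> borel_measurable lebesgue"
      using borel_measurable_integrable[OF I] by measurable
    have "\<bar>h x\<bar> * \<bar>\<psi> x\<bar> \<le> \<bar>B\<bar> * \<bar>h x\<bar>" for x
      using \<psi>(2)[of x] by (subst mult.commute, intro mult_right_mono) auto
    then show "AE x in lebesgue. norm (indicator K x *\<^sub>R h x * \<psi> x) \<le> norm (B * indicator K x *\<^sub>R h x)"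
      by (intro AE_I2) (auto simp: indicator_def abs_mult)
  qed
  also have "(\<lambda>x. (indicator K x *\<^sub>R h x) * \<psi> x) = (\<lambda>x. indicator \<Omega> x *\<^sub>R (h x * \<psi> x))"
    using \<psi>(3,5) by (auto simp: indicator_def fun_eq_iff)
  finally show ?thesis
    using \<Omega> by (simp add: integrable_restrict_space)
qed

text \<open>The test functions of \<open>box_indicator_approx\<close> converge to the indicator of
  the open box and are dominated by that of the closed one, so the vanishing of the test integrals
  passes to the box.\<close>

lemma fundamental_lemma_box:
  fixes h :: "'a::euclidean_space \<Rightarrow> real"
  assumes \<Omega>: "open \<Omega>" and h: "locally_integrable \<Omega> h"
    and z: "\<And>\<phi>. \<phi> \<in> test_functions \<Omega> \<Longrightarrow> (\<integral>x. h x * \<phi> x \<partial>lebesgue_on \<Omega>) = 0"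
    and ab: "cbox a b \<subseteq> \<Omega>"
  shows "integral (cbox a b) h = 0"
proof -
  obtain \<phi> :: "nat \<Rightarrow> 'a \<Rightarrow> real" where \<phi>: "\<And>n. smooth (\<phi> n)" "\<And>n x. 0 \<le> \<phi> n x" "\<And>n x. \<phi> n x \<le> 1"
    "\<And>n x. x \<notin> box a b \<Longrightarrow> \<phi> n x = 0" "\<And>x. (\<lambda>n. \<phi> n x) \<longlonglongrightarrow> indicator (box a b) x"
    using box_indicator_approx[of a b] by blast
  have K: "compact (cbox a b)" by simp
  have supp: "{x. \<phi> n x \<noteq> 0} \<subseteq> cbox a b" for n
    using \<phi>(4) box_subset_cbox by blast
  have test: "\<phi> n \<in> test_functions \<Omega>" for n
    by (rule test_functionsI[OF \<phi>(1) supp K ab])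
  note I = locally_integrable_mult_integrable[OF \<Omega> h _ _ _ K ab]
  have Iind: "integrable (lebesgue_on \<Omega>) (\<lambda>x. h x * indicator (cbox a b) x)"
    by (rule I[where B = 1]) (auto simp: indicator_def)
  have Ibox: "integrable (lebesgue_on \<Omega>) (\<lambda>x. h x * indicator (box a b) x)"
    by (rule I[where B = 1]) (use box_subset_cbox in \<open>auto simp: indicator_def\<close>)
  have In: "integrable (lebesgue_on \<Omega>) (\<lambda>x. h x * \<phi> n x)" for n
    by (rule I[where B = 1]) (use \<phi>(2,3) supp bbs_measurable[OF test_functions_bbs[OF test]] in auto)
  have "(\<lambda>n. \<integral>x. h x * \<phi> n x \<partial>lebesgue_on \<Omega>) \<longlonglongrightarrow> (\<integral>x. h x * indicator (box a b) x \<partial>lebesgue_on \<Omega>)"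
  proof (rule integral_dominated_convergence)
    show "integrable (lebesgue_on \<Omega>) (\<lambda>x. norm (h x * indicator (cbox a b) x))"
      using Iind by (rule integrable_norm)
    have "norm (h x * \<phi> n x) \<le> norm (h x * indicator (cbox a b) x)" for n x
    proof (cases "x \<in> cbox a b")
      case True
      then show ?thesis using \<phi>(2,3)[of n x] by (simp add: abs_mult mult_left_le)
    next
      case False
      then have "\<phi> n x = 0" using supp by blast
      then show ?thesis by simp
    qed
    then show "AE x in lebesgue_on \<Omega>. norm (h x * \<phi> n x) \<le> norm (h x * indicator (cbox a b) x)" for n
      by (intro AE_I2)
    show "AE x in lebesgue_on \<Omega>. (\<lambda>n. h x * \<phi> n x) \<longlonglongrightarrow> h x * indicator (box a b) x"
      by (intro AE_I2 tendsto_mult tendsto_const \<phi>(5))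
  qed (use In Ibox in auto)
  then have "(\<integral>x. h x * indicator (box a b) x \<partial>lebesgue_on \<Omega>) = 0"
    using z[OF test] by (simp add: LIMSEQ_const_iff)
  moreover have "(\<integral>x. h x * indicator (box a b) x \<partial>lebesgue_on \<Omega>) = (\<integral>x. indicator \<Omega> x *\<^sub>R (h x * indicator (box a b) x) \<partial>lebesgue)"
    using \<Omega> by (intro integral_restrict_space) auto
  moreover have "(\<lambda>x. indicator \<Omega> x *\<^sub>R (h x * indicator (box a b) x)) = (\<lambda>x. indicator (box a b) x *\<^sub>R h x)"
    using ab box_subset_cbox[of a b] by (auto simp: indicator_def fun_eq_iff)
  moreover have "(\<integral>x. indicator (box a b) x *\<^sub>R h x \<partial>lebesgue) = (\<integral>x. h x \<partial>lebesgue_on (box a b))"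
    by (intro integral_restrict_space[symmetric]) auto
  moreover have "integrable (lebesgue_on (cbox a b)) h"
    using h ab by (auto simp: locally_integrable_def)
  then have "integrable (lebesgue_on (box a b)) h"
    using set_integrable_subset[of lebesgue "cbox a b" h "box a b"]
    by (simp add: set_integrable_def integrable_restrict_space box_subset_cbox)
  then have "(\<integral>x. h x \<partial>lebesgue_on (box a b)) = integral (box a b) h"
    by (intro lebesgue_integral_eq_integral) auto
  ultimately show ?thesis by (simp add: integral_open_interval)
qed

text \<open>Lebesgue differentiation: on a countable cover by closed boxes, almost every value of h
  is the limit of averages over small cubes, and all these averages are 0 by
  \<open>fundamental_lemma_box\<close>.\<close>

lemma fundamental_lemma:
  fixes h :: "'a::euclidean_space \<Rightarrow> real"
  assumes \<Omega>: "open \<Omega>" and h: "locally_integrable \<Omega> h"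
    and z: "\<And>\<phi>. \<phi> \<in> test_functions \<Omega> \<Longrightarrow> (\<integral>x. h x * \<phi> x \<partial>lebesgue_on \<Omega>) = 0"
  shows "AE x in lebesgue_on \<Omega>. h x = 0"
proof -
  obtain \<D> where \<D>: "countable \<D>" "\<D> \<subseteq> Pow \<Omega>" "\<And>X. X \<in> \<D> \<Longrightarrow> \<exists>a b. X = cbox a b" "\<Union>\<D> = \<Omega>"
    using open_countable_Union_open_cbox[OF \<Omega>] by blast
  have neg: "negligible {x \<in> X. h x \<noteq> 0}" if X: "X \<in> \<D>" for X
  proof -
    obtain c d where cd: "X = cbox c d" using \<D>(3)[OF X] by blast
    have sub: "cbox c d \<subseteq> \<Omega>" using \<D>(2) X cd by blast
    \<comment> \<open>As h is only locally integrable in \<Omega>, it is cut off to one box before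
      the differentiation theorem is applied on the whole space.\<close>
    define f where "f x = (if x \<in> cbox c d then h x else 0)" for x
    have "integrable (lebesgue_on (cbox c d)) h"
      using h sub by (auto simp: locally_integrable_def)
    then have "h absolutely_integrable_on cbox c d"
      by (simp add: absolutely_integrable_on_def set_integrable_def integrable_restrict_space)
    then have "(\<lambda>x. if x \<in> cbox c d then h x else 0) absolutely_integrable_on UNIV"
      by (simp add: absolutely_integrable_restrict_UNIV)
    then have "f absolutely_integrable_on UNIV" by (simp add: f_def[abs_def])
    then have "f integrable_on cbox a b" for a b
      by (meson absolutely_integrable_on_def integrable_on_subcbox set_lebesgue_integral_eq_integral(1) subset_UNIV)
    then obtain N where N: "negligible N"
      "\<And>x e. \<lbrakk>x \<notin> N; 0 < e\<rbrakk> \<Longrightarrow> \<exists>d>0. \<forall>t. 0 < t \<and> t < d \<longrightarrow>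
         norm (integral (cbox x (x + t *\<^sub>R One)) f /\<^sub>R t ^ DIM('a) - f x) < e"
      using integrable_ccontinuous_explicit[of f] by blast
    have "h x = 0" if x: "x \<in> box c d" "x \<notin> N" for x
    proof (rule ccontr)
      assume "h x \<noteq> 0"
      have xc: "x \<in> cbox c d" using x box_subset_cbox by blast
      have "\<bar>h x\<bar> > 0" using \<open>h x \<noteq> 0\<close> by simp
      then obtain d' where d': "d' > 0" "\<And>t. 0 < t \<Longrightarrow> t < d' \<Longrightarrow>
         norm (integral (cbox x (x + t *\<^sub>R One)) f /\<^sub>R t ^ DIM('a) - f x) < \<bar>h x\<bar>"
        using N(2)[OF x(2)] by blast
      have "((\<lambda>t. x + t *\<^sub>R One) \<longlongrightarrow> x + 0 *\<^sub>R One) (at_right (0::real))"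
        by (intro tendsto_intros)
      then have "\<forall>\<^sub>F t in at_right (0::real). x + t *\<^sub>R One \<in> box c d"
        using x(1) open_box topological_tendstoD by fastforce
      moreover have "\<forall>\<^sub>F t in at_right (0::real). 0 < t \<and> t < d'"
        using d'(1) by (auto simp: eventually_at_right_field)
      ultimately have "\<forall>\<^sub>F t in at_right (0::real). x + t *\<^sub>R One \<in> box c d \<and> 0 < t \<and> t < d'"
        by (rule eventually_conj)
      then obtain t where t: "x + t *\<^sub>R One \<in> box c d" "0 < t" "t < d'"
        using eventually_happens[of _ "at_right (0::real)"] by auto
      have sub2: "cbox x (x + t *\<^sub>R One) \<subseteq> cbox c d"
        using xc t(1) box_subset_cbox[of c d] by (fastforce simp: mem_box dest!: bspec)
      have "integral (cbox x (x + t *\<^sub>R One)) f = integral (cbox x (x + t *\<^sub>R One)) h"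
        using sub2 by (intro integral_cong) (auto simp: f_def)
      also have "\<dots> = 0"
        using sub2 sub by (intro fundamental_lemma_box[OF \<Omega> h z]) auto
      finally show False
        using d'(2)[OF t(2,3)] xc by (simp add: f_def)
    qed
    \<comment> \<open>Points on the faces are left out, as small cubes attached there may leave the
      box; the faces are negligible.\<close>
    then have "{x \<in> X. h x \<noteq> 0} \<subseteq> N \<union> (cbox c d - box c d)"
      using cd by auto
    then show ?thesis
      using N(1) negligible_frontier_interval[of c d] negligible_subset negligible_Un by blast
  qed
  have "negligible (\<Union>X\<in>\<D>. {x \<in> X. h x \<noteq> 0})"
    using \<D>(1) neg by (intro negligible_countable_Union) auto
  moreover have "(\<Union>X\<in>\<D>. {x \<in> X. h x \<noteq> 0}) = {x \<in> \<Omega>. h x \<noteq> 0}"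
    using \<D>(4) by auto
  ultimately have "{x \<in> \<Omega>. h x \<noteq> 0} \<in> null_sets lebesgue"
    by (simp add: negligible_iff_null_sets)
  then have "AE x in lebesgue. x \<notin> {x \<in> \<Omega>. h x \<noteq> 0}"
    by (rule AE_not_in)
  then show ?thesis
    using \<Omega> by (auto simp: AE_restrict_space_iff)
qed

section \<open>Uniqueness of weak gradients\<close>

lemma locally_integrable_inner:
  "locally_integrable \<Omega> g \<Longrightarrow> locally_integrable \<Omega> (\<lambda>x. g x \<bullet> i)"
  by (auto simp: locally_integrable_def)

lemma locally_integrable_diff:
  "locally_integrable \<Omega> f \<Longrightarrow> locally_integrable \<Omega> g \<Longrightarrow> locally_integrable \<Omega> (\<lambda>x. f x - g x)"
  by (auto simp: locally_integrable_def)

lemma locally_integrable_test_integrable: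
  assumes "open \<Omega>" "locally_integrable \<Omega> h" "\<phi> \<in> test_functions \<Omega>"
  shows "integrable (lebesgue_on \<Omega>) (\<lambda>x. h x * \<phi> x)"
proof -
  obtain B where "\<And>x. \<bar>\<phi> x\<bar> \<le> B" using test_functions_bbs[OF assms(3)] by (auto simp: bbs_def)
  then show ?thesis
    using assms(3) closure_subset[of "{x. \<phi> x \<noteq> 0}"]
    by (intro locally_integrable_mult_integrable[OF assms(1,2) bbs_measurable[OF test_functions_bbs[OF assms(3)]],
          where K = "closure {x. \<phi> x \<noteq> 0}" and B = B]) (auto simp: test_functions_def)
qed

lemma has_weak_gradient_diff:
  assumes "open \<Omega>" "has_weak_gradient \<Omega> u g" "has_weak_gradient \<Omega> v k"
  shows "has_weak_gradient \<Omega> (\<lambda>x. u x - v x) (\<lambda>x. g x - k x)"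
  unfolding has_weak_gradient_def
proof (intro conjI ballI)
  have l: "locally_integrable \<Omega> u" "locally_integrable \<Omega> v" "locally_integrable \<Omega> g" "locally_integrable \<Omega> k"
    using assms by (auto simp: has_weak_gradient_def)
  then show "locally_integrable \<Omega> (\<lambda>x. u x - v x)" "locally_integrable \<Omega> (\<lambda>x. g x - k x)"
    by (auto intro: locally_integrable_diff)
  fix \<phi> and i :: 'a assume \<phi>: "\<phi> \<in> test_functions \<Omega>" "i \<in> Basis"
  note T = locally_integrable_test_integrable[OF assms(1) _ test_functions_frechet_derivative[OF \<phi>(1), of i]]
  note T' = locally_integrable_test_integrable[OF assms(1) locally_integrable_inner \<phi>(1)]
  have "(\<integral>x. (u x - v x) * frechet_derivative \<phi> (at x) i \<partial>lebesgue_on \<Omega>) =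
    (\<integral>x. u x * frechet_derivative \<phi> (at x) i \<partial>lebesgue_on \<Omega>) - (\<integral>x. v x * frechet_derivative \<phi> (at x) i \<partial>lebesgue_on \<Omega>)"
    using T[OF l(1)] T[OF l(2)] by (simp add: left_diff_distrib)
  also have "\<dots> = - ((\<integral>x. (g x \<bullet> i) * \<phi> x \<partial>lebesgue_on \<Omega>) - (\<integral>x. (k x \<bullet> i) * \<phi> x \<partial>lebesgue_on \<Omega>))"
    using assms \<phi> by (simp add: has_weak_gradient_def)
  also have "\<dots> = - (\<integral>x. (g x - k x) \<bullet> i * \<phi> x \<partial>lebesgue_on \<Omega>)"
    using T'[OF l(3), of i] T'[OF l(4), of i] by (simp add: left_diff_distrib inner_diff_left)
  finally show "(\<integral>x. (u x - v x) * frechet_derivative \<phi> (at x) i \<partial>lebesgue_on \<Omega>) =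
    - (\<integral>x. (g x - k x) \<bullet> i * \<phi> x \<partial>lebesgue_on \<Omega>)" .
qed

lemma has_weak_gradient_zero:
  assumes "open \<Omega>" "has_weak_gradient \<Omega> (\<lambda>x. 0) g"
  shows "AE x in lebesgue_on \<Omega>. g x = 0"
proof -
  have l: "locally_integrable \<Omega> g" using assms by (auto simp: has_weak_gradient_def)
  have "AE x in lebesgue_on \<Omega>. g x \<bullet> i = 0" if "i \<in> Basis" for i
    using assms that by (intro fundamental_lemma locally_integrable_inner l) (auto simp: has_weak_gradient_def)
  then have "AE x in lebesgue_on \<Omega>. \<forall>i\<in>Basis. g x \<bullet> i = 0"
    by (subst AE_ball_countable) (auto simp: countable_finite)
  then show ?thesis
    by (rule AE_mp) (auto intro!: AE_I2 simp: euclidean_eq_iff[where 'a = 'a])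
qed

lemma has_weak_gradient_unique:
  assumes "open \<Omega>" "has_weak_gradient \<Omega> u g" "has_weak_gradient \<Omega> u k"
  shows "AE x in lebesgue_on \<Omega>. g x = k x"
  using has_weak_gradient_zero[OF assms(1), of "\<lambda>x. g x - k x"] has_weak_gradient_diff[OF assms] by simp

text \<open>Uniqueness makes the choice in \<open>weak_gradient\<close> harmless: every weak
  gradient, in particular the classical gradient of a test function, may be used in its place under
  an integral.\<close>

lemma weak_gradient_AE_eq:
  assumes "open \<Omega>" "has_weak_gradient \<Omega> u g"
  shows "AE x in lebesgue_on \<Omega>. weak_gradient \<Omega> u x = g x"
  using assms someI[of "has_weak_gradient \<Omega> u" g]
  by (intro has_weak_gradient_unique[of \<Omega> u]) (auto simp: weak_gradient_def)

section \<open>Reduction to test functions\<close>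

text \<open>Distance to the complement instead of the frontier: it is 1-Lipschitz on the whole space
  and vanishes outside \<Omega>, so that integrals can run over \<open>lborel\<close>. On \<Omega>
  both distances agree (\<open>infdist_frontier_eq_depth\<close>).\<close>

definition depth :: "'a::euclidean_space set \<Rightarrow> 'a \<Rightarrow> real" where
  "depth \<Omega> x = infdist x (- \<Omega>)"

text \<open>The denominator of the Hardy quotient. Outside \<Omega> the depth is 0 and division by
  zero yields 0, so the integral over the whole space sees only \<Omega>.\<close>

definition mass :: "'a::euclidean_space set \<Rightarrow> real \<Rightarrow> ('a \<Rightarrow> real) \<Rightarrow> real" where
  "mass \<Omega> p f = (\<integral>x. (\<bar>f x\<bar> / depth \<Omega> x) powr p \<partial>lborel)"

definition energy :: "real \<Rightarrow> ('a::euclidean_space \<Rightarrow> real) \<Rightarrow> real" where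
  "energy p f = (\<integral>x. norm (grad f x) powr p \<partial>lborel)"

lemma depth_nonneg: "depth \<Omega> x \<ge> 0"
  by (simp add: depth_def infdist_nonneg)

lemma depth_zero: "x \<notin> \<Omega> \<Longrightarrow> depth \<Omega> x = 0"
  by (simp add: depth_def)

lemma depth_lipschitz: "\<bar>depth \<Omega> x - depth \<Omega> y\<bar> \<le> norm (x - y)"
  using infdist_triangle_abs[of x "- \<Omega>" y] by (simp add: depth_def dist_norm)

lemma continuous_on_depth: "continuous_on A (depth \<Omega>)"
  unfolding depth_def by (intro continuous_intros)

lemma depth_measurable [measurable]: "depth \<Omega> \<in> borel_measurable borel"
  by (intro borel_measurable_continuous_onI continuous_on_depth)

text \<open>Convexity of the power for a + b = (1 - l) a/(1 - l) + l b/l, as the average of two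
  tangent inequalities. For l near 0 the factor of the main term a is near 1, at the price of a
  large factor on the error b.\<close>

lemma powr_split:
  fixes a b p l :: real
  assumes "a \<ge> 0" "b \<ge> 0" "p > 1" "0 < l" "l < 1"
  shows "(a + b) powr p \<le> (1 - l) powr (1 - p) * a powr p + l powr (1 - p) * b powr p"
proof -
  let ?x = "a + b" and ?y = "a / (1 - l)" and ?z = "b / l"
  have "?x powr p + p * ?x powr (p - 1) * (?y - ?x) \<le> ?y powr p"
    "?x powr p + p * ?x powr (p - 1) * (?z - ?x) \<le> ?z powr p"
    using assms by (intro powr_tangent; simp)+
  then have "(1 - l) * (?x powr p + p * ?x powr (p - 1) * (?y - ?x)) +
      l * (?x powr p + p * ?x powr (p - 1) * (?z - ?x)) \<le> (1 - l) * ?y powr p + l * ?z powr p"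
    using assms by (intro add_mono mult_left_mono) auto
  moreover have "(1 - l) * (?x powr p + p * ?x powr (p - 1) * (?y - ?x)) +
      l * (?x powr p + p * ?x powr (p - 1) * (?z - ?x)) =
      ?x powr p + p * ?x powr (p - 1) * (((1 - l) * ?y + l * ?z) - ?x)"
    by (simp add: algebra_simps)
  moreover have "(1 - l) * ?y + l * ?z = ?x" using assms by simp
  moreover have "(1 - l) * ?y powr p = (1 - l) powr (1 - p) * a powr p"
    "l * ?z powr p = l powr (1 - p) * b powr p"
    using assms by (simp_all add: powr_divide powr_diff)
  ultimately show ?thesis by simp
qed

lemma test_functions_energy_integrable:
  "\<phi> \<in> test_functions \<Omega> \<Longrightarrow> p > 0 \<Longrightarrow> integrable lborel (\<lambda>x. norm (grad \<phi> x) powr p)"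
  by (intro bbs_integrable bbs_powr' test_functions_grad_bbs) auto

lemma energy_nonneg: "energy p f \<ge> 0"
  by (simp add: energy_def)

lemma mass_nonneg: "mass \<Omega> p f \<ge> 0"
  by (simp add: mass_def)

locale bounded_open =
  fixes \<Omega> :: "'a::euclidean_space set"
  assumes open_\<Omega>: "open \<Omega>" and nonempty: "\<Omega> \<noteq> {}" and bounded: "bounded \<Omega>"
begin

lemma compl_nonempty: "- \<Omega> \<noteq> {}"
  using bounded not_bounded_UNIV by (metis Compl_empty_eq double_compl)

lemma depth_pos: "x \<in> \<Omega> \<Longrightarrow> depth \<Omega> x > 0"
  unfolding depth_def using infdist_pos_not_in_closed[of "- \<Omega>" x] open_\<Omega> compl_nonempty by auto

lemma depth_pos_iff: "depth \<Omega> x > 0 \<longleftrightarrow> x \<in> \<Omega>"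
  using depth_pos depth_zero by force

text \<open>The segment from x to a nearest point of the complement crosses the frontier, so the
  frontier is no farther away than the complement; conversely it is contained in the complement of
  the open set.\<close>

lemma infdist_frontier_eq_depth:
  assumes x: "x \<in> \<Omega>"
  shows "infdist x (frontier \<Omega>) = depth \<Omega> x"
proof (rule antisym)
  obtain y where y: "y \<in> - \<Omega>" "infdist x (- \<Omega>) = dist x y"
    using infdist_attains_inf[of "- \<Omega>" x] open_\<Omega> compl_nonempty by auto
  have "closed_segment x y \<inter> frontier \<Omega> \<noteq> {}"
    using x y by (intro connected_Int_frontier) auto
  then obtain z where z: "z \<in> closed_segment x y" "z \<in> frontier \<Omega>" by blast
  have "infdist x (frontier \<Omega>) \<le> dist x z" using z by (intro infdist_le)
  also have "\<dots> \<le> dist x y" using z(1) segment_bound(1)[of z x y] by (simp add: dist_norm norm_minus_commute)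
  finally show "infdist x (frontier \<Omega>) \<le> depth \<Omega> x" using y by (simp add: depth_def)
  have "frontier \<Omega> \<subseteq> - \<Omega>" using open_\<Omega> by (auto simp: frontier_def interior_open)
  then show "depth \<Omega> x \<le> infdist x (frontier \<Omega>)"
    unfolding depth_def using z(2) by (intro infdist_mono) auto
qed

lemma compact_depth_ge:
  assumes "c > 0"
  shows "compact {x. depth \<Omega> x \<ge> c}" "{x. depth \<Omega> x \<ge> c} \<subseteq> \<Omega>"
proof -
  show sub: "{x. depth \<Omega> x \<ge> c} \<subseteq> \<Omega>"
    using assms depth_pos_iff by force
  have "closed {x. depth \<Omega> x \<ge> c}"
    by (intro closed_Collect_le continuous_on_depth continuous_intros)
  then show "compact {x. depth \<Omega> x \<ge> c}"
    using bounded_subset[OF bounded sub] compact_eq_bounded_closed by blast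
qed

lemma compact_depth_bound:
  assumes "compact K" "K \<subseteq> \<Omega>"
  obtains c where "c > 0" "\<And>x. x \<in> K \<Longrightarrow> c \<le> depth \<Omega> x"
proof (cases "K = {}")
  case False
  then obtain y where "y \<in> K" "\<And>x. x \<in> K \<Longrightarrow> depth \<Omega> y \<le> depth \<Omega> x"
    using continuous_attains_inf[OF assms(1) _ continuous_on_depth] by blast
  then show ?thesis using that[of "depth \<Omega> y"] depth_pos assms by blast
qed (use that[of 1] in auto)

lemma test_functions_depth_bound:
  assumes "\<phi> \<in> test_functions \<Omega>"
  obtains c where "c > 0" "\<And>x. x \<in> closure {x. \<phi> x \<noteq> 0} \<Longrightarrow> c \<le> depth \<Omega> x"
  using compact_depth_bound[of "closure {x. \<phi> x \<noteq> 0}"] assms by (auto simp: test_functions_def)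

lemma bbs_divide_depth:
  assumes "bbs f" "c > 0" "\<And>x. f x \<noteq> 0 \<Longrightarrow> c \<le> depth \<Omega> x"
  shows "bbs (\<lambda>x. \<bar>f x\<bar> / depth \<Omega> x)"
proof -
  have "bbs (\<lambda>x. \<bar>f x\<bar> * inverse (depth \<Omega> x))"
  proof (rule bbs_mult[OF bbs_abs[OF assms(1)]])
    show "\<bar>inverse (depth \<Omega> x)\<bar> \<le> inverse c" if "\<bar>f x\<bar> \<noteq> 0" for x
      using assms(3)[of x] that assms(2) by (auto simp: le_imp_inverse_le)
  qed measurable
  then show ?thesis by (simp add: divide_inverse)
qed

lemma test_functions_quotient_bbs:
  assumes "\<phi> \<in> test_functions \<Omega>"
  shows "bbs (\<lambda>x. \<bar>\<phi> x\<bar> / depth \<Omega> x)"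
proof -
  obtain c where "c > 0" "\<And>x. x \<in> closure {x. \<phi> x \<noteq> 0} \<Longrightarrow> c \<le> depth \<Omega> x"
    using test_functions_depth_bound[OF assms] by blast
  then show ?thesis
    using closure_subset[of "{x. \<phi> x \<noteq> 0}"]
    by (intro bbs_divide_depth[OF test_functions_bbs[OF assms]]) auto
qed

lemma test_functions_mass_integrable:
  "\<phi> \<in> test_functions \<Omega> \<Longrightarrow> p > 0 \<Longrightarrow> integrable lborel (\<lambda>x. (\<bar>\<phi> x\<bar> / depth \<Omega> x) powr p)"
  by (intro bbs_integrable bbs_powr' test_functions_quotient_bbs) (auto simp: depth_nonneg)

lemma test_functions_outside: "\<phi> \<in> test_functions \<Omega> \<Longrightarrow> x \<notin> \<Omega> \<Longrightarrow> \<phi> x = 0"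
  using closure_subset[of "{x. \<phi> x \<noteq> 0}"] by (auto simp: test_functions_def)

lemma test_functions_grad_outside: "\<phi> \<in> test_functions \<Omega> \<Longrightarrow> x \<notin> \<Omega> \<Longrightarrow> grad \<phi> x = 0"
  by (intro grad_outside_support) (auto simp: test_functions_def)

lemma weak_gradient_test_AE:
  "\<phi> \<in> test_functions \<Omega> \<Longrightarrow> AE x in lebesgue_on \<Omega>. weak_gradient \<Omega> \<phi> x = grad \<phi> x"
  by (intro weak_gradient_AE_eq open_\<Omega> has_weak_gradient_grad test_functions_UNIV)

lemma nn_energy_test:
  assumes "\<phi> \<in> test_functions \<Omega>" "p > 0"
  shows "(\<integral>\<^sup>+x. ennreal (norm (grad \<phi> x) powr p) \<partial>lebesgue_on \<Omega>) = ennreal (energy p \<phi>)"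
proof -
  have "(\<integral>\<^sup>+x. ennreal (norm (grad \<phi> x) powr p) \<partial>lebesgue_on \<Omega>) =
      (\<integral>\<^sup>+x. ennreal (norm (grad \<phi> x) powr p) \<partial>lborel)"
    using assms by (intro nn_integral_lebesgue_on open_\<Omega>) (auto simp: test_functions_grad_outside)
  also have "\<dots> = ennreal (energy p \<phi>)"
    unfolding energy_def using assms by (intro nn_integral_eq_integral test_functions_energy_integrable) auto
  finally show ?thesis .
qed

lemma nn_mass_eq:
  fixes u :: "'a \<Rightarrow> real"
  shows "(\<integral>\<^sup>+x. ennreal (\<bar>u x\<bar> powr p / infdist x (frontier \<Omega>) powr p) \<partial>lebesgue_on \<Omega>) =
    (\<integral>\<^sup>+x. ennreal ((\<bar>u x\<bar> / depth \<Omega> x) powr p) \<partial>lebesgue_on \<Omega>)"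
  by (intro nn_integral_cong) (auto simp: infdist_frontier_eq_depth powr_divide depth_nonneg)

lemma nn_mass_test:
  assumes "\<phi> \<in> test_functions \<Omega>" "p > 0"
  shows "(\<integral>\<^sup>+x. ennreal ((\<bar>\<phi> x\<bar> / depth \<Omega> x) powr p) \<partial>lebesgue_on \<Omega>) = ennreal (mass \<Omega> p \<phi>)"
proof -
  have "(\<integral>\<^sup>+x. ennreal ((\<bar>\<phi> x\<bar> / depth \<Omega> x) powr p) \<partial>lebesgue_on \<Omega>) =
      (\<integral>\<^sup>+x. ennreal ((\<bar>\<phi> x\<bar> / depth \<Omega> x) powr p) \<partial>lborel)"
    using assms by (intro nn_integral_lebesgue_on open_\<Omega>) (auto simp: test_functions_outside)
  also have "\<dots> = ennreal (mass \<Omega> p \<phi>)"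
    unfolding mass_def using assms by (intro nn_integral_eq_integral test_functions_mass_integrable) auto
  finally show ?thesis .
qed

text \<open>Completeness of Lebesgue measure. The chosen weak gradient is determined only up to null
  sets, and its measurability has to be inherited from a known representative.\<close>

lemma borel_measurable_lebesgue_on_AE:
  fixes f g :: "'a \<Rightarrow> 'b::euclidean_space"
  assumes "f \<in> borel_measurable (lebesgue_on \<Omega>)" "AE x in lebesgue_on \<Omega>. f x = g x"
  shows "g \<in> borel_measurable (lebesgue_on \<Omega>)"
proof -
  have "(\<lambda>x. indicator \<Omega> x *\<^sub>R g x) \<in> borel_measurable lebesgue"
  proof (rule borel_measurable_AE)
    show "(\<lambda>x. indicator \<Omega> x *\<^sub>R f x) \<in> borel_measurable lebesgue"
      using assms(1) open_\<Omega> by (simp add: borel_measurable_restrict_space_iff)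
    show "AE x in lebesgue. indicator \<Omega> x *\<^sub>R f x = indicator \<Omega> x *\<^sub>R g x"
      using assms(2) open_\<Omega> by (simp add: AE_restrict_space_iff) (elim eventually_mono, auto simp: indicator_def)
  qed
  then show ?thesis using open_\<Omega> by (simp add: borel_measurable_restrict_space_iff)
qed

lemma borel_measurable_lebesgue_on:
  "f \<in> borel_measurable borel \<Longrightarrow> f \<in> borel_measurable (lebesgue_on \<Omega>)"
  by (intro measurable_restrict_space1 measurable_completion) auto

lemma test_functions_sobolev:
  assumes \<phi>: "\<phi> \<in> test_functions \<Omega>" and p: "p > 1"
  shows "\<phi> \<in> sobolev p \<Omega>"
proof -
  have \<Omega>s: "\<Omega> \<in> sets lebesgue" using open_\<Omega> by simp
  have "\<phi> \<in> borel_measurable (lebesgue_on \<Omega>)"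
    using bbs_measurable[OF test_functions_bbs[OF \<phi>]] by (rule borel_measurable_lebesgue_on)
  moreover have "integrable (lebesgue_on \<Omega>) (\<lambda>x. \<bar>\<phi> x\<bar> powr p)"
    using p by (intro integrable_lebesgue_on_of_lborel[OF _ \<Omega>s] bbs_integrable bbs_powr test_functions_bbs[OF \<phi>]) auto
  moreover have g: "grad \<phi> \<in> borel_measurable (lebesgue_on \<Omega>)"
    by (intro borel_measurable_lebesgue_on borel_measurable_continuous_onI
        smooth_continuous_grad test_functions_smooth[OF \<phi>])
  then have w: "weak_gradient \<Omega> \<phi> \<in> borel_measurable (lebesgue_on \<Omega>)"
    using weak_gradient_test_AE[OF \<phi>] by (elim borel_measurable_lebesgue_on_AE) (elim eventually_mono, auto)
  moreover have "integrable (lebesgue_on \<Omega>) (\<lambda>x. norm (grad \<phi> x) powr p)"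
    using p by (intro integrable_lebesgue_on_of_lborel[OF _ \<Omega>s] test_functions_energy_integrable[OF \<phi>]) auto
  then have "integrable (lebesgue_on \<Omega>) (\<lambda>x. norm (weak_gradient \<Omega> \<phi> x) powr p)"
    by (rule integrable_cong_AE_imp) (use w weak_gradient_test_AE[OF \<phi>] in \<open>auto elim: eventually_mono\<close>)
  moreover have "has_weak_gradient \<Omega> \<phi> (grad \<phi>)"
    using has_weak_gradient_grad[OF open_\<Omega> test_functions_UNIV[OF \<phi>]] .
  ultimately show ?thesis by (auto simp: sobolev_def Lp_space_def)
qed

lemma test_functions_sobolev_zero:
  assumes \<phi>: "\<phi> \<in> test_functions \<Omega>" and p: "p > 1"
  shows "\<phi> \<in> sobolev_zero p \<Omega>"
proof -
  have z: "(\<lambda>x. 0) \<in> test_functions \<Omega>"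
    by (rule test_functionsI[OF smooth_const, of _ "{}"]) auto
  \<comment> \<open>The approximating test function is \<phi> itself. The weak gradient chosen for
    the zero function vanishes only almost everywhere, which is enough for its norm to be 0.\<close>
  have "AE x in lebesgue_on \<Omega>. weak_gradient \<Omega> (\<lambda>x. 0) x = 0"
    using weak_gradient_AE_eq[OF open_\<Omega> has_weak_gradient_grad[OF open_\<Omega> test_functions_UNIV[OF z]]]
    by (simp add: grad_def)
  then have "(\<integral>x. norm (weak_gradient \<Omega> (\<lambda>x. 0) x) powr p \<partial>lebesgue_on \<Omega>) = 0"
    by (intro integral_eq_zero_AE) (elim eventually_mono, auto)
  then have "sobolev_norm p \<Omega> (\<lambda>x. \<phi> x - \<phi> x) = 0"
    by (simp add: sobolev_norm_def)
  then show ?thesis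
    using test_functions_sobolev[OF assms] \<phi> by (auto simp: sobolev_zero_def intro!: bexI[of _ \<phi>])
qed

lemma hardy_constant_nonneg: "hardy_constant \<Omega> p \<ge> 0"
  by (simp add: hardy_constant_def)

lemma mass_eq_0_AE:
  assumes "\<phi> \<in> test_functions \<Omega>" "p > 0" "AE x in lebesgue_on \<Omega>. \<phi> x = 0"
  shows "mass \<Omega> p \<phi> = 0"
proof -
  have "ennreal (mass \<Omega> p \<phi>) = (\<integral>\<^sup>+x. ennreal ((\<bar>\<phi> x\<bar> / depth \<Omega> x) powr p) \<partial>lebesgue_on \<Omega>)"
    using nn_mass_test[OF assms(1,2)] by simp
  also have "\<dots> = (\<integral>\<^sup>+x. 0 \<partial>lebesgue_on \<Omega>)"
    using assms(3) by (intro nn_integral_cong_AE) (elim eventually_mono, auto)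
  finally show ?thesis by (simp add: mass_nonneg)
qed

lemma hardy_constant_le:
  assumes \<phi>: "\<phi> \<in> test_functions \<Omega>" and p: "p > 1"
  shows "hardy_constant \<Omega> p * mass \<Omega> p \<phi> \<le> energy p \<phi>"
proof (cases "AE x in lebesgue_on \<Omega>. \<phi> x = 0")
  case True
  then show ?thesis using mass_eq_0_AE[OF \<phi>] p by (simp add: energy_nonneg)
next
  case False
  let ?Q = "\<lambda>u. (\<integral>\<^sup>+x. ennreal (norm (weak_gradient \<Omega> u x) powr p) \<partial>lebesgue_on \<Omega>) /
       (\<integral>\<^sup>+x. ennreal (\<bar>u x\<bar> powr p / infdist x (frontier \<Omega>) powr p) \<partial>lebesgue_on \<Omega>)"
  let ?I = "INF u \<in> {u \<in> sobolev_zero p \<Omega>. \<not> (AE x in lebesgue_on \<Omega>. u x = 0)}. ?Q u"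
  have "?I \<le> ?Q \<phi>"
    using test_functions_sobolev_zero[OF assms] False by (intro INF_lower) auto
  also have "(\<integral>\<^sup>+x. ennreal (norm (weak_gradient \<Omega> \<phi> x) powr p) \<partial>lebesgue_on \<Omega>) =
      (\<integral>\<^sup>+x. ennreal (norm (grad \<phi> x) powr p) \<partial>lebesgue_on \<Omega>)"
    using weak_gradient_test_AE[OF \<phi>] by (intro nn_integral_cong_AE) (elim eventually_mono, auto)
  finally have le: "?I \<le> ennreal (energy p \<phi>) / ennreal (mass \<Omega> p \<phi>)"
    using nn_energy_test[OF \<phi>] nn_mass_eq nn_mass_test[OF \<phi>] p by simp
  show ?thesis
  proof (cases "mass \<Omega> p \<phi> = 0")
    case True
    then show ?thesis by (simp add: energy_nonneg)
  next
    case False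
    then have m: "mass \<Omega> p \<phi> > 0" using mass_nonneg[of \<Omega> p \<phi>] by linarith
    have "?I \<le> ennreal (energy p \<phi> / mass \<Omega> p \<phi>)"
      using le m by (simp add: divide_ennreal energy_nonneg)
    then have "enn2real ?I \<le> energy p \<phi> / mass \<Omega> p \<phi>"
      by (intro enn2real_leI) (auto simp: energy_nonneg mass_nonneg)
    then show ?thesis using m by (simp add: hardy_constant_def field_simps)
  qed
qed

text \<open>Supplies a competitor with finite quotient, so that the infimum defining the Hardy
  constant is not infinite.\<close>

lemma test_function_mass_pos:
  assumes "p > 0"
  obtains \<phi> where "\<phi> \<in> test_functions \<Omega>" "mass \<Omega> p \<phi> > 0"
proof -
  obtain x a b where ab: "x \<in> box a b" "cbox a b \<subseteq> \<Omega>"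
    using nonempty open_contains_cbox open_\<Omega> by (metis ex_in_conv)
  obtain \<beta> where \<beta>: "smooth \<beta>" "\<And>x. \<beta> x \<ge> 0" "\<And>x. \<beta> x > 0 \<longleftrightarrow> x \<in> box a b"
    using box_bump[of a b] by blast
  have "{x. \<beta> x \<noteq> 0} \<subseteq> cbox a b"
    using \<beta>(2,3) box_subset_cbox by (metis (mono_tags) less_eq_real_def mem_Collect_eq subsetD subsetI)
  then have t: "\<beta> \<in> test_functions \<Omega>"
    using \<beta>(1) ab(2) by (intro test_functionsI[of \<beta> "cbox a b"]) auto
  have "mass \<Omega> p \<beta> \<noteq> 0"
  proof
    assume "mass \<Omega> p \<beta> = 0"
    then have "AE x in lborel. (\<bar>\<beta> x\<bar> / depth \<Omega> x) powr p = 0"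
      unfolding mass_def using test_functions_mass_integrable[OF t assms]
      by (subst (asm) integral_nonneg_eq_0_iff_AE) auto
    then have "AE x in lborel. x \<notin> box a b"
    proof (rule eventually_mono)
      fix x assume *: "(\<bar>\<beta> x\<bar> / depth \<Omega> x) powr p = 0"
      show "x \<notin> box a b"
      proof
        assume "x \<in> box a b"
        then have "\<beta> x > 0" "depth \<Omega> x > 0"
          using \<beta>(3) ab(2) box_subset_cbox[of a b] by (auto intro!: depth_pos)
        then show False using * by simp
      qed
    qed
    then have "box a b \<in> null_sets lborel"
      by (subst (asm) AE_iff_null_sets[symmetric]) auto
    then have "negligible (box a b)"
      by (simp add: negligible_iff_null_sets null_sets_completionI)
    then show False using ab(1) by (simp add: negligible_interval)
  qed
  then show ?thesis using that[OF t] mass_nonneg[of \<Omega> p \<beta>] by linarith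
qed

section \<open>The Hardy inequality on the Sobolev closure\<close>

lemma Lp_space_diff:
  fixes f g :: "'a \<Rightarrow> 'b::euclidean_space"
  assumes "p > 1" "f \<in> Lp_space p \<Omega>" "g \<in> Lp_space p \<Omega>"
  shows "(\<lambda>x. f x - g x) \<in> Lp_space p \<Omega>"
proof -
  have m: "f \<in> borel_measurable (lebesgue_on \<Omega>)" "g \<in> borel_measurable (lebesgue_on \<Omega>)"
    and i: "integrable (lebesgue_on \<Omega>) (\<lambda>x. norm (f x) powr p)"
      "integrable (lebesgue_on \<Omega>) (\<lambda>x. norm (g x) powr p)"
    using assms by (auto simp: Lp_space_def)
  let ?c = "(1 / 2) powr (1 - p) :: real"
  have "integrable (lebesgue_on \<Omega>) (\<lambda>x. ?c * norm (f x) powr p + ?c * norm (g x) powr p)"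
    using i by auto
  then have "integrable (lebesgue_on \<Omega>) (\<lambda>x. norm (f x - g x) powr p)"
  proof (rule Bochner_Integration.integrable_bound)
    show "(\<lambda>x. norm (f x - g x) powr p) \<in> borel_measurable (lebesgue_on \<Omega>)"
      using m by measurable
    have "norm (norm (f x - g x) powr p) \<le> norm (?c * norm (f x) powr p + ?c * norm (g x) powr p)" for x
    proof -
      have "norm (f x - g x) powr p \<le> (norm (f x) + norm (g x)) powr p"
        using assms(1) by (intro powr_mono2 norm_triangle_ineq4) auto
      also have "\<dots> \<le> ?c * norm (f x) powr p + ?c * norm (g x) powr p"
        using powr_split[of "norm (f x)" "norm (g x)" p "1/2"] assms(1) by simp
      finally show ?thesis by simp
    qed
    then show "AE x in lebesgue_on \<Omega>. norm (norm (f x - g x) powr p) \<le> norm (?c * norm (f x) powr p + ?c * norm (g x) powr p)"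
      by (intro AE_I2)
  qed
  then show ?thesis using m by (simp add: Lp_space_def)
qed

lemma sobolev_weak_gradient:
  "u \<in> sobolev p \<Omega> \<Longrightarrow> has_weak_gradient \<Omega> u (weak_gradient \<Omega> u)"
  using someI_ex[of "has_weak_gradient \<Omega> u"] unfolding sobolev_def weak_gradient_def by auto

lemma weak_gradient_diff_test:
  assumes "u \<in> sobolev p \<Omega>" "\<phi> \<in> test_functions \<Omega>"
  shows "AE x in lebesgue_on \<Omega>. weak_gradient \<Omega> (\<lambda>x. u x - \<phi> x) x = weak_gradient \<Omega> u x - grad \<phi> x"
  by (intro weak_gradient_AE_eq has_weak_gradient_diff open_\<Omega> sobolev_weak_gradient[OF assms(1)]
      has_weak_gradient_grad test_functions_UNIV[OF assms(2)])

lemma grad_Lp_space: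
  assumes "\<phi> \<in> test_functions \<Omega>" "p > 1"
  shows "grad \<phi> \<in> Lp_space p \<Omega>"
proof -
  have "integrable (lebesgue_on \<Omega>) (\<lambda>x. norm (grad \<phi> x) powr p)"
    using assms open_\<Omega> by (intro integrable_lebesgue_on_of_lborel test_functions_energy_integrable[OF assms(1)]) auto
  moreover have "grad \<phi> \<in> borel_measurable (lebesgue_on \<Omega>)"
    by (intro borel_measurable_lebesgue_on borel_measurable_continuous_onI
        smooth_continuous_grad test_functions_smooth[OF assms(1)])
  ultimately show ?thesis by (simp add: Lp_space_def)
qed

text \<open>Linearity and uniqueness replace the weak gradient chosen for u - \<phi> by the
  difference of gradients almost everywhere; the Sobolev norm then controls both integrals
  separately.\<close>

lemma sobolev_zero_approx:
  assumes u: "u \<in> sobolev_zero p \<Omega>" and p: "p > 1"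
  obtains \<phi> :: "nat \<Rightarrow> 'a \<Rightarrow> real" where "\<And>n. \<phi> n \<in> test_functions \<Omega>"
    "(\<lambda>n. \<integral>x. \<bar>u x - \<phi> n x\<bar> powr p \<partial>lebesgue_on \<Omega>) \<longlonglongrightarrow> 0"
    "(\<lambda>n. \<integral>x. norm (weak_gradient \<Omega> u x - grad (\<phi> n) x) powr p \<partial>lebesgue_on \<Omega>) \<longlonglongrightarrow> 0"
proof -
  have us: "u \<in> sobolev p \<Omega>" using u by (simp add: sobolev_zero_def)
  have "\<exists>\<phi>\<in>test_functions \<Omega>. sobolev_norm p \<Omega> (\<lambda>x. u x - \<phi> x) < inverse (real (Suc n))" for n
    using u by (simp add: sobolev_zero_def)
  then obtain \<phi> where \<phi>: "\<And>n. \<phi> n \<in> test_functions \<Omega>"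
    "\<And>n. sobolev_norm p \<Omega> (\<lambda>x. u x - \<phi> n x) < inverse (real (Suc n))"
    by metis
  define A where "A n = (\<integral>x. \<bar>u x - \<phi> n x\<bar> powr p \<partial>lebesgue_on \<Omega>)" for n
  define B where "B n = (\<integral>x. norm (weak_gradient \<Omega> u x - grad (\<phi> n) x) powr p \<partial>lebesgue_on \<Omega>)" for n
  have AB0: "A n \<ge> 0" "B n \<ge> 0" for n by (simp_all add: A_def B_def)
  have wm: "weak_gradient \<Omega> u \<in> borel_measurable (lebesgue_on \<Omega>)"
    using us by (simp add: sobolev_def Lp_space_def)
  have gm: "grad (\<phi> n) \<in> borel_measurable (lebesgue_on \<Omega>)" for n
    using grad_Lp_space[OF \<phi>(1) p] by (simp add: Lp_space_def)
  have "(\<integral>x. norm (weak_gradient \<Omega> (\<lambda>x. u x - \<phi> n x) x) powr p \<partial>lebesgue_on \<Omega>) = B n" for n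
    unfolding B_def
  proof (rule integral_cong_AE)
    note ae = weak_gradient_diff_test[OF us \<phi>(1)[of n]]
    have "(\<lambda>x. weak_gradient \<Omega> u x - grad (\<phi> n) x) \<in> borel_measurable (lebesgue_on \<Omega>)"
      using wm gm by measurable
    then have "weak_gradient \<Omega> (\<lambda>x. u x - \<phi> n x) \<in> borel_measurable (lebesgue_on \<Omega>)"
      by (rule borel_measurable_lebesgue_on_AE) (use ae in \<open>elim eventually_mono, simp\<close>)
    then show "(\<lambda>x. norm (weak_gradient \<Omega> (\<lambda>x. u x - \<phi> n x) x) powr p) \<in> borel_measurable (lebesgue_on \<Omega>)"
      by measurable
    show "AE x in lebesgue_on \<Omega>. norm (weak_gradient \<Omega> (\<lambda>x. u x - \<phi> n x) x) powr p =
       norm (weak_gradient \<Omega> u x - grad (\<phi> n) x) powr p"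
      using ae by (elim eventually_mono) simp
  qed (use wm gm in measurable)
  then have norm_eq: "sobolev_norm p \<Omega> (\<lambda>x. u x - \<phi> n x) = (A n + B n) powr (1 / p)" for n
    by (simp add: sobolev_norm_def A_def)
  have AB: "A n + B n \<le> inverse (real (Suc n)) powr p" for n
  proof -
    have "A n + B n = ((A n + B n) powr (1 / p)) powr p"
      using AB0[of n] p by (simp add: powr_powr)
    also have "\<dots> \<le> inverse (real (Suc n)) powr p"
      using \<phi>(2)[of n] p unfolding norm_eq by (intro powr_mono2) auto
    finally show ?thesis .
  qed
  have "(\<lambda>n. inverse (real (Suc n)) powr p) \<longlonglongrightarrow> 0"
    using p by (intro tendsto_zero_powrI LIMSEQ_inverse_real_of_nat tendsto_const) auto
  note lim = tendsto_sandwich[OF _ _ tendsto_const this]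
  have le: "A n \<le> inverse (real (Suc n)) powr p" "B n \<le> inverse (real (Suc n)) powr p" for n
    using AB[of n] AB0[of n] by linarith+
  have "A \<longlonglongrightarrow> 0" by (rule lim) (use AB0 le in \<open>auto intro!: always_eventually\<close>)
  moreover have "B \<longlonglongrightarrow> 0" by (rule lim) (use AB0 le in \<open>auto intro!: always_eventually\<close>)
  ultimately have "A \<longlonglongrightarrow> 0" "B \<longlonglongrightarrow> 0" .
  then show ?thesis using that[of \<phi>] \<phi>(1) by (simp add: A_def[abs_def] B_def[abs_def])
qed

lemma energy_le_split:
  assumes us: "u \<in> sobolev p \<Omega>" and p: "p > 1" and \<phi>: "\<phi> \<in> test_functions \<Omega>" and l: "0 < l" "l < 1"
  shows "energy p \<phi> \<le> (1 - l) powr (1 - p) * (\<integral>x. norm (weak_gradient \<Omega> u x) powr p \<partial>lebesgue_on \<Omega>) +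
    l powr (1 - p) * (\<integral>x. norm (weak_gradient \<Omega> u x - grad \<phi> x) powr p \<partial>lebesgue_on \<Omega>)"
proof -
  have L: "weak_gradient \<Omega> u \<in> Lp_space p \<Omega>" "(\<lambda>x. weak_gradient \<Omega> u x - grad \<phi> x) \<in> Lp_space p \<Omega>" 
    using us grad_Lp_space[OF \<phi> p] by (auto intro!: Lp_space_diff p simp: sobolev_def)
  have I: "integrable (lebesgue_on \<Omega>) (\<lambda>x. norm (weak_gradient \<Omega> u x) powr p)"
    "integrable (lebesgue_on \<Omega>) (\<lambda>x. norm (weak_gradient \<Omega> u x - grad \<phi> x) powr p)"
    "integrable (lebesgue_on \<Omega>) (\<lambda>x. norm (grad \<phi> x) powr p)"
    using L grad_Lp_space[OF \<phi> p] by (auto simp: Lp_space_def)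
  have "energy p \<phi> = (\<integral>x. norm (grad \<phi> x) powr p \<partial>lebesgue_on \<Omega>)"
    unfolding energy_def using test_functions_grad_outside[OF \<phi>] p
    by (intro integral_lebesgue_on[symmetric] open_\<Omega> bbs_measurable bbs_powr' test_functions_grad_bbs[OF \<phi>]) auto
  also have "\<dots> \<le> (\<integral>x. (1 - l) powr (1 - p) * norm (weak_gradient \<Omega> u x) powr p +
      l powr (1 - p) * norm (weak_gradient \<Omega> u x - grad \<phi> x) powr p \<partial>lebesgue_on \<Omega>)"
  proof (rule integral_mono)
    fix x
    have "norm (grad \<phi> x) powr p \<le> (norm (weak_gradient \<Omega> u x) + norm (weak_gradient \<Omega> u x - grad \<phi> x)) powr p"
      using p norm_triangle_sub[of "grad \<phi> x" "weak_gradient \<Omega> u x"]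
      by (intro powr_mono2) (auto simp: norm_minus_commute)
    also have "\<dots> \<le> (1 - l) powr (1 - p) * norm (weak_gradient \<Omega> u x) powr p +
      l powr (1 - p) * norm (weak_gradient \<Omega> u x - grad \<phi> x) powr p"
      using p l by (intro powr_split) auto
    finally show "norm (grad \<phi> x) powr p \<le> (1 - l) powr (1 - p) * norm (weak_gradient \<Omega> u x) powr p +
      l powr (1 - p) * norm (weak_gradient \<Omega> u x - grad \<phi> x) powr p" .
  qed (use I in auto)
  finally show ?thesis using I by simp
qed

text \<open>Passage from test functions to their closure. The masses are lower semicontinuous by
  Fatou's lemma along a subsequence converging almost everywhere; the energies are compared through
  \<open>energy_le_split\<close>, with an error that vanishes in the limit. In particular the mass
  of u is finite.\<close>

lemma sobolev_zero_mass_le: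
  assumes u: "u \<in> sobolev_zero p \<Omega>" and p: "p > 1" and H: "H > 0"
    and hardy: "\<And>\<phi>. \<phi> \<in> test_functions \<Omega> \<Longrightarrow> H * mass \<Omega> p \<phi> \<le> energy p \<phi>"
  shows "(\<integral>\<^sup>+x. ennreal ((\<bar>u x\<bar> / depth \<Omega> x) powr p) \<partial>lebesgue_on \<Omega>) \<le>
    ennreal ((\<integral>x. norm (weak_gradient \<Omega> u x) powr p \<partial>lebesgue_on \<Omega>) / H)" (is "?den \<le> ennreal (?N / H)")
proof -
  have us: "u \<in> sobolev p \<Omega>" using u by (simp add: sobolev_zero_def)
  have uL: "u \<in> Lp_space p \<Omega>" using us by (simp add: sobolev_def)
  obtain \<phi> :: "nat \<Rightarrow> 'a \<Rightarrow> real" where \<phi>: "\<And>n. \<phi> n \<in> test_functions \<Omega>"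
    "(\<lambda>n. \<integral>x. \<bar>u x - \<phi> n x\<bar> powr p \<partial>lebesgue_on \<Omega>) \<longlonglongrightarrow> 0"
    "(\<lambda>n. \<integral>x. norm (weak_gradient \<Omega> u x - grad (\<phi> n) x) powr p \<partial>lebesgue_on \<Omega>) \<longlonglongrightarrow> 0"
    using sobolev_zero_approx[OF u p] by blast
  define B where "B n = (\<integral>x. norm (weak_gradient \<Omega> u x - grad (\<phi> n) x) powr p \<partial>lebesgue_on \<Omega>)" for n
  have \<phi>L: "\<phi> n \<in> Lp_space p \<Omega>" for n
    using test_functions_sobolev[OF \<phi>(1) p] by (simp add: sobolev_def)
  have "integrable (lebesgue_on \<Omega>) (\<lambda>x. \<bar>u x - \<phi> n x\<bar> powr p)" for n
    using Lp_space_diff[OF p uL \<phi>L] by (simp add: Lp_space_def)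
  then obtain r where r: "strict_mono r" "AE x in lebesgue_on \<Omega>. (\<lambda>n. \<bar>u x - \<phi> (r n) x\<bar> powr p) \<longlonglongrightarrow> 0"
    using tendsto_L1_AE_subseq[of "lebesgue_on \<Omega>" "\<lambda>n x. \<bar>u x - \<phi> n x\<bar> powr p"] \<phi>(2) by auto
  have conv: "AE x in lebesgue_on \<Omega>. (\<lambda>n. ennreal ((\<bar>\<phi> (r n) x\<bar> / depth \<Omega> x) powr p)) \<longlonglongrightarrow> ennreal ((\<bar>u x\<bar> / depth \<Omega> x) powr p)"
  proof (rule AE_mp[OF r(2)], rule AE_I2, rule impI)
    fix x assume x: "x \<in> space (lebesgue_on \<Omega>)" and *: "(\<lambda>n. \<bar>u x - \<phi> (r n) x\<bar> powr p) \<longlonglongrightarrow> 0"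
    have "(\<lambda>n. (\<bar>u x - \<phi> (r n) x\<bar> powr p) powr (1 / p)) \<longlonglongrightarrow> 0"
      using * p by (intro tendsto_zero_powrI[OF * tendsto_const]) auto
    then have "(\<lambda>n. u x - \<phi> (r n) x) \<longlonglongrightarrow> 0"
      using p by (simp add: powr_powr tendsto_rabs_zero_iff)
    then have "(\<lambda>n. u x - (u x - \<phi> (r n) x)) \<longlonglongrightarrow> u x - 0"
      by (intro tendsto_diff tendsto_const)
    then have "(\<lambda>n. \<phi> (r n) x) \<longlonglongrightarrow> u x" by simp
    moreover have "depth \<Omega> x > 0" using x by (auto intro: depth_pos)
    ultimately show "(\<lambda>n. ennreal ((\<bar>\<phi> (r n) x\<bar> / depth \<Omega> x) powr p)) \<longlonglongrightarrow> ennreal ((\<bar>u x\<bar> / depth \<Omega> x) powr p)"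
      using p by (intro tendsto_ennrealI tendsto_powr' tendsto_divide tendsto_rabs tendsto_const) auto
  qed
  have meas: "(\<lambda>x. ennreal ((\<bar>\<phi> (r n) x\<bar> / depth \<Omega> x) powr p)) \<in> borel_measurable (lebesgue_on \<Omega>)" for n
  proof -
    have [measurable]: "\<phi> (r n) \<in> borel_measurable (lebesgue_on \<Omega>)" "depth \<Omega> \<in> borel_measurable (lebesgue_on \<Omega>)"
      using \<phi>L borel_measurable_lebesgue_on[OF depth_measurable] by (auto simp: Lp_space_def)
    show ?thesis by measurable
  qed
  have den: "?den \<le> liminf (\<lambda>n. ennreal (mass \<Omega> p (\<phi> (r n))))"
  proof -
    have "?den = (\<integral>\<^sup>+x. liminf (\<lambda>n. ennreal ((\<bar>\<phi> (r n) x\<bar> / depth \<Omega> x) powr p)) \<partial>lebesgue_on \<Omega>)"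
      by (rule nn_integral_cong_AE, rule eventually_mono[OF conv], rule lim_imp_Liminf[symmetric])
        simp_all
    also have "\<dots> \<le> liminf (\<lambda>n. \<integral>\<^sup>+x. ennreal ((\<bar>\<phi> (r n) x\<bar> / depth \<Omega> x) powr p) \<partial>lebesgue_on \<Omega>)"
      by (intro nn_integral_liminf meas)
    finally show ?thesis using nn_mass_test[OF \<phi>(1)] p by simp
  qed
  have lam: "?den \<le> ennreal ((1 - l) powr (1 - p) * ?N / H)" if l: "0 < l" "l < 1" for l
  proof -
    have "ennreal (mass \<Omega> p (\<phi> (r n))) \<le> ennreal (((1 - l) powr (1 - p) * ?N + l powr (1 - p) * B (r n)) / H)" for n
      using order_trans[OF hardy[OF \<phi>(1)] energy_le_split[OF us p \<phi>(1) l]] H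
      by (intro ennreal_leI) (simp add: B_def field_simps)
    then have "?den \<le>
        liminf (\<lambda>n. ennreal (((1 - l) powr (1 - p) * ?N + l powr (1 - p) * B (r n)) / H))"
      by (intro order_trans[OF den] Liminf_mono always_eventually) auto
    moreover have "(\<lambda>n. B (r n)) \<longlonglongrightarrow> 0"
      using LIMSEQ_subseq_LIMSEQ[OF \<phi>(3) r(1)] by (simp add: B_def[abs_def] o_def)
    then have "(\<lambda>n. ennreal (((1 - l) powr (1 - p) * ?N + l powr (1 - p) * B (r n)) / H)) \<longlonglongrightarrow>
        ennreal (((1 - l) powr (1 - p) * ?N + l powr (1 - p) * 0) / H)"
      using H by (intro tendsto_ennrealI tendsto_intros) auto
    then have "liminf (\<lambda>n. ennreal (((1 - l) powr (1 - p) * ?N + l powr (1 - p) * B (r n)) / H)) =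
        ennreal ((1 - l) powr (1 - p) * ?N / H)"
      by (simp add: lim_imp_Liminf)
    ultimately show ?thesis by simp
  qed
  \<comment> \<open>The order of limits matters: the factor l^(1 - p) of the error blows up for l
    near 0, so n tends to infinity for fixed l, and only then does l tend to 0.\<close>
  have "((\<lambda>l. ennreal ((1 - l) powr (1 - p) * ?N / H)) \<longlongrightarrow> ennreal ((1 - 0) powr (1 - p) * ?N / H)) (at_right 0)"
    using H by (intro tendsto_ennrealI tendsto_intros) auto
  then have "((\<lambda>l. ennreal ((1 - l) powr (1 - p) * ?N / H)) \<longlongrightarrow> ennreal (?N / H)) (at_right 0)" by simp
  then show ?thesis
  proof (rule tendsto_lowerbound)
    have "\<forall>\<^sub>F l in at_right (0::real). 0 < l \<and> l < 1"
      by (auto simp: eventually_at_right_field intro!: exI[of _ 1])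
    then show "\<forall>\<^sub>F l in at_right 0. ?den \<le> ennreal ((1 - l) powr (1 - p) * ?N / H)"
      by (elim eventually_mono) (use lam in auto)
  qed simp
qed

text \<open>For positive H every quotient in the infimum is at least H by
  \<open>sobolev_zero_mass_le\<close>, whose bound also makes each denominator finite; the
  denominators are nonzero because u does not vanish almost everywhere.\<close>

lemma hardy_constant_ge:
  assumes p: "p > 1"
    and hardy: "\<And>\<phi>. \<phi> \<in> test_functions \<Omega> \<Longrightarrow> H * mass \<Omega> p \<phi> \<le> energy p \<phi>"
  shows "H \<le> hardy_constant \<Omega> p"
proof (cases "H > 0")
  case False
  then show ?thesis using hardy_constant_nonneg[of p] by linarith
next
  case H: True
  let ?Q = "\<lambda>u. (\<integral>\<^sup>+x. ennreal (norm (weak_gradient \<Omega> u x) powr p) \<partial>lebesgue_on \<Omega>) /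
       (\<integral>\<^sup>+x. ennreal (\<bar>u x\<bar> powr p / infdist x (frontier \<Omega>) powr p) \<partial>lebesgue_on \<Omega>)"
  let ?I = "INF u \<in> {u \<in> sobolev_zero p \<Omega>. \<not> (AE x in lebesgue_on \<Omega>. u x = 0)}. ?Q u"
  have "ennreal H \<le> ?Q u" if u: "u \<in> sobolev_zero p \<Omega>" "\<not> (AE x in lebesgue_on \<Omega>. u x = 0)" for u
  proof -
    let ?N = "\<integral>x. norm (weak_gradient \<Omega> u x) powr p \<partial>lebesgue_on \<Omega>"
    let ?den = "\<integral>\<^sup>+x. ennreal ((\<bar>u x\<bar> / depth \<Omega> x) powr p) \<partial>lebesgue_on \<Omega>"
    have uL: "u \<in> Lp_space p \<Omega>" "weak_gradient \<Omega> u \<in> Lp_space p \<Omega>"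
      using u(1) by (auto simp: sobolev_zero_def sobolev_def)
    have le: "?den \<le> ennreal (?N / H)"
      by (rule sobolev_zero_mass_le[OF u(1) p H hardy])
    have num: "(\<integral>\<^sup>+x. ennreal (norm (weak_gradient \<Omega> u x) powr p) \<partial>lebesgue_on \<Omega>) = ennreal ?N"
      using uL by (intro nn_integral_eq_integral) (auto simp: Lp_space_def)
    have "?den \<noteq> 0"
    proof
      assume 0: "?den = 0"
      have [measurable]: "u \<in> borel_measurable (lebesgue_on \<Omega>)" "depth \<Omega> \<in> borel_measurable (lebesgue_on \<Omega>)"
        using uL borel_measurable_lebesgue_on[OF depth_measurable] by (auto simp: Lp_space_def)
      have "(\<lambda>x. ennreal ((\<bar>u x\<bar> / depth \<Omega> x) powr p)) \<in> borel_measurable (lebesgue_on \<Omega>)"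
        by measurable
      then have "AE x in lebesgue_on \<Omega>. ennreal ((\<bar>u x\<bar> / depth \<Omega> x) powr p) = 0"
        using 0 by (simp add: nn_integral_0_iff_AE)
      then have "AE x in lebesgue_on \<Omega>. u x = 0"
      proof (rule AE_mp, intro AE_I2 impI)
        fix x assume "x \<in> space (lebesgue_on \<Omega>)" and *: "ennreal ((\<bar>u x\<bar> / depth \<Omega> x) powr p) = 0"
        then have "depth \<Omega> x > 0" by (auto intro: depth_pos)
        then show "u x = 0" using * by simp
      qed
      then show False using u(2) by blast
    qed
    moreover obtain m where m: "?den = ennreal m" "m \<ge> 0"
      using le by (cases ?den) (auto simp: top_unique)
    ultimately have m0: "m > 0" by (cases "m = 0") auto
    have N0: "?N \<ge> 0" by simp
    have "m \<le> ?N / H" using le m N0 H by (simp add: ennreal_le_iff divide_nonneg_pos del: integral_nonneg)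
    then have "H \<le> ?N / m" using m0 H by (simp add: field_simps)
    then have "ennreal H \<le> ennreal ?N / ennreal m"
      using N0 m0 by (subst divide_ennreal) (auto intro: ennreal_leI)
    then show ?thesis using num m(1) nn_mass_eq by simp
  qed
  then have lower: "ennreal H \<le> ?I" by (intro INF_greatest) auto
  \<comment> \<open>\<open>enn2real\<close> sends infinity to 0, so the lower bound survives the
    conversion only because some quotient is finite.\<close>
  obtain \<phi> where \<phi>: "\<phi> \<in> test_functions \<Omega>" "mass \<Omega> p \<phi> > 0"
    using test_function_mass_pos[of p] p by auto
  have "\<not> (AE x in lebesgue_on \<Omega>. \<phi> x = 0)"
    using mass_eq_0_AE[OF \<phi>(1)] \<phi>(2) p by fastforce
  then have "?I \<le> ?Q \<phi>"
    using test_functions_sobolev_zero[OF \<phi>(1) p] by (intro INF_lower) auto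
  also have "(\<integral>\<^sup>+x. ennreal (norm (weak_gradient \<Omega> \<phi> x) powr p) \<partial>lebesgue_on \<Omega>) =
      (\<integral>\<^sup>+x. ennreal (norm (grad \<phi> x) powr p) \<partial>lebesgue_on \<Omega>)"
    using weak_gradient_test_AE[OF \<phi>(1)] by (intro nn_integral_cong_AE) (elim eventually_mono, auto)
  finally have "?I \<le> ennreal (energy p \<phi>) / ennreal (mass \<Omega> p \<phi>)"
    using nn_energy_test[OF \<phi>(1)] nn_mass_eq nn_mass_test[OF \<phi>(1)] p by simp
  also have "\<dots> = ennreal (energy p \<phi> / mass \<Omega> p \<phi>)"
    using \<phi>(2) by (simp add: divide_ennreal energy_nonneg)
  finally have "?I < top"
    by (rule le_less_trans) simp
  then have "enn2real (ennreal H) \<le> enn2real ?I"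
    using lower by (intro enn2real_mono) auto
  then show ?thesis using H by (simp add: hardy_constant_def)
qed

end

section \<open>Lipschitz competitors\<close>

lemma integral_pos_box:
  fixes F :: "'a::euclidean_space \<Rightarrow> real"
  assumes "bbs F" "\<And>x. F x \<ge> 0" "\<And>x. x \<in> box a b \<Longrightarrow> F x > 0" "x \<in> box a b"
  shows "(\<integral>x. F x \<partial>lborel) > 0"
proof -
  have "(\<integral>x. F x \<partial>lborel) \<noteq> 0"
  proof
    assume "(\<integral>x. F x \<partial>lborel) = 0"
    then have "AE x in lborel. F x = 0"
      using bbs_integrable[OF assms(1)] assms(2) by (subst (asm) integral_nonneg_eq_0_iff_AE) auto
    then have "AE x in lborel. x \<notin> box a b"
      by (rule eventually_mono) (use assms(3) in force)
    then have "box a b \<in> null_sets lborel"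
      by (subst (asm) AE_iff_null_sets[symmetric]) auto
    then have "negligible (box a b)"
      by (simp add: negligible_iff_null_sets null_sets_completionI)
    then show False using assms(4) by (simp add: negligible_interval)
  qed
  moreover have "(\<integral>x. F x \<partial>lborel) \<ge> 0" using assms(2) by simp
  ultimately show ?thesis by linarith
qed

lemma mollifier:
  fixes \<epsilon> :: real
  assumes "\<epsilon> > 0"
  obtains \<eta> :: "'a::euclidean_space \<Rightarrow> real" where "\<eta> \<in> test_functions UNIV" "\<And>z. \<eta> z \<ge> 0"
    "\<And>z. \<eta> z \<noteq> 0 \<Longrightarrow> norm z < \<epsilon>" "(\<integral>z. \<eta> z \<partial>lborel) = 1"
proof -
  obtain a b :: 'a where ab: "cbox a b \<subseteq> ball 0 \<epsilon>" "0 \<in> box a b"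
    using open_contains_cbox[of "ball 0 \<epsilon>" "0 :: 'a"] assms by (metis centre_in_ball open_ball)
  obtain \<beta> where \<beta>: "smooth \<beta>" "\<And>x. \<beta> x \<ge> 0" "\<And>x. \<beta> x > 0 \<longleftrightarrow> x \<in> box a b"
    using box_bump[of a b] by blast
  have pos: "x \<in> box a b" if "\<beta> x \<noteq> 0" for x
    using \<beta>(2,3)[of x] that by linarith
  have supp: "{x. \<beta> x \<noteq> 0} \<subseteq> cbox a b"
    using pos box_subset_cbox by blast
  have t: "\<beta> \<in> test_functions UNIV"
    by (rule test_functionsI[OF \<beta>(1) supp]) auto
  have I: "(\<integral>x. \<beta> x \<partial>lborel) > 0"
    by (rule integral_pos_box[OF test_functions_bbs[OF t] \<beta>(2) _ ab(2)]) (use \<beta>(3) in auto)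
  show ?thesis
  proof
    let ?\<eta> = "\<lambda>x. inverse (\<integral>x. \<beta> x \<partial>lborel) * \<beta> x"
    show "?\<eta> \<in> test_functions UNIV"
      by (rule test_functions_mult[OF smooth_const t])
    show "?\<eta> z \<ge> 0" for z using \<beta>(2) I by simp
    show "norm z < \<epsilon>" if "?\<eta> z \<noteq> 0" for z
      using supp ab(1) that by auto
    show "(\<integral>z. ?\<eta> z \<partial>lborel) = 1" using I by simp
  qed
qed

text \<open>An average of values within \<delta> of c is within \<delta> of c. The free centre c
  serves for approximation errors (c = f x), for sup bounds (c = 0), and for confining values to the
  unit interval (c = 1/2).\<close>

lemma conv_close:
  assumes \<eta>: "bbs \<eta>" "\<And>z. \<eta> z \<ge> 0" "(\<integral>z. \<eta> z \<partial>lborel) = 1" and f: "bbs f"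
    and close: "\<And>z. \<eta> z \<noteq> 0 \<Longrightarrow> \<bar>f (x + z) - c\<bar> \<le> \<delta>"
  shows "\<bar>conv \<eta> f x - c\<bar> \<le> \<delta>"
proof -
  note I = bbs_integrable[OF \<eta>(1)] bbs_integrable[OF bbs_conv_integrand[OF \<eta>(1) f, of x]]
  have "conv \<eta> f x - c = (\<integral>z. \<eta> z * f (x + z) - c * \<eta> z \<partial>lborel)"
    using I \<eta>(3) by (simp add: conv_def)
  also have "\<bar>\<dots>\<bar> \<le> (\<integral>z. \<delta> * \<eta> z \<partial>lborel)"
  proof (rule Bochner_Integration.integral_abs_bound_integral)
    fix z
    show "\<bar>\<eta> z * f (x + z) - c * \<eta> z\<bar> \<le> \<delta> * \<eta> z"
    proof (cases "\<eta> z = 0")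
      case False
      have "\<eta> z * f (x + z) - c * \<eta> z = (f (x + z) - c) * \<eta> z"
        by (simp add: algebra_simps)
      then have "\<bar>\<eta> z * f (x + z) - c * \<eta> z\<bar> = \<bar>f (x + z) - c\<bar> * \<eta> z"
        using \<eta>(2)[of z] by (simp add: abs_mult)
      then show ?thesis using close[OF False] \<eta>(2)[of z] by (simp add: mult_right_mono)
    qed simp
  qed (use I in auto)
  finally show ?thesis using \<eta>(3) by simp
qed

section \<open>Calculus of upper gradients at a point\<close>

definition ugrad :: "('a::euclidean_space \<Rightarrow> real) \<Rightarrow> 'a \<Rightarrow> real \<Rightarrow> bool" where
  "ugrad f x k \<longleftrightarrow> (\<forall>e>0. \<forall>\<^sub>F y in nhds x. \<bar>f y - f x\<bar> \<le> (k + e) * norm (y - x))"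

lemma upper_grad_iff_ugrad: "upper_grad f g \<longleftrightarrow> (\<forall>x. ugrad f x (g x))"
  by (simp add: upper_grad_def ugrad_def)

lemma ugrad_cong:
  assumes "ugrad f x k" "\<forall>\<^sub>F y in nhds x. g y = f y"
  shows "ugrad g x k"
  unfolding ugrad_def
proof (intro allI impI)
  fix e :: real assume "e > 0"
  then have "\<forall>\<^sub>F y in nhds x. \<bar>f y - f x\<bar> \<le> (k + e) * norm (y - x)"
    using assms(1) by (simp add: ugrad_def)
  then show "\<forall>\<^sub>F y in nhds x. \<bar>g y - g x\<bar> \<le> (k + e) * norm (y - x)"
    using assms(2) by eventually_elim (use eventually_nhds_x_imp_x[OF assms(2)] in simp)
qed

lemma ugrad_const: "k \<ge> 0 \<Longrightarrow> ugrad (\<lambda>y. c) x k"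
  by (auto simp: ugrad_def intro!: always_eventually mult_nonneg_nonneg add_nonneg_nonneg)

lemma ugrad_lipschitz: "(\<And>y. \<bar>f y - f x\<bar> \<le> k * norm (y - x)) \<Longrightarrow> ugrad f x k"
  unfolding ugrad_def
proof (intro allI impI always_eventually)
  fix e :: real and y assume *: "\<And>y. \<bar>f y - f x\<bar> \<le> k * norm (y - x)" and "e > 0"
  then show "\<bar>f y - f x\<bar> \<le> (k + e) * norm (y - x)"
    using *[of y] by (simp add: distrib_right add_increasing2)
qed

lemma ugrad_dominated:
  assumes "ugrad f x k" "\<And>y. \<bar>g y - g x\<bar> \<le> \<bar>f y - f x\<bar>"
  shows "ugrad g x k"
  unfolding ugrad_def
proof (intro allI impI)
  fix e :: real assume "e > 0"
  then have "\<forall>\<^sub>F y in nhds x. \<bar>f y - f x\<bar> \<le> (k + e) * norm (y - x)"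
    using assms(1) by (simp add: ugrad_def)
  then show "\<forall>\<^sub>F y in nhds x. \<bar>g y - g x\<bar> \<le> (k + e) * norm (y - x)"
    by eventually_elim (use assms(2) order_trans in blast)
qed

lemma ugrad_tendsto:
  assumes "ugrad f x k"
  shows "(f \<longlongrightarrow> f x) (nhds x)"
proof (rule Lim_null[THEN iffD2], rule Lim_null_comparison)
  show "\<forall>\<^sub>F y in nhds x. norm (f y - f x) \<le> (k + 1) * norm (y - x)"
    using assms by (auto simp: ugrad_def)
  have "((\<lambda>y. (k + 1) * norm (y - x)) \<longlongrightarrow> (k + 1) * norm (x - x)) (nhds x)"
    by (intro tendsto_intros filterlim_ident)
  then show "((\<lambda>y. (k + 1) * norm (y - x)) \<longlongrightarrow> 0) (nhds x)" by simp
qed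

lemma ugrad_has_derivative:
  assumes "(f has_derivative (\<lambda>v. g \<bullet> v)) (at x)"
  shows "ugrad f x (norm g)"
  unfolding ugrad_def
proof (intro allI impI)
  fix e :: real assume "e > 0"
  then obtain d where d: "d > 0"
    "\<And>y. norm (y - x) < d \<Longrightarrow> norm (f y - f x - g \<bullet> (y - x)) \<le> e * norm (y - x)"
    using assms unfolding has_derivative_at_alt by blast
  have "\<forall>\<^sub>F y in nhds x. dist y x < d" using d(1) by (rule eventually_nhds_metric[THEN iffD2, OF exI[of _ d], OF conjI]) auto
  then show "\<forall>\<^sub>F y in nhds x. \<bar>f y - f x\<bar> \<le> (norm g + e) * norm (y - x)"
  proof eventually_elim
    case (elim y)
    have "\<bar>f y - f x\<bar> \<le> \<bar>f y - f x - g \<bullet> (y - x)\<bar> + \<bar>g \<bullet> (y - x)\<bar>" by simp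
    also have "\<dots> \<le> e * norm (y - x) + norm g * norm (y - x)"
      using d(2)[of y] elim Cauchy_Schwarz_ineq2[of g "y - x"]
      by (intro add_mono) (auto simp: dist_norm)
    finally show ?case by (simp add: algebra_simps)
  qed
qed

lemma ugrad_smooth: "smooth \<phi> \<Longrightarrow> ugrad \<phi> x (norm (grad \<phi> x))"
  by (intro ugrad_has_derivative smooth_has_derivative_grad)

text \<open>Distributes a tolerance over the two perturbed factors of a product, as the chain and
  product rules require: for e' \<le> 1 the excess e' (a + k + e') is at most e' (a + k +
  1).\<close>

lemma small_factor:
  fixes a k e :: real
  assumes "a \<ge> 0" "k \<ge> 0" "e > 0"
  obtains e' where "e' > 0" "(a + e') * (k + e') \<le> a * k + e"
proof
  let ?e = "min 1 (e / (a + k + 1))"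
  show "?e > 0" using assms by (simp add: divide_pos_pos)
  have "?e * (a + k + ?e) \<le> e / (a + k + 1) * (a + k + 1)"
    using assms by (intro mult_mono) auto
  also have "\<dots> = e" using assms by simp
  finally show "(a + ?e) * (k + ?e) \<le> a * k + e" by (simp add: algebra_simps)
qed

lemma ugrad_compose:
  assumes f: "ugrad f x k" "k \<ge> 0" and \<phi>: "(\<phi> has_real_derivative m) (at (f x))"
  shows "ugrad (\<lambda>y. \<phi> (f y)) x (\<bar>m\<bar> * k)"
  unfolding ugrad_def
proof (intro allI impI)
  fix e :: real assume "e > 0"
  then obtain e' where e': "e' > 0" "(\<bar>m\<bar> + e') * (k + e') \<le> \<bar>m\<bar> * k + e"
    using small_factor[of "\<bar>m\<bar>" k e] f(2) by auto
  have "ugrad \<phi> (f x) (norm m)"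
    using \<phi> by (intro ugrad_has_derivative) (simp add: has_field_derivative_def)
  then have "\<forall>\<^sub>F t in nhds (f x). \<bar>\<phi> t - \<phi> (f x)\<bar> \<le> (\<bar>m\<bar> + e') * norm (t - f x)"
    using e'(1) by (simp add: ugrad_def)
  from eventually_compose_filterlim[OF this ugrad_tendsto[OF f(1)]]
  have 1: "\<forall>\<^sub>F y in nhds x. \<bar>\<phi> (f y) - \<phi> (f x)\<bar> \<le> (\<bar>m\<bar> + e') * norm (f y - f x)" .
  have 2: "\<forall>\<^sub>F y in nhds x. \<bar>f y - f x\<bar> \<le> (k + e') * norm (y - x)"
    using f(1) e'(1) by (simp add: ugrad_def)
  show "\<forall>\<^sub>F y in nhds x. \<bar>\<phi> (f y) - \<phi> (f x)\<bar> \<le> (\<bar>m\<bar> * k + e) * norm (y - x)"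
    using 1 2
  proof eventually_elim
    case (elim y)
    note elim(1)
    also have "(\<bar>m\<bar> + e') * norm (f y - f x) \<le> (\<bar>m\<bar> + e') * ((k + e') * norm (y - x))"
      using elim(2) e'(1) by (intro mult_left_mono) auto
    also have "\<dots> \<le> (\<bar>m\<bar> * k + e) * norm (y - x)"
      using mult_right_mono[OF e'(2) norm_ge_zero[of "y - x"]] by (simp only: mult.assoc)
    finally show ?case .
  qed
qed

lemma ugrad_mult:
  assumes f: "ugrad f x k" "k \<ge> 0" and g: "ugrad g x m" "m \<ge> 0"
  shows "ugrad (\<lambda>y. f y * g y) x (\<bar>f x\<bar> * m + \<bar>g x\<bar> * k)"
  unfolding ugrad_def
proof (intro allI impI)
  fix e :: real assume e: "e > 0"
  obtain e1 where e1: "e1 > 0" "(\<bar>f x\<bar> + e1) * (m + e1) \<le> \<bar>f x\<bar> * m + e / 2"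
    using small_factor[of "\<bar>f x\<bar>" m "e / 2"] g(2) e by auto
  obtain e2 where e2: "e2 > 0" "(\<bar>g x\<bar> + e2) * (k + e2) \<le> \<bar>g x\<bar> * k + e / 2"
    using small_factor[of "\<bar>g x\<bar>" k "e / 2"] f(2) e by auto
  have 1: "\<forall>\<^sub>F y in nhds x. dist (f y) (f x) < e1"
    using ugrad_tendsto[OF f(1)] e1(1) by (rule tendstoD)
  have 2: "\<forall>\<^sub>F y in nhds x. \<bar>g y - g x\<bar> \<le> (m + e1) * norm (y - x)"
    using g(1) e1(1) by (simp add: ugrad_def)
  have 3: "\<forall>\<^sub>F y in nhds x. \<bar>f y - f x\<bar> \<le> (k + e2) * norm (y - x)"
    using f(1) e2(1) by (simp add: ugrad_def)
  show "\<forall>\<^sub>F y in nhds x. \<bar>f y * g y - f x * g x\<bar> \<le> (\<bar>f x\<bar> * m + \<bar>g x\<bar> * k + e) * norm (y - x)"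
    using 1 2 3
  proof eventually_elim
    case (elim y)
    have "f y * g y - f x * g x = f y * (g y - g x) + g x * (f y - f x)"
      by (simp add: algebra_simps)
    then have "\<bar>f y * g y - f x * g x\<bar> \<le> \<bar>f y\<bar> * \<bar>g y - g x\<bar> + \<bar>g x\<bar> * \<bar>f y - f x\<bar>"
      using abs_triangle_ineq[of "f y * (g y - g x)" "g x * (f y - f x)"] by (simp add: abs_mult)
    also have "\<dots> \<le> (\<bar>f x\<bar> + e1) * ((m + e1) * norm (y - x)) + (\<bar>g x\<bar> + e2) * ((k + e2) * norm (y - x))"
      using elim e1(1) e2(1) by (intro add_mono mult_mono) (auto simp: dist_real_def)
    also have "\<dots> \<le> (\<bar>f x\<bar> * m + e / 2) * norm (y - x) + (\<bar>g x\<bar> * k + e / 2) * norm (y - x)"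
      using mult_right_mono[OF e1(2) norm_ge_zero[of "y - x"]] mult_right_mono[OF e2(2) norm_ge_zero[of "y - x"]]
      by (simp only: mult.assoc)
    finally show ?case by (simp add: algebra_simps)
  qed
qed

text \<open>A mean value inequality without derivatives. The bound for increments along the segment
  is additive over adjacent intervals and holds, with an extra e, on short intervals around each
  point, so the bisection principle \<open>Bolzano\<close> extends it to the whole segment.\<close>

lemma ugrad_bound_lipschitz:
  fixes f :: "'a::euclidean_space \<Rightarrow> real"
  assumes "\<And>x. ugrad f x (g x)" "\<And>x. g x \<le> L"
  shows "\<bar>f y - f x\<bar> \<le> L * norm (y - x)"
proof (rule field_le_epsilon)
  fix e' :: real assume e': "e' > 0"
  define e where "e = e' / (norm (y - x) + 1)"
  have n1: "norm (y - x) + 1 > 0" by (simp add: add_nonneg_pos)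
  then have e: "e > 0" "e * (norm (y - x) + 1) = e'" using e' by (simp_all add: e_def)
  let ?\<gamma> = "\<lambda>t. x + t *\<^sub>R (y - x)"
  let ?P = "\<lambda>a b. \<bar>f (?\<gamma> b) - f (?\<gamma> a)\<bar> \<le> (L + e) * norm (y - x) * (b - a)"
  have "?P 0 1"
  proof (rule Bolzano[where P = ?P])
    fix a b c :: real assume "?P a b" "?P b c"
    moreover have "(L + e) * norm (y - x) * (c - a) =
      (L + e) * norm (y - x) * (b - a) + (L + e) * norm (y - x) * (c - b)"
      by (simp add: algebra_simps)
    ultimately show "?P a c" by linarith
  next
    fix t :: real
    have "\<forall>\<^sub>F z in nhds (?\<gamma> t). \<bar>f z - f (?\<gamma> t)\<bar> \<le> (g (?\<gamma> t) + e) * norm (z - ?\<gamma> t)"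
      using assms(1) e(1) by (simp add: ugrad_def)
    then have ev: "\<forall>\<^sub>F z in nhds (?\<gamma> t). \<bar>f z - f (?\<gamma> t)\<bar> \<le> (L + e) * norm (z - ?\<gamma> t)"
    proof eventually_elim
      case (elim z)
      also have "(g (?\<gamma> t) + e) * norm (z - ?\<gamma> t) \<le> (L + e) * norm (z - ?\<gamma> t)"
        using assms(2) by (intro mult_right_mono) auto
      finally show ?case .
    qed
    have "((\<lambda>s. x + s *\<^sub>R (y - x)) \<longlongrightarrow> ?\<gamma> t) (nhds t)" by (intro tendsto_intros filterlim_ident)
    from eventually_compose_filterlim[OF ev this]
    have "\<forall>\<^sub>F s in nhds t. \<bar>f (?\<gamma> s) - f (?\<gamma> t)\<bar> \<le> (L + e) * norm (?\<gamma> s - ?\<gamma> t)" .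
    then obtain d where d: "d > 0" "\<And>s. dist s t < d \<Longrightarrow> \<bar>f (?\<gamma> s) - f (?\<gamma> t)\<bar> \<le> (L + e) * norm (?\<gamma> s - ?\<gamma> t)"
      by (auto simp: eventually_nhds_metric)
    have eq: "norm (?\<gamma> s - ?\<gamma> t) = \<bar>s - t\<bar> * norm (y - x)" for s
      by (metis add_diff_cancel_left norm_scaleR scaleR_left_diff_distrib)
    show "\<exists>d>0. \<forall>a b. a \<le> t \<and> t \<le> b \<and> b - a < d \<longrightarrow> ?P a b"
    proof (intro exI[of _ d] conjI allI impI)
      fix a b assume ab: "a \<le> t \<and> t \<le> b \<and> b - a < d"
      then have "\<bar>f (?\<gamma> b) - f (?\<gamma> t)\<bar> \<le> (L + e) * (\<bar>b - t\<bar> * norm (y - x))"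
        "\<bar>f (?\<gamma> a) - f (?\<gamma> t)\<bar> \<le> (L + e) * (\<bar>a - t\<bar> * norm (y - x))"
        using d(2)[of b] d(2)[of a] unfolding eq by (auto simp: dist_real_def)
      moreover have "(L + e) * (\<bar>b - t\<bar> * norm (y - x)) + (L + e) * (\<bar>a - t\<bar> * norm (y - x)) =
          (L + e) * norm (y - x) * (b - a)"
        using ab by (simp add: algebra_simps)
      ultimately show "?P a b" by linarith
    qed (rule d(1))
  qed simp
  then have "\<bar>f y - f x\<bar> \<le> (L + e) * norm (y - x)" by simp
  also have "\<dots> \<le> L * norm (y - x) + e * (norm (y - x) + 1)"
    using e(1) by (simp add: algebra_simps)
  finally show "\<bar>f y - f x\<bar> \<le> L * norm (y - x) + e'" using e(2) by simp
qed

lemma upper_grad_lipschitz: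
  assumes "upper_grad f g" "bbs g"
  obtains L where "L \<ge> 0" "\<And>x y. \<bar>f x - f y\<bar> \<le> L * norm (x - y)"
proof -
  obtain L where L: "\<And>x. \<bar>g x\<bar> \<le> L" using assms(2) by (auto simp: bbs_def)
  have "g x \<le> L" for x using L[of x] by simp
  moreover have "L \<ge> 0" using L[of undefined] by simp
  ultimately show ?thesis
    using that[of L] ugrad_bound_lipschitz[of f g L] assms(1) by (auto simp: upper_grad_iff_ugrad)
qed

text \<open>The gradient of the mollified function is at most the average of g, Jensen's inequality
  moves the power inside, and averaging preserves the integral. Mollification thus does not increase
  the energy.\<close>

lemma energy_conv_le:
  assumes \<eta>: "\<eta> \<in> test_functions UNIV" "\<And>z. \<eta> z \<ge> 0" "(\<integral>z. \<eta> z \<partial>lborel) = 1" and f: "bbs f"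
    and g: "upper_grad f g" "bbs g" "\<And>x. g x \<ge> 0" and p: "p > 1"
  shows "energy p (conv \<eta> f) \<le> (\<integral>x. g x powr p \<partial>lborel)"
proof -
  obtain L where L: "\<And>x y. \<bar>f x - f y\<bar> \<le> L * norm (x - y)"
    using upper_grad_lipschitz[OF g(1,2)] by blast
  note b\<eta> = test_functions_bbs[OF \<eta>(1)]
  have bg: "bbs (\<lambda>x. g x powr p)" using g p by (intro bbs_powr') auto
  have "energy p (conv \<eta> f) \<le> (\<integral>x. conv \<eta> (\<lambda>x. g x powr p) x \<partial>lborel)"
    unfolding energy_def
  proof (rule integral_mono)
    show "norm (grad (conv \<eta> f) x) powr p \<le> conv \<eta> (\<lambda>x. g x powr p) x" for x
    proof -
      have "norm (grad (conv \<eta> f) x) powr p \<le> conv \<eta> g x powr p"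
        using p norm_grad_conv_le[OF \<eta>(1,2) f g(1) L g(2,3)] by (intro powr_mono2) auto
      also have "\<dots> \<le> conv \<eta> (\<lambda>x. g x powr p) x"
        by (rule conv_jensen[OF b\<eta> \<eta>(2,3) g(2,3) p])
      finally show ?thesis .
    qed
    have "bbs (\<lambda>x. norm (grad (conv \<eta> f) x))"
    proof (rule bbs_dominated[where C = 1, OF bbs_conv[OF \<eta>(1) g(2)]])
      show "\<bar>norm (grad (conv \<eta> f) x)\<bar> \<le> 1 * \<bar>conv \<eta> g x\<bar>" for x
        using norm_grad_conv_le[OF \<eta>(1,2) f g(1) L g(2,3), of x] by simp
      show "(\<lambda>x. norm (grad (conv \<eta> f) x)) \<in> borel_measurable borel"
        by (intro borel_measurable_continuous_onI continuous_intros smooth_continuous_grad smooth_conv \<eta>(1) f)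
    qed
    then show "integrable lborel (\<lambda>x. norm (grad (conv \<eta> f) x) powr p)"
      using p by (intro bbs_integrable bbs_powr') auto
    show "integrable lborel (conv \<eta> (\<lambda>x. g x powr p))"
      by (intro bbs_integrable bbs_conv \<eta>(1) bg)
  qed
  also have "\<dots> = (\<integral>x. g x powr p \<partial>lborel)"
    using integral_conv[OF b\<eta> bg] \<eta>(3) by simp
  finally show ?thesis .
qed

context bounded_open
begin

text \<open>The kernel moves points by less than \<epsilon> and d is 1-Lipschitz, so the support
  loses at most \<epsilon> of its depth.\<close>

lemma conv_test_functions_depth:
  assumes "\<eta> \<in> test_functions UNIV" "\<And>z. \<eta> z \<noteq> 0 \<Longrightarrow> norm z < \<epsilon>" "bbs f"
    and "\<And>x. f x \<noteq> 0 \<Longrightarrow> c \<le> depth \<Omega> x" "\<epsilon> < c"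
  shows "conv \<eta> f \<in> test_functions \<Omega>" "conv \<eta> f x \<noteq> 0 \<Longrightarrow> c - \<epsilon> \<le> depth \<Omega> x"
proof -
  have d: "c - \<epsilon> \<le> depth \<Omega> x" if "\<eta> z \<noteq> 0" "f (x + z) \<noteq> 0" for x z
    using assms(2)[OF that(1)] assms(4)[OF that(2)] depth_lipschitz[of \<Omega> "x + z" x] by simp
  show "conv \<eta> f \<in> test_functions \<Omega>"
    using d compact_depth_ge[of "c - \<epsilon>"] assms(5)
    by (intro conv_test_functions[OF assms(1,3), of "{x. depth \<Omega> x \<ge> c - \<epsilon>}"]) auto
  show "c - \<epsilon> \<le> depth \<Omega> x" if "conv \<eta> f x \<noteq> 0"
  proof (rule ccontr)
    assume "\<not> c - \<epsilon> \<le> depth \<Omega> x"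
    then have "\<eta> z * f (x + z) = 0" for z using d[of z x] by auto
    then have "(\<lambda>z. \<eta> z * f (x + z)) = (\<lambda>z. 0)" by blast
    then show False using that by (simp add: conv_def)
  qed
qed

lemma integrable_indicator_\<Omega>: "integrable lborel (\<lambda>x. c * indicator \<Omega> x :: real)"
  using emeasure_bounded_finite[OF bounded] open_\<Omega> by (intro integrable_mult_right integrable_real_indicator) auto

text \<open>Enlarges the class of competitors from test functions to functions with an upper
  gradient supported at positive depth, such as expressions in d. The energy does not grow under
  mollification; at scales up to c/2 the support stays at depth at least c/2, where the weight is
  bounded, so the masses converge.\<close>

lemma hardy_constant_upper_grad:
  assumes f: "bbs f" and c: "c > 0" "\<And>x. f x \<noteq> 0 \<Longrightarrow> c \<le> depth \<Omega> x"
    and g: "upper_grad f g" "bbs g" "\<And>x. g x \<ge> 0" and p: "p > 1"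
  shows "hardy_constant \<Omega> p * mass \<Omega> p f \<le> (\<integral>x. g x powr p \<partial>lborel)"
proof -
  obtain L where L: "L \<ge> 0" "\<And>x y. \<bar>f x - f y\<bar> \<le> L * norm (x - y)"
    using upper_grad_lipschitz[OF g(1,2)] by blast
  obtain B where B: "\<And>x. \<bar>f x\<bar> \<le> B" using f by (auto simp: bbs_def)
  define \<epsilon> where "\<epsilon> n = c / 2 * inverse (real (Suc n))" for n
  have \<epsilon>: "\<epsilon> n > 0" "\<epsilon> n \<le> c / 2" for n
    using c(1) by (simp_all add: \<epsilon>_def field_simps)
  have \<epsilon>lim: "\<epsilon> \<longlonglongrightarrow> 0"
    unfolding \<epsilon>_def using tendsto_mult[OF tendsto_const LIMSEQ_inverse_real_of_nat, of "c / 2"] by simp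
  have "\<exists>\<eta> :: 'a \<Rightarrow> real. \<eta> \<in> test_functions UNIV \<and> (\<forall>z. \<eta> z \<ge> 0) \<and>
      (\<forall>z. \<eta> z \<noteq> 0 \<longrightarrow> norm z < \<epsilon> n) \<and> (\<integral>z. \<eta> z \<partial>lborel) = 1" for n
    using mollifier[OF \<epsilon>(1)] by metis
  then obtain \<eta> :: "nat \<Rightarrow> 'a \<Rightarrow> real" where \<eta>: "\<And>n. \<eta> n \<in> test_functions UNIV" "\<And>n z. \<eta> n z \<ge> 0"
      "\<And>n z. \<eta> n z \<noteq> 0 \<Longrightarrow> norm z < \<epsilon> n" "\<And>n. (\<integral>z. \<eta> n z \<partial>lborel) = 1"
    by metis
  let ?w = "\<lambda>n. conv (\<eta> n) f"
  have \<epsilon>c: "\<epsilon> n < c" for n using \<epsilon>(2)[of n] c(1) by linarith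
  have w1: "?w n \<in> test_functions \<Omega>" for n
    by (rule conv_test_functions_depth(1)[OF \<eta>(1) \<eta>(3) f c(2) \<epsilon>c])
  have wd: "c / 2 \<le> depth \<Omega> x" if "?w n x \<noteq> 0" for n x
  proof -
    have "c - \<epsilon> n \<le> depth \<Omega> x"
      by (rule conv_test_functions_depth(2)[OF \<eta>(1) \<eta>(3) f c(2) \<epsilon>c that])
    then show ?thesis using \<epsilon>(2)[of n] by linarith
  qed
  have close: "\<bar>?w n x - f x\<bar> \<le> L * \<epsilon> n" for n x
  proof (rule conv_close[OF test_functions_bbs[OF \<eta>(1)] \<eta>(2,4) f])
    fix z assume "\<eta> n z \<noteq> 0"
    then have "L * norm z \<le> L * \<epsilon> n" using \<eta>(3)[of n z] L(1) by (intro mult_left_mono) auto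
    then show "\<bar>f (x + z) - f x\<bar> \<le> L * \<epsilon> n" using L(2)[of "x + z" x] by simp
  qed
  have wB: "\<bar>?w n x\<bar> \<le> B" for n x
    using conv_close[OF test_functions_bbs[OF \<eta>(1)] \<eta>(2,4) f, of n x 0 B] B by simp
  have lim: "(\<lambda>n. mass \<Omega> p (?w n)) \<longlonglongrightarrow> mass \<Omega> p f"
    unfolding mass_def
  proof (rule integral_dominated_convergence[OF _ _ integrable_indicator_\<Omega>[of "(B / (c / 2)) powr p"]])
    have "bbs (\<lambda>x. \<bar>f x\<bar> / depth \<Omega> x)" by (rule bbs_divide_depth[OF f c])
    from bbs_integrable[OF bbs_powr'[OF this]] 
    show "(\<lambda>x. (\<bar>f x\<bar> / depth \<Omega> x) powr p) \<in> borel_measurable lborel"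
      using p by (intro borel_measurable_integrable) (auto simp: depth_nonneg)
    show "(\<lambda>x. (\<bar>?w n x\<bar> / depth \<Omega> x) powr p) \<in> borel_measurable lborel" for n
      using test_functions_mass_integrable[OF w1] p by (intro borel_measurable_integrable) auto
    show "AE x in lborel. (\<lambda>n. (\<bar>?w n x\<bar> / depth \<Omega> x) powr p) \<longlonglongrightarrow> (\<bar>f x\<bar> / depth \<Omega> x) powr p"
    proof (rule AE_I2)
      fix x
      have "(\<lambda>n. L * \<epsilon> n) \<longlonglongrightarrow> L * 0" by (intro tendsto_mult tendsto_const \<epsilon>lim)
      then have "(\<lambda>n. L * \<epsilon> n) \<longlonglongrightarrow> 0" by simp
      then have "(\<lambda>n. ?w n x - f x) \<longlonglongrightarrow> 0"
        by (rule Lim_null_comparison[rotated]) (use close in auto)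
      then have wx: "(\<lambda>n. ?w n x) \<longlonglongrightarrow> f x" by (rule Lim_null[THEN iffD2])
      show "(\<lambda>n. (\<bar>?w n x\<bar> / depth \<Omega> x) powr p) \<longlonglongrightarrow> (\<bar>f x\<bar> / depth \<Omega> x) powr p"
      proof (cases "depth \<Omega> x = 0")
        case False
        then show ?thesis using p depth_nonneg[of \<Omega> x]
          by (intro tendsto_powr' tendsto_divide tendsto_rabs wx tendsto_const) auto
      qed simp
    qed
    show "AE x in lborel. norm ((\<bar>?w n x\<bar> / depth \<Omega> x) powr p) \<le> (B / (c / 2)) powr p * indicator \<Omega> x" for n
    proof (rule AE_I2)
      fix x
      show "norm ((\<bar>?w n x\<bar> / depth \<Omega> x) powr p) \<le> (B / (c / 2)) powr p * indicator \<Omega> x"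
      proof (cases "?w n x = 0")
        case False
        have d: "c / 2 \<le> depth \<Omega> x" by (rule wd[OF False])
        then have "x \<in> \<Omega>" using c(1) depth_pos_iff[of x] by linarith
        moreover have "\<bar>?w n x\<bar> / depth \<Omega> x \<le> B / (c / 2)"
          using d c(1) wB[of n x] by (intro frac_le) auto
        then have "(\<bar>?w n x\<bar> / depth \<Omega> x) powr p \<le> (B / (c / 2)) powr p"
          using p by (intro powr_mono2) (auto simp: depth_nonneg)
        ultimately show ?thesis by simp
      qed simp
    qed
  qed
  have "(\<lambda>n. hardy_constant \<Omega> p * mass \<Omega> p (?w n)) \<longlonglongrightarrow> hardy_constant \<Omega> p * mass \<Omega> p f"
    by (intro tendsto_mult tendsto_const lim)
  then show ?thesis
  proof (rule LIMSEQ_le_const2, intro exI allI impI)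
    fix n
    have "hardy_constant \<Omega> p * mass \<Omega> p (?w n) \<le> energy p (?w n)"
      by (rule hardy_constant_le[OF w1 p])
    also have "\<dots> \<le> (\<integral>x. g x powr p \<partial>lborel)"
      by (rule energy_conv_le[OF \<eta>(1,2,4) f g p])
    finally show "hardy_constant \<Omega> p * mass \<Omega> p (?w n) \<le> (\<integral>x. g x powr p \<partial>lborel)" .
  qed
qed

end

section \<open>Upper semicontinuity and right lower semicontinuity\<close>

lemma ugrad_mono: "ugrad f x k \<Longrightarrow> k \<le> m \<Longrightarrow> ugrad f x m"
  unfolding ugrad_def
proof (intro allI impI)
  fix e :: real assume *: "\<forall>e>0. \<forall>\<^sub>F y in nhds x. \<bar>f y - f x\<bar> \<le> (k + e) * norm (y - x)" "k \<le> m" "e > 0"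
  then have "\<forall>\<^sub>F y in nhds x. \<bar>f y - f x\<bar> \<le> (k + e) * norm (y - x)" by blast
  then show "\<forall>\<^sub>F y in nhds x. \<bar>f y - f x\<bar> \<le> (m + e) * norm (y - x)"
  proof eventually_elim
    case (elim y)
    also have "(k + e) * norm (y - x) \<le> (m + e) * norm (y - x)"
      using *(2) by (intro mult_right_mono) auto
    finally show ?case .
  qed
qed

text \<open>For a > 1 the function is differentiable also at 0, with derivative 0. The substitution
  with exponent s/p > 1 therefore causes no trouble at zeros of \<phi>.\<close>

lemma has_real_derivative_abs_powr:
  fixes a t :: real
  assumes "a > 1"
  shows "((\<lambda>t. \<bar>t\<bar> powr a) has_real_derivative a * \<bar>t\<bar> powr (a - 1) * sgn t) (at t)"
proof -
  consider "t > 0" | "t < 0" | "t = 0" by linarith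
  then show ?thesis
  proof cases
    case 1
    have "((\<lambda>t. t powr a) has_real_derivative a * t powr (a - 1)) (at t)"
      using 1 by (rule has_real_derivative_powr)
    then have "((\<lambda>t. \<bar>t\<bar> powr a) has_real_derivative a * t powr (a - 1)) (at t)"
      by (rule has_field_derivative_transform_within_open[where S = "{0<..}"]) (use 1 in auto)
    then show ?thesis using 1 by simp
  next
    case 2
    have "((\<lambda>t. (- t) powr a) has_real_derivative a * (- t) powr (a - 1) * (- 1)) (at t)"
      using 2 by (auto intro!: derivative_eq_intros simp: powr_diff)
    then have "((\<lambda>t. \<bar>t\<bar> powr a) has_real_derivative a * (- t) powr (a - 1) * (- 1)) (at t)"
      by (rule has_field_derivative_transform_within_open[where S = "{..<0}"]) (use 2 in auto)
    then show ?thesis using 2 by simp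
  next
    case 3
    have "((\<lambda>h. \<bar>h\<bar> powr (a - 1)) \<longlongrightarrow> \<bar>0\<bar> powr (a - 1)) (at (0::real))"
      using assms by (intro tendsto_powr' tendsto_rabs tendsto_ident_at tendsto_const) auto
    then have lim: "((\<lambda>h. \<bar>h\<bar> powr (a - 1)) \<longlongrightarrow> 0) (at (0::real))" by simp
    have "((\<lambda>h. \<bar>h\<bar> powr a / h) \<longlongrightarrow> 0) (at (0::real))"
    proof (rule Lim_null_comparison[OF _ lim])
      show "\<forall>\<^sub>F h in at (0::real). norm (\<bar>h\<bar> powr a / h) \<le> \<bar>h\<bar> powr (a - 1)"
        unfolding eventually_at_filter
        by (intro always_eventually) (auto simp: powr_diff abs_divide)
    qed
    then show ?thesis using 3 by (simp add: DERIV_def)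
  qed
qed

text \<open>Dominated convergence along sequences of exponents. The dominating function is (1 + B)^M
  on the set where h is nonzero: the base is at least 1, so its powers increase with the exponent,
  and M bounds the exponents.\<close>

lemma tendsto_integral_powr:
  fixes h :: "'a::euclidean_space \<Rightarrow> real"
  assumes h: "bbs h" "\<And>x. h x \<ge> 0" and p: "p > 0"
  shows "((\<lambda>s. \<integral>x. h x powr s \<partial>lborel) \<longlongrightarrow> (\<integral>x. h x powr p \<partial>lborel)) (at p within {0<..})"
  unfolding tendsto_at_iff_sequentially
proof (intro allI impI)
  fix X :: "nat \<Rightarrow> real" assume X: "\<forall>i. X i \<in> {0<..} - {p}" "X \<longlonglongrightarrow> p"
  obtain M where M: "\<And>n. \<bar>X n\<bar> \<le> M"
    using X(2) by (metis Bseq_def convergent_def convergent_imp_Bseq real_norm_def)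
  obtain B where B: "\<And>x. \<bar>h x\<bar> \<le> B" using h(1) by (auto simp: bbs_def)
  have B0: "B \<ge> 0" using B[of undefined] by linarith
  have [measurable]: "h \<in> borel_measurable borel" using h(1) by (rule bbs_measurable)
  define k where "k x = (1 + B) powr M * indicator {x. h x \<noteq> 0} x" for x
  have "bbs k"
    unfolding bbs_def
  proof (intro conjI)
    show "k \<in> borel_measurable borel" unfolding k_def by measurable
    show "\<exists>C. \<forall>x. \<bar>k x\<bar> \<le> C" by (rule exI[of _ "(1 + B) powr M"]) (simp add: k_def indicator_def)
    show "bounded {x. k x \<noteq> 0}"
      by (rule bounded_subset[of "{x. h x \<noteq> 0}"]) (use h(1) in \<open>auto simp: k_def bbs_def indicator_def\<close>)
  qed
  have "(\<lambda>n. \<integral>x. h x powr X n \<partial>lborel) \<longlonglongrightarrow> (\<integral>x. h x powr p \<partial>lborel)"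
  proof (rule integral_dominated_convergence[OF _ _ bbs_integrable[OF \<open>bbs k\<close>]])
    show "AE x in lborel. (\<lambda>n. h x powr X n) \<longlonglongrightarrow> h x powr p"
    proof (rule AE_I2)
      fix x show "(\<lambda>n. h x powr X n) \<longlonglongrightarrow> h x powr p"
      proof (cases "h x = 0")
        case False
        then show ?thesis by (intro tendsto_powr tendsto_const X(2))
      qed simp
    qed
    show "AE x in lborel. norm (h x powr X n) \<le> k x" for n
    proof (rule AE_I2)
      fix x show "norm (h x powr X n) \<le> k x"
      proof (cases "h x = 0")
        case False
        have "h x powr X n \<le> (1 + B) powr X n"
          using B[of x] h(2)[of x] X(1) by (intro powr_mono2) (auto simp: less_imp_le)
        also have "\<dots> \<le> (1 + B) powr M"
          using M[of n] B0 by (intro powr_mono) auto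
        finally show ?thesis using False by (simp add: k_def)
      qed (simp add: k_def)
    qed
  qed measurable
  then show "((\<lambda>s. \<integral>x. h x powr s \<partial>lborel) \<circ> X) \<longlonglongrightarrow> (\<integral>x. h x powr p \<partial>lborel)"
    by (simp add: o_def)
qed

text \<open>Young's inequality with the weights 1 - p/s and p/s for a^s and b^s. Used under the
  integral sign, it stands in for Hoelder's inequality.\<close>

lemma young_powr:
  fixes a b s p :: real
  assumes "a \<ge> 0" "b \<ge> 0" "0 < p" "p < s"
  shows "a powr (s - p) * b powr p \<le> (1 - p / s) * a powr s + p / s * b powr s"
proof (cases "a = 0 \<or> b = 0")
  case False
  have "(a powr s) powr (1 - p / s) * (b powr s) powr (p / s) \<le> (1 - p / s) * a powr s + p / s * b powr s"
    using assms False by (intro Youngs_inequality_0) auto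
  then show ?thesis using assms by (simp add: powr_powr right_diff_distrib)
qed (use assms in auto)

context bounded_open
begin

lemma tendsto_energy:
  assumes "\<phi> \<in> test_functions \<Omega>" "p > 0"
  shows "((\<lambda>s. energy s \<phi>) \<longlongrightarrow> energy p \<phi>) (at p within {0<..})"
  unfolding energy_def using assms by (intro tendsto_integral_powr test_functions_grad_bbs) auto

lemma tendsto_mass:
  assumes "\<phi> \<in> test_functions \<Omega>" "p > 0"
  shows "((\<lambda>s. mass \<Omega> s \<phi>) \<longlongrightarrow> mass \<Omega> p \<phi>) (at p within {0<..})"
  unfolding mass_def using assms
  by (intro tendsto_integral_powr test_functions_quotient_bbs) (auto simp: depth_nonneg)

text \<open>Contrapositive of \<open>hardy_constant_ge\<close>: a number above the Hardy constant
  fails the inequality for some test function.\<close>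

lemma hardy_constant_near_minimizer:
  assumes "p > 1" "e > 0"
  obtains \<phi> where "\<phi> \<in> test_functions \<Omega>" "energy p \<phi> < (hardy_constant \<Omega> p + e) * mass \<Omega> p \<phi>"
  using hardy_constant_ge[OF assms(1), of "hardy_constant \<Omega> p + e"] assms(2) by fastforce

lemma hardy_constant_upper_semicontinuous:
  assumes p: "p > 1" and e: "e > 0"
  shows "\<forall>\<^sub>F s in at p within {1<..}. hardy_constant \<Omega> s < hardy_constant \<Omega> p + e"
proof -
  obtain \<phi> where \<phi>: "\<phi> \<in> test_functions \<Omega>" "energy p \<phi> < (hardy_constant \<Omega> p + e) * mass \<Omega> p \<phi>"
    using hardy_constant_near_minimizer[OF assms] by blast
  have "((\<lambda>s. (hardy_constant \<Omega> p + e) * mass \<Omega> s \<phi> - energy s \<phi>) \<longlongrightarrow>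
      (hardy_constant \<Omega> p + e) * mass \<Omega> p \<phi> - energy p \<phi>) (at p within {0<..})"
    using p by (intro tendsto_intros tendsto_energy[OF \<phi>(1)] tendsto_mass[OF \<phi>(1)]) auto
  then have "((\<lambda>s. (hardy_constant \<Omega> p + e) * mass \<Omega> s \<phi> - energy s \<phi>) \<longlongrightarrow>
      (hardy_constant \<Omega> p + e) * mass \<Omega> p \<phi> - energy p \<phi>) (at p within {1<..})"
    by (rule tendsto_within_subset) auto
  moreover have "(hardy_constant \<Omega> p + e) * mass \<Omega> p \<phi> - energy p \<phi> > 0" using \<phi>(2) by simp
  ultimately have "\<forall>\<^sub>F s in at p within {1<..}. (hardy_constant \<Omega> p + e) * mass \<Omega> s \<phi> - energy s \<phi> > 0"
    by (rule order_tendstoD(1))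
  moreover have "\<forall>\<^sub>F s in at p within {1<..}. s > 1"
    by (auto simp: eventually_at_filter)
  ultimately show ?thesis
  proof eventually_elim
    case (elim s)
    have "hardy_constant \<Omega> s * mass \<Omega> s \<phi> < (hardy_constant \<Omega> p + e) * mass \<Omega> s \<phi>"
      using elim hardy_constant_le[OF \<phi>(1), of s] by linarith
    then show ?case using mass_nonneg[of \<Omega> s \<phi>] by (simp add: mult_less_cancel_right)
  qed
qed

lemma bbs_depth: "bbs (depth \<Omega>)"
proof (rule bbs_continuous[OF continuous_on_depth])
  show "Elementary_Metric_Spaces.bounded {x. depth \<Omega> x \<noteq> 0}"
    by (rule bounded_subset[OF bounded]) (use depth_zero in auto)
qed

lemma ugrad_depth: "ugrad (depth \<Omega>) x 1"
  by (rule ugrad_lipschitz) (use depth_lipschitz in auto)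

lemma eventually_depth_pos: "x \<in> \<Omega> \<Longrightarrow> \<forall>\<^sub>F y in nhds x. depth \<Omega> y > 0"
  using open_\<Omega> depth_pos by (auto simp: eventually_nhds)

text \<open>For \<open>s > p\<close> the substitution \<open>f = \<bar>\<phi>\<bar> powr (s/p) * d powr (1 - s/p)\<close> keeps the mass:
  \<open>(f/d) powr p = (\<bar>\<phi>\<bar>/d) powr s\<close>.\<close>

lemma substitution_upper_grad:
  assumes \<phi>: "\<phi> \<in> test_functions \<Omega>" and a: "a > 1"
  defines "q \<equiv> \<lambda>x. \<bar>\<phi> x\<bar> / depth \<Omega> x"
  shows "upper_grad (\<lambda>x. q x powr a * depth \<Omega> x)
    (\<lambda>x. a * (q x powr (a - 1) * norm (grad \<phi> x)) + (a - 1) * q x powr a)" (is "upper_grad ?f ?g")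
  unfolding upper_grad_iff_ugrad
proof
  fix x
  have q0: "q x \<ge> 0" for x by (simp add: q_def depth_nonneg)
  show "ugrad ?f x (?g x)"
  proof (cases "x \<in> \<Omega>")
    case False
    \<comment> \<open>The power of d cannot be differentiated where d vanishes, but the support of
      \<phi> keeps away from there: the competitor is 0 in a neighbourhood.\<close>
    then have x: "x \<notin> closure {x. \<phi> x \<noteq> 0}" using \<phi> by (auto simp: test_functions_def)
    have "\<forall>\<^sub>F y in nhds x. \<phi> y = 0"
      using x closure_subset[of "{x. \<phi> x \<noteq> 0}"]
      by (auto simp: eventually_nhds intro!: exI[of _ "- closure {x. \<phi> x \<noteq> 0}"])
    then have "\<forall>\<^sub>F y in nhds x. ?f y = 0"
      by eventually_elim (simp add: q_def)
    moreover have "?g x \<ge> 0" using a q0 by simp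
    ultimately show ?thesis
      by (intro ugrad_cong[OF ugrad_const[of "?g x" 0]])
  next
    case True
    then have d: "depth \<Omega> x > 0" by (rule depth_pos)
    \<comment> \<open>Near a point of \<Omega> the competitor equals |\<phi>|^a d^(1 - a). The chain
      rule for each factor, with upper gradient 1 for d, gives two terms that regroup into powers of
      q.\<close>
    have "((\<lambda>t. t powr (1 - a)) has_real_derivative (1 - a) * depth \<Omega> x powr (1 - a - 1)) (at (depth \<Omega> x))"
      using d by (rule has_real_derivative_powr)
    from ugrad_compose[OF ugrad_depth _ this]
    have 1: "ugrad (\<lambda>y. depth \<Omega> y powr (1 - a)) x (\<bar>(1 - a) * depth \<Omega> x powr (1 - a - 1)\<bar> * 1)" by simp
    have 2: "ugrad (\<lambda>y. \<bar>\<phi> y\<bar> powr a) x (\<bar>a * \<bar>\<phi> x\<bar> powr (a - 1) * sgn (\<phi> x)\<bar> * norm (grad \<phi> x))"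
      by (rule ugrad_compose[OF ugrad_smooth _ has_real_derivative_abs_powr[OF a]])
        (use test_functions_smooth[OF \<phi>] in auto)
    have "ugrad (\<lambda>y. \<bar>\<phi> y\<bar> powr a * depth \<Omega> y powr (1 - a)) x
      (\<bar>\<bar>\<phi> x\<bar> powr a\<bar> * (\<bar>(1 - a) * depth \<Omega> x powr (1 - a - 1)\<bar> * 1) +
       \<bar>depth \<Omega> x powr (1 - a)\<bar> * (\<bar>a * \<bar>\<phi> x\<bar> powr (a - 1) * sgn (\<phi> x)\<bar> * norm (grad \<phi> x)))"
      (is "ugrad _ _ ?k")
      by (rule ugrad_mult[OF 2 _ 1]) auto
    moreover have "?k \<le> ?g x"
    proof -
      have qb: "q x powr b = \<bar>\<phi> x\<bar> powr b * inverse (depth \<Omega> x powr b)" for b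
        unfolding q_def using d by (subst powr_divide) (auto simp: divide_inverse)
      have "\<bar>\<bar>\<phi> x\<bar> powr a\<bar> * (\<bar>(1 - a) * depth \<Omega> x powr (1 - a - 1)\<bar> * 1) = (a - 1) * q x powr a"
        unfolding qb using a d by (simp add: abs_mult powr_minus[of _ a])
      moreover have "\<bar>depth \<Omega> x powr (1 - a)\<bar> * (\<bar>a * \<bar>\<phi> x\<bar> powr (a - 1) * sgn (\<phi> x)\<bar> * norm (grad \<phi> x))
        \<le> a * (q x powr (a - 1) * norm (grad \<phi> x))"
      proof -
        have "depth \<Omega> x powr (1 - a) = inverse (depth \<Omega> x powr (a - 1))"
          using powr_minus[of "depth \<Omega> x" "a - 1"] by simp
        moreover have "\<bar>sgn (\<phi> x)\<bar> \<le> 1" by (simp add: sgn_real_def)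
        then have "a * \<bar>\<phi> x\<bar> powr (a - 1) * \<bar>sgn (\<phi> x)\<bar> \<le> a * \<bar>\<phi> x\<bar> powr (a - 1) * 1"
          using a by (intro mult_left_mono) auto
        then have "inverse (depth \<Omega> x powr (a - 1)) * ((a * \<bar>\<phi> x\<bar> powr (a - 1) * \<bar>sgn (\<phi> x)\<bar>) * norm (grad \<phi> x)) \<le>
          inverse (depth \<Omega> x powr (a - 1)) * ((a * \<bar>\<phi> x\<bar> powr (a - 1) * 1) * norm (grad \<phi> x))"
          using a by (intro mult_left_mono mult_right_mono) auto
        ultimately show ?thesis unfolding qb using a d
          by (simp add: abs_mult mult_ac)
      qed
      ultimately show ?thesis by linarith
    qed
    ultimately have "ugrad (\<lambda>y. \<bar>\<phi> y\<bar> powr a * depth \<Omega> y powr (1 - a)) x (?g x)"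
      by (rule ugrad_mono)
    moreover have "\<forall>\<^sub>F y in nhds x. ?f y = \<bar>\<phi> y\<bar> powr a * depth \<Omega> y powr (1 - a)"
      using eventually_depth_pos[OF True]
      by eventually_elim (simp add: q_def powr_divide powr_diff)
    ultimately show ?thesis by (rule ugrad_cong)
  qed
qed

text \<open>The p-th power of the upper gradient is split by \<open>powr_split\<close>; since (a -
  1) p = s - p, the main part is q^(s - p) |\<nabla>\<phi>|^p, and Young's inequality turns it into
  s-th powers. For fixed l and s tending to p, the coefficients of the mass on the right tend to 0
  and that of the energy to (1 - l)^(1 - p).\<close>

lemma hardy_constant_le_larger_exponent:
  assumes p: "p > 1" and s: "s > p" and l: "0 < l" "l < 1" and \<phi>: "\<phi> \<in> test_functions \<Omega>"
  shows "hardy_constant \<Omega> p * mass \<Omega> s \<phi> \<le>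
    (1 - l) powr (1 - p) * (s / p) powr p * ((1 - p / s) * mass \<Omega> s \<phi> + p / s * energy s \<phi>) +
    l powr (1 - p) * (s / p - 1) powr p * mass \<Omega> s \<phi>"
proof -
  define a where "a = s / p"
  have a: "a > 1" "a * p = s" using p s by (auto simp: a_def)
  define q where "q x = \<bar>\<phi> x\<bar> / depth \<Omega> x" for x
  have q0: "q x \<ge> 0" for x by (simp add: q_def depth_nonneg)
  let ?f = "\<lambda>x. q x powr a * depth \<Omega> x"
  let ?g = "\<lambda>x. a * (q x powr (a - 1) * norm (grad \<phi> x)) + (a - 1) * q x powr a"
  obtain c where c: "c > 0" "\<And>x. x \<in> closure {x. \<phi> x \<noteq> 0} \<Longrightarrow> c \<le> depth \<Omega> x"
    using test_functions_depth_bound[OF \<phi>] by blast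
  have bq: "bbs q" unfolding q_def[abs_def] by (rule test_functions_quotient_bbs[OF \<phi>])
  have bqa: "bbs (\<lambda>x. q x powr a)" "bbs (\<lambda>x. q x powr (a - 1))"
    using a(1) q0 by (auto intro!: bbs_powr' bq)
  have bf: "bbs ?f" by (rule bbs_mult_bbs[OF bqa(1) bbs_depth])
  have bg: "bbs ?g"
    by (intro bbs_add bbs_cmult bbs_mult_bbs bqa test_functions_grad_bbs[OF \<phi>])
  have "hardy_constant \<Omega> p * mass \<Omega> p ?f \<le> (\<integral>x. ?g x powr p \<partial>lborel)"
  proof (rule hardy_constant_upper_grad[OF bf c(1) _ _ bg _ p])
    show "c \<le> depth \<Omega> x" if "?f x \<noteq> 0" for x
    proof -
      have "\<phi> x \<noteq> 0" using that by (auto simp: q_def)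
      then show ?thesis using c(2) closure_subset[of "{x. \<phi> x \<noteq> 0}"] by blast
    qed
    show "upper_grad ?f ?g" unfolding q_def by (rule substitution_upper_grad[OF \<phi> a(1)])
    show "?g x \<ge> 0" for x using a(1) by simp
  qed
  moreover have "mass \<Omega> p ?f = mass \<Omega> s \<phi>"
  proof -
    have "(\<bar>?f x\<bar> / depth \<Omega> x) powr p = (\<bar>\<phi> x\<bar> / depth \<Omega> x) powr s" for x
    proof (cases "depth \<Omega> x = 0")
      case False
      then have "\<bar>?f x\<bar> / depth \<Omega> x = q x powr a"
        using depth_nonneg[of \<Omega> x] by (simp add: abs_mult)
      then show ?thesis using a(2) q0[of x] by (simp add: powr_powr q_def)
    qed simp
    then show ?thesis by (simp add: mass_def)
  qed
  moreover have "(\<integral>x. ?g x powr p \<partial>lborel) \<le> (\<integral>x.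
      (1 - l) powr (1 - p) * a powr p * ((1 - p / s) * q x powr s + p / s * norm (grad \<phi> x) powr s) +
      l powr (1 - p) * (a - 1) powr p * q x powr s \<partial>lborel)"
  proof (rule integral_mono)
    fix x
    have "?g x powr p \<le> (1 - l) powr (1 - p) * (a * (q x powr (a - 1) * norm (grad \<phi> x))) powr p +
      l powr (1 - p) * ((a - 1) * q x powr a) powr p"
      using a(1) p l by (intro powr_split) auto
    also have "((a - 1) * q x powr a) powr p = (a - 1) powr p * q x powr s"
      using a by (simp add: powr_mult powr_powr)
    also have "(a * (q x powr (a - 1) * norm (grad \<phi> x))) powr p = a powr p * (q x powr (s - p) * norm (grad \<phi> x) powr p)"
    proof -
      have "(a - 1) * p = s - p" using a(2) by (simp add: algebra_simps)
      then show ?thesis using a by (simp add: powr_mult powr_powr)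
    qed
    also have "(1 - l) powr (1 - p) * (a powr p * (q x powr (s - p) * norm (grad \<phi> x) powr p)) \<le>
        (1 - l) powr (1 - p) * (a powr p * ((1 - p / s) * q x powr s + p / s * norm (grad \<phi> x) powr s))"
      using p s q0 by (intro mult_left_mono young_powr) auto
    finally show "?g x powr p \<le> (1 - l) powr (1 - p) * a powr p * ((1 - p / s) * q x powr s + p / s * norm (grad \<phi> x) powr s) +
      l powr (1 - p) * (a - 1) powr p * q x powr s"
      by (simp add: mult.assoc)
  next
    show "integrable lborel (\<lambda>x. ?g x powr p)"
      using a(1) p by (intro bbs_integrable bbs_powr' bg) auto
    show "integrable lborel (\<lambda>x. (1 - l) powr (1 - p) * a powr p * ((1 - p / s) * q x powr s + p / s * norm (grad \<phi> x) powr s) +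
      l powr (1 - p) * (a - 1) powr p * q x powr s)"
      using p s q0 by (intro bbs_integrable bbs_add bbs_cmult bbs_powr' bq test_functions_grad_bbs[OF \<phi>]) auto
  qed
  moreover have "(\<integral>x.
      (1 - l) powr (1 - p) * a powr p * ((1 - p / s) * q x powr s + p / s * norm (grad \<phi> x) powr s) +
      l powr (1 - p) * (a - 1) powr p * q x powr s \<partial>lborel) =
    (1 - l) powr (1 - p) * a powr p * ((1 - p / s) * mass \<Omega> s \<phi> + p / s * energy s \<phi>) +
    l powr (1 - p) * (a - 1) powr p * mass \<Omega> s \<phi>"
    using test_functions_mass_integrable[OF \<phi>, of s] test_functions_energy_integrable[OF \<phi>, of s] p s
    by (simp add: mass_def energy_def q_def)
  ultimately show ?thesis by (simp add: a_def)
qed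

lemma hardy_constant_right_lower_semicontinuous:
  assumes p: "p > 1" and e: "e > 0"
  shows "\<forall>\<^sub>F s in at_right p. hardy_constant \<Omega> p - e < hardy_constant \<Omega> s"
proof -
  let ?H = "hardy_constant \<Omega> p"
  \<comment> \<open>The parameter l is fixed first, so close to 0 that the limit of the lower bound
    for s tending to p still exceeds H - e.\<close>
  have "((\<lambda>l. ?H * (1 - l) powr (p - 1)) \<longlongrightarrow> ?H * (1 - 0) powr (p - 1)) (at_right (0::real))"
    by (intro tendsto_intros) auto
  then have "\<forall>\<^sub>F l in at_right (0::real). ?H - e < ?H * (1 - l) powr (p - 1)"
    using e by (intro order_tendstoD(1)) auto
  moreover have "\<forall>\<^sub>F l in at_right (0::real). 0 < l \<and> l < 1"
    by (auto simp: eventually_at_right_field intro!: exI[of _ 1])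
  ultimately have "\<forall>\<^sub>F l in at_right (0::real). ?H - e < ?H * (1 - l) powr (p - 1) \<and> 0 < l \<and> l < 1"
    by (rule eventually_conj)
  then obtain l where l: "?H - e < ?H * (1 - l) powr (p - 1)" "0 < l" "l < 1"
    using eventually_happens[of _ "at_right (0::real)"] by auto
  have gen: "N / P * m \<le> E" if "N * m \<le> P * E" "P > 0" for N P m E :: real
    using that by (simp add: field_simps)
  let ?A = "(1 - l) powr (1 - p)" and ?B = "l powr (1 - p)"
  \<comment> \<open>The inequality of \<open>hardy_constant_le_larger_exponent\<close> solved for
    the quotient of energy and mass at the exponent s.\<close>
  let ?K = "\<lambda>s. (?H - ?B * (s / p - 1) powr p - ?A * (s / p) powr p * (1 - p / s)) / (?A * (s / p) powr p * (p / s))"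
  have "(?K \<longlongrightarrow> (?H - ?B * (p / p - 1) powr p - ?A * (p / p) powr p * (1 - p / p)) / (?A * (p / p) powr p * (p / p))) (at_right p)"
    using p l by (intro tendsto_intros) (auto simp: eventually_at_right_field intro!: exI[of _ "p + 1"])
  moreover have "(?H - ?B * (p / p - 1) powr p - ?A * (p / p) powr p * (1 - p / p)) / (?A * (p / p) powr p * (p / p)) =
    ?H * (1 - l) powr (p - 1)"
    using p l powr_minus[of "1 - l" "p - 1"] by (simp add: divide_inverse)
  ultimately have "\<forall>\<^sub>F s in at_right p. ?H - e < ?K s"
    using l(1) by (intro order_tendstoD(1)) auto
  moreover have "\<forall>\<^sub>F s in at_right p. s > p"
    by (auto simp: eventually_at_filter)
  ultimately show ?thesis
  proof eventually_elim
    case (elim s)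
    have "?K s \<le> hardy_constant \<Omega> s"
    proof (rule hardy_constant_ge)
      show "s > 1" using elim p by simp
      fix \<phi> assume \<phi>: "\<phi> \<in> test_functions \<Omega>"
      have pos: "?A * (s / p) powr p * (p / s) > 0" using p elim l by simp
      have "(?H - ?B * (s / p - 1) powr p - ?A * (s / p) powr p * (1 - p / s)) * mass \<Omega> s \<phi> \<le>
          (?A * (s / p) powr p * (p / s)) * energy s \<phi>"
        using hardy_constant_le_larger_exponent[OF p elim(2) l(2,3) \<phi>]
        by (simp only: algebra_simps)
      then show "?K s * mass \<Omega> s \<phi> \<le> energy s \<phi>"
        by (intro gen pos)
    qed
    then show ?case using elim by linarith
  qed
qed

end

section \<open>The distance near the boundary\<close>

lemma C_on_2_grad:
  assumes "C_on 2 UNIV \<gamma>"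
  shows "(\<gamma> has_derivative (\<lambda>v. grad \<gamma> x \<bullet> v)) (at x)" "continuous_on UNIV (grad \<gamma>)"
proof -
  have C: "C_on (Suc (Suc 0)) UNIV \<gamma>" using assms by (simp add: numeral_2_eq_2)
  have d: "\<gamma> differentiable (at x)" for x using C by simp
  then have "frechet_derivative \<gamma> (at x) = (\<lambda>v. grad \<gamma> x \<bullet> v)"
    by (auto simp: grad_inner)
  then show "(\<gamma> has_derivative (\<lambda>v. grad \<gamma> x \<bullet> v)) (at x)"
    using d frechet_derivative_works[of \<gamma> "at x"] by simp
  have "continuous_on UNIV (\<lambda>x. frechet_derivative \<gamma> (at x) v)" for v
    using C by (auto simp: continuous_on_eq_continuous_at intro: differentiable_imp_continuous_within)
  then show "continuous_on UNIV (grad \<gamma>)"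
    unfolding grad_def by (intro continuous_intros)
qed

context bounded_open
begin

lemma mem_of_dist_depth: "dist x y < depth \<Omega> x \<Longrightarrow> y \<in> \<Omega>"
proof -
  assume "dist x y < depth \<Omega> x"
  then have "depth \<Omega> y > 0" using depth_lipschitz[of \<Omega> x y] by (simp add: dist_norm)
  then show ?thesis by (simp add: depth_pos_iff)
qed

lemma depth_geI:
  assumes "ball x \<rho> \<subseteq> \<Omega>"
  shows "\<rho> \<le> depth \<Omega> x"
proof -
  obtain y where y: "y \<in> - \<Omega>" "infdist x (- \<Omega>) = dist x y"
    using infdist_attains_inf[of "- \<Omega>" x] open_\<Omega> compl_nonempty by auto
  then have "y \<notin> ball x \<rho>" using assms by auto
  then show ?thesis using y by (simp add: depth_def)
qed

text \<open>A quantitative substitute for a normal derivative of d: on a whole ball around x0,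
  moving by h in one fixed direction increases the depth by nearly h. It is a statement about
  differences, so d need not be differentiable.\<close>

definition inward_normal :: "real \<Rightarrow> 'a \<Rightarrow> real \<Rightarrow> 'a \<Rightarrow> bool" where
  "inward_normal \<epsilon> x0 r N \<longleftrightarrow> norm N = 1 \<and> r > 0 \<and>
    (\<forall>x\<in>\<Omega> \<inter> ball x0 r. \<forall>h. 0 < h \<and> h < r \<longrightarrow> depth \<Omega> x + (1 - \<epsilon>) * h \<le> depth \<Omega> (x + h *\<^sub>R N))"

text \<open>A point \<open>y\<close> within \<open>\<rho> = d x + (1 - \<epsilon>) h\<close> of \<open>x + h N\<close> is reached from the point \<open>x + w'\<close> of the
  ball \<open>B(x, d x) \<subseteq> \<Omega>\<close> by a displacement \<open>h N + w''\<close> with \<open>|w''| < (1 - \<epsilon>) h\<close>, along which the defining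
  function increases.\<close>

lemma inward_normal_exists:
  assumes C2: "C2_boundary \<Omega>" and x0: "x0 \<in> frontier \<Omega>" and \<epsilon>: "0 < \<epsilon>" "\<epsilon> < 1"
  obtains r N where "inward_normal \<epsilon> x0 r N"
proof -
  obtain r0 \<nu> \<gamma> where r0: "r0 > 0" "norm \<nu> = 1" "C_on 2 UNIV \<gamma>"
    and \<Omega>r: "\<Omega> \<inter> ball x0 r0 = {y \<in> ball x0 r0. \<gamma> (y - (y \<bullet> \<nu>) *\<^sub>R \<nu>) < y \<bullet> \<nu>}"
    using bspec[OF C2[unfolded C2_boundary_def] x0] by (elim exE conjE) (rule that)
  \<comment> \<open>A defining function: within the ball of radius r0 it is positive exactly on
    \<Omega>, and \<open>G\<close> below is its gradient.\<close>
  define \<Phi> where "\<Phi> y = y \<bullet> \<nu> - \<gamma> (y - (y \<bullet> \<nu>) *\<^sub>R \<nu>)" for y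
  define w where "w y = grad \<gamma> (y - (y \<bullet> \<nu>) *\<^sub>R \<nu>)" for y
  define G where "G y = \<nu> - w y + (w y \<bullet> \<nu>) *\<^sub>R \<nu>" for y
  have \<Phi>pos: "\<Phi> y > 0 \<longleftrightarrow> y \<in> \<Omega>" if "y \<in> ball x0 r0" for y
  proof -
    have "y \<in> \<Omega> \<longleftrightarrow> \<gamma> (y - (y \<bullet> \<nu>) *\<^sub>R \<nu>) < y \<bullet> \<nu>" using \<Omega>r that by blast
    then show ?thesis by (simp add: \<Phi>_def)
  qed
  have deriv: "(\<Phi> has_derivative (\<lambda>v. G y \<bullet> v)) (at y within S)" for y S
  proof -
    have "((\<lambda>y. y - (y \<bullet> \<nu>) *\<^sub>R \<nu>) has_derivative (\<lambda>v. v - (v \<bullet> \<nu>) *\<^sub>R \<nu>)) (at y)"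
      by (auto intro!: derivative_eq_intros)
    from has_derivative_compose[OF this C_on_2_grad(1)[OF r0(3)]]
    have "((\<lambda>y. \<gamma> (y - (y \<bullet> \<nu>) *\<^sub>R \<nu>)) has_derivative (\<lambda>v. w y \<bullet> (v - (v \<bullet> \<nu>) *\<^sub>R \<nu>))) (at y)"
      by (simp add: w_def)
    then have "(\<Phi> has_derivative (\<lambda>v. v \<bullet> \<nu> - w y \<bullet> (v - (v \<bullet> \<nu>) *\<^sub>R \<nu>))) (at y)"
      unfolding \<Phi>_def[abs_def] by (auto intro!: derivative_eq_intros)
    also have "(\<lambda>v. v \<bullet> \<nu> - w y \<bullet> (v - (v \<bullet> \<nu>) *\<^sub>R \<nu>)) = (\<lambda>v. G y \<bullet> v)"
      by (auto simp: G_def algebra_simps inner_commute)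
    finally show ?thesis by (rule has_derivative_at_withinI)
  qed
  have contG: "continuous_on UNIV G"
    unfolding G_def[abs_def] w_def
    by (intro continuous_intros continuous_on_compose2[OF C_on_2_grad(2)[OF r0(3)]]) auto
  define q where "q = G x0"
  \<comment> \<open>The gradient is \<nu> minus a vector orthogonal to \<nu>, so it cannot
    vanish.\<close>
  have "q \<bullet> \<nu> = 1"
    using r0(2) by (simp add: q_def G_def algebra_simps power2_norm_eq_inner[symmetric])
  then have q: "norm q > 0" by auto
  \<comment> \<open>Chosen for the final balance: the increment has length at most 2h, so the
    linearisation error is at most \<epsilon> |q| h, and this is exactly the gain |q| h - (1 -
    \<epsilon>) |q| h that the linear part guarantees.\<close>
  define \<kappa> where "\<kappa> = \<epsilon> * norm q / 2"
  have \<kappa>: "\<kappa> > 0" using q \<epsilon> by (simp add: \<kappa>_def)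
  have "isCont G x0" using contG by (simp add: continuous_on_eq_continuous_at)
  then obtain \<delta> where \<delta>: "\<delta> > 0" "\<And>y. dist y x0 < \<delta> \<Longrightarrow> dist (G y) q < \<kappa>"
    using \<kappa> unfolding continuous_at_eps_delta q_def by blast
  have lin: "\<bar>\<Phi> y - \<Phi> z - q \<bullet> (y - z)\<bar> \<le> norm (y - z) * \<kappa>" if yz: "y \<in> ball x0 \<delta>" "z \<in> ball x0 \<delta>" for y z
  proof -
    have "norm (\<Phi> y - \<Phi> z - G x0 \<bullet> (y - z)) \<le> norm (y - z) * \<kappa>"
    proof (rule differentiable_bound_linearization[where S = "ball x0 \<delta>" and f' = "\<lambda>x v. G x \<bullet> v"])
      show "z + t *\<^sub>R (y - z) \<in> ball x0 \<delta>" if "t \<in> {0..1}" for t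
        using convexD_alt[OF convex_ball yz(2,1), of t] that by (simp add: algebra_simps)
      show "onorm ((\<lambda>v. G x \<bullet> v) - (\<lambda>v. G x0 \<bullet> v)) \<le> \<kappa>" if "x \<in> ball x0 \<delta>" for x
      proof (rule onorm_le)
        fix v
        have "\<bar>(G x - G x0) \<bullet> v\<bar> \<le> norm (G x - G x0) * norm v"
          by (rule Cauchy_Schwarz_ineq2)
        also have "\<dots> \<le> \<kappa> * norm v"
          using \<delta>(2)[of x] that by (intro mult_right_mono) (auto simp: dist_norm dist_commute q_def norm_minus_commute)
        finally show "norm (((\<lambda>v. G x \<bullet> v) - (\<lambda>v. G x0 \<bullet> v)) v) \<le> \<kappa> * norm v"
          by (simp add: inner_diff_left)
      qed
    qed (use \<delta>(1) deriv in auto)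
    then show ?thesis by (simp add: q_def)
  qed
  define N where "N = q /\<^sub>R norm q"
  have N: "norm N = 1" "q \<bullet> N = norm q"
    using q by (simp_all add: N_def power2_norm_eq_inner[symmetric] power2_eq_square)
  \<comment> \<open>Every point involved lies within 4r of x0: r for x, h < r for the shift, and
    less than 2r for the radius \<rho>.\<close>
  define r where "r = min \<delta> r0 / 4"
  have r: "r > 0" "4 * r \<le> \<delta>" "4 * r \<le> r0" using \<delta>(1) r0(1) by (auto simp: r_def)
  have "inward_normal \<epsilon> x0 r N"
    unfolding inward_normal_def
  proof (intro conjI ballI allI impI N(1) r(1))
    fix x h assume x: "x \<in> \<Omega> \<inter> ball x0 r" and h: "0 < h \<and> h < r"
    define d where "d = depth \<Omega> x"
    define \<rho> where "\<rho> = d + (1 - \<epsilon>) * h"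
    have d0: "d > 0" using x depth_pos by (simp add: d_def)
    have "x0 \<notin> \<Omega>" using x0 open_\<Omega> by (auto simp: frontier_def interior_open)
    then have "d \<le> norm (x - x0)"
      using depth_lipschitz[of \<Omega> x x0] depth_zero[of x0 \<Omega>] by (simp add: d_def)
    moreover have xr: "norm (x - x0) < r" using x by (auto simp: dist_norm norm_minus_commute)
    ultimately have dr: "d < r" by linarith
    have eh: "(1 - \<epsilon>) * h \<ge> 0" "(1 - \<epsilon>) * h \<le> h" using \<epsilon> h by (auto simp: mult_left_le_one_le)
    have \<rho>: "\<rho> > 0" "\<rho> < 2 * r" using d0 dr eh conjunct2[OF h] unfolding \<rho>_def by linarith+
    have "ball (x + h *\<^sub>R N) \<rho> \<subseteq> \<Omega>"
    proof
      fix y assume y: "y \<in> ball (x + h *\<^sub>R N) \<rho>"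
      define v where "v = y - (x + h *\<^sub>R N)"
      have v: "norm v < \<rho>" using y by (simp add: v_def dist_norm norm_minus_commute)
      define v' where "v' = (d / \<rho>) *\<^sub>R v"
      define v'' where "v'' = ((1 - \<epsilon>) * h / \<rho>) *\<^sub>R v"
      have "d / \<rho> + (1 - \<epsilon>) * h / \<rho> = 1"
        using \<rho>(1) by (simp add: \<rho>_def add_divide_distrib[symmetric])
      then have vsum: "v = v' + v''"
        unfolding v'_def v''_def by (metis scaleR_left_distrib scaleR_one)
      have nv': "norm v' < d"
      proof -
        have "norm v' = d / \<rho> * norm v" using d0 \<rho>(1) by (simp add: v'_def)
        also have "\<dots> < d / \<rho> * \<rho>" using v d0 \<rho>(1) by (intro mult_strict_left_mono) auto
        finally show ?thesis using \<rho>(1) by simp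
      qed
      have nv'': "norm v'' \<le> (1 - \<epsilon>) * h"
      proof -
        have "norm v'' = (1 - \<epsilon>) * h / \<rho> * norm v" using eh(1) \<rho>(1) by (simp add: v''_def)
        also have "\<dots> \<le> (1 - \<epsilon>) * h / \<rho> * \<rho>" using v eh(1) \<rho>(1) by (intro mult_left_mono) auto
        finally show ?thesis using \<rho>(1) by simp
      qed
      let ?z = "x + v'"
      have z\<Omega>: "?z \<in> \<Omega>"
        using nv' by (intro mem_of_dist_depth[of x]) (simp add: d_def dist_norm)
      have zr: "norm (?z - x0) < 2 * r"
        using norm_triangle_ineq[of "x - x0" v'] nv' dr xr by (simp add: algebra_simps)
      have yr: "norm (y - x0) < 4 * r"
      proof -
        have "y - x0 = (x - x0) + (h *\<^sub>R N + v)" by (simp add: v_def)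
        then have "norm (y - x0) \<le> norm (x - x0) + (norm (h *\<^sub>R N) + norm v)"
          by (metis add_left_mono norm_triangle_ineq norm_triangle_le order_trans)
        then show ?thesis using xr v \<rho>(2) h N(1) by simp
      qed
      have in_ball: "?z \<in> ball x0 \<delta>" "y \<in> ball x0 \<delta>" "?z \<in> ball x0 r0" "y \<in> ball x0 r0"
        using zr yr r by (auto simp: dist_norm norm_minus_commute)
      have yz: "y - ?z = h *\<^sub>R N + v''" using vsum by (simp add: v_def algebra_simps)
      have "norm (y - ?z) \<le> norm (h *\<^sub>R N) + norm v''"
        unfolding yz by (rule norm_triangle_ineq)
      then have nyz: "norm (y - ?z) \<le> 2 * h"
      proof -
        have "norm (h *\<^sub>R N) = h" using h N(1) by simp
        then show ?thesis
          using \<open>norm (y - ?z) \<le> norm (h *\<^sub>R N) + norm v''\<close> nv'' eh(2) by linarith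
      qed
      have "norm (y - ?z) * \<kappa> \<le> 2 * h * \<kappa>" using nyz \<kappa> by (intro mult_right_mono) auto
      also have "\<dots> = \<epsilon> * norm q * h" by (simp add: \<kappa>_def)
      finally have 1: "norm (y - ?z) * \<kappa> \<le> \<epsilon> * norm q * h" .
      have "q \<bullet> v'' \<ge> - (norm q * norm v'')"
        using Cauchy_Schwarz_ineq2[of q v''] by linarith
      moreover have "norm q * norm v'' \<le> norm q * ((1 - \<epsilon>) * h)"
        using nv'' by (intro mult_left_mono) auto
      ultimately have "q \<bullet> v'' \<ge> - (norm q * ((1 - \<epsilon>) * h))" by linarith
      then have 2: "q \<bullet> (y - ?z) \<ge> \<epsilon> * norm q * h"
        unfolding yz inner_add_right inner_scaleR_right N(2) by (simp add: algebra_simps)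
      have "\<Phi> y - \<Phi> ?z \<ge> q \<bullet> (y - ?z) - norm (y - ?z) * \<kappa>"
        using lin[OF in_ball(2,1)] by linarith
      then have "\<Phi> y \<ge> \<Phi> ?z" using 1 2 by linarith
      moreover have "\<Phi> ?z > 0" using \<Phi>pos[OF in_ball(3)] z\<Omega> by blast
      ultimately have "\<Phi> y > 0" by linarith
      then show "y \<in> \<Omega>" using \<Phi>pos[OF in_ball(4)] by blast
    qed
    then show "depth \<Omega> x + (1 - \<epsilon>) * h \<le> depth \<Omega> (x + h *\<^sub>R N)"
      unfolding \<rho>_def d_def by (rule depth_geI)
  qed
  then show ?thesis using that by blast
qed

end

section \<open>A Lipschitz partition of unity along the boundary\<close>

definition tent :: "'a::euclidean_space \<Rightarrow> real \<Rightarrow> 'a \<Rightarrow> real" where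
  "tent c r x = max 0 (min 1 (2 - 2 * dist x c / r))"

lemma tent_bounds: "0 \<le> tent c r x" "tent c r x \<le> 1"
  by (auto simp: tent_def)

lemma tent_lipschitz:
  assumes "r > 0"
  shows "\<bar>tent c r x - tent c r y\<bar> \<le> 2 / r * norm (x - y)"
proof -
  have "\<bar>tent c r x - tent c r y\<bar> \<le> \<bar>(2 - 2 * dist x c / r) - (2 - 2 * dist y c / r)\<bar>"
    unfolding tent_def by (simp add: max_def min_def abs_if)
  also have "\<dots> = 2 / r * \<bar>dist x c - dist y c\<bar>"
    using assms by (simp add: abs_if field_simps)
  also have "\<dots> \<le> 2 / r * norm (x - y)"
    using assms dist_triangle[of x c y] dist_triangle[of y c x]
    by (intro mult_left_mono) (auto simp: dist_norm[symmetric] abs_le_iff dist_commute)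
  finally show ?thesis .
qed

lemma tent_outside: "r > 0 \<Longrightarrow> x \<notin> ball c r \<Longrightarrow> tent c r x = 0"
  by (auto simp: tent_def dist_commute field_simps max_def min_def)

lemma tent_inside: "r > 0 \<Longrightarrow> dist x c \<le> r / 2 \<Longrightarrow> tent c r x = 1"
  by (auto simp: tent_def field_simps max_def min_def)

lemma lipschitz_sum:
  fixes f :: "nat \<Rightarrow> 'a::real_normed_vector \<Rightarrow> real"
  assumes "\<And>k x y. k < m \<Longrightarrow> \<bar>f k x - f k y\<bar> \<le> L k * norm (x - y)"
  shows "\<bar>(\<Sum>k<m. f k x) - (\<Sum>k<m. f k y)\<bar> \<le> (\<Sum>k<m. L k) * norm (x - y)"
proof -
  have "\<bar>(\<Sum>k<m. f k x) - (\<Sum>k<m. f k y)\<bar> = \<bar>\<Sum>k<m. f k x - f k y\<bar>"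
    by (simp add: sum_subtractf)
  also have "\<dots> \<le> (\<Sum>k<m. \<bar>f k x - f k y\<bar>)" by (rule sum_abs)
  also have "\<dots> \<le> (\<Sum>k<m. L k * norm (x - y))" using assms by (intro sum_mono) auto
  finally show ?thesis by (simp add: sum_distrib_right)
qed

context bounded_open
begin

text \<open>The members sum to 1 on the strip of depth at most \<beta>, and each is supported in a
  ball with an inward normal. They are required to be Lipschitz only, because the chart estimates
  use differences of \<eta> and never its gradient.\<close>

definition boundary_partition ::
    "real \<Rightarrow> nat \<Rightarrow> (nat \<Rightarrow> 'a \<Rightarrow> real) \<Rightarrow> real \<Rightarrow> real \<Rightarrow> bool" where
  "boundary_partition \<epsilon> m \<eta> L \<beta> \<longleftrightarrow> L \<ge> 0 \<and> \<beta> > 0 \<and>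
    (\<forall>k<m. (\<exists>c r N. inward_normal \<epsilon> c r N \<and> (\<forall>x. x \<notin> ball c r \<longrightarrow> \<eta> k x = 0)) \<and>
       (\<forall>x. 0 \<le> \<eta> k x \<and> \<eta> k x \<le> 1) \<and> (\<forall>x y. \<bar>\<eta> k x - \<eta> k y\<bar> \<le> L * norm (x - y))) \<and>
    (\<forall>x\<in>\<Omega>. depth \<Omega> x \<le> \<beta> \<longrightarrow> (\<Sum>k<m. \<eta> k x) = 1)"

text \<open>Partial sums of tents are capped at 1 and differenced. Since tents are nonnegative, so
  are the members; telescoping gives the sum min(1, total), which is 1 wherever some tent is 1. No
  division by the total is involved.\<close>

lemma boundary_partition_exists:
  assumes C2: "C2_boundary \<Omega>" and \<epsilon>: "0 < \<epsilon>" "\<epsilon> < 1"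
  obtains m \<eta> L \<beta> where "boundary_partition \<epsilon> m \<eta> L \<beta>"
proof -
  have "\<exists>r N. inward_normal \<epsilon> x r N" if "x \<in> frontier \<Omega>" for x
    using inward_normal_exists[OF C2 that \<epsilon>] by blast
  then obtain r N where rN: "\<And>x. x \<in> frontier \<Omega> \<Longrightarrow> inward_normal \<epsilon> x (r x) (N x)"
    by metis
  have r: "r x > 0" if "x \<in> frontier \<Omega>" for x
    using rN[OF that] by (simp add: inward_normal_def)
  have "compact (frontier \<Omega>)" using bounded by (simp add: compact_frontier_bounded)
  moreover have "frontier \<Omega> \<subseteq> (\<Union>x\<in>frontier \<Omega>. ball x (r x / 4))"
    using r by force
  ultimately obtain F where F: "F \<subseteq> frontier \<Omega>" "finite F" "frontier \<Omega> \<subseteq> (\<Union>x\<in>F. ball x (r x / 4))"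
    using compactE_image[of "frontier \<Omega>" "frontier \<Omega>" "\<lambda>x. ball x (r x / 4)"] by (metis open_ball)
  obtain xs where xs: "set xs = F" using finite_list[OF F(2)] by blast
  define m where "m = length xs"
  have xsm: "xs ! k \<in> frontier \<Omega>" if "k < m" for k
    using that F(1) xs nth_mem by (force simp: m_def)
  define \<theta> where "\<theta> k = tent (xs ! k) (r (xs ! k))" for k
  define S where "S k x = min 1 (\<Sum>j<k. \<theta> j x)" for k x
  define \<eta> where "\<eta> k x = S (Suc k) x - S k x" for k x
  define l where "l k = 2 / r (xs ! k)" for k
  define L where "L = 2 * (\<Sum>k<m. l k)"
  \<comment> \<open>Less than a quarter of every radius: a point of depth at most \<beta> is within
    \<beta> of the frontier, hence within half a radius of some centre, where the tent is 1.
    Inserting 1 keeps \<open>Min\<close> on a nonempty set.\<close>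
  define \<beta> where "\<beta> = Min (insert 1 ((\<lambda>x. r x / 4) ` F)) / 2"
  have \<theta>0: "\<theta> k x \<ge> 0" for k x by (simp add: \<theta>_def tent_bounds)
  have l0: "l k \<ge> 0" if "k < m" for k using r[OF xsm[OF that]] by (simp add: l_def)
  have Slip: "\<bar>S k x - S k y\<bar> \<le> (\<Sum>k<m. l k) * norm (x - y)" if "k \<le> m" for k x y
  proof -
    have "\<bar>S k x - S k y\<bar> \<le> \<bar>(\<Sum>j<k. \<theta> j x) - (\<Sum>j<k. \<theta> j y)\<bar>"
      by (simp add: S_def min_def abs_if)
    also have "\<dots> \<le> (\<Sum>j<k. l j) * norm (x - y)"
    proof (rule lipschitz_sum)
      show "\<bar>\<theta> j x - \<theta> j y\<bar> \<le> l j * norm (x - y)" if "j < k" for j x y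
        using tent_lipschitz[OF r[OF xsm[of j]], of "xs ! j" x y] that \<open>k \<le> m\<close> by (simp add: \<theta>_def l_def)
    qed
    also have "\<dots> \<le> (\<Sum>k<m. l k) * norm (x - y)"
      using that l0 by (intro mult_right_mono sum_mono2) auto
    finally show ?thesis .
  qed
  have \<beta>: "\<beta> > 0" "\<And>x. x \<in> F \<Longrightarrow> \<beta> < r x / 4"
  proof -
    have "Min (insert 1 ((\<lambda>x. r x / 4) ` F)) > 0"
      using F(1,2) r by (subst Min_gr_iff) (auto simp: subset_iff)
    then show "\<beta> > 0" by (simp add: \<beta>_def)
    fix x assume x: "x \<in> F"
    have "Min (insert 1 ((\<lambda>x. r x / 4) ` F)) \<le> r x / 4"
      using F(2) x by (intro Min_le) auto
    then show "\<beta> < r x / 4" using \<open>\<beta> > 0\<close> by (simp add: \<beta>_def)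
  qed
  have "boundary_partition \<epsilon> m \<eta> L \<beta>"
    unfolding boundary_partition_def
  proof (intro conjI allI impI ballI)
    show "L \<ge> 0" unfolding L_def using l0 by (auto intro!: mult_nonneg_nonneg sum_nonneg)
    show "\<beta> > 0" by (rule \<beta>)
    fix k assume k: "k < m"
    show "\<exists>c r N. inward_normal \<epsilon> c r N \<and> (\<forall>x. x \<notin> ball c r \<longrightarrow> \<eta> k x = 0)"
    proof (intro exI conjI allI impI)
      show "inward_normal \<epsilon> (xs ! k) (r (xs ! k)) (N (xs ! k))" by (rule rN[OF xsm[OF k]])
      fix x assume "x \<notin> ball (xs ! k) (r (xs ! k))"
      then have "\<theta> k x = 0" using tent_outside[OF r[OF xsm[OF k]]] by (simp add: \<theta>_def)
      then show "\<eta> k x = 0" by (simp add: \<eta>_def S_def)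
    qed
    fix x y
    have "(\<Sum>j<k. \<theta> j x) \<ge> 0" using \<theta>0 by (simp add: sum_nonneg)
    then show "0 \<le> \<eta> k x" "\<eta> k x \<le> 1" using \<theta>0[of k x] by (auto simp: \<eta>_def S_def min_def)
    show "\<bar>\<eta> k x - \<eta> k y\<bar> \<le> L * norm (x - y)"
      using Slip[of "Suc k" x y] Slip[of k x y] k by (simp add: \<eta>_def L_def)
  next
    fix x assume x: "x \<in> \<Omega>" "depth \<Omega> x \<le> \<beta>"
    have "frontier \<Omega> \<noteq> {}"
      using frontier_eq_empty nonempty compl_nonempty by blast
    then obtain z where z: "z \<in> frontier \<Omega>" "infdist x (frontier \<Omega>) = dist x z"
      using infdist_attains_inf[of "frontier \<Omega>" x] by auto
    then have dz: "dist x z \<le> \<beta>" using infdist_frontier_eq_depth[OF x(1)] x(2) by simp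
    obtain c where c: "c \<in> F" "z \<in> ball c (r c / 4)" using F(3) z(1) by blast
    obtain j where j: "j < m" "xs ! j = c" using c(1) xs by (metis in_set_conv_nth m_def)
    have "dist x c \<le> dist x z + dist z c" by (rule dist_triangle)
    also have "\<dots> \<le> r c / 2" using dz \<beta>(2)[OF c(1)] c(2) by (simp add: dist_commute)
    finally have "\<theta> j x = 1"
      using tent_inside[OF r[OF xsm[OF j(1)]], of x] j(2) by (simp add: \<theta>_def)
    moreover have "\<theta> j x \<le> (\<Sum>j<m. \<theta> j x)"
      using \<theta>0 j(1) by (intro member_le_sum) auto
    ultimately have "S m x = 1" by (simp add: S_def)
    moreover have "(\<Sum>k<m. \<eta> k x) = S m x - S 0 x"
      unfolding \<eta>_def by (rule sum_lessThan_telescope)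
    ultimately show "(\<Sum>k<m. \<eta> k x) = 1" by (simp add: S_def)
  qed
  then show ?thesis using that by blast
qed

end

section \<open>Hardy inequalities near the boundary\<close>

text \<open>Weighted arithmetic-geometric mean for t0 and t1, multiplied by t1^(\<delta> - 1): the
  tangent at t1 lies above the concave power.\<close>

lemma powr_tangent_concave:
  fixes \<delta> t0 t1 :: real
  assumes "0 < \<delta>" "\<delta> < 1" "t0 \<ge> 0" "t1 > 0"
  shows "t0 powr \<delta> \<le> t1 powr \<delta> + \<delta> * t1 powr (\<delta> - 1) * (t0 - t1)"
proof (cases "t0 = 0")
  case True
  have "t1 powr \<delta> = t1 powr (\<delta> - 1) * t1" using assms by (simp add: powr_diff)
  then have "t1 powr \<delta> + \<delta> * t1 powr (\<delta> - 1) * (0 - t1) = (1 - \<delta>) * t1 powr \<delta>"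
    by (simp add: algebra_simps)
  then show ?thesis using True assms by simp
next
  case False
  have "t0 powr \<delta> * t1 powr (1 - \<delta>) \<le> \<delta> * t0 + (1 - \<delta>) * t1"
    using assms False by (intro Youngs_inequality_0) auto
  then have "t0 powr \<delta> * t1 powr (1 - \<delta>) * t1 powr (\<delta> - 1) \<le> (\<delta> * t0 + (1 - \<delta>) * t1) * t1 powr (\<delta> - 1)"
    by (intro mult_right_mono) auto
  moreover have "t1 powr (1 - \<delta>) * t1 powr (\<delta> - 1) = 1"
    using assms by (simp add: powr_add[symmetric])
  moreover have "t1 powr \<delta> = t1 powr (\<delta> - 1) * t1" using assms by (simp add: powr_diff)
  ultimately show ?thesis by (simp add: algebra_simps)
qed

text \<open>Bernoulli's inequality for a negative exponent: with z = t0/t1 the power z^(1 - s) is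
  the exponential of (1 - s) ln z, bounded below through 1 + x \<le> exp x and ln z \<le> z -
  1.\<close>

lemma powr_tangent_negative:
  fixes s t0 t1 :: real
  assumes "s > 1" "t0 > 0" "t1 > 0"
  shows "t1 powr (1 - s) + (s - 1) * t1 powr (- s) * (t1 - t0) \<le> t0 powr (1 - s)"
proof -
  define z where "z = t0 / t1"
  have z: "z > 0" using assms by (simp add: z_def)
  have "1 + (1 - s) * (z - 1) \<le> 1 + (1 - s) * ln z"
    using ln_le_minus_one[OF z] assms by (intro add_left_mono mult_left_mono_neg) auto
  also have "\<dots> \<le> exp ((1 - s) * ln z)" by (rule exp_ge_add_one_self)
  also have "\<dots> = z powr (1 - s)" using z by (simp add: powr_def)
  finally have "t1 powr (1 - s) * (1 + (1 - s) * (z - 1)) \<le> t1 powr (1 - s) * z powr (1 - s)"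
    by (intro mult_left_mono) auto
  also have "t1 powr (1 - s) * z powr (1 - s) = t0 powr (1 - s)"
    using assms by (simp add: z_def powr_divide)
  also have "t1 powr (1 - s) * (1 + (1 - s) * (z - 1)) = t1 powr (1 - s) + (s - 1) * t1 powr (- s) * (t1 - t0)"
  proof -
    have "t1 powr (1 - s) = t1 powr (- s) * t1"
      using assms by (simp add: powr_minus powr_diff divide_inverse)
    then have "t1 powr (1 - s) * (z - 1) = t1 powr (- s) * (t0 - t1)"
      using assms by (simp add: z_def field_simps)
    then have "(1 - s) * (t1 powr (1 - s) * (z - 1)) = (1 - s) * (t1 powr (- s) * (t0 - t1))" by simp
    then show ?thesis by (simp add: algebra_simps)
  qed
  finally show ?thesis .
qed

lemma bbs_lipschitz:
  assumes "L \<ge> 0" "\<And>x y. \<bar>f x - f y\<bar> \<le> L * norm (x - y)" "\<And>x. x \<notin> ball c r \<Longrightarrow> f x = 0"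
  shows "bbs f"
proof (rule bbs_continuous)
  have "L-lipschitz_on UNIV f"
    using assms(1,2) by (intro lipschitz_onI) (auto simp: dist_norm)
  then show "continuous_on UNIV f" by (rule lipschitz_on_continuous_on)
  show "Elementary_Metric_Spaces.bounded {x. f x \<noteq> 0}"
    by (rule bounded_subset[OF bounded_ball[of c r]]) (use assms(3) in blast)
qed

context bounded_open
begin

text \<open>Along N the function d^\<delta> grows at a rate of at least \<delta> (1 - \<epsilon>)
  d^(\<delta> - 1), up to replacing d by d + h in the rate. The integral of its difference quotient
  against \<eta> stays bounded once the translation is moved to \<eta>; Fatou's lemma then lets h
  tend to 0.\<close>

lemma integrable_depth_chart:
  assumes inw: "inward_normal \<epsilon> c r N" and \<epsilon>: "0 < \<epsilon>" "\<epsilon> < 1" and \<delta>: "0 < \<delta>" "\<delta> < 1"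
    and \<eta>: "\<And>x. x \<notin> ball c r \<Longrightarrow> \<eta> x = 0" "\<And>x. 0 \<le> \<eta> x" "L \<ge> 0" "\<And>x y. \<bar>\<eta> x - \<eta> y\<bar> \<le> L * norm (x - y)"
  shows "integrable lborel (\<lambda>x. \<eta> x * depth \<Omega> x powr (\<delta> - 1))"
proof -
  have N: "norm N = 1" and r: "r > 0" using inw by (auto simp: inward_normal_def)
  have b\<eta>: "bbs \<eta>" by (rule bbs_lipschitz[OF \<eta>(3,4,1)])
  have bD: "bbs (\<lambda>x. depth \<Omega> x powr \<delta>)"
    using \<delta> by (intro bbs_powr' bbs_depth) (auto simp: depth_nonneg)
  have [measurable]: "\<eta> \<in> borel_measurable borel" using b\<eta> by (rule bbs_measurable)
  have [measurable]: "\<Omega> \<in> sets borel" using open_\<Omega> by simp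
  define h where "h n = r / 2 * inverse (real (Suc n))" for n
  have h: "h n > 0" "h n < r" for n
  proof -
    show "h n > 0" using r by (simp add: h_def)
    have "r / 2 * inverse (real (Suc n)) \<le> r / 2 * 1"
      using r by (intro mult_left_mono) (auto simp: field_simps)
    then show "h n < r" using r by (simp add: h_def)
  qed
  have hlim: "h \<longlonglongrightarrow> 0"
    unfolding h_def using tendsto_mult[OF tendsto_const LIMSEQ_inverse_real_of_nat, of "r / 2"] by simp
  define J where "J = (\<integral>x. depth \<Omega> x powr \<delta> \<partial>lborel)"
  define C where "C = L * J / (\<delta> * (1 - \<epsilon>))"
  \<comment> \<open>Replacing d by d + h bounds the singular weight, so all integrals exist before
    the uniform bound C is available; the weight itself returns for h tending to 0.\<close>
  define F where "F n x = \<eta> x * (indicator \<Omega> x * (depth \<Omega> x + h n) powr (\<delta> - 1))" for n x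
  have [measurable]: "F n \<in> borel_measurable borel" for n unfolding F_def by measurable
  have F0: "F n x \<ge> 0" for n x using \<eta>(2) by (simp add: F_def)
  have bF: "bbs (F n)" for n
    unfolding F_def
  proof (rule bbs_mult[OF b\<eta>])
    show "\<bar>indicator \<Omega> x * (depth \<Omega> x + h n) powr (\<delta> - 1)\<bar> \<le> h n powr (\<delta> - 1)" for x
      using powr_mono2'[of "\<delta> - 1" "h n" "depth \<Omega> x + h n"] \<delta> h(1)[of n] depth_nonneg[of \<Omega> x]
      by (auto simp: indicator_def)
  qed measurable
  have FC: "(\<integral>x. F n x \<partial>lborel) \<le> C" for n
  proof -
    note h = h[of n]
    let ?P = "\<lambda>x. \<eta> x * depth \<Omega> (h n *\<^sub>R N + x) powr \<delta>"
    have P: "bbs ?P" "bbs (\<lambda>x. \<eta> x * depth \<Omega> x powr \<delta>)"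
      by (intro bbs_mult_bbs b\<eta> bD bbs_translate[OF bD])+
    have Q: "bbs (\<lambda>x. \<eta> (- h n *\<^sub>R N + x) * depth \<Omega> x powr \<delta>)"
      by (intro bbs_mult_bbs bbs_translate[OF b\<eta>] bD)
    have "\<delta> * (1 - \<epsilon>) * h n * (\<integral>x. F n x \<partial>lborel) = (\<integral>x. \<delta> * (1 - \<epsilon>) * h n * F n x \<partial>lborel)"
      by simp
    also have "\<dots> \<le> (\<integral>x. ?P x - \<eta> x * depth \<Omega> x powr \<delta> \<partial>lborel)"
    proof (rule integral_mono)
      show "integrable lborel (\<lambda>x. \<delta> * (1 - \<epsilon>) * h n * F n x)"
        by (intro integrable_mult_right bbs_integrable bF)
      show "integrable lborel (\<lambda>x. ?P x - \<eta> x * depth \<Omega> x powr \<delta>)"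
        by (intro bbs_integrable bbs_diff P)
      fix x
      show "\<delta> * (1 - \<epsilon>) * h n * F n x \<le> ?P x - \<eta> x * depth \<Omega> x powr \<delta>"
      proof (cases "x \<in> \<Omega> \<inter> ball c r")
        case True
        define d where "d = depth \<Omega> x"
        define t where "t = d + (1 - \<epsilon>) * h n"
        have d: "d > 0" using True depth_pos by (simp add: d_def)
        have eh: "(1 - \<epsilon>) * h n > 0" "(1 - \<epsilon>) * h n \<le> h n" using \<epsilon> h by (auto simp: mult_left_le_one_le)
        have t: "t > 0" "t \<le> d + h n" using eh d by (auto simp: t_def)
        have "t \<le> depth \<Omega> (h n *\<^sub>R N + x)"
          using inw True h by (simp add: inward_normal_def t_def d_def add.commute)
        then have 1: "t powr \<delta> \<le> depth \<Omega> (h n *\<^sub>R N + x) powr \<delta>"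
          using \<delta> t by (intro powr_mono2) auto
        have 2: "d powr \<delta> \<le> t powr \<delta> + \<delta> * t powr (\<delta> - 1) * (d - t)"
          using \<delta> d t by (intro powr_tangent_concave) auto
        have "(d + h n) powr (\<delta> - 1) \<le> t powr (\<delta> - 1)"
          using \<delta> t by (intro powr_mono2') auto
        then have "\<delta> * ((1 - \<epsilon>) * h n) * (d + h n) powr (\<delta> - 1) \<le> \<delta> * ((1 - \<epsilon>) * h n) * t powr (\<delta> - 1)"
          using \<delta> eh by (intro mult_left_mono) auto
        also have "\<dots> = - (\<delta> * t powr (\<delta> - 1) * (d - t))" by (simp add: t_def)
        also have "\<dots> \<le> depth \<Omega> (h n *\<^sub>R N + x) powr \<delta> - d powr \<delta>" using 1 2 by linarith
        finally have "\<eta> x * (\<delta> * ((1 - \<epsilon>) * h n) * (d + h n) powr (\<delta> - 1)) \<le>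
            \<eta> x * (depth \<Omega> (h n *\<^sub>R N + x) powr \<delta> - d powr \<delta>)"
          using \<eta>(2) by (intro mult_left_mono) auto
        then show ?thesis using True by (simp add: F_def d_def algebra_simps)
      next
        case False
        then consider "x \<notin> \<Omega>" | "x \<notin> ball c r" by blast
        then show ?thesis
        proof cases
          case 1
          then show ?thesis using \<eta>(2)[of x] by (simp add: F_def depth_zero)
        next
          case 2
          then show ?thesis using \<eta>(1)[of x] by (simp add: F_def)
        qed
      qed
    qed
    also have "\<dots> = (\<integral>x. ?P x \<partial>lborel) - (\<integral>x. \<eta> x * depth \<Omega> x powr \<delta> \<partial>lborel)"
      using P by (intro Bochner_Integration.integral_diff bbs_integrable)
    \<comment> \<open>The shift passes to \<eta>, whose Lipschitz bound L h cancels the factor h on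
      the left.\<close>
    also have "(\<integral>x. ?P x \<partial>lborel) = (\<integral>x. \<eta> (- h n *\<^sub>R N + x) * depth \<Omega> x powr \<delta> \<partial>lborel)"
      using integral_translate[OF bbs_measurable[OF Q], of "h n *\<^sub>R N"] by simp
    also have "\<dots> - (\<integral>x. \<eta> x * depth \<Omega> x powr \<delta> \<partial>lborel) =
        (\<integral>x. \<eta> (- h n *\<^sub>R N + x) * depth \<Omega> x powr \<delta> - \<eta> x * depth \<Omega> x powr \<delta> \<partial>lborel)"
      using P Q by (intro Bochner_Integration.integral_diff[symmetric] bbs_integrable)
    also have "\<dots> \<le> (\<integral>x. L * h n * depth \<Omega> x powr \<delta> \<partial>lborel)"
    proof (rule integral_mono)
      fix x
      have "\<eta> (- h n *\<^sub>R N + x) - \<eta> x \<le> L * h n"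
        using \<eta>(4)[of "- h n *\<^sub>R N + x" x] N h(1) by simp
      then have "(\<eta> (- h n *\<^sub>R N + x) - \<eta> x) * depth \<Omega> x powr \<delta> \<le> L * h n * depth \<Omega> x powr \<delta>"
        by (intro mult_right_mono) auto
      then show "\<eta> (- h n *\<^sub>R N + x) * depth \<Omega> x powr \<delta> - \<eta> x * depth \<Omega> x powr \<delta> \<le> L * h n * depth \<Omega> x powr \<delta>"
        by (simp add: left_diff_distrib)
    next
      show "integrable lborel (\<lambda>x. \<eta> (- h n *\<^sub>R N + x) * depth \<Omega> x powr \<delta> - \<eta> x * depth \<Omega> x powr \<delta>)"
        by (intro bbs_integrable bbs_diff P Q)
    qed (intro integrable_mult_right bbs_integrable bD)
    also have "\<dots> = h n * (L * J)" by (simp add: J_def)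
    finally have "h n * (\<delta> * (1 - \<epsilon>) * (\<integral>x. F n x \<partial>lborel)) \<le> h n * (L * J)" by (simp add: mult_ac)
    then have "\<delta> * (1 - \<epsilon>) * (\<integral>x. F n x \<partial>lborel) \<le> L * J" using h by simp
    then show ?thesis using \<delta> \<epsilon> by (simp add: C_def field_simps)
  qed
  have lim: "(\<lambda>n. F n x) \<longlonglongrightarrow> \<eta> x * depth \<Omega> x powr (\<delta> - 1)" for x
  proof (cases "x \<in> \<Omega>")
    case True
    have "depth \<Omega> x + 0 \<noteq> 0" using depth_pos[OF True] by simp
    from tendsto_powr[OF tendsto_add[OF tendsto_const hlim] tendsto_const this]
    have "(\<lambda>n. \<eta> x * (indicator \<Omega> x * (depth \<Omega> x + h n) powr (\<delta> - 1))) \<longlonglongrightarrow>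
        \<eta> x * (indicator \<Omega> x * (depth \<Omega> x + 0) powr (\<delta> - 1))"
      by (intro tendsto_mult tendsto_const)
    then show ?thesis using True by (simp add: F_def)
  qed (simp add: F_def depth_zero)
  have "(\<integral>\<^sup>+x. ennreal (\<eta> x * depth \<Omega> x powr (\<delta> - 1)) \<partial>lborel) = (\<integral>\<^sup>+x. liminf (\<lambda>n. ennreal (F n x)) \<partial>lborel)"
    by (intro nn_integral_cong lim_imp_Liminf[symmetric] tendsto_ennrealI lim) simp
  also have "\<dots> \<le> liminf (\<lambda>n. \<integral>\<^sup>+x. ennreal (F n x) \<partial>lborel)"
    by (intro nn_integral_liminf) measurable
  also have "(\<lambda>n. \<integral>\<^sup>+x. ennreal (F n x) \<partial>lborel) = (\<lambda>n. ennreal (\<integral>x. F n x \<partial>lborel))"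
    using F0 by (intro ext nn_integral_eq_integral bbs_integrable bF) auto
  also have "liminf (\<lambda>n. ennreal (\<integral>x. F n x \<partial>lborel)) \<le> liminf (\<lambda>n::nat. ennreal C)"
    by (intro Liminf_mono always_eventually allI ennreal_leI FC)
  also have "\<dots> < \<infinity>" by (simp add: Liminf_const)
  finally show ?thesis
    using \<eta>(2) by (intro integrableI_nonneg) auto
qed

text \<open>Integrates \<open>\<eta> * \<bar>u\<bar> powr s\<close> against the difference quotient of \<open>d powr (1 - s)\<close> in direction \<open>N\<close> and
  moves the translation to the other factor.\<close>

lemma local_hardy_chart:
  assumes inw: "inward_normal \<epsilon> x0 r N" and \<epsilon>: "0 < \<epsilon>" "\<epsilon> < 1" and s: "s > 1"
    and \<eta>: "\<And>x. x \<notin> ball x0 r \<Longrightarrow> \<eta> x = 0" "\<And>x. 0 \<le> \<eta> x" "\<And>x. \<eta> x \<le> 1" "L \<ge> 0"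
      "\<And>x y. \<bar>\<eta> x - \<eta> y\<bar> \<le> L * norm (x - y)"
    and u: "u \<in> test_functions \<Omega>"
  shows "(s - 1) * (1 - \<epsilon>) * (\<integral>x. \<eta> x * (\<bar>u x\<bar> / depth \<Omega> x) powr s \<partial>lborel) \<le>
    s * (\<integral>x. \<eta> x * ((\<bar>u x\<bar> / depth \<Omega> x) powr (s - 1) * norm (grad u x)) \<partial>lborel) +
    L * (\<integral>x. depth \<Omega> x * (\<bar>u x\<bar> / depth \<Omega> x) powr s \<partial>lborel)"
proof -
  have N: "norm N = 1" and r: "r > 0" using inw by (auto simp: inward_normal_def)
  obtain c where c: "c > 0" "\<And>x. x \<in> closure {x. u x \<noteq> 0} \<Longrightarrow> c \<le> depth \<Omega> x"
    using test_functions_depth_bound[OF u] by blast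
  have cu: "c \<le> depth \<Omega> x" if "u x \<noteq> 0" for x
    using c(2) that closure_subset[of "{x. u x \<noteq> 0}"] by blast
  note bu = test_functions_bbs[OF u] and bgu = test_functions_grad_bbs[OF u]
  have b\<eta>: "bbs \<eta>" by (rule bbs_lipschitz[OF \<eta>(4,5,1)])
  have [measurable]: "u \<in> borel_measurable borel" using bu by (rule bbs_measurable)
  define q where "q x = \<bar>u x\<bar> / depth \<Omega> x" for x
  have bq: "bbs q" unfolding q_def[abs_def] by (rule test_functions_quotient_bbs[OF u])
  have q0: "q x \<ge> 0" for x by (simp add: q_def depth_nonneg)
  \<comment> \<open>The left side of the claim is a multiple of the integral of A d^(-s);
    \<open>g\<close> below is an upper gradient of A by the product rule, with the Lipschitz
    constant L of \<eta>.\<close>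
  define A where "A x = \<eta> x * \<bar>u x\<bar> powr s" for x
  define g where "g x = s * (\<eta> x * (\<bar>u x\<bar> powr (s - 1) * norm (grad u x))) + L * \<bar>u x\<bar> powr s" for x
  have bA: "bbs A" unfolding A_def using s by (intro bbs_mult_bbs b\<eta> bbs_powr bu) auto
  have [measurable]: "A \<in> borel_measurable borel" using bA by (rule bbs_measurable)
  have bg: "bbs g" unfolding g_def
    using s by (intro bbs_add bbs_cmult bbs_mult_bbs b\<eta> bbs_powr bu bgu) auto
  have A0: "A x \<ge> 0" for x using \<eta>(2) by (simp add: A_def)
  have g0: "g x \<ge> 0" for x using \<eta>(2,4) s by (simp add: g_def)
  have Ac: "c \<le> depth \<Omega> x" "x \<in> \<Omega>" "x \<in> ball x0 r" if "A x \<noteq> 0" for x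
  proof -
    have "u x \<noteq> 0" "\<eta> x \<noteq> 0" using that by (auto simp: A_def)
    then show "c \<le> depth \<Omega> x" "x \<in> ball x0 r" using cu \<eta>(1) by blast+
    then show "x \<in> \<Omega>" using c(1) depth_pos_iff[of x] by linarith
  qed
  have ug: "upper_grad A g"
    unfolding upper_grad_iff_ugrad
  proof
    fix x
    have 1: "ugrad \<eta> x L" using \<eta>(5) by (intro ugrad_lipschitz) auto
    have 2: "ugrad (\<lambda>y. \<bar>u y\<bar> powr s) x (\<bar>s * \<bar>u x\<bar> powr (s - 1) * sgn (u x)\<bar> * norm (grad u x))"
      by (rule ugrad_compose[OF ugrad_smooth _ has_real_derivative_abs_powr[OF s]])
        (use test_functions_smooth[OF u] in auto)
    have "\<bar>s * \<bar>u x\<bar> powr (s - 1) * sgn (u x)\<bar> * norm (grad u x) \<le> s * \<bar>u x\<bar> powr (s - 1) * norm (grad u x)"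
      using s by (intro mult_right_mono) (auto simp: abs_mult sgn_real_def)
    then have "\<bar>\<eta> x\<bar> * (\<bar>s * \<bar>u x\<bar> powr (s - 1) * sgn (u x)\<bar> * norm (grad u x)) \<le>
        \<eta> x * (s * \<bar>u x\<bar> powr (s - 1) * norm (grad u x))"
      using \<eta>(2)[of x] by (simp only: abs_of_nonneg) (intro mult_left_mono, auto)
    then have "\<bar>\<eta> x\<bar> * (\<bar>s * \<bar>u x\<bar> powr (s - 1) * sgn (u x)\<bar> * norm (grad u x)) + \<bar>\<bar>u x\<bar> powr s\<bar> * L \<le> g x"
      by (simp add: g_def mult_ac)
    then show "ugrad A x (g x)"
      unfolding A_def[abs_def]
      by (rule ugrad_mono[OF ugrad_mult[OF 1 \<eta>(4) 2], rotated]) (use s in auto)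
  qed
  \<comment> \<open>The weight d^(1 - s), truncated below depth c/2 to make it bounded. It agrees
    with the full weight on the support of A and of its translates by at most c/2, since A lives at
    depth at least c.\<close>
  define W where "W x = indicator {x. c / 2 \<le> depth \<Omega> x} x * depth \<Omega> x powr (1 - s)" for x
  have W0: "W x \<ge> 0" for x by (simp add: W_def)
  have bW: "bbs W"
  proof -
    have "bbs (indicator {x. c / 2 \<le> depth \<Omega> x})"
      unfolding bbs_def
    proof (intro conjI)
      show "indicator {x. c / 2 \<le> depth \<Omega> x} \<in> borel_measurable borel"
        by (intro borel_measurable_indicator) simp
      show "\<exists>B. \<forall>x. \<bar>indicator {x. c / 2 \<le> depth \<Omega> x} x :: real\<bar> \<le> B"
        by (rule exI[of _ 1]) (simp add: indicator_def)
      have "{x. (indicator {x. c / 2 \<le> depth \<Omega> x} x :: real) \<noteq> 0} \<subseteq> {x. c / 2 \<le> depth \<Omega> x}"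
        by (auto simp: indicator_def)
      then show "Elementary_Metric_Spaces.bounded {x. (indicator {x. c / 2 \<le> depth \<Omega> x} x :: real) \<noteq> 0}"
        by (rule bounded_subset[rotated]) (use compact_depth_ge(1)[of "c / 2"] c(1) in \<open>auto intro: compact_imp_bounded\<close>)
    qed
    then show ?thesis
      unfolding W_def
    proof (rule bbs_mult)
      show "\<bar>depth \<Omega> x powr (1 - s)\<bar> \<le> (c / 2) powr (1 - s)"
        if "(indicator {x. c / 2 \<le> depth \<Omega> x} x :: real) \<noteq> 0" for x
        using that c(1) s by (auto simp: indicator_def intro!: powr_mono2' split: if_splits)
    qed measurable
  qed
  \<comment> \<open>The bound r keeps the shifts within the range of the inward normal, the bound
    c/2 keeps the translates of A where the weight is not truncated.\<close>
  define m where "m = min r (c / 2)"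
  have m: "m > 0" "m \<le> r" "m \<le> c / 2" using r c(1) by (auto simp: m_def)
  define h where "h n = m / 2 * inverse (real (Suc n))" for n
  have h: "h n > 0" "h n < m" for n
  proof -
    show "h n > 0" using m by (simp add: h_def)
    have "m / 2 * inverse (real (Suc n)) \<le> m / 2 * 1"
      using m by (intro mult_left_mono) (auto simp: field_simps)
    then show "h n < m" using m by (simp add: h_def)
  qed
  have hlim: "h \<longlonglongrightarrow> 0"
    unfolding h_def using tendsto_mult[OF tendsto_const LIMSEQ_inverse_real_of_nat, of "m / 2"] by simp
  let ?R = "\<lambda>n. \<integral>x. W x * max (\<bar>A (x + h n *\<^sub>R (- N)) - A x\<bar> / h n) (g x * norm (- N)) \<partial>lborel"
  obtain Lip where lip: "\<And>x y. \<bar>A x - A y\<bar> \<le> Lip * norm (x - y)"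
    using upper_grad_lipschitz[OF ug bg] by blast
  note UG = upper_grad_tendsto[OF ug lip bbs_measurable[OF bA] bg g0 bW h(1) hlim, where v = "- N"]
  have step: "(s - 1) * (1 - \<epsilon>) * (\<integral>x. A x * (depth \<Omega> x + h n) powr (- s) \<partial>lborel) \<le> ?R n" for n
  proof -
    note h = h[of n]
    have hr: "h n < r" "h n \<le> c / 2" using h m by auto
    let ?D' = "\<lambda>x. depth \<Omega> (h n *\<^sub>R N + x)"
    have inc: "depth \<Omega> x + (1 - \<epsilon>) * h n \<le> ?D' x" if "A x \<noteq> 0" for x
      using inw Ac[OF that] h hr by (simp add: inward_normal_def add.commute)
    have eh: "(1 - \<epsilon>) * h n > 0" "(1 - \<epsilon>) * h n \<le> h n" using \<epsilon> h by (auto simp: mult_left_le_one_le)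
    have b1: "bbs (\<lambda>x. A x * (depth \<Omega> x + h n) powr (- s))"
    proof (rule bbs_mult[OF bA])
      show "\<bar>(depth \<Omega> x + h n) powr (- s)\<bar> \<le> h n powr (- s)" for x
        using powr_mono2'[of "- s" "h n" "depth \<Omega> x + h n"] s h(1) depth_nonneg[of \<Omega> x] by auto
    qed measurable
    have b2: "bbs (\<lambda>x. A x * depth \<Omega> x powr (1 - s))"
    proof (rule bbs_mult[OF bA])
      show "\<bar>depth \<Omega> x powr (1 - s)\<bar> \<le> c powr (1 - s)" if "A x \<noteq> 0" for x
        using Ac(1)[OF that] s c(1) by (auto intro!: powr_mono2')
    qed measurable
    have b3: "bbs (\<lambda>x. A x * ?D' x powr (1 - s))"
    proof (rule bbs_mult[OF bA])
      show "\<bar>?D' x powr (1 - s)\<bar> \<le> c powr (1 - s)" if "A x \<noteq> 0" for x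
        using Ac(1)[OF that] inc[OF that] eh s c(1) by (auto intro!: powr_mono2')
    qed measurable
    have AW: "A x * depth \<Omega> x powr (1 - s) = A x * W x" for x
      using Ac(1)[of x] c(1) by (cases "A x = 0") (auto simp: W_def)
    have A'W: "A (- h n *\<^sub>R N + x) * depth \<Omega> x powr (1 - s) = A (- h n *\<^sub>R N + x) * W x" for x
    proof (cases "A (- h n *\<^sub>R N + x) = 0")
      case False
      have "depth \<Omega> x \<ge> depth \<Omega> (- h n *\<^sub>R N + x) - h n"
        using depth_lipschitz[of \<Omega> "- h n *\<^sub>R N + x" x] N h(1) by simp
      then have "depth \<Omega> x \<ge> c / 2" using Ac(1)[OF False] hr(2) by linarith
      then show ?thesis by (simp add: W_def)
    qed simp
    have bA': "bbs (\<lambda>x. A (- h n *\<^sub>R N + x))" by (rule bbs_translate[OF bA])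
    have "h n * ((s - 1) * (1 - \<epsilon>) * (\<integral>x. A x * (depth \<Omega> x + h n) powr (- s) \<partial>lborel)) =
      (\<integral>x. h n * ((s - 1) * (1 - \<epsilon>)) * (A x * (depth \<Omega> x + h n) powr (- s)) \<partial>lborel)"
      by simp
    also have "\<dots> \<le> (\<integral>x. A x * depth \<Omega> x powr (1 - s) - A x * ?D' x powr (1 - s) \<partial>lborel)"
    proof (rule integral_mono)
      show "integrable lborel (\<lambda>x. h n * ((s - 1) * (1 - \<epsilon>)) * (A x * (depth \<Omega> x + h n) powr (- s)))"
        by (intro integrable_mult_right bbs_integrable b1)
      show "integrable lborel (\<lambda>x. A x * depth \<Omega> x powr (1 - s) - A x * ?D' x powr (1 - s))"
        by (intro bbs_integrable bbs_diff b2 b3)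
      fix x
      show "h n * ((s - 1) * (1 - \<epsilon>)) * (A x * (depth \<Omega> x + h n) powr (- s)) \<le>
          A x * depth \<Omega> x powr (1 - s) - A x * ?D' x powr (1 - s)"
      proof (cases "A x = 0")
        case False
        define d where "d = depth \<Omega> x"
        define t where "t = d + (1 - \<epsilon>) * h n"
        have d: "d > 0" using Ac(1)[OF False] c(1) by (simp add: d_def)
        have t: "t > 0" "t \<le> d + h n" using eh d by (auto simp: t_def)
        have 1: "?D' x powr (1 - s) \<le> t powr (1 - s)"
          using inc[OF False] t s by (intro powr_mono2') (auto simp: t_def d_def)
        have 2: "t powr (1 - s) + (s - 1) * t powr (- s) * (t - d) \<le> d powr (1 - s)"
          using s d t by (intro powr_tangent_negative) auto
        \<comment> \<open>The intermediate depth t depends on \<epsilon>; passing to d + h gives an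
          integrand that is dominated by A d^(-s) and converges to it.\<close>
        have "(d + h n) powr (- s) \<le> t powr (- s)"
          using s t by (intro powr_mono2') auto
        then have "(s - 1) * ((1 - \<epsilon>) * h n) * (d + h n) powr (- s) \<le> (s - 1) * ((1 - \<epsilon>) * h n) * t powr (- s)"
          using s eh by (intro mult_left_mono) auto
        also have "\<dots> = (s - 1) * t powr (- s) * (t - d)" by (simp add: t_def)
        also have "\<dots> \<le> d powr (1 - s) - ?D' x powr (1 - s)" using 1 2 by linarith
        finally have "A x * ((s - 1) * ((1 - \<epsilon>) * h n) * (d + h n) powr (- s)) \<le>
            A x * (d powr (1 - s) - ?D' x powr (1 - s))"
          using A0 by (intro mult_left_mono) auto
        then show ?thesis by (simp add: d_def algebra_simps)
      qed simp
    qed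
    also have "\<dots> = (\<integral>x. A x * depth \<Omega> x powr (1 - s) \<partial>lborel) - (\<integral>x. A x * ?D' x powr (1 - s) \<partial>lborel)"
      by (intro Bochner_Integration.integral_diff bbs_integrable b2 b3)
    also have "(\<integral>x. A x * depth \<Omega> x powr (1 - s) \<partial>lborel) = (\<integral>x. A x * W x \<partial>lborel)"
      by (simp add: AW)
    also have "(\<integral>x. A x * ?D' x powr (1 - s) \<partial>lborel) =
        (\<integral>x. A (- h n *\<^sub>R N + x) * depth \<Omega> x powr (1 - s) \<partial>lborel)"
      using integral_translate[of "\<lambda>x. A (- h n *\<^sub>R N + x) * depth \<Omega> x powr (1 - s)" "h n *\<^sub>R N"]
        bbs_measurable[OF bA'] by simp
    also have "\<dots> = (\<integral>x. A (- h n *\<^sub>R N + x) * W x \<partial>lborel)"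
      by (intro Bochner_Integration.integral_cong refl A'W)
    also have "(\<integral>x. A x * W x \<partial>lborel) - (\<integral>x. A (- h n *\<^sub>R N + x) * W x \<partial>lborel) =
        (\<integral>x. A x * W x - A (- h n *\<^sub>R N + x) * W x \<partial>lborel)"
      by (intro Bochner_Integration.integral_diff[symmetric] bbs_integrable bbs_mult_bbs bA bA' bW)
    also have "\<dots> \<le> (\<integral>x. h n * (W x * max (\<bar>A (x + h n *\<^sub>R (- N)) - A x\<bar> / h n) (g x * norm (- N))) \<partial>lborel)"
    proof (rule integral_mono)
      show "integrable lborel (\<lambda>x. A x * W x - A (- h n *\<^sub>R N + x) * W x)"
        by (intro bbs_integrable bbs_diff bbs_mult_bbs bA bA' bW)
      show "integrable lborel (\<lambda>x. h n * (W x * max (\<bar>A (x + h n *\<^sub>R (- N)) - A x\<bar> / h n) (g x * norm (- N))))"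
        by (intro integrable_mult_right UG(2))
      fix x
      have "A x * W x - A (- h n *\<^sub>R N + x) * W x = W x * (A x - A (x + h n *\<^sub>R (- N)))"
        by (simp add: algebra_simps)
      also have "\<dots> \<le> W x * \<bar>A (x + h n *\<^sub>R (- N)) - A x\<bar>"
        using W0 by (intro mult_left_mono) auto
      also have "\<dots> = W x * (h n * (\<bar>A (x + h n *\<^sub>R (- N)) - A x\<bar> / h n))"
        using h by simp
      also have "\<dots> \<le> W x * (h n * max (\<bar>A (x + h n *\<^sub>R (- N)) - A x\<bar> / h n) (g x * norm (- N)))"
        using W0 h by (intro mult_left_mono) auto
      finally show "A x * W x - A (- h n *\<^sub>R N + x) * W x \<le>
        h n * (W x * max (\<bar>A (x + h n *\<^sub>R (- N)) - A x\<bar> / h n) (g x * norm (- N)))"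
        by (simp only: mult_ac)
    qed
    also have "\<dots> = h n * ?R n" by (rule integral_mult_right_zero)
    finally show ?thesis using h(1) by (simp only: mult_le_cancel_left_pos)
  qed
  have b4: "bbs (\<lambda>x. A x * depth \<Omega> x powr (- s))"
  proof (rule bbs_mult[OF bA])
    show "\<bar>depth \<Omega> x powr (- s)\<bar> \<le> c powr (- s)" if "A x \<noteq> 0" for x
      using Ac(1)[OF that] s c(1) by (auto intro!: powr_mono2')
  qed measurable
  have "(\<lambda>n. \<integral>x. A x * (depth \<Omega> x + h n) powr (- s) \<partial>lborel) \<longlonglongrightarrow> (\<integral>x. A x * depth \<Omega> x powr (- s) \<partial>lborel)"
  proof (rule integral_dominated_convergence[OF _ _ bbs_integrable[OF b4]])
    show "AE x in lborel. (\<lambda>n. A x * (depth \<Omega> x + h n) powr (- s)) \<longlonglongrightarrow> A x * depth \<Omega> x powr (- s)"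
    proof (rule AE_I2)
      fix x
      show "(\<lambda>n. A x * (depth \<Omega> x + h n) powr (- s)) \<longlonglongrightarrow> A x * depth \<Omega> x powr (- s)"
      proof (cases "A x = 0")
        case False
        have "depth \<Omega> x + 0 \<noteq> 0" using Ac(1)[OF False] c(1) by linarith
        from tendsto_powr[OF tendsto_add[OF tendsto_const hlim] tendsto_const this]
        have "(\<lambda>n. A x * (depth \<Omega> x + h n) powr (- s)) \<longlonglongrightarrow> A x * (depth \<Omega> x + 0) powr (- s)"
          by (intro tendsto_mult tendsto_const)
        then show ?thesis by simp
      qed simp
    qed
    show "AE x in lborel. norm (A x * (depth \<Omega> x + h n) powr (- s)) \<le> A x * depth \<Omega> x powr (- s)" for n
    proof (rule AE_I2)
      fix x
      show "norm (A x * (depth \<Omega> x + h n) powr (- s)) \<le> A x * depth \<Omega> x powr (- s)"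
      proof (cases "A x = 0")
        case False
        have "(depth \<Omega> x + h n) powr (- s) \<le> depth \<Omega> x powr (- s)"
          using Ac(1)[OF False] c(1) s h(1)[of n] by (intro powr_mono2') auto
        then show ?thesis using A0[of x] by (simp add: abs_mult mult_left_mono)
      qed simp
    qed
  qed measurable
  then have "(\<lambda>n. (s - 1) * (1 - \<epsilon>) * (\<integral>x. A x * (depth \<Omega> x + h n) powr (- s) \<partial>lborel)) \<longlonglongrightarrow>
      (s - 1) * (1 - \<epsilon>) * (\<integral>x. A x * depth \<Omega> x powr (- s) \<partial>lborel)"
    by (intro tendsto_mult tendsto_const)
  from LIMSEQ_le[OF this UG(1)] step
  have "(s - 1) * (1 - \<epsilon>) * (\<integral>x. A x * depth \<Omega> x powr (- s) \<partial>lborel) \<le> (\<integral>x. W x * (g x * norm (- N)) \<partial>lborel)"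
    by blast
  moreover have "A x * depth \<Omega> x powr (- s) = \<eta> x * q x powr s" for x
  proof (cases "u x = 0")
    case False
    have d: "depth \<Omega> x > 0" using cu[OF False] c(1) by linarith
    have "q x powr s = \<bar>u x\<bar> powr s * inverse (depth \<Omega> x powr s)"
      unfolding q_def using d by (subst powr_divide) (auto simp: divide_inverse)
    then show ?thesis by (simp add: A_def powr_minus)
  qed (simp add: A_def q_def)
  \<comment> \<open>A factor d is left over in the Lipschitz term, since |u|^s d^(1 - s) = d q^s;
    this gain makes the term small in a thin strip.\<close>
  moreover have "W x * (g x * norm (- N)) = s * (\<eta> x * (q x powr (s - 1) * norm (grad u x))) + L * (depth \<Omega> x * q x powr s)" for x
  proof (cases "u x = 0")
    case False
    have d: "depth \<Omega> x > 0" "c / 2 \<le> depth \<Omega> x" using cu[OF False] c(1) by linarith+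
    have qb: "q x powr b = \<bar>u x\<bar> powr b * inverse (depth \<Omega> x powr b)" for b
      unfolding q_def using d(1) by (subst powr_divide) (auto simp: divide_inverse)
    have W: "W x = depth \<Omega> x powr (1 - s)" using d by (simp add: W_def)
    have e1: "depth \<Omega> x powr (1 - s) = inverse (depth \<Omega> x powr (s - 1))"
      using powr_minus[of "depth \<Omega> x" "s - 1"] by simp
    have e2: "depth \<Omega> x powr (1 - s) = depth \<Omega> x * inverse (depth \<Omega> x powr s)"
      using d(1) by (simp add: powr_diff divide_inverse)
    have "W x * g x = s * (\<eta> x * ((\<bar>u x\<bar> powr (s - 1) * depth \<Omega> x powr (1 - s)) * norm (grad u x))) +
       L * (depth \<Omega> x powr (1 - s) * \<bar>u x\<bar> powr s)"
      unfolding W g_def by (simp add: algebra_simps)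
    also have "\<bar>u x\<bar> powr (s - 1) * depth \<Omega> x powr (1 - s) = q x powr (s - 1)"
      unfolding qb e1 ..
    also have "depth \<Omega> x powr (1 - s) * \<bar>u x\<bar> powr s = depth \<Omega> x * q x powr s"
      unfolding qb e2 by simp
    finally show ?thesis using N by simp
  qed (simp add: g_def q_def)
  moreover have "(\<integral>x. s * (\<eta> x * (q x powr (s - 1) * norm (grad u x))) + L * (depth \<Omega> x * q x powr s) \<partial>lborel) =
    s * (\<integral>x. \<eta> x * (q x powr (s - 1) * norm (grad u x)) \<partial>lborel) + L * (\<integral>x. depth \<Omega> x * q x powr s \<partial>lborel)"
  proof -
    have "integrable lborel (\<lambda>x. \<eta> x * (q x powr (s - 1) * norm (grad u x)))"
      using s q0 by (intro bbs_integrable bbs_mult_bbs b\<eta> bbs_powr' bq bgu) auto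
    moreover have "integrable lborel (\<lambda>x. depth \<Omega> x * q x powr s)"
      using s q0 by (intro bbs_integrable bbs_mult_bbs bbs_depth bbs_powr' bq) auto
    ultimately show ?thesis by simp
  qed
  ultimately show ?thesis by (simp add: q_def)
qed

lemma boundary_partition_chart:
  assumes "boundary_partition \<epsilon> m \<eta> L \<beta>" "k < m"
  obtains c r N where "inward_normal \<epsilon> c r N" "\<And>x. x \<notin> ball c r \<Longrightarrow> \<eta> k x = 0"
proof -
  have "\<exists>c r N. inward_normal \<epsilon> c r N \<and> (\<forall>x. x \<notin> ball c r \<longrightarrow> \<eta> k x = 0)"
    using assms unfolding boundary_partition_def by blast
  then show ?thesis using that by blast
qed

text \<open>In the strip the partition sums to 1 and each chart is covered by
  \<open>integrable_depth_chart\<close>; deeper inside, the power is bounded on the bounded set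
  \<Omega>. The result decides which powers of d have finite mass.\<close>

lemma integrable_depth_powr:
  assumes C2: "C2_boundary \<Omega>" and \<delta>: "0 < \<delta>" "\<delta> < 1"
  shows "integrable lborel (\<lambda>x. depth \<Omega> x powr (\<delta> - 1))"
proof -
  obtain m \<eta> L \<beta> where P: "boundary_partition (1 / 2) m \<eta> L \<beta>"
    by (rule boundary_partition_exists[OF C2, of "1 / 2"]) auto
  have L: "L \<ge> 0" and \<beta>: "\<beta> > 0" using P by (auto simp: boundary_partition_def)
  have \<eta>: "0 \<le> \<eta> k x" "\<bar>\<eta> k x - \<eta> k y\<bar> \<le> L * norm (x - y)" if "k < m" for k x y
    using P that by (auto simp: boundary_partition_def)
  have chart: "integrable lborel (\<lambda>x. \<eta> k x * depth \<Omega> x powr (\<delta> - 1))" if k: "k < m" for k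
  proof -
    obtain c r N where "inward_normal (1 / 2) c r N" "\<And>x. x \<notin> ball c r \<Longrightarrow> \<eta> k x = 0"
      using boundary_partition_chart[OF P k] by blast
    then show ?thesis
      using \<eta>[OF k] L \<delta> by (intro integrable_depth_chart[of "1 / 2" c r N \<delta> "\<eta> k" L]) auto
  qed
  let ?G = "\<lambda>x. (\<Sum>k<m. \<eta> k x * depth \<Omega> x powr (\<delta> - 1)) + \<beta> powr (\<delta> - 1) * indicator \<Omega> x"
  have I: "integrable lborel ?G"
    by (intro Bochner_Integration.integrable_add Bochner_Integration.integrable_sum chart integrable_indicator_\<Omega>) auto
  show ?thesis
  proof (rule Bochner_Integration.integrable_bound[OF I])
    have "norm (depth \<Omega> x powr (\<delta> - 1)) \<le> norm (?G x)" for x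
    proof -
      have S: "(\<Sum>k<m. \<eta> k x * depth \<Omega> x powr (\<delta> - 1)) \<ge> 0"
        using \<eta>(1) by (intro sum_nonneg) auto
      have "depth \<Omega> x powr (\<delta> - 1) \<le> ?G x"
      proof (cases "x \<in> \<Omega>")
        case True
        show ?thesis
        proof (cases "depth \<Omega> x \<le> \<beta>")
          case True
          then have "(\<Sum>k<m. \<eta> k x) = 1" using P \<open>x \<in> \<Omega>\<close> by (auto simp: boundary_partition_def)
          then have "(\<Sum>k<m. \<eta> k x * depth \<Omega> x powr (\<delta> - 1)) = depth \<Omega> x powr (\<delta> - 1)"
            by (simp add: sum_distrib_right[symmetric])
          then show ?thesis by simp
        next
          case False
          then have "depth \<Omega> x powr (\<delta> - 1) \<le> \<beta> powr (\<delta> - 1)"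
            using \<beta> \<delta> by (intro powr_mono2') auto
          then show ?thesis using S True by simp
        qed
      qed (use S in \<open>simp add: depth_zero\<close>)
      then show ?thesis by simp
    qed
    then show "AE x in lborel. norm (depth \<Omega> x powr (\<delta> - 1)) \<le> norm (?G x)" by (intro AE_I2)
  qed measurable
qed

text \<open>The test functions \<open>d powr a\<close>, truncated near the boundary, for \<open>a > 1 - 1/p\<close>.\<close>

lemma hardy_constant_le_powr:
  assumes C2: "C2_boundary \<Omega>" and p: "p > 1" and a: "1 - 1 / p < a" "a < 1"
  shows "hardy_constant \<Omega> p \<le> a powr p"
proof -
  \<comment> \<open>With this \<delta> the p-th power of d^a / d is d^(\<delta> - 1), and the
    condition a > 1 - 1/p says precisely that \<delta> > 0, the range of integrability.\<close>
  define \<delta> where "\<delta> = (a - 1) * p + 1"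
  have "(1 - 1 / p) * p < a * p" using a(1) p by (intro mult_strict_right_mono) auto
  then have "p - 1 < a * p" using p by (simp add: algebra_simps)
  then have \<delta>: "0 < \<delta>" "\<delta> < 1" "(a - 1) * p = \<delta> - 1"
    using a p by (auto simp: \<delta>_def algebra_simps mult_less_cancel_right1)
  have a0: "a > 0"
  proof -
    have "1 / p < 1" using p by simp
    then show ?thesis using a(1) by linarith
  qed
  define I where "I = (\<integral>x. depth \<Omega> x powr (\<delta> - 1) \<partial>lborel)"
  note int = integrable_depth_powr[OF C2 \<delta>(1,2)]
  obtain C where C: "\<And>x. depth \<Omega> x \<le> C" "C > 0"
  proof -
    obtain C where "\<And>x. \<bar>depth \<Omega> x\<bar> \<le> C" using bbs_depth by (auto simp: bbs_def)
    then have "depth \<Omega> x \<le> max C 1" for x by (smt (verit))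
    then show ?thesis using that[of "max C 1"] by auto
  qed
  have I: "I > 0"
  proof -
    obtain x l u where xlu: "x \<in> box l u" "cbox l u \<subseteq> \<Omega>"
      using nonempty open_contains_cbox open_\<Omega> by (metis ex_in_conv)
    have "(\<integral>x. depth \<Omega> x \<partial>lborel) > 0"
      by (rule integral_pos_box[OF bbs_depth depth_nonneg _ xlu(1)])
        (use xlu(2) box_subset_cbox depth_pos in blast)
    \<comment> \<open>Positivity of I by comparison with the integral of d: the exponent \<delta> -
      2 is negative, so d^(\<delta> - 2) is at least C^(\<delta> - 2) in \<Omega>.\<close>
    then have "0 < C powr (\<delta> - 2) * (\<integral>x. depth \<Omega> x \<partial>lborel)" using C(2) by simp
    also have "\<dots> = (\<integral>x. C powr (\<delta> - 2) * depth \<Omega> x \<partial>lborel)" by simp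
    also have "\<dots> \<le> I"
      unfolding I_def
    proof (rule integral_mono[OF _ int])
      show "integrable lborel (\<lambda>x. C powr (\<delta> - 2) * depth \<Omega> x)"
        by (intro integrable_mult_right bbs_integrable bbs_depth)
      fix x
      show "C powr (\<delta> - 2) * depth \<Omega> x \<le> depth \<Omega> x powr (\<delta> - 1)"
      proof (cases "depth \<Omega> x = 0")
        case False
        then have d: "depth \<Omega> x > 0" using depth_nonneg[of \<Omega> x] by linarith
        have "C powr (\<delta> - 2) * depth \<Omega> x \<le> depth \<Omega> x powr (\<delta> - 2) * depth \<Omega> x"
          using d C(1) \<delta> by (intro mult_right_mono powr_mono2') auto
        also have "\<dots> = depth \<Omega> x powr (\<delta> - 1)"
          using powr_mult_base[of "depth \<Omega> x" "\<delta> - 2"] d by (simp add: mult.commute)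
        finally show ?thesis .
      qed simp
    qed
    finally show ?thesis .
  qed
  define h where "h n = inverse (real (Suc n))" for n
  have h: "h n > 0" for n by (simp add: h_def)
  have hlim: "h \<longlonglongrightarrow> 0" unfolding h_def by (rule LIMSEQ_inverse_real_of_nat)
  \<comment> \<open>Subtracting a constant before taking the positive part keeps the upper gradient
    of d^a at depth h and beyond, and makes f vanish nearer to the boundary.\<close>
  define f where "f n x = max 0 (depth \<Omega> x powr a - h n powr a)" for n x
  define g where "g n x = indicator {x. h n \<le> depth \<Omega> x} x * (a * depth \<Omega> x powr (a - 1))" for n x
  have bDa: "bbs (\<lambda>x. depth \<Omega> x powr a)" using a0 by (intro bbs_powr' bbs_depth) (auto simp: depth_nonneg)
  have f0: "f n x \<ge> 0" for n x by (simp add: f_def)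
  have fle: "f n x \<le> depth \<Omega> x powr a" for n x by (simp add: f_def)
  have [measurable]: "f n \<in> borel_measurable borel" for n unfolding f_def by measurable
  have bf: "bbs (f n)" for n
    by (rule bbs_dominated[where C = 1, OF bDa]) (use f0 fle in auto)
  have fd: "h n \<le> depth \<Omega> x" if "f n x \<noteq> 0" for n x
  proof (rule ccontr)
    assume "\<not> h n \<le> depth \<Omega> x"
    then have "depth \<Omega> x powr a \<le> h n powr a" using a0 by (intro powr_mono2) (auto simp: depth_nonneg)
    then show False using that by (simp add: f_def)
  qed
  have g0: "g n x \<ge> 0" for n x using a0 by (simp add: g_def)
  have bg: "bbs (g n)" for n
  proof (rule bbs_dominated[where C = "a * h n powr (a - 1) / h n", OF bbs_depth])
    show "g n \<in> borel_measurable borel" unfolding g_def by measurable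
    fix x
    show "\<bar>g n x\<bar> \<le> a * h n powr (a - 1) / h n * \<bar>depth \<Omega> x\<bar>"
    proof (cases "h n \<le> depth \<Omega> x")
      case True
      have "depth \<Omega> x powr (a - 1) \<le> h n powr (a - 1)" using True h[of n] a by (intro powr_mono2') auto
      moreover have "1 \<le> depth \<Omega> x / h n" using True h[of n] by simp
      ultimately have "depth \<Omega> x powr (a - 1) * 1 \<le> h n powr (a - 1) * (depth \<Omega> x / h n)"
        by (intro mult_mono) auto
      then have "a * depth \<Omega> x powr (a - 1) \<le> a * (h n powr (a - 1) * (depth \<Omega> x / h n))"
        using a0 by (intro mult_left_mono) auto
      then show ?thesis using True a0 depth_nonneg[of \<Omega> x] by (simp add: g_def)
    next
      case False
      then show ?thesis using a0 h[of n] depth_nonneg[of \<Omega> x] by (simp add: g_def)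
    qed
  qed
  have ug: "upper_grad (f n) (g n)" for n
    unfolding upper_grad_iff_ugrad
  proof
    fix x
    show "ugrad (f n) x (g n x)"
    proof (cases "h n \<le> depth \<Omega> x")
      case True
      then have d: "depth \<Omega> x > 0" using h[of n] by linarith
      from ugrad_compose[OF ugrad_depth _ has_real_derivative_powr[OF d, of a]]
      have "ugrad (\<lambda>y. depth \<Omega> y powr a) x (g n x)"
        using True a0 by (simp add: g_def)
      then show ?thesis
        by (rule ugrad_dominated) (simp add: f_def max_def abs_if)
    next
      case False
      have "open {y. depth \<Omega> y < h n}"
        by (intro open_Collect_less continuous_on_depth continuous_intros)
      then have "\<forall>\<^sub>F y in nhds x. depth \<Omega> y < h n"
        using False by (auto simp: eventually_nhds)
      then have "\<forall>\<^sub>F y in nhds x. f n y = 0"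
        by eventually_elim (use fd in force)
      then show ?thesis using g0 by (intro ugrad_cong[OF ugrad_const[of "g n x" 0]])
    qed
  qed
  have upper: "hardy_constant \<Omega> p * mass \<Omega> p (f n) \<le> a powr p * I" for n
  proof -
    have "hardy_constant \<Omega> p * mass \<Omega> p (f n) \<le> (\<integral>x. g n x powr p \<partial>lborel)"
      by (rule hardy_constant_upper_grad[OF bf h fd ug bg g0 p])
    also have "\<dots> \<le> (\<integral>x. a powr p * depth \<Omega> x powr (\<delta> - 1) \<partial>lborel)"
    proof (rule integral_mono)
      show "integrable lborel (\<lambda>x. g n x powr p)"
        using p g0 by (intro bbs_integrable bbs_powr' bg) auto
      show "integrable lborel (\<lambda>x. a powr p * depth \<Omega> x powr (\<delta> - 1))"
        by (intro integrable_mult_right int)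
      fix x
      have "g n x \<le> a * depth \<Omega> x powr (a - 1)"
        using a0 by (simp add: g_def indicator_def)
      then have "g n x powr p \<le> (a * depth \<Omega> x powr (a - 1)) powr p"
        using p g0 by (intro powr_mono2) auto
      also have "\<dots> = a powr p * depth \<Omega> x powr (\<delta> - 1)"
        using a0 \<delta>(3) by (simp add: powr_mult powr_powr)
      finally show "g n x powr p \<le> a powr p * depth \<Omega> x powr (\<delta> - 1)" .
    qed
    finally show ?thesis by (simp add: I_def)
  qed
  have mlim: "(\<lambda>n. mass \<Omega> p (f n)) \<longlonglongrightarrow> I"
    unfolding mass_def I_def
  proof (rule integral_dominated_convergence[OF _ _ int])
    have eq: "(depth \<Omega> x powr a / depth \<Omega> x) powr p = depth \<Omega> x powr (\<delta> - 1)" for x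
    proof (cases "depth \<Omega> x = 0")
      case False
      then have d: "depth \<Omega> x > 0" using depth_nonneg[of \<Omega> x] by linarith
      have "depth \<Omega> x powr a / depth \<Omega> x = depth \<Omega> x powr (a - 1)"
        using d by (simp add: powr_diff)
      then show ?thesis using \<delta>(3) by (simp add: powr_powr)
    qed simp
    show "AE x in lborel. (\<lambda>n. (\<bar>f n x\<bar> / depth \<Omega> x) powr p) \<longlonglongrightarrow> depth \<Omega> x powr (\<delta> - 1)"
    proof (rule AE_I2)
      fix x
      have "(\<lambda>n. h n powr a) \<longlonglongrightarrow> 0"
        using a0 h by (intro tendsto_zero_powrI[OF hlim tendsto_const]) (auto simp: less_imp_le)
      then have "(\<lambda>n. f n x) \<longlonglongrightarrow> max 0 (depth \<Omega> x powr a - 0)"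
        unfolding f_def by (intro tendsto_intros)
      then have fx: "(\<lambda>n. f n x) \<longlonglongrightarrow> depth \<Omega> x powr a" by (simp add: max_def)
      have "(\<lambda>n. (\<bar>f n x\<bar> / depth \<Omega> x) powr p) \<longlonglongrightarrow> (\<bar>depth \<Omega> x powr a\<bar> / depth \<Omega> x) powr p"
      proof (cases "depth \<Omega> x = 0")
        case False
        then show ?thesis using p depth_nonneg[of \<Omega> x]
          by (intro tendsto_powr' tendsto_divide tendsto_rabs fx tendsto_const) auto
      qed simp
      then show "(\<lambda>n. (\<bar>f n x\<bar> / depth \<Omega> x) powr p) \<longlonglongrightarrow> depth \<Omega> x powr (\<delta> - 1)"
        by (simp add: eq)
    qed
    show "AE x in lborel. norm ((\<bar>f n x\<bar> / depth \<Omega> x) powr p) \<le> depth \<Omega> x powr (\<delta> - 1)" for n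
    proof (rule AE_I2)
      fix x
      have "(\<bar>f n x\<bar> / depth \<Omega> x) powr p \<le> (depth \<Omega> x powr a / depth \<Omega> x) powr p"
        using p f0[of n x] fle[of n x] depth_nonneg[of \<Omega> x]
        by (intro powr_mono2 divide_right_mono) auto
      then show "norm ((\<bar>f n x\<bar> / depth \<Omega> x) powr p) \<le> depth \<Omega> x powr (\<delta> - 1)"
        by (simp add: eq)
    qed
  qed measurable
  have "hardy_constant \<Omega> p * I \<le> a powr p * I"
    by (rule LIMSEQ_le_const2[OF tendsto_mult[OF tendsto_const mlim]]) (use upper in auto)
  then show ?thesis using I by simp
qed

lemma hardy_constant_le_half_line:
  assumes C2: "C2_boundary \<Omega>" and p: "p > 1"
  shows "hardy_constant \<Omega> p \<le> ((p - 1) / p) powr p"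
proof -
  have eq: "(p - 1) / p = 1 - 1 / p" using p by (simp add: field_simps)
  have "((\<lambda>a. a powr p) \<longlongrightarrow> (1 - 1 / p) powr p) (at_right (1 - 1 / p))"
    using p by (intro tendsto_intros) auto
  then have "hardy_constant \<Omega> p \<le> (1 - 1 / p) powr p"
  proof (rule tendsto_lowerbound)
    have "\<forall>\<^sub>F a in at_right (1 - 1 / p). 1 - 1 / p < a \<and> a < 1"
      using p by (auto simp: eventually_at_right_field intro!: exI[of _ 1])
    then show "\<forall>\<^sub>F a in at_right (1 - 1 / p). hardy_constant \<Omega> p \<le> a powr p"
      by eventually_elim (use hardy_constant_le_powr[OF C2 p] in blast)
  qed simp
  then show ?thesis by (simp add: eq)
qed

text \<open>The chart estimates are summed over the partition. The term with the Lipschitz constant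
  gains a factor b, as d \<le> b on the support, and the mixed term is split by Young's inequality
  with a free parameter \<mu>. The constants \<beta> and K are fixed before s, \<mu> and u, so the
  bound is uniform in these.\<close>

lemma local_hardy:
  assumes C2: "C2_boundary \<Omega>" and \<epsilon>: "0 < \<epsilon>" "\<epsilon> < 1"
  obtains \<beta> K where "\<beta> > 0" "K \<ge> 0"
    "\<And>b s \<mu> u. b \<le> \<beta> \<Longrightarrow> s > 1 \<Longrightarrow> \<mu> > 0 \<Longrightarrow> u \<in> test_functions \<Omega> \<Longrightarrow> (\<And>x. u x \<noteq> 0 \<Longrightarrow> depth \<Omega> x \<le> b) \<Longrightarrow>
      \<mu> powr (s - 1) * ((s - 1) * (1 - \<epsilon> - \<mu>) - K * b) * mass \<Omega> s u \<le> energy s u"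
proof -
  obtain m \<eta> L \<beta> where P: "boundary_partition \<epsilon> m \<eta> L \<beta>"
    using boundary_partition_exists[OF C2 \<epsilon>] by blast
  have L: "L \<ge> 0" and \<beta>: "\<beta> > 0" using P by (auto simp: boundary_partition_def)
  have main: "\<mu> powr (s - 1) * ((s - 1) * (1 - \<epsilon> - \<mu>) - (real m * L) * b) * mass \<Omega> s u \<le> energy s u"
    if b: "b \<le> \<beta>" and s: "s > 1" and \<mu>: "\<mu> > 0" and u: "u \<in> test_functions \<Omega>"
      and supp: "\<And>x. u x \<noteq> 0 \<Longrightarrow> depth \<Omega> x \<le> b" for b s \<mu> u
  proof -
    define q where "q x = \<bar>u x\<bar> / depth \<Omega> x" for x
    define G where "G x = norm (grad u x)" for x
    have bq: "bbs q" unfolding q_def[abs_def] by (rule test_functions_quotient_bbs[OF u])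
    have q0: "q x \<ge> 0" for x by (simp add: q_def depth_nonneg)
    have bG: "bbs G" unfolding G_def[abs_def] by (rule test_functions_grad_bbs[OF u])
    have bqs: "bbs (\<lambda>x. q x powr s)" "bbs (\<lambda>x. q x powr (s - 1) * G x)"
      using s q0 by (auto intro!: bbs_mult_bbs bbs_powr' bq bG)
    let ?J = "\<integral>x. depth \<Omega> x * q x powr s \<partial>lborel"
    have b\<eta>: "bbs (\<eta> k)" if k: "k < m" for k
    proof -
      obtain c r N where "inward_normal \<epsilon> c r N" "\<And>x. x \<notin> ball c r \<Longrightarrow> \<eta> k x = 0"
        using boundary_partition_chart[OF P k] by blast
      then show ?thesis using P k by (intro bbs_lipschitz[of L "\<eta> k" c r]) (auto simp: boundary_partition_def)
    qed
    have chart: "(s - 1) * (1 - \<epsilon>) * (\<integral>x. \<eta> k x * q x powr s \<partial>lborel) \<le>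
        s * (\<integral>x. \<eta> k x * (q x powr (s - 1) * G x) \<partial>lborel) + L * ?J" if k: "k < m" for k
    proof -
      obtain c r N where "inward_normal \<epsilon> c r N" "\<And>x. x \<notin> ball c r \<Longrightarrow> \<eta> k x = 0"
        using boundary_partition_chart[OF P k] by blast
      then show ?thesis
        unfolding q_def G_def using P k s u \<epsilon>
        by (intro local_hardy_chart[of \<epsilon> c r N]) (auto simp: boundary_partition_def)
    qed
    have sum1: "(\<Sum>k<m. \<eta> k x) * y = y" if "u x \<noteq> 0 \<or> y = 0" for x y
    proof (cases "y = 0")
      case False
      then have "u x \<noteq> 0" using that by simp
      then have "x \<in> \<Omega>" "depth \<Omega> x \<le> \<beta>" using test_functions_outside[OF u] supp[of x] b by force+
      then show ?thesis using P by (simp add: boundary_partition_def)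
    qed simp
    have S1: "(\<Sum>k<m. \<integral>x. \<eta> k x * q x powr s \<partial>lborel) = mass \<Omega> s u"
    proof -
      have "(\<Sum>k<m. \<integral>x. \<eta> k x * q x powr s \<partial>lborel) = (\<integral>x. (\<Sum>k<m. \<eta> k x * q x powr s) \<partial>lborel)"
        by (intro Bochner_Integration.integral_sum[symmetric] bbs_integrable bbs_mult_bbs b\<eta> bqs) auto
      also have "\<dots> = (\<integral>x. q x powr s \<partial>lborel)"
        by (intro Bochner_Integration.integral_cong refl)
          (use sum1 in \<open>auto simp: sum_distrib_right[symmetric] q_def\<close>)
      finally show ?thesis by (simp add: mass_def q_def)
    qed
    have S2: "(\<Sum>k<m. \<integral>x. \<eta> k x * (q x powr (s - 1) * G x) \<partial>lborel) = (\<integral>x. q x powr (s - 1) * G x \<partial>lborel)"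
    proof -
      have "(\<Sum>k<m. \<integral>x. \<eta> k x * (q x powr (s - 1) * G x) \<partial>lborel) = (\<integral>x. (\<Sum>k<m. \<eta> k x * (q x powr (s - 1) * G x)) \<partial>lborel)"
        by (intro Bochner_Integration.integral_sum[symmetric] bbs_integrable bbs_mult_bbs b\<eta> bqs) auto
      also have "\<dots> = (\<integral>x. q x powr (s - 1) * G x \<partial>lborel)"
      proof (intro Bochner_Integration.integral_cong refl)
        fix x
        show "(\<Sum>k<m. \<eta> k x * (q x powr (s - 1) * G x)) = q x powr (s - 1) * G x"
          unfolding sum_distrib_right[symmetric] by (rule sum1) (auto simp: q_def)
      qed
      finally show ?thesis .
    qed
    have "(\<Sum>k<m. (s - 1) * (1 - \<epsilon>) * (\<integral>x. \<eta> k x * q x powr s \<partial>lborel)) \<le>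
        (\<Sum>k<m. s * (\<integral>x. \<eta> k x * (q x powr (s - 1) * G x) \<partial>lborel) + L * ?J)"
      using chart by (intro sum_mono) auto
    then have 1: "(s - 1) * (1 - \<epsilon>) * mass \<Omega> s u \<le>
        s * (\<integral>x. q x powr (s - 1) * G x \<partial>lborel) + real m * (L * ?J)"
      by (simp add: sum.distrib sum_distrib_left[symmetric] S1 S2)
    have "?J \<le> (\<integral>x. b * q x powr s \<partial>lborel)"
    proof (rule integral_mono)
      show "integrable lborel (\<lambda>x. depth \<Omega> x * q x powr s)"
        by (intro bbs_integrable bbs_mult_bbs bbs_depth bqs)
      show "integrable lborel (\<lambda>x. b * q x powr s)" by (intro integrable_mult_right bbs_integrable bqs)
      show "depth \<Omega> x * q x powr s \<le> b * q x powr s" for x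
        using supp[of x] by (cases "u x = 0") (auto simp: q_def intro!: mult_right_mono)
    qed
    then have J: "?J \<le> b * mass \<Omega> s u" by (simp add: mass_def q_def)
    have "s * (\<integral>x. q x powr (s - 1) * G x \<partial>lborel) = (\<integral>x. s * (q x powr (s - 1) * G x) \<partial>lborel)" by simp
    also have "\<dots> \<le> (\<integral>x. (s - 1) * \<mu> * q x powr s + \<mu> powr (1 - s) * G x powr s \<partial>lborel)"
    proof (rule integral_mono)
      show "integrable lborel (\<lambda>x. s * (q x powr (s - 1) * G x))"
        by (intro integrable_mult_right bbs_integrable bqs)
      show "integrable lborel (\<lambda>x. (s - 1) * \<mu> * q x powr s + \<mu> powr (1 - s) * G x powr s)"
        using s by (intro bbs_integrable bbs_add bbs_cmult bqs bbs_powr' bG) (auto simp: G_def)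
      fix x
      \<comment> \<open>Scaling for Young's inequality: the factors \<kappa>^(s - 1) and \<kappa>^(1
        - s) cancel in the product, while the s-th powers acquire the factors \<mu> and \<mu>^(1 -
        s).\<close>
      define \<kappa> where "\<kappa> = \<mu> powr (1 / s)"
      have \<kappa>: "\<kappa> > 0" "\<kappa> powr s = \<mu>" using \<mu> s by (auto simp: \<kappa>_def powr_powr)
      have "(\<kappa> * q x) powr (s - 1) * (G x * \<kappa> powr (1 - s)) powr 1 \<le>
          (1 - 1 / s) * (\<kappa> * q x) powr s + 1 / s * (G x * \<kappa> powr (1 - s)) powr s"
        using s \<kappa> q0[of x] by (intro young_powr) (auto simp: G_def)
      moreover have "(\<kappa> * q x) powr (s - 1) * (G x * \<kappa> powr (1 - s)) powr 1 = q x powr (s - 1) * G x"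
      proof -
        have "\<kappa> powr (s - 1) * \<kappa> powr (1 - s) = 1" using \<kappa> by (simp add: powr_add[symmetric])
        moreover have "(\<kappa> * q x) powr (s - 1) * (G x * \<kappa> powr (1 - s)) powr 1 =
            (\<kappa> powr (s - 1) * \<kappa> powr (1 - s)) * (q x powr (s - 1) * G x)"
          using \<kappa> q0[of x] by (simp add: powr_mult G_def)
        ultimately show ?thesis by simp
      qed
      moreover have "(\<kappa> * q x) powr s = \<mu> * q x powr s" using \<kappa> q0[of x] by (simp add: powr_mult)
      moreover have "(G x * \<kappa> powr (1 - s)) powr s = \<mu> powr (1 - s) * G x powr s"
      proof -
        have "(\<kappa> powr (1 - s)) powr s = \<mu> powr (1 - s)"
          using \<kappa> by (metis mult.commute powr_powr)
        then show ?thesis by (simp add: powr_mult G_def)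
      qed
      ultimately have "q x powr (s - 1) * G x \<le> (1 - 1 / s) * (\<mu> * q x powr s) + 1 / s * (\<mu> powr (1 - s) * G x powr s)"
        by simp
      then have "s * (q x powr (s - 1) * G x) \<le> s * ((1 - 1 / s) * (\<mu> * q x powr s) + 1 / s * (\<mu> powr (1 - s) * G x powr s))"
        using s by (intro mult_left_mono) auto
      also have "\<dots> = (s - 1) * \<mu> * q x powr s + \<mu> powr (1 - s) * G x powr s"
        using s by (simp add: field_simps)
      finally show "s * (q x powr (s - 1) * G x) \<le> (s - 1) * \<mu> * q x powr s + \<mu> powr (1 - s) * G x powr s" .
    qed
    also have "\<dots> = (s - 1) * \<mu> * mass \<Omega> s u + \<mu> powr (1 - s) * energy s u"
      using test_functions_mass_integrable[OF u, of s] test_functions_energy_integrable[OF u, of s] s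
      by (simp add: mass_def energy_def q_def G_def)
    finally have 2: "s * (\<integral>x. q x powr (s - 1) * G x \<partial>lborel) \<le> (s - 1) * \<mu> * mass \<Omega> s u + \<mu> powr (1 - s) * energy s u" .
    have "real m * (L * ?J) \<le> real m * (L * (b * mass \<Omega> s u))"
      using J L by (intro mult_left_mono) auto
    then have "(s - 1) * (1 - \<epsilon>) * mass \<Omega> s u \<le>
        (s - 1) * \<mu> * mass \<Omega> s u + \<mu> powr (1 - s) * energy s u + real m * (L * (b * mass \<Omega> s u))"
      using 1 2 by linarith
    then have "((s - 1) * (1 - \<epsilon> - \<mu>) - (real m * L) * b) * mass \<Omega> s u \<le> \<mu> powr (1 - s) * energy s u"
      by (simp add: algebra_simps)
    then have "\<mu> powr (s - 1) * (((s - 1) * (1 - \<epsilon> - \<mu>) - (real m * L) * b) * mass \<Omega> s u) \<le>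
        \<mu> powr (s - 1) * (\<mu> powr (1 - s) * energy s u)"
      by (intro mult_left_mono) auto
    also have "\<dots> = (\<mu> powr (s - 1) * \<mu> powr (1 - s)) * energy s u" by simp
    also have "\<mu> powr (s - 1) * \<mu> powr (1 - s) = 1" using \<mu> by (simp add: powr_add[symmetric])
    finally show ?thesis by (simp add: mult.assoc)
  qed
  show ?thesis
    by (rule that[of \<beta> "real m * L"]) (use \<beta> L main in auto)
qed

text \<open>In a thin strip along the boundary the constant is that of the half-line.\<close>

lemma boundary_hardy:
  assumes C2: "C2_boundary \<Omega>" and p: "p > 1" and e: "e > 0"
  obtains \<beta> where "\<beta> > 0" "\<forall>\<^sub>F s in at_left p. \<forall>u\<in>test_functions \<Omega>. (\<forall>x. u x \<noteq> 0 \<longrightarrow> depth \<Omega> x \<le> \<beta>) \<longrightarrow>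
    (hardy_constant \<Omega> p - e) * mass \<Omega> s u \<le> energy s u"
proof -
  \<comment> \<open>The maximiser of \<mu>^(p - 1) (1 - \<mu>); without error terms it turns the
    bound of \<open>local_hardy\<close> into ((p - 1)/p)^p. It stays fixed while s varies.\<close>
  define \<mu> where "\<mu> = (p - 1) / p"
  have \<mu>: "\<mu> > 0" "1 - \<mu> = 1 / p" using p by (auto simp: \<mu>_def field_simps)
  let ?\<Psi> = "\<lambda>s \<epsilon> t. \<mu> powr (s - 1) * ((s - 1) * (1 - \<epsilon> - \<mu>) - t)"
  have "?\<Psi> p 0 0 = \<mu> powr (p - 1) * \<mu>"
    using \<mu>(2) p by (simp add: \<mu>_def)
  also have "\<dots> = \<mu> powr p" using \<mu>(1) by (simp add: powr_diff)
  finally have H: "hardy_constant \<Omega> p \<le> ?\<Psi> p 0 0"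
    using hardy_constant_le_half_line[OF C2 p] by (simp add: \<mu>_def)
  \<comment> \<open>The parameters are fixed in the order \<epsilon>, width b, exponent s. The
    constant K and the admissible widths depend on \<epsilon>, but not on s.\<close>
  have "((\<lambda>\<epsilon>. ?\<Psi> p \<epsilon> 0) \<longlongrightarrow> ?\<Psi> p 0 0) (at_right 0)" by (intro tendsto_intros)
  then have "\<forall>\<^sub>F \<epsilon> in at_right 0. hardy_constant \<Omega> p - e < ?\<Psi> p \<epsilon> 0"
    using H e by (intro order_tendstoD(1)) auto
  moreover have "\<forall>\<^sub>F \<epsilon> in at_right (0::real). 0 < \<epsilon> \<and> \<epsilon> < 1"
    by (auto simp: eventually_at_right_field intro!: exI[of _ 1])
  ultimately have "\<forall>\<^sub>F \<epsilon> in at_right (0::real). hardy_constant \<Omega> p - e < ?\<Psi> p \<epsilon> 0 \<and> 0 < \<epsilon> \<and> \<epsilon> < 1"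
    by (rule eventually_conj)
  then obtain \<epsilon> where \<epsilon>: "hardy_constant \<Omega> p - e < ?\<Psi> p \<epsilon> 0" "0 < \<epsilon>" "\<epsilon> < 1"
    using eventually_happens[of _ "at_right (0::real)"] by auto
  obtain \<beta>0 K where K: "\<beta>0 > 0" "K \<ge> 0"
    "\<And>b s \<mu> u. b \<le> \<beta>0 \<Longrightarrow> s > 1 \<Longrightarrow> \<mu> > 0 \<Longrightarrow> u \<in> test_functions \<Omega> \<Longrightarrow> (\<And>x. u x \<noteq> 0 \<Longrightarrow> depth \<Omega> x \<le> b) \<Longrightarrow>
      \<mu> powr (s - 1) * ((s - 1) * (1 - \<epsilon> - \<mu>) - K * b) * mass \<Omega> s u \<le> energy s u"
    using local_hardy[OF C2 \<epsilon>(2,3)] by blast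
  have "((\<lambda>b. ?\<Psi> p \<epsilon> (K * b)) \<longlongrightarrow> ?\<Psi> p \<epsilon> (K * 0)) (at_right 0)" by (intro tendsto_intros)
  then have "\<forall>\<^sub>F b in at_right 0. hardy_constant \<Omega> p - e < ?\<Psi> p \<epsilon> (K * b)"
    using \<epsilon>(1) by (intro order_tendstoD(1)) auto
  moreover have "\<forall>\<^sub>F b in at_right (0::real). 0 < b \<and> b < \<beta>0"
    using K(1) by (auto simp: eventually_at_right_field)
  ultimately have "\<forall>\<^sub>F b in at_right (0::real). hardy_constant \<Omega> p - e < ?\<Psi> p \<epsilon> (K * b) \<and> 0 < b \<and> b < \<beta>0"
    by (rule eventually_conj)
  then obtain b where b: "hardy_constant \<Omega> p - e < ?\<Psi> p \<epsilon> (K * b)" "0 < b" "b < \<beta>0"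
    using eventually_happens[of _ "at_right (0::real)"] by auto
  have "((\<lambda>s. ?\<Psi> s \<epsilon> (K * b)) \<longlongrightarrow> ?\<Psi> p \<epsilon> (K * b)) (at_left p)"
    using \<mu>(1) by (intro tendsto_intros) auto
  then have "\<forall>\<^sub>F s in at_left p. hardy_constant \<Omega> p - e < ?\<Psi> s \<epsilon> (K * b)"
    using b(1) by (intro order_tendstoD(1)) auto
  moreover have "\<forall>\<^sub>F s in at_left p. s > 1"
    using p by (auto simp: eventually_at_left_field)
  ultimately have "\<forall>\<^sub>F s in at_left p. \<forall>u\<in>test_functions \<Omega>. (\<forall>x. u x \<noteq> 0 \<longrightarrow> depth \<Omega> x \<le> b) \<longrightarrow>
    (hardy_constant \<Omega> p - e) * mass \<Omega> s u \<le> energy s u"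
  proof eventually_elim
    case (elim s)
    show ?case
    proof (intro ballI impI)
      fix u assume u: "u \<in> test_functions \<Omega>" "\<forall>x. u x \<noteq> 0 \<longrightarrow> depth \<Omega> x \<le> b"
      have "(hardy_constant \<Omega> p - e) * mass \<Omega> s u \<le> ?\<Psi> s \<epsilon> (K * b) * mass \<Omega> s u"
        using elim(1) by (intro mult_right_mono mass_nonneg) auto
      also have "\<dots> \<le> energy s u"
        using b(3) elim(2) \<mu>(1) u by (intro K(3)) auto
      finally show "(hardy_constant \<Omega> p - e) * mass \<Omega> s u \<le> energy s u" .
    qed
  qed
  then show ?thesis using that b(2) by blast
qed

end

section \<open>Regularisation in the interior\<close>

text \<open>Again the tangent at the mean, now for a density on any Euclidean space and a bounded
  Borel function h whose support may be unbounded.\<close>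

lemma weighted_jensen:
  fixes \<kappa> h :: "'b::euclidean_space \<Rightarrow> real"
  assumes \<kappa>: "bbs \<kappa>" "\<And>z. \<kappa> z \<ge> 0" "(\<integral>z. \<kappa> z \<partial>lborel) = 1"
    and h: "h \<in> borel_measurable borel" "\<And>z. h z \<ge> 0" "\<And>z. h z \<le> B" and s: "s > 1"
  shows "(\<integral>z. \<kappa> z * h z \<partial>lborel) powr s \<le> (\<integral>z. \<kappa> z * h z powr s \<partial>lborel)"
proof -
  let ?a = "\<integral>z. \<kappa> z * h z \<partial>lborel"
  have a: "?a \<ge> 0" by (rule Bochner_Integration.integral_nonneg) (use \<kappa> h in auto)
  have [measurable]: "h \<in> borel_measurable borel" by (rule h)
  have I1: "integrable lborel \<kappa>" by (rule bbs_integrable[OF \<kappa>(1)])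
  have I2: "integrable lborel (\<lambda>z. \<kappa> z * h z)"
    by (rule bbs_integrable[OF bbs_mult[OF \<kappa>(1), where C = B]]) (use h in auto)
  have I3: "integrable lborel (\<lambda>z. \<kappa> z * h z powr s)"
    by (rule bbs_integrable[OF bbs_mult[OF \<kappa>(1), where C = "B powr s"]]) (use h s in \<open>auto intro: powr_mono2\<close>)
  have "?a powr s = ?a powr s * 1 + s * ?a powr (s - 1) * (?a - ?a * 1)" by simp
  also have "\<dots> = (\<integral>z. ?a powr s * \<kappa> z + s * ?a powr (s - 1) * (\<kappa> z * h z - ?a * \<kappa> z) \<partial>lborel)"
    unfolding \<kappa>(3)[symmetric] using I1 I2 by simp
  also have "\<dots> \<le> (\<integral>z. \<kappa> z * h z powr s \<partial>lborel)"
  proof (rule integral_mono[OF _ I3])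
    show "integrable lborel (\<lambda>z. ?a powr s * \<kappa> z + s * ?a powr (s - 1) * (\<kappa> z * h z - ?a * \<kappa> z))"
      using I1 I2 by auto
    fix z
    have "\<kappa> z * (?a powr s + s * ?a powr (s - 1) * (h z - ?a)) \<le> \<kappa> z * h z powr s"
      using powr_tangent[OF h(2) a s] \<kappa>(2) by (intro mult_left_mono) auto
    then show "?a powr s * \<kappa> z + s * ?a powr (s - 1) * (\<kappa> z * h z - ?a * \<kappa> z) \<le> \<kappa> z * h z powr s"
      by (simp add: algebra_simps)
  qed
  finally show ?thesis .
qed

lemma bbs_pair_mult:
  fixes a :: "'a::euclidean_space \<Rightarrow> real" and b :: "'b::euclidean_space \<Rightarrow> real"
  assumes "bbs a" "bbs b"
  shows "bbs (\<lambda>(x, y). a x * b y)"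
proof -
  have [measurable]: "a \<in> borel_measurable borel" "b \<in> borel_measurable borel"
    using assms by (auto simp: bbs_def)
  obtain B C where BC: "\<And>x. \<bar>a x\<bar> \<le> B" "\<And>x. \<bar>b x\<bar> \<le> C" using assms by (auto simp: bbs_def)
  have "(\<lambda>(x, y). a x * b y) \<in> borel_measurable (borel \<Otimes>\<^sub>M borel)" by measurable
  moreover have "\<bar>a x * b y\<bar> \<le> B * C" for x y
  proof -
    have "B \<ge> 0" using BC(1)[of x] by linarith
    then show ?thesis using BC(1)[of x] BC(2)[of y] by (simp add: abs_mult mult_mono)
  qed
  moreover have "Elementary_Metric_Spaces.bounded {p. (\<lambda>(x, y). a x * b y) p \<noteq> 0}"
    by (rule bounded_subset[of "{x. a x \<noteq> 0} \<times> {y. b y \<noteq> 0}"])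
      (use assms in \<open>auto simp: bbs_def intro: bounded_Times\<close>)
  ultimately show ?thesis by (auto simp: bbs_def borel_prod)
qed

lemma bbs_integral_pair:
  fixes F :: "'a::euclidean_space \<times> 'b::euclidean_space \<Rightarrow> real"
  assumes "bbs F"
  shows "(\<integral>x. (\<integral>z. F (x, z) \<partial>lborel) \<partial>lborel) = (\<integral>y. F y \<partial>lborel)"
proof -
  have "integrable (lborel \<Otimes>\<^sub>M lborel) F"
    using bbs_integrable[OF assms] by (simp add: lborel_prod)
  from lborel_pair.integral_fst'[OF this] show ?thesis by (simp add: lborel_prod)
qed

lemma bbs_indicator:
  fixes A :: "'a::euclidean_space set"
  assumes "A \<in> sets borel" "Elementary_Metric_Spaces.bounded A"
  shows "bbs (indicator A :: 'a \<Rightarrow> real)"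
  unfolding bbs_def
proof (intro conjI)
  show "(indicator A :: 'a \<Rightarrow> real) \<in> borel_measurable borel"
    using assms(1) by (rule borel_measurable_indicator)
  show "\<exists>B. \<forall>x. \<bar>indicator A x :: real\<bar> \<le> B" by (rule exI[of _ 1]) (simp add: indicator_def)
  show "Elementary_Metric_Spaces.bounded {x. (indicator A x :: real) \<noteq> 0}"
    by (rule bounded_subset[OF assms(2)]) (auto simp: indicator_def)
qed

text \<open>The difference is an average of \<open>|\<nabla>f| (x + t z)\<close> over \<open>z\<close> and \<open>t \<in> [0,1]\<close>.\<close>

lemma conv_difference_Lp:
  fixes f :: "'a::euclidean_space \<Rightarrow> real"
  assumes \<eta>: "\<eta> \<in> test_functions UNIV" "\<And>z. \<eta> z \<ge> 0" "\<And>z. \<eta> z \<noteq> 0 \<Longrightarrow> norm z < \<epsilon>" "(\<integral>z. \<eta> z \<partial>lborel) = 1"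
    and f: "f \<in> test_functions UNIV" and s: "s > 1" and \<epsilon>: "\<epsilon> > 0"
  shows "(\<integral>x. \<bar>conv \<eta> f x - f x\<bar> powr s \<partial>lborel) \<le> \<epsilon> powr s * energy s f"
proof -
  define G where "G x = norm (grad f x)" for x
  have bG: "bbs G" unfolding G_def[abs_def] by (rule test_functions_grad_bbs[OF f])
  have G0: "G x \<ge> 0" for x by (simp add: G_def)
  obtain B where B: "\<And>x. \<bar>G x\<bar> \<le> B" using bG by (auto simp: bbs_def)
  obtain R where R: "\<And>x. G x \<noteq> 0 \<Longrightarrow> norm x \<le> R" using bG by (auto simp: bbs_def bounded_iff)
  note b\<eta> = test_functions_bbs[OF \<eta>(1)] and bf = test_functions_bbs[OF f]
  note sm = test_functions_smooth[OF f]
  have [measurable]: "\<eta> \<in> borel_measurable borel" "G \<in> borel_measurable borel"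
    using b\<eta> bG by (auto simp: bbs_def)
  define \<iota> :: "real \<Rightarrow> real" where "\<iota> = indicator {0..1}"
  have b\<iota>: "bbs \<iota>" unfolding \<iota>_def by (intro bbs_indicator) auto
  have [measurable]: "\<iota> \<in> borel_measurable borel" using b\<iota> by (rule bbs_measurable)
  \<comment> \<open>A probability density on pairs: z distributed according to \<eta>, and t uniform
    on the unit interval. One application of Jensen's inequality then covers both averages.\<close>
  define \<kappa> where "\<kappa> = (\<lambda>(z::'a, t). \<eta> z * \<iota> t)"
  have b\<kappa>: "bbs \<kappa>" unfolding \<kappa>_def by (rule bbs_pair_mult[OF b\<eta> b\<iota>])
  have \<kappa>0: "\<kappa> y \<ge> 0" for y using \<eta>(2) by (auto simp: \<kappa>_def \<iota>_def split: prod.splits)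
  have \<kappa>1: "(\<integral>y. \<kappa> y \<partial>lborel) = 1"
    unfolding bbs_integral_pair[OF b\<kappa>, symmetric] by (simp add: \<kappa>_def \<iota>_def \<eta>(4))
  have [measurable]: "\<kappa> \<in> borel_measurable borel" using b\<kappa> by (rule bbs_measurable)
  let ?\<tau> = "\<lambda>y::'a \<times> real. snd y *\<^sub>R fst y"
  have \<tau>m: "?\<tau> \<in> borel_measurable borel"
    unfolding borel_prod[symmetric] by measurable
  have \<tau>: "norm (?\<tau> y) \<le> \<epsilon>" if "\<kappa> y \<noteq> 0" for y
  proof -
    have 1: "\<eta> (fst y) \<noteq> 0" "0 \<le> snd y" "snd y \<le> 1"
      using that by (auto simp: \<kappa>_def \<iota>_def indicator_def split: prod.splits if_splits)
    have "\<bar>snd y\<bar> * norm (fst y) \<le> 1 * \<epsilon>"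
      using \<eta>(3)[OF 1(1)] 1 \<epsilon> by (intro mult_mono) auto
    then show ?thesis by simp
  qed
  have Gm: "(\<lambda>y. G (x + ?\<tau> y)) \<in> borel_measurable borel" for x
    by (rule measurable_compose[OF _ bbs_measurable[OF bG]]) (intro borel_measurable_add borel_measurable_const \<tau>m)
  have bk: "bbs (\<lambda>y. \<kappa> y * G (x + ?\<tau> y))" for x
    by (rule bbs_mult[OF b\<kappa> Gm, where C = B]) (use B in auto)
  have ftc: "\<bar>f (x + z) - f x\<bar> \<le> (\<integral>t. \<iota> t * (G (x + t *\<^sub>R z) * norm z) \<partial>lborel)" for x z
  proof -
    let ?\<gamma> = "\<lambda>t. grad f (x + t *\<^sub>R z) \<bullet> z"
    have cg: "continuous_on UNIV (\<lambda>t. grad f (x + t *\<^sub>R z))"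
      by (rule continuous_on_compose2[OF smooth_continuous_grad[OF sm, of UNIV]]) (auto intro!: continuous_intros)
    have "(\<integral>t. indicator {0..1} t *\<^sub>R ?\<gamma> t \<partial>lborel) = f (x + 1 *\<^sub>R z) - f (x + 0 *\<^sub>R z)"
    proof (rule integral_FTC_Icc)
      fix t :: real
      have "((\<lambda>t. x + t *\<^sub>R z) has_derivative (\<lambda>t. t *\<^sub>R z)) (at t within {0..1})"
        by (auto intro!: derivative_eq_intros)
      from has_derivative_compose[OF this smooth_has_derivative_grad[OF sm]]
      show "((\<lambda>t. f (x + t *\<^sub>R z)) has_vector_derivative ?\<gamma> t) (at t within {0..1})"
        by (simp add: has_vector_derivative_def mult.commute)
    next
      show "continuous_on {0..1} ?\<gamma>"
        by (intro continuous_intros continuous_on_subset[OF cg]) auto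
    qed simp
    then have "f (x + z) - f x = (\<integral>t. \<iota> t * ?\<gamma> t \<partial>lborel)" by (simp add: \<iota>_def)
    also have "\<bar>\<dots>\<bar> \<le> (\<integral>t. \<iota> t * (G (x + t *\<^sub>R z) * norm z) \<partial>lborel)"
    proof (rule Bochner_Integration.integral_abs_bound_integral)
      have cs: "\<bar>?\<gamma> t\<bar> \<le> G (x + t *\<^sub>R z) * norm z" for t
        unfolding G_def by (rule Cauchy_Schwarz_ineq2)
      have GB: "G (x + t *\<^sub>R z) * norm z \<le> B * norm z" for t
        using B[of "x + t *\<^sub>R z"] by (intro mult_right_mono) auto
      show "integrable lborel (\<lambda>t. \<iota> t * ?\<gamma> t)"
      proof (rule bbs_integrable[OF bbs_mult[OF b\<iota>, where C = "B * norm z"]])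
        show "?\<gamma> \<in> borel_measurable borel"
          by (intro borel_measurable_continuous_onI continuous_intros cg)
        show "\<bar>?\<gamma> t\<bar> \<le> B * norm z" for t using cs GB order_trans by blast
      qed
      show "integrable lborel (\<lambda>t. \<iota> t * (G (x + t *\<^sub>R z) * norm z))"
      proof (rule bbs_integrable[OF bbs_mult[OF b\<iota>, where C = "B * norm z"]])
        show "(\<lambda>t. G (x + t *\<^sub>R z) * norm z) \<in> borel_measurable borel"
          unfolding G_def by (intro borel_measurable_continuous_onI continuous_intros cg)
        show "\<bar>G (x + t *\<^sub>R z) * norm z\<bar> \<le> B * norm z" for t using GB G0 by (simp add: abs_mult)
      qed
      show "\<bar>\<iota> t * ?\<gamma> t\<bar> \<le> \<iota> t * (G (x + t *\<^sub>R z) * norm z)" for t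
        using cs[of t] by (simp add: \<iota>_def indicator_def)
    qed
    finally show ?thesis .
  qed
  have diff: "\<bar>conv \<eta> f x - f x\<bar> \<le> \<epsilon> * (\<integral>y. \<kappa> y * G (x + ?\<tau> y) \<partial>lborel)" for x
  proof -
    note I = bbs_integrable[OF b\<eta>] bbs_integrable[OF bbs_conv_integrand[OF b\<eta> bf, of x]]
    have Im: "integrable lborel (\<lambda>z. \<integral>t. \<epsilon> * (\<kappa> (z, t) * G (x + t *\<^sub>R z)) \<partial>lborel)"
    proof -
      have "integrable (lborel \<Otimes>\<^sub>M lborel) (\<lambda>y. \<epsilon> * (\<kappa> y * G (x + ?\<tau> y)))"
        using bbs_integrable[OF bbs_cmult[OF bk]] by (simp add: lborel_prod)
      from lborel_pair.integrable_fst'[OF this] show ?thesis by simp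
    qed
    have "conv \<eta> f x - f x = (\<integral>z. \<eta> z * f (x + z) - f x * \<eta> z \<partial>lborel)"
      using I \<eta>(4) by (simp add: conv_def)
    also have "\<bar>\<dots>\<bar> \<le> (\<integral>z. (\<integral>t. \<epsilon> * (\<kappa> (z, t) * G (x + t *\<^sub>R z)) \<partial>lborel) \<partial>lborel)"
    proof (rule Bochner_Integration.integral_abs_bound_integral[OF _ Im])
      show "integrable lborel (\<lambda>z. \<eta> z * f (x + z) - f x * \<eta> z)" using I by auto
      fix z
      show "\<bar>\<eta> z * f (x + z) - f x * \<eta> z\<bar> \<le> (\<integral>t. \<epsilon> * (\<kappa> (z, t) * G (x + t *\<^sub>R z)) \<partial>lborel)"
      proof (cases "\<eta> z = 0")
        case False
        have "\<eta> z * f (x + z) - f x * \<eta> z = \<eta> z * (f (x + z) - f x)"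
          by (simp add: algebra_simps)
        then have "\<bar>\<eta> z * f (x + z) - f x * \<eta> z\<bar> = \<eta> z * \<bar>f (x + z) - f x\<bar>"
          using \<eta>(2)[of z] by (simp add: abs_mult)
        also have "\<dots> \<le> \<eta> z * (\<integral>t. \<iota> t * (G (x + t *\<^sub>R z) * norm z) \<partial>lborel)"
          using ftc \<eta>(2) by (intro mult_left_mono) auto
        also have "\<dots> = (\<eta> z * norm z) * (\<integral>t. \<iota> t * G (x + t *\<^sub>R z) \<partial>lborel)"
          by (simp add: mult.assoc[symmetric])
        also have "\<dots> \<le> (\<eta> z * \<epsilon>) * (\<integral>t. \<iota> t * G (x + t *\<^sub>R z) \<partial>lborel)"
          using \<eta>(2) \<eta>(3)[OF False] G0
          by (intro mult_right_mono mult_left_mono Bochner_Integration.integral_nonneg) (auto simp: \<iota>_def)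
        also have "\<dots> = (\<integral>t. \<epsilon> * (\<kappa> (z, t) * G (x + t *\<^sub>R z)) \<partial>lborel)"
          by (simp add: \<kappa>_def mult.assoc)
        finally show ?thesis .
      qed (simp add: \<kappa>_def)
    qed
    also have "\<dots> = (\<integral>y. \<epsilon> * (\<kappa> y * G (x + ?\<tau> y)) \<partial>lborel)"
      using bbs_integral_pair[OF bbs_cmult[OF bk, of \<epsilon> x]] by simp
    finally show ?thesis by simp
  qed
  \<comment> \<open>The integrand on the product space has bounded support, because x + t z must lie
    where the gradient is nonzero and t z has length at most \<epsilon>; this justifies exchanging
    the integrals.\<close>
  define F where "F = (\<lambda>(x, y). \<kappa> y * G (x + ?\<tau> y) powr s)"
  have bF: "bbs F"
  proof (rule bbs_dominated[where C = "B powr s"])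
    show "bbs (\<lambda>(x::'a, y). indicator (cball 0 (R + \<epsilon>)) x * \<kappa> y)"
      by (rule bbs_pair_mult[OF _ b\<kappa>]) (rule bbs_indicator, auto)
    have "(\<lambda>(x, y). \<kappa> y * G (x + ?\<tau> y) powr s) \<in> borel_measurable (borel \<Otimes>\<^sub>M borel)"
    proof -
      have [measurable]: "(\<lambda>p. ?\<tau> (snd p)) \<in> borel_measurable (borel \<Otimes>\<^sub>M borel)"
        by (rule measurable_compose[OF measurable_snd \<tau>m])
      show ?thesis unfolding case_prod_beta by measurable
    qed
    then show "F \<in> borel_measurable borel" by (simp add: F_def borel_prod)
    fix p :: "'a \<times> ('a \<times> real)"
    obtain x y where p: "p = (x, y)" by (cases p)
    show "\<bar>F p\<bar> \<le> B powr s * \<bar>case p of (x, y) \<Rightarrow> indicator (cball 0 (R + \<epsilon>)) x * \<kappa> y\<bar>"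
    proof (cases "\<kappa> y = 0 \<or> G (x + ?\<tau> y) = 0")
      case False
      have "norm x \<le> norm (x + ?\<tau> y) + norm (?\<tau> y)"
        using norm_triangle_ineq4[of "x + ?\<tau> y" "?\<tau> y"] by simp
      also have "\<dots> \<le> R + \<epsilon>" using False R \<tau> by (intro add_mono) auto
      finally have "x \<in> cball 0 (R + \<epsilon>)" by simp
      moreover have "G (x + ?\<tau> y) powr s \<le> B powr s"
        using B[of "x + ?\<tau> y"] G0 s by (intro powr_mono2) auto
      ultimately show ?thesis using \<kappa>0[of y] by (simp add: p F_def abs_mult mult.commute mult_left_mono)
    qed (use s in \<open>auto simp: p F_def\<close>)
  qed
  have "(\<integral>x. \<bar>conv \<eta> f x - f x\<bar> powr s \<partial>lborel) \<le> (\<integral>x. \<epsilon> powr s * (\<integral>y. F (x, y) \<partial>lborel) \<partial>lborel)"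
  proof (rule integral_mono)
    show "integrable lborel (\<lambda>x. \<bar>conv \<eta> f x - f x\<bar> powr s)"
      using s by (intro bbs_integrable bbs_powr bbs_diff bbs_conv \<eta>(1) bf) auto
    have "integrable (lborel \<Otimes>\<^sub>M lborel) F" using bbs_integrable[OF bF] by (simp add: lborel_prod)
    then show "integrable lborel (\<lambda>x. \<epsilon> powr s * (\<integral>y. F (x, y) \<partial>lborel))"
      by (intro integrable_mult_right lborel_pair.integrable_fst')
    fix x
    have "\<bar>conv \<eta> f x - f x\<bar> powr s \<le> (\<epsilon> * (\<integral>y. \<kappa> y * G (x + ?\<tau> y) \<partial>lborel)) powr s"
      using diff[of x] s by (intro powr_mono2) auto
    also have "\<dots> = \<epsilon> powr s * (\<integral>y. \<kappa> y * G (x + ?\<tau> y) \<partial>lborel) powr s"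
      by (rule powr_mult)
    also have "\<dots> \<le> \<epsilon> powr s * (\<integral>y. \<kappa> y * G (x + ?\<tau> y) powr s \<partial>lborel)"
      using B by (intro mult_left_mono weighted_jensen[OF b\<kappa> \<kappa>0 \<kappa>1 Gm G0 _ s, of x B]) (auto simp: abs_le_iff)
    finally show "\<bar>conv \<eta> f x - f x\<bar> powr s \<le> \<epsilon> powr s * (\<integral>y. F (x, y) \<partial>lborel)"
      by (simp add: F_def)
  qed
  also have "\<dots> = \<epsilon> powr s * (\<integral>y. (\<integral>x. F (x, y) \<partial>lborel) \<partial>lborel)"
    using bbs_Fubini[OF bF] by simp
  \<comment> \<open>Translation invariance makes the inner integral independent of the displacement,
    and \<kappa> has integral 1.\<close>
  also have "(\<lambda>y. \<integral>x. F (x, y) \<partial>lborel) = (\<lambda>y. \<kappa> y * energy s f)"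
  proof
    fix y
    have "(\<integral>x. G (?\<tau> y + x) powr s \<partial>lborel) = (\<integral>x. G x powr s \<partial>lborel)"
      by (rule integral_translate) measurable
    then show "(\<integral>x. F (x, y) \<partial>lborel) = \<kappa> y * energy s f"
      by (simp add: F_def energy_def G_def add.commute)
  qed
  also have "(\<integral>y. \<kappa> y * energy s f \<partial>lborel) = energy s f" using \<kappa>1 by simp
  finally show ?thesis .
qed

context bounded_open
begin

text \<open>The quantifiers carry the content: for s near p the estimate holds for all f of depth at
  least b and energy at most A0 at once. It is obtained by testing the exponent p with a
  mollification of f whose scale \<epsilon> is chosen before s.\<close>

lemma interior_hardy:
  assumes p: "p > 1" and b: "b > 0" and A0: "A0 \<ge> 0" and e: "e > 0"
  shows "\<forall>\<^sub>F s in at_left p. \<forall>f\<in>test_functions \<Omega>. (\<forall>x. f x \<noteq> 0 \<longrightarrow> b \<le> depth \<Omega> x) \<longrightarrow> energy s f \<le> A0 \<longrightarrow>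
    hardy_constant \<Omega> p * mass \<Omega> s f \<le> energy s f + e"
proof -
  let ?H = "hardy_constant \<Omega> p"
  have H0: "?H \<ge> 0" by (rule hardy_constant_nonneg)
  have "((\<lambda>l. ((1 - l) powr (1 - p) - 1) * A0) \<longlongrightarrow> ((1 - 0) powr (1 - p) - 1) * A0) (at_right (0::real))"
    by (intro tendsto_intros) auto
  then have "\<forall>\<^sub>F l in at_right (0::real). ((1 - l) powr (1 - p) - 1) * A0 < e / 2"
    using e by (intro order_tendstoD(2)) auto
  moreover have "\<forall>\<^sub>F l in at_right (0::real). 0 < l \<and> l < 1"
    by (auto simp: eventually_at_right_field intro!: exI[of _ 1])
  ultimately have "\<forall>\<^sub>F l in at_right (0::real). ((1 - l) powr (1 - p) - 1) * A0 < e / 2 \<and> 0 < l \<and> l < 1"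
    by (rule eventually_conj)
  then obtain l where l: "((1 - l) powr (1 - p) - 1) * A0 < e / 2" "0 < l" "l < 1"
    using eventually_happens[of _ "at_right (0::real)"] by auto
  have "((\<lambda>\<epsilon>. l powr (1 - p) * (2 / b) powr p * \<epsilon> powr p * A0 * ?H) \<longlongrightarrow>
      l powr (1 - p) * (2 / b) powr p * 0 powr p * A0 * ?H) (at_right (0::real))"
    using p by (intro tendsto_intros tendsto_powr') (auto simp: eventually_at_right_field intro!: exI[of _ 1])
  then have "\<forall>\<^sub>F \<epsilon> in at_right (0::real). l powr (1 - p) * (2 / b) powr p * \<epsilon> powr p * A0 * ?H < e / 2"
    using e by (intro order_tendstoD(2)) auto
  moreover have "\<forall>\<^sub>F \<epsilon> in at_right (0::real). 0 < \<epsilon> \<and> \<epsilon> < b / 2"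
    using b by (auto simp: eventually_at_right_field intro!: exI[of _ "b / 2"])
  ultimately have "\<forall>\<^sub>F \<epsilon> in at_right (0::real). l powr (1 - p) * (2 / b) powr p * \<epsilon> powr p * A0 * ?H < e / 2 \<and> 0 < \<epsilon> \<and> \<epsilon> < b / 2"
    by (rule eventually_conj)
  then obtain \<epsilon> where \<epsilon>: "l powr (1 - p) * (2 / b) powr p * \<epsilon> powr p * A0 * ?H < e / 2" "0 < \<epsilon>" "\<epsilon> < b / 2"
    using eventually_happens[of _ "at_right (0::real)"] by auto
  obtain \<eta> :: "'a \<Rightarrow> real" where \<eta>: "\<eta> \<in> test_functions UNIV" "\<And>z. \<eta> z \<ge> 0"
    "\<And>z. \<eta> z \<noteq> 0 \<Longrightarrow> norm z < \<epsilon>" "(\<integral>z. \<eta> z \<partial>lborel) = 1"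
    using mollifier[OF \<epsilon>(2)] by blast
  note b\<eta> = test_functions_bbs[OF \<eta>(1)]
  obtain S where S: "\<And>z. \<bar>\<eta> z\<bar> \<le> S" using b\<eta> by (auto simp: bbs_def)
  have S0: "S \<ge> 0" using S[of 0] by linarith
  define V where "V = (\<integral>x. indicator \<Omega> x \<partial>(lborel :: 'a measure) :: real)"
  have V0: "V \<ge> 0" by (simp add: V_def)
  have I\<Omega>: "integrable lborel (indicator \<Omega> :: 'a \<Rightarrow> real)" using integrable_indicator_\<Omega>[of 1] by simp
  \<comment> \<open>A bound for the gradient of the mollified function: the supremum of the kernel
    times the integral of |\<nabla>f|, which is at most V + A0. It depends neither on s nor on f, so
    K^(p - s) tends to 1; the summand 1 makes the base at least 1.\<close>
  define K where "K = 1 + S * (V + A0)"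
  have K: "K \<ge> 1" using S0 V0 A0 by (simp add: K_def)
  \<comment> \<open>The total error: the multiplicative loss against the energy bound A0, the
    comparison of masses, and the mollification. At s = p the middle term vanishes, and the choices
    of l and \<epsilon> leave less than e/2 for each of the others.\<close>
  define \<Theta> where "\<Theta> s = ((1 - l) powr (1 - s) * K powr (p - s) - 1) * A0 +
    (1 - l) powr (1 - s) * (?H * ((1 - s / p) * V)) + l powr (1 - s) * (2 / b) powr s * \<epsilon> powr s * A0 * ?H" for s
  have "(\<Theta> \<longlongrightarrow> \<Theta> p) (at_left p)"
    unfolding \<Theta>_def using l(2,3) K b \<epsilon>(2) p by (intro tendsto_intros) auto
  moreover have "\<Theta> p < e"
    using l(1) \<epsilon>(1) K p by (simp add: \<Theta>_def)
  ultimately have "\<forall>\<^sub>F s in at_left p. \<Theta> s < e" by (rule order_tendstoD(2))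
  moreover have "\<forall>\<^sub>F s in at_left p. 1 < s \<and> s < p"
    using p by (auto simp: eventually_at_left_field)
  ultimately show ?thesis
  proof eventually_elim
    case (elim s)
    then have s: "s > 1" "s < p" and \<Theta>: "\<Theta> s < e" by auto
    show ?case
    proof (intro ballI impI)
      fix f assume f: "f \<in> test_functions \<Omega>" and supp: "\<forall>x. f x \<noteq> 0 \<longrightarrow> b \<le> depth \<Omega> x"
        and E: "energy s f \<le> A0"
      note bf = test_functions_bbs[OF f]
      define w where "w = conv \<eta> f"
      have \<epsilon>b: "\<epsilon> < b" using \<epsilon> b by linarith
      have suppb: "b \<le> depth \<Omega> x" if "f x \<noteq> 0" for x using supp that by blast
      have w: "w \<in> test_functions \<Omega>"
        unfolding w_def by (rule conv_test_functions_depth(1)[OF \<eta>(1,3) bf suppb \<epsilon>b])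
      have wd: "b / 2 \<le> depth \<Omega> x" if "w x \<noteq> 0" for x
      proof -
        have "b - \<epsilon> \<le> depth \<Omega> x"
          by (rule conv_test_functions_depth(2)[OF \<eta>(1,3) bf suppb \<epsilon>b that[unfolded w_def]])
        then show ?thesis using \<epsilon>(3) by linarith
      qed
      define G where "G x = norm (grad f x)" for x
      have bG: "bbs G" unfolding G_def[abs_def] by (rule test_functions_grad_bbs[OF f])
      have G0: "G x \<ge> 0" for x by (simp add: G_def)
      have ug: "upper_grad f G"
        unfolding upper_grad_iff_ugrad G_def by (simp add: ugrad_smooth test_functions_smooth[OF f])
      have IGs: "integrable lborel (\<lambda>x. G x powr s)"
        using s G0 by (intro bbs_integrable bbs_powr' bG) auto
      \<comment> \<open>On \<Omega> the gradient norm G is at most 1 + G^s, and outside it is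
        0.\<close>
      have Gint: "(\<integral>x. G x \<partial>lborel) \<le> V + A0"
      proof -
        have "(\<integral>x. G x \<partial>lborel) \<le> (\<integral>x. indicator \<Omega> x + G x powr s \<partial>lborel)"
        proof (rule integral_mono[OF bbs_integrable[OF bG]])
          show "integrable lborel (\<lambda>x. indicator \<Omega> x + G x powr s)" using I\<Omega> IGs by simp
          show "G x \<le> indicator \<Omega> x + G x powr s" for x
          proof (cases "x \<in> \<Omega>")
            case True
            have "G x \<le> 1 + G x powr s"
            proof (cases "G x \<le> 1")
              case False
              then have "G x powr 1 \<le> G x powr s" using s by (intro powr_mono) auto
              then show ?thesis using False by simp
            qed (simp add: add_increasing2)
            then show ?thesis using True by simp
          next
            case False
            then show ?thesis using test_functions_grad_outside[OF f] by (simp add: G_def)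
          qed
        qed
        also have "\<dots> = V + energy s f" using I\<Omega> IGs by (simp add: V_def energy_def G_def)
        finally show ?thesis using E by linarith
      qed
      have gw: "norm (grad w x) \<le> K" for x
      proof -
        obtain L where L: "\<And>x y. \<bar>f x - f y\<bar> \<le> L * norm (x - y)"
          using test_functions_lipschitz[OF f] by blast
        have "norm (grad w x) \<le> conv \<eta> G x"
          unfolding w_def by (rule norm_grad_conv_le[OF \<eta>(1,2) bf ug L bG G0])
        also have "\<dots> \<le> (\<integral>z. S * G (x + z) \<partial>lborel)"
          unfolding conv_def
        proof (rule integral_mono)
          show "integrable lborel (\<lambda>z. \<eta> z * G (x + z))" by (rule bbs_integrable[OF bbs_conv_integrand[OF b\<eta> bG]])
          show "integrable lborel (\<lambda>z. S * G (x + z))" by (rule bbs_integrable[OF bbs_cmult[OF bbs_translate[OF bG]]])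
          show "\<eta> z * G (x + z) \<le> S * G (x + z)" for z
            using S[of z] G0 by (intro mult_right_mono) auto
        qed
        also have "\<dots> = S * (\<integral>z. G z \<partial>lborel)"
          using integral_translate[OF bbs_measurable[OF bG], of x] by simp
        also have "\<dots> \<le> K" using mult_left_mono[OF Gint S0] by (simp add: K_def)
        finally show ?thesis .
      qed
      have Ew: "energy s w \<le> energy s f"
        using energy_conv_le[OF \<eta>(1,2,4) bf ug bG G0 s(1)] by (simp add: w_def energy_def G_def)
      have Ep: "energy p w \<le> K powr (p - s) * energy s f"
      proof -
        have "energy p w \<le> (\<integral>x. K powr (p - s) * norm (grad w x) powr s \<partial>lborel)"
          unfolding energy_def
        proof (rule integral_mono)
          show "integrable lborel (\<lambda>x. norm (grad w x) powr p)"
            using p by (intro test_functions_energy_integrable[OF w]) auto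
          show "integrable lborel (\<lambda>x. K powr (p - s) * norm (grad w x) powr s)"
            using s by (intro integrable_mult_right test_functions_energy_integrable[OF w]) auto
          fix x
          have "norm (grad w x) powr p = norm (grad w x) powr (p - s) * norm (grad w x) powr s"
            by (simp add: powr_add[symmetric])
          also have "\<dots> \<le> K powr (p - s) * norm (grad w x) powr s"
            using gw[of x] s by (intro mult_right_mono powr_mono2) auto
          finally show "norm (grad w x) powr p \<le> K powr (p - s) * norm (grad w x) powr s" .
        qed
        also have "\<dots> = K powr (p - s) * energy s w" by (simp add: energy_def)
        also have "\<dots> \<le> K powr (p - s) * energy s f" using Ew by (intro mult_left_mono) auto
        finally show ?thesis .
      qed
      \<comment> \<open>Young's inequality against the constant 1 raises the exponent from s to p at
        a cost that vanishes as s tends to p.\<close>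
      have Mw: "mass \<Omega> s w \<le> mass \<Omega> p w + (1 - s / p) * V"
      proof -
        define q where "q x = \<bar>w x\<bar> / depth \<Omega> x" for x
        have q0: "q x \<ge> 0" for x by (simp add: q_def depth_nonneg)
        have Iq: "integrable lborel (\<lambda>x. q x powr s)" "integrable lborel (\<lambda>x. q x powr p)"
          unfolding q_def using p s by (intro test_functions_mass_integrable[OF w]; simp)+
        have "(\<integral>x. q x powr s \<partial>lborel) \<le> (\<integral>x. q x powr p + (1 - s / p) * indicator \<Omega> x \<partial>lborel)"
        proof (rule integral_mono[OF Iq(1)])
          show "integrable lborel (\<lambda>x. q x powr p + (1 - s / p) * indicator \<Omega> x)"
            using Iq(2) I\<Omega> by simp
          fix x
          show "q x powr s \<le> q x powr p + (1 - s / p) * indicator \<Omega> x"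
          proof (cases "x \<in> \<Omega>")
            case True
            have "1 powr (p - s) * q x powr s \<le> (1 - s / p) * 1 powr p + s / p * q x powr p"
              using s q0 by (intro young_powr) auto
            moreover have "s / p * q x powr p \<le> 1 * q x powr p"
              using s p by (intro mult_right_mono) auto
            ultimately show ?thesis using True by simp
          qed (simp add: q_def depth_zero)
        qed
        also have "\<dots> = (\<integral>x. q x powr p \<partial>lborel) + (1 - s / p) * V"
          using Iq(2) I\<Omega> by (simp add: V_def)
        finally show ?thesis by (simp add: mass_def q_def)
      qed
      \<comment> \<open>The mass of f is compared with that of w through w - f. This difference
        lives at depth at least b/2, so the weight contributes at most (2/b)^s, and the rest is
        controlled by \<open>conv_difference_Lp\<close>.\<close>
      have Mf: "mass \<Omega> s f \<le> (1 - l) powr (1 - s) * mass \<Omega> s w + l powr (1 - s) * ((2 / b) powr s * (\<epsilon> powr s * energy s f))"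
      proof -
        have bd: "bbs (\<lambda>x. conv \<eta> f x - f x)" by (intro bbs_diff bbs_conv \<eta>(1) bf)
        have Id: "integrable lborel (\<lambda>x. \<bar>w x - f x\<bar> powr s)"
          using s unfolding w_def by (intro bbs_integrable bbs_powr bd) auto
        have Iw: "integrable lborel (\<lambda>x. (\<bar>w x\<bar> / depth \<Omega> x) powr s)"
          and If: "integrable lborel (\<lambda>x. (\<bar>f x\<bar> / depth \<Omega> x) powr s)"
          using s by (intro test_functions_mass_integrable w f; simp)+
        have "mass \<Omega> s f \<le> (\<integral>x. (1 - l) powr (1 - s) * (\<bar>w x\<bar> / depth \<Omega> x) powr s +
            l powr (1 - s) * ((2 / b) powr s * \<bar>w x - f x\<bar> powr s) \<partial>lborel)"
          unfolding mass_def
        proof (rule integral_mono[OF If])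
          show "integrable lborel (\<lambda>x. (1 - l) powr (1 - s) * (\<bar>w x\<bar> / depth \<Omega> x) powr s +
            l powr (1 - s) * ((2 / b) powr s * \<bar>w x - f x\<bar> powr s))"
            by (intro Bochner_Integration.integrable_add integrable_mult_right Iw Id)
          fix x
          have d0: "depth \<Omega> x \<ge> 0" by (rule depth_nonneg)
          have "\<bar>f x\<bar> / depth \<Omega> x \<le> (\<bar>w x\<bar> + \<bar>w x - f x\<bar>) / depth \<Omega> x"
            using d0 by (intro divide_right_mono) auto
          then have "(\<bar>f x\<bar> / depth \<Omega> x) powr s \<le> (\<bar>w x\<bar> / depth \<Omega> x + \<bar>w x - f x\<bar> / depth \<Omega> x) powr s"
            using s d0 by (intro powr_mono2) (auto simp: add_divide_distrib)
          also have "\<dots> \<le> (1 - l) powr (1 - s) * (\<bar>w x\<bar> / depth \<Omega> x) powr s + l powr (1 - s) * (\<bar>w x - f x\<bar> / depth \<Omega> x) powr s"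
            using s l d0 by (intro powr_split) auto
          also have "(\<bar>w x - f x\<bar> / depth \<Omega> x) powr s \<le> (2 / b) powr s * \<bar>w x - f x\<bar> powr s"
          proof (cases "w x = f x")
            case False
            then have "w x \<noteq> 0 \<or> f x \<noteq> 0" by auto
            then have d: "b / 2 \<le> depth \<Omega> x" using wd[of x] suppb[of x] b by auto
            have "\<bar>w x - f x\<bar> / depth \<Omega> x \<le> \<bar>w x - f x\<bar> / (b / 2)"
              using d b by (intro divide_left_mono) auto
            then have "(\<bar>w x - f x\<bar> / depth \<Omega> x) powr s \<le> (2 / b * \<bar>w x - f x\<bar>) powr s"
              using s d0 by (intro powr_mono2) (auto simp: mult.commute)
            also have "\<dots> = (2 / b) powr s * \<bar>w x - f x\<bar> powr s"
              by (rule powr_mult)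
            finally show ?thesis .
          qed simp
          finally show "(\<bar>f x\<bar> / depth \<Omega> x) powr s \<le> (1 - l) powr (1 - s) * (\<bar>w x\<bar> / depth \<Omega> x) powr s +
            l powr (1 - s) * ((2 / b) powr s * \<bar>w x - f x\<bar> powr s)"
            by (simp add: mult_left_mono)
        qed
        also have "\<dots> = (1 - l) powr (1 - s) * mass \<Omega> s w + l powr (1 - s) * ((2 / b) powr s * (\<integral>x. \<bar>w x - f x\<bar> powr s \<partial>lborel))"
          using Iw Id by (simp add: mass_def)
        also have "\<dots> \<le> (1 - l) powr (1 - s) * mass \<Omega> s w + l powr (1 - s) * ((2 / b) powr s * (\<epsilon> powr s * energy s f))"
          unfolding w_def
          by (intro add_left_mono mult_left_mono conv_difference_Lp[OF \<eta> test_functions_UNIV[OF f] s(1) \<epsilon>(2)]) auto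
        finally show ?thesis .
      qed
      have E0: "energy s f \<ge> 0" by (rule energy_nonneg)
      let ?L = "(1 - l) powr (1 - s)" and ?C = "l powr (1 - s) * (2 / b) powr s * \<epsilon> powr s"
      have "?H * mass \<Omega> s w \<le> ?H * (mass \<Omega> p w + (1 - s / p) * V)"
        using Mw H0 by (rule mult_left_mono)
      also have "\<dots> \<le> K powr (p - s) * energy s f + ?H * ((1 - s / p) * V)"
        using hardy_constant_le[OF w p] Ep by (simp add: distrib_left)
      finally have 1: "?L * (?H * mass \<Omega> s w) \<le> ?L * (K powr (p - s) * energy s f + ?H * ((1 - s / p) * V))"
        by (intro mult_left_mono) auto
      have "?H * mass \<Omega> s f \<le> ?H * (?L * mass \<Omega> s w + l powr (1 - s) * ((2 / b) powr s * (\<epsilon> powr s * energy s f)))"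
        using Mf H0 by (rule mult_left_mono)
      also have "\<dots> = ?L * (?H * mass \<Omega> s w) + ?C * ?H * energy s f" by (simp add: algebra_simps)
      also have "\<dots> \<le> ?L * (K powr (p - s) * energy s f + ?H * ((1 - s / p) * V)) + ?C * ?H * A0"
        using E H0 by (intro add_mono[OF 1] mult_left_mono) auto
      also have "\<dots> = energy s f + (?L * K powr (p - s) - 1) * energy s f + ?L * (?H * ((1 - s / p) * V)) + ?C * A0 * ?H"
        by (simp add: algebra_simps)
      \<comment> \<open>Both factors of the product are at least 1, so the coefficient is
        nonnegative and the bound on the energy may be inserted: the multiplicative loss becomes an
        additive one.\<close>
      also have "\<dots> \<le> energy s f + (?L * K powr (p - s) - 1) * A0 + ?L * (?H * ((1 - s / p) * V)) + ?C * A0 * ?H"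
      proof -
        have "1 powr (1 - s) \<le> ?L" using l s by (intro powr_mono2') auto
        moreover have "1 \<le> K powr (p - s)" using K s by (intro ge_one_powr_ge_zero) auto
        ultimately have "1 * 1 \<le> ?L * K powr (p - s)" by (intro mult_mono) auto
        then show ?thesis using E by (intro add_right_mono add_left_mono mult_left_mono) auto
      qed
      also have "\<dots> = energy s f + \<Theta> s" by (simp add: \<Theta>_def)
      finally show "?H * mass \<Omega> s f \<le> energy s f + e" using \<Theta> by linarith
    qed
  qed
qed

end

section \<open>Left lower semicontinuity\<close>

lemma norm_grad_le_lipschitz:
  assumes d: "f differentiable (at x)" and lip: "\<And>y. \<bar>f y - f x\<bar> \<le> L * norm (y - x)"
  shows "norm (grad f x) \<le> L"
proof (rule norm_grad_le[OF d])
  fix v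
  have "((\<lambda>t. \<bar>(f (x + t *\<^sub>R v) - f x) / t\<bar>) \<longlongrightarrow> \<bar>frechet_derivative f (at x) v\<bar>) (at (0::real))"
    by (intro tendsto_rabs directional_limit d)
  then show "\<bar>frechet_derivative f (at x) v\<bar> \<le> L * norm v"
  proof (rule tendsto_upperbound)
    have "\<bar>(f (x + t *\<^sub>R v) - f x) / t\<bar> \<le> L * norm v" if "t \<noteq> 0" for t
    proof -
      have "\<bar>f (x + t *\<^sub>R v) - f x\<bar> \<le> L * norm v * \<bar>t\<bar>"
        using lip[of "x + t *\<^sub>R v"] by (simp add: mult_ac)
      then show ?thesis using that by (simp add: abs_divide pos_divide_le_eq)
    qed
    then show "\<forall>\<^sub>F t in at (0::real). \<bar>(f (x + t *\<^sub>R v) - f x) / t\<bar> \<le> L * norm v"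
      by (auto simp: eventually_at_filter)
  qed simp
qed

lemma conv_lipschitz:
  assumes \<eta>: "bbs \<eta>" "\<And>z. \<eta> z \<ge> 0" "(\<integral>z. \<eta> z \<partial>lborel) = 1" and f: "bbs f"
    and lip: "\<And>x y. \<bar>f x - f y\<bar> \<le> L * norm (x - y)"
  shows "\<bar>conv \<eta> f x - conv \<eta> f y\<bar> \<le> L * norm (x - y)"
proof -
  note I = bbs_integrable[OF \<eta>(1)] bbs_integrable[OF bbs_conv_integrand[OF \<eta>(1) f]]
  have "conv \<eta> f x - conv \<eta> f y = (\<integral>z. \<eta> z * f (x + z) - \<eta> z * f (y + z) \<partial>lborel)"
    using I by (simp add: conv_def)
  also have "\<bar>\<dots>\<bar> \<le> (\<integral>z. L * norm (x - y) * \<eta> z \<partial>lborel)"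
  proof (rule Bochner_Integration.integral_abs_bound_integral)
    fix z
    have "\<eta> z * f (x + z) - \<eta> z * f (y + z) = \<eta> z * (f (x + z) - f (y + z))"
      by (simp add: algebra_simps)
    then have "\<bar>\<eta> z * f (x + z) - \<eta> z * f (y + z)\<bar> = \<eta> z * \<bar>f (x + z) - f (y + z)\<bar>"
      using \<eta>(2)[of z] by (simp add: abs_mult)
    also have "\<dots> \<le> \<eta> z * (L * norm ((x + z) - (y + z)))"
      using \<eta>(2) lip[of "x + z" "y + z"] by (intro mult_left_mono) auto
    finally show "\<bar>\<eta> z * f (x + z) - \<eta> z * f (y + z)\<bar> \<le> L * norm (x - y) * \<eta> z"
      by (simp add: mult.commute)
  qed (use I in auto)
  finally show ?thesis using \<eta>(3) by simp
qed

lemma grad_locally_const: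
  assumes "open S" "x \<in> S" "\<And>y. y \<in> S \<Longrightarrow> f y = c"
  shows "grad f x = 0"
proof (rule grad_eqI)
  have "(f has_derivative (\<lambda>v. 0)) (at x)"
    by (rule has_derivative_transform_within_open[OF has_derivative_const assms(1,2)]) (use assms(3) in simp)
  then show "(f has_derivative (\<lambda>v. 0 \<bullet> v)) (at x)" by simp
qed

lemma grad_mult:
  assumes "smooth f" "smooth g"
  shows "grad (\<lambda>x. f x * g x) x = f x *\<^sub>R grad g x + g x *\<^sub>R grad f x"
proof (rule grad_eqI)
  have "((\<lambda>x. f x * g x) has_derivative (\<lambda>v. f x * (grad g x \<bullet> v) + (grad f x \<bullet> v) * g x)) (at x)"
    using assms by (intro has_derivative_mult smooth_has_derivative_grad)
  then show "((\<lambda>x. f x * g x) has_derivative (\<lambda>v. (f x *\<^sub>R grad g x + g x *\<^sub>R grad f x) \<bullet> v)) (at x)"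
    by (simp add: inner_add_left mult.commute)
qed

lemma grad_const: "grad (\<lambda>x. c) x = 0"
  by (rule grad_locally_const[of UNIV]) auto

lemma grad_one_minus:
  assumes "smooth f"
  shows "grad (\<lambda>x. 1 - f x) x = - grad f x"
proof (rule grad_eqI)
  have "((\<lambda>x. 1 - f x) has_derivative (\<lambda>v. 0 - grad f x \<bullet> v)) (at x)"
    using assms by (intro has_derivative_diff has_derivative_const smooth_has_derivative_grad)
  then show "((\<lambda>x. 1 - f x) has_derivative (\<lambda>v. (- grad f x) \<bullet> v)) (at x)" by simp
qed

text \<open>Yields \<psi>^s + (1 - \<psi>)^s \<le> 1 for a cutoff \<psi>, so that the main parts of
  the two energies after cutting add up to no more than one.\<close>

lemma powr_le_self:
  fixes t s :: real
  assumes "0 \<le> t" "t \<le> 1" "s \<ge> 1"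
  shows "t powr s \<le> t"
proof (cases "t = 0")
  case False
  have "t powr s \<le> t powr 1" using assms False by (intro powr_mono') auto
  then show ?thesis using assms by simp
qed simp

context bounded_open
begin

text \<open>A piecewise linear function of d/b, mollified at scale b. The linear part runs from
  depth 2b to 3b, so a margin of b on either side absorbs the mollification, and the Lipschitz
  constant 1/b is preserved by averaging.\<close>

lemma cutoff:
  assumes b: "b > 0"
  obtains \<psi> where "smooth \<psi>" "\<And>x. 0 \<le> \<psi> x" "\<And>x. \<psi> x \<le> 1"
    "\<And>x. depth \<Omega> x \<le> b \<Longrightarrow> \<psi> x = 0" "\<And>x. 4 * b \<le> depth \<Omega> x \<Longrightarrow> \<psi> x = 1"
    "\<And>x. norm (grad \<psi> x) \<le> 1 / b" "\<And>x. grad \<psi> x \<noteq> 0 \<Longrightarrow> b \<le> depth \<Omega> x \<and> depth \<Omega> x \<le> 4 * b"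
proof -
  obtain \<eta> :: "'a \<Rightarrow> real" where \<eta>: "\<eta> \<in> test_functions UNIV" "\<And>z. \<eta> z \<ge> 0"
    "\<And>z. \<eta> z \<noteq> 0 \<Longrightarrow> norm z < b" "(\<integral>z. \<eta> z \<partial>lborel) = 1"
    using mollifier[OF b] by blast
  note b\<eta> = test_functions_bbs[OF \<eta>(1)]
  define \<psi>0 where "\<psi>0 x = max 0 (min 1 (depth \<Omega> x / b - 2))" for x
  have bounds: "0 \<le> \<psi>0 x" "\<psi>0 x \<le> 1" for x by (auto simp: \<psi>0_def)
  have lip: "\<bar>\<psi>0 x - \<psi>0 y\<bar> \<le> 1 / b * norm (x - y)" for x y
  proof -
    have "\<bar>\<psi>0 x - \<psi>0 y\<bar> \<le> \<bar>(depth \<Omega> x / b - 2) - (depth \<Omega> y / b - 2)\<bar>"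
      unfolding \<psi>0_def by (simp add: max_def min_def abs_if)
    also have "\<dots> = \<bar>depth \<Omega> x - depth \<Omega> y\<bar> / b"
      using b by (simp add: diff_divide_distrib[symmetric] abs_divide)
    also have "\<dots> \<le> norm (x - y) / b" using b depth_lipschitz by (intro divide_right_mono) auto
    finally show ?thesis by simp
  qed
  obtain c R where R: "\<Omega> \<subseteq> ball c R"
    using bounded bounded_subset_ballD by metis
  have bb: "bbs \<psi>0"
  proof (rule bbs_lipschitz[OF _ lip])
    fix x assume "x \<notin> ball c R"
    then have "depth \<Omega> x = 0" using R by (intro depth_zero) blast
    then show "\<psi>0 x = 0" by (simp add: \<psi>0_def)
  qed (use b in auto)
  define \<psi> where "\<psi> = conv \<eta> \<psi>0"
  have near: "\<bar>depth \<Omega> (x + z) - depth \<Omega> x\<bar> < b" if "\<eta> z \<noteq> 0" for x z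
    using depth_lipschitz[of \<Omega> "x + z" x] \<eta>(3)[OF that] by simp
  have sm: "smooth \<psi>" unfolding \<psi>_def by (rule smooth_conv[OF \<eta>(1) bb])
  have half: "\<bar>\<psi> x - 1 / 2\<bar> \<le> 1 / 2" for x
    unfolding \<psi>_def
  proof (rule conv_close[OF b\<eta> \<eta>(2,4) bb])
    show "\<bar>\<psi>0 (x + z) - 1 / 2\<bar> \<le> 1 / 2" for z using bounds[of "x + z"] by linarith
  qed
  have zero: "\<psi> x = 0" if x: "depth \<Omega> x \<le> b" for x
  proof -
    have "\<bar>\<psi> x - 0\<bar> \<le> 0"
      unfolding \<psi>_def
    proof (rule conv_close[OF b\<eta> \<eta>(2,4) bb])
      fix z assume "\<eta> z \<noteq> 0"
      then have "depth \<Omega> (x + z) \<le> 2 * b" using near[of z x] x by linarith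
      then have "depth \<Omega> (x + z) / b \<le> 2" using b by (simp add: pos_divide_le_eq)
      then show "\<bar>\<psi>0 (x + z) - 0\<bar> \<le> 0" by (simp add: \<psi>0_def)
    qed
    then show ?thesis by simp
  qed
  have one: "\<psi> x = 1" if x: "4 * b \<le> depth \<Omega> x" for x
  proof -
    have "\<bar>\<psi> x - 1\<bar> \<le> 0"
      unfolding \<psi>_def
    proof (rule conv_close[OF b\<eta> \<eta>(2,4) bb])
      fix z assume "\<eta> z \<noteq> 0"
      then have "3 * b \<le> depth \<Omega> (x + z)" using near[of z x] x by linarith
      then have "3 \<le> depth \<Omega> (x + z) / b" using b by (simp add: pos_le_divide_eq)
      then show "\<bar>\<psi>0 (x + z) - 1\<bar> \<le> 0" by (simp add: \<psi>0_def)
    qed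
    then show ?thesis by simp
  qed
  show ?thesis
  proof
    show "smooth \<psi>" by (rule sm)
    show "0 \<le> \<psi> x" "\<psi> x \<le> 1" for x using half[of x] by linarith+
    show "depth \<Omega> x \<le> b \<Longrightarrow> \<psi> x = 0" "4 * b \<le> depth \<Omega> x \<Longrightarrow> \<psi> x = 1" for x
      by (rule zero, assumption) (rule one, assumption)
    show "norm (grad \<psi> x) \<le> 1 / b" for x
    proof (rule norm_grad_le_lipschitz[OF smooth_differentiable[OF sm]])
      show "\<bar>\<psi> y - \<psi> x\<bar> \<le> 1 / b * norm (y - x)" for y
        unfolding \<psi>_def by (rule conv_lipschitz[OF b\<eta> \<eta>(2,4) bb lip])
    qed
    show "b \<le> depth \<Omega> x \<and> depth \<Omega> x \<le> 4 * b" if "grad \<psi> x \<noteq> 0" for x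
    proof (rule ccontr)
      assume "\<not> ?thesis"
      then consider "depth \<Omega> x < b" | "4 * b < depth \<Omega> x" by linarith
      then have "grad \<psi> x = 0"
      proof cases
        case 1
        show ?thesis
          by (rule grad_locally_const[of "{y. depth \<Omega> y < b}"])
            (use 1 zero in \<open>auto intro!: open_Collect_less continuous_on_depth\<close>)
      next
        case 2
        show ?thesis
          by (rule grad_locally_const[of "{y. 4 * b < depth \<Omega> y}"])
            (use 2 one in \<open>auto intro!: open_Collect_less continuous_on_depth\<close>)
      qed
      then show False using that by simp
    qed
  qed
qed

text \<open>The part of the mass in the shell where the cutoff of scale b varies. As 1/b \<le> 4/d
  there, errors caused by the gradient of the cutoff are bounded by this quantity.\<close>

definition shell_mass :: "real \<Rightarrow> real \<Rightarrow> ('a \<Rightarrow> real) \<Rightarrow> real" where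
  "shell_mass b s v = (\<integral>x. indicator {x. b \<le> depth \<Omega> x \<and> depth \<Omega> x \<le> 4 * b} x * (\<bar>v x\<bar> / depth \<Omega> x) powr s \<partial>lborel)"

lemma shell_mass_integrable:
  assumes "v \<in> test_functions \<Omega>" "s > 0" "b > 0"
  shows "integrable lborel (\<lambda>x. indicator {x. b \<le> depth \<Omega> x \<and> depth \<Omega> x \<le> 4 * b} x * (\<bar>v x\<bar> / depth \<Omega> x) powr s)"
proof (intro bbs_integrable bbs_mult_bbs bbs_indicator bbs_powr' test_functions_quotient_bbs[OF assms(1)])
  show "Elementary_Metric_Spaces.bounded {x. b \<le> depth \<Omega> x \<and> depth \<Omega> x \<le> 4 * b}"
    by (rule bounded_subset[OF compact_imp_bounded[OF compact_depth_ge(1)[OF assms(3)]]]) auto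
  have "{x. b \<le> depth \<Omega> x \<and> depth \<Omega> x \<le> 4 * b} = {x. b \<le> depth \<Omega> x} \<inter> {x. depth \<Omega> x \<le> 4 * b}" by auto
  moreover have "closed {x. b \<le> depth \<Omega> x}" "closed {x. depth \<Omega> x \<le> 4 * b}"
    by (intro closed_Collect_le continuous_on_depth continuous_intros)+
  ultimately show "{x. b \<le> depth \<Omega> x \<and> depth \<Omega> x \<le> 4 * b} \<in> sets borel"
    by (simp add: closed_Int)
qed (use assms in \<open>auto simp: depth_nonneg\<close>)

text \<open>The gradient of \<psi> acts only on the shell, where it is at most 4/d;
  \<open>powr_split\<close> separates its contribution, once for each piece, with the factor 4^s.
  The main terms recombine because \<psi>^s + (1 - \<psi>)^s \<le> 1. Off the shell v coincides with
  one of the two pieces, so mass can be lost on the shell only.\<close>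

lemma cutoff_split:
  assumes \<psi>: "smooth \<psi>" "\<And>x. 0 \<le> \<psi> x" "\<And>x. \<psi> x \<le> 1"
    "\<And>x. depth \<Omega> x \<le> b \<Longrightarrow> \<psi> x = 0" "\<And>x. 4 * b \<le> depth \<Omega> x \<Longrightarrow> \<psi> x = 1"
    "\<And>x. norm (grad \<psi> x) \<le> 1 / b" "\<And>x. grad \<psi> x \<noteq> 0 \<Longrightarrow> b \<le> depth \<Omega> x \<and> depth \<Omega> x \<le> 4 * b"
    and b: "b > 0" and s: "s > 1" and l: "0 < l" "l < 1" and v: "v \<in> test_functions \<Omega>"
  defines "v1 \<equiv> \<lambda>x. \<psi> x * v x" and "v2 \<equiv> \<lambda>x. (1 - \<psi> x) * v x"
  shows "v1 \<in> test_functions \<Omega>" "v2 \<in> test_functions \<Omega>"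
    "energy s v1 + energy s v2 \<le> (1 - l) powr (1 - s) * energy s v + 2 * l powr (1 - s) * 4 powr s * shell_mass b s v"
    "mass \<Omega> s v \<le> mass \<Omega> s v1 + mass \<Omega> s v2 + shell_mass b s v"
    "mass \<Omega> s v2 \<le> mass \<Omega> s v"
proof -
  have sm1: "smooth (\<lambda>x. 1 - \<psi> x)" by (intro smooth_diff smooth_const \<psi>(1))
  show v1: "v1 \<in> test_functions \<Omega>" unfolding v1_def by (rule test_functions_mult[OF \<psi>(1) v])
  show v2: "v2 \<in> test_functions \<Omega>" unfolding v2_def by (rule test_functions_mult[OF sm1 v])
  note smv = test_functions_smooth[OF v]
  define sh :: "'a \<Rightarrow> real" where "sh = indicator {x. b \<le> depth \<Omega> x \<and> depth \<Omega> x \<le> 4 * b}"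
  define q where "q x = \<bar>v x\<bar> / depth \<Omega> x" for x
  have q0: "q x \<ge> 0" for x by (simp add: q_def depth_nonneg)
  have sh: "sh x = 0 \<or> sh x = 1" for x by (simp add: sh_def indicator_def)
  have Is: "integrable lborel (\<lambda>x. sh x * q x powr s)"
    unfolding sh_def q_def using shell_mass_integrable[OF v _ b] s by simp
  have Im: "integrable lborel (\<lambda>x. (\<bar>w x\<bar> / depth \<Omega> x) powr s)" if "w \<in> test_functions \<Omega>" for w
    using s by (intro test_functions_mass_integrable[OF that]) auto
  have Ie: "integrable lborel (\<lambda>x. norm (grad w x) powr s)" if "w \<in> test_functions \<Omega>" for w
    using s by (intro test_functions_energy_integrable[OF that]) auto
  have cut: "\<bar>v x\<bar> * norm (grad \<psi> x) \<le> sh x * (4 * q x)" for x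
  proof (cases "grad \<psi> x = 0")
    case True
    then show ?thesis using sh[of x] q0[of x] by auto
  next
    case False
    then have d: "b \<le> depth \<Omega> x" "depth \<Omega> x \<le> 4 * b" using \<psi>(7) by blast+
    have "norm (grad \<psi> x) \<le> 4 / depth \<Omega> x"
    proof -
      have "1 / b \<le> 4 / depth \<Omega> x" using d b by (simp add: field_simps)
      then show ?thesis using \<psi>(6)[of x] by linarith
    qed
    then have "\<bar>v x\<bar> * norm (grad \<psi> x) \<le> \<bar>v x\<bar> * (4 / depth \<Omega> x)" by (intro mult_left_mono) auto
    then show ?thesis using d by (simp add: sh_def q_def mult.commute)
  qed
  have est: "norm (t *\<^sub>R grad v x + v x *\<^sub>R g) powr s \<le> (1 - l) powr (1 - s) * (t powr s * norm (grad v x) powr s) +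
      l powr (1 - s) * (4 powr s * (sh x * q x powr s))"
    if t: "t \<ge> 0" and g: "norm g = norm (grad \<psi> x)" for t x g
  proof -
    have "norm (t *\<^sub>R grad v x + v x *\<^sub>R g) \<le> t * norm (grad v x) + \<bar>v x\<bar> * norm (grad \<psi> x)"
      using norm_triangle_ineq[of "t *\<^sub>R grad v x" "v x *\<^sub>R g"] t g by simp
    also have "\<dots> \<le> t * norm (grad v x) + sh x * (4 * q x)" using cut by (intro add_left_mono)
    finally have "norm (t *\<^sub>R grad v x + v x *\<^sub>R g) powr s \<le> (t * norm (grad v x) + sh x * (4 * q x)) powr s"
      using s by (intro powr_mono2) auto
    also have "\<dots> \<le> (1 - l) powr (1 - s) * (t * norm (grad v x)) powr s + l powr (1 - s) * (sh x * (4 * q x)) powr s"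
      using s l t q0[of x] sh[of x] by (intro powr_split) auto
    also have "(t * norm (grad v x)) powr s = t powr s * norm (grad v x) powr s" by (rule powr_mult)
    also have "(sh x * (4 * q x)) powr s = 4 powr s * (sh x * q x powr s)"
      using sh[of x] by (auto simp: powr_mult)
    finally show ?thesis .
  qed
  have g1: "grad v1 x = \<psi> x *\<^sub>R grad v x + v x *\<^sub>R grad \<psi> x" for x
    unfolding v1_def by (rule grad_mult[OF \<psi>(1) smv])
  have g2: "grad v2 x = (1 - \<psi> x) *\<^sub>R grad v x + v x *\<^sub>R (- grad \<psi> x)" for x
    unfolding v2_def using grad_mult[OF sm1 smv, of x] grad_one_minus[OF \<psi>(1), of x] by simp
  have "energy s v1 + energy s v2 = (\<integral>x. norm (grad v1 x) powr s + norm (grad v2 x) powr s \<partial>lborel)"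
    using Ie[OF v1] Ie[OF v2] by (simp add: energy_def)
  also have "\<dots> \<le> (\<integral>x. (1 - l) powr (1 - s) * norm (grad v x) powr s +
      2 * l powr (1 - s) * 4 powr s * (sh x * q x powr s) \<partial>lborel)"
  proof (rule integral_mono)
    show "integrable lborel (\<lambda>x. norm (grad v1 x) powr s + norm (grad v2 x) powr s)"
      using Ie[OF v1] Ie[OF v2] by simp
    show "integrable lborel (\<lambda>x. (1 - l) powr (1 - s) * norm (grad v x) powr s +
      2 * l powr (1 - s) * 4 powr s * (sh x * q x powr s))"
      by (intro Bochner_Integration.integrable_add integrable_mult_right Ie v Is)
    fix x
    have p1: "\<psi> x powr s \<le> \<psi> x" "(1 - \<psi> x) powr s \<le> 1 - \<psi> x"
      using \<psi>(2,3)[of x] s by (auto intro!: powr_le_self)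
    have e1: "norm (grad v1 x) powr s \<le> (1 - l) powr (1 - s) * (\<psi> x powr s * norm (grad v x) powr s) +
        l powr (1 - s) * (4 powr s * (sh x * q x powr s))"
      unfolding g1 by (rule est) (use \<psi>(2) in auto)
    have e2: "norm (grad v2 x) powr s \<le> (1 - l) powr (1 - s) * ((1 - \<psi> x) powr s * norm (grad v x) powr s) +
        l powr (1 - s) * (4 powr s * (sh x * q x powr s))"
      unfolding g2 by (rule est) (use \<psi>(3) in auto)
    have "(\<psi> x powr s + (1 - \<psi> x) powr s) * norm (grad v x) powr s \<le> 1 * norm (grad v x) powr s"
      using p1 by (intro mult_right_mono) auto
    then have "(1 - l) powr (1 - s) * ((\<psi> x powr s + (1 - \<psi> x) powr s) * norm (grad v x) powr s) \<le>
        (1 - l) powr (1 - s) * norm (grad v x) powr s"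
      by (intro mult_left_mono) auto
    then show "norm (grad v1 x) powr s + norm (grad v2 x) powr s \<le>
        (1 - l) powr (1 - s) * norm (grad v x) powr s + 2 * l powr (1 - s) * 4 powr s * (sh x * q x powr s)"
      using e1 e2 by (simp add: algebra_simps)
  qed
  also have "\<dots> = (1 - l) powr (1 - s) * energy s v + 2 * l powr (1 - s) * 4 powr s * shell_mass b s v"
    using Ie[OF v] Is by (simp add: energy_def shell_mass_def sh_def q_def)
  finally show "energy s v1 + energy s v2 \<le> (1 - l) powr (1 - s) * energy s v + 2 * l powr (1 - s) * 4 powr s * shell_mass b s v" .
  have "mass \<Omega> s v \<le> (\<integral>x. (\<bar>v1 x\<bar> / depth \<Omega> x) powr s + (\<bar>v2 x\<bar> / depth \<Omega> x) powr s + sh x * q x powr s \<partial>lborel)"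
    unfolding mass_def
  proof (rule integral_mono[OF Im[OF v]])
    show "integrable lborel (\<lambda>x. (\<bar>v1 x\<bar> / depth \<Omega> x) powr s + (\<bar>v2 x\<bar> / depth \<Omega> x) powr s + sh x * q x powr s)"
      by (intro Bochner_Integration.integrable_add Im v1 v2 Is)
    fix x
    consider "depth \<Omega> x \<le> b" | "4 * b \<le> depth \<Omega> x" | "b \<le> depth \<Omega> x" "depth \<Omega> x \<le> 4 * b" by linarith
    then show "(\<bar>v x\<bar> / depth \<Omega> x) powr s \<le> (\<bar>v1 x\<bar> / depth \<Omega> x) powr s + (\<bar>v2 x\<bar> / depth \<Omega> x) powr s + sh x * q x powr s"
    proof cases
      case 1
      then have "v2 x = v x" using \<psi>(4) by (simp add: v2_def)
      then show ?thesis using sh[of x] by auto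
    next
      case 2
      then have "v1 x = v x" using \<psi>(5) by (simp add: v1_def)
      then show ?thesis using sh[of x] by auto
    next
      case 3
      then show ?thesis by (simp add: sh_def q_def)
    qed
  qed
  also have "\<dots> = mass \<Omega> s v1 + mass \<Omega> s v2 + shell_mass b s v"
    using Im[OF v1] Im[OF v2] Is by (simp add: mass_def shell_mass_def sh_def q_def)
  finally show "mass \<Omega> s v \<le> mass \<Omega> s v1 + mass \<Omega> s v2 + shell_mass b s v" .
  show "mass \<Omega> s v2 \<le> mass \<Omega> s v"
    unfolding mass_def
  proof (rule integral_mono[OF Im[OF v2] Im[OF v]])
    fix x
    have "(1 - \<psi> x) * \<bar>v x\<bar> \<le> 1 * \<bar>v x\<bar>"
      using \<psi>(2,3)[of x] by (intro mult_right_mono) auto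
    then have "\<bar>v2 x\<bar> \<le> \<bar>v x\<bar>" using \<psi>(3)[of x] by (simp add: v2_def abs_mult)
    then show "(\<bar>v2 x\<bar> / depth \<Omega> x) powr s \<le> (\<bar>v x\<bar> / depth \<Omega> x) powr s"
      using s depth_nonneg[of \<Omega> x] by (intro powr_mono2 divide_right_mono) auto
  qed
qed

text \<open>Consecutive scales differ by the factor 5 while a shell spans a factor 4, so the shells
  are pairwise disjoint and their masses add up to at most the total; one of J shells carries at
  most the average.\<close>

lemma shell_pigeonhole:
  assumes v: "v \<in> test_functions \<Omega>" and s: "s > 0" and b: "b > 0" and J: "J > 0"
  obtains j where "j < J" "real J * shell_mass (b / 5 ^ j) s v \<le> mass \<Omega> s v"
proof -
  define sh :: "nat \<Rightarrow> 'a \<Rightarrow> real" where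
    "sh j = indicator {x. b / 5 ^ j \<le> depth \<Omega> x \<and> depth \<Omega> x \<le> 4 * (b / 5 ^ j)}" for j
  have bj: "b / 5 ^ j > 0" for j using b by simp
  have Is: "integrable lborel (\<lambda>x. sh j x * (\<bar>v x\<bar> / depth \<Omega> x) powr s)" for j
    unfolding sh_def by (rule shell_mass_integrable[OF v s bj])
  have sumsh: "(\<Sum>j<J. sh j x) \<le> 1" for x
  proof -
    let ?A = "{j\<in>{..<J}. b / 5 ^ j \<le> depth \<Omega> x \<and> depth \<Omega> x \<le> 4 * (b / 5 ^ j)}"
    have disj: "False" if jk: "j < k" "b / 5 ^ j \<le> depth \<Omega> x" "depth \<Omega> x \<le> 4 * (b / 5 ^ k)" for j k
    proof -
      have "(5::real) ^ Suc j \<le> 5 ^ k" using jk(1) by (intro power_increasing) auto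
      then have "b / 5 ^ k \<le> b / 5 ^ Suc j" using b by (intro divide_left_mono) auto
      then have "4 * (b / 5 ^ k) \<le> 4 / 5 * (b / 5 ^ j)" by simp
      then show False using jk(2,3) bj[of j] by linarith
    qed
    have "card ?A \<le> Suc 0"
      using disj by (subst card_le_Suc0_iff_eq) (auto, metis linorder_neqE_nat)
    have "(\<Sum>j<J. sh j x) = (\<Sum>j\<in>?A. 1)"
      by (intro sum.mono_neutral_cong_right) (auto simp: sh_def indicator_def)
    also have "\<dots> = real (card ?A)" by simp
    also have "\<dots> \<le> 1" using \<open>card ?A \<le> Suc 0\<close> by simp
    finally show ?thesis .
  qed
  have "(\<Sum>j<J. shell_mass (b / 5 ^ j) s v) = (\<integral>x. (\<Sum>j<J. sh j x * (\<bar>v x\<bar> / depth \<Omega> x) powr s) \<partial>lborel)"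
    unfolding shell_mass_def using Is by (subst Bochner_Integration.integral_sum) (auto simp: sh_def)
  also have "\<dots> \<le> mass \<Omega> s v"
    unfolding mass_def
  proof (rule integral_mono)
    show "integrable lborel (\<lambda>x. \<Sum>j<J. sh j x * (\<bar>v x\<bar> / depth \<Omega> x) powr s)"
      by (intro Bochner_Integration.integrable_sum Is)
    show "integrable lborel (\<lambda>x. (\<bar>v x\<bar> / depth \<Omega> x) powr s)"
      by (rule test_functions_mass_integrable[OF v s])
    fix x
    have "(\<Sum>j<J. sh j x) * (\<bar>v x\<bar> / depth \<Omega> x) powr s \<le> 1 * (\<bar>v x\<bar> / depth \<Omega> x) powr s"
      using sumsh by (intro mult_right_mono) auto
    then show "(\<Sum>j<J. sh j x * (\<bar>v x\<bar> / depth \<Omega> x) powr s) \<le> (\<bar>v x\<bar> / depth \<Omega> x) powr s"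
      by (simp add: sum_distrib_right)
  qed
  finally have tot: "(\<Sum>j<J. shell_mass (b / 5 ^ j) s v) \<le> mass \<Omega> s v" .
  have "\<exists>j<J. real J * shell_mass (b / 5 ^ j) s v \<le> mass \<Omega> s v"
  proof (rule ccontr)
    assume "\<not> ?thesis"
    then have "mass \<Omega> s v / real J < shell_mass (b / 5 ^ j) s v" if "j < J" for j
      using that J by (auto simp: not_le pos_divide_less_eq mult.commute)
    then have "(\<Sum>j<J. mass \<Omega> s v / real J) < (\<Sum>j<J. shell_mass (b / 5 ^ j) s v)"
      using J by (intro sum_strict_mono) auto
    then show False using tot J by simp
  qed
  then show ?thesis using that by blast
qed

lemma shell_mass_le:
  assumes "v \<in> test_functions \<Omega>" "s > 0" "b > 0"
  shows "shell_mass b s v \<le> mass \<Omega> s v"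
  unfolding shell_mass_def mass_def
  by (rule integral_mono[OF shell_mass_integrable[OF assms] test_functions_mass_integrable[OF assms(1,2)]])
    (auto simp: indicator_def)

lemma mass_cmult: "mass \<Omega> s (\<lambda>x. c * v x) = \<bar>c\<bar> powr s * mass \<Omega> s v"
proof -
  have "(\<bar>c * v x\<bar> / depth \<Omega> x) powr s = \<bar>c\<bar> powr s * (\<bar>v x\<bar> / depth \<Omega> x) powr s" for x
    by (simp add: abs_mult flip: powr_mult times_divide_eq_right)
  then show ?thesis by (simp add: mass_def)
qed

lemma energy_cmult:
  assumes "smooth v"
  shows "energy s (\<lambda>x. c * v x) = \<bar>c\<bar> powr s * energy s v"
  using grad_mult[OF smooth_const assms, of c] by (simp add: energy_def grad_const powr_mult)

text \<open>A normalised \<open>v\<close> is cut at one of \<open>J\<close> disjoint shells, one of which carries mass at most \<open>1/J\<close>.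
  The inner part is regularised and tested with the exponent \<open>p\<close>, the outer part obeys the Hardy
  inequality of the strip.\<close>

lemma hardy_constant_left_lower_semicontinuous:
  assumes C2: "C2_boundary \<Omega>" and p: "p > 1" and e: "e > 0"
  shows "\<forall>\<^sub>F s in at_left p. hardy_constant \<Omega> p - e \<le> hardy_constant \<Omega> s"
proof -
  let ?H = "hardy_constant \<Omega> p"
  have H0: "?H \<ge> 0" by (rule hardy_constant_nonneg)
  have "((\<lambda>l. ((1 - l) powr (1 - p) - 1) * ?H) \<longlongrightarrow> ((1 - 0) powr (1 - p) - 1) * ?H) (at_right (0::real))"
    by (intro tendsto_intros) auto
  then have "\<forall>\<^sub>F l in at_right (0::real). ((1 - l) powr (1 - p) - 1) * ?H < e / 4"
    using e by (intro order_tendstoD(2)) auto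
  moreover have "\<forall>\<^sub>F l in at_right (0::real). 0 < l \<and> l < 1"
    by (auto simp: eventually_at_right_field intro!: exI[of _ 1])
  ultimately have "\<forall>\<^sub>F l in at_right (0::real). ((1 - l) powr (1 - p) - 1) * ?H < e / 4 \<and> 0 < l \<and> l < 1"
    by (rule eventually_conj)
  then obtain l where l: "((1 - l) powr (1 - p) - 1) * ?H < e / 4" "0 < l" "l < 1"
    using eventually_happens[of _ "at_right (0::real)"] by auto
  \<comment> \<open>Bounds the coefficient of the shell mass in \<open>cutoff_split\<close> for all
    exponents 1 < s < p.\<close>
  define C where "C = 2 * l powr (1 - p) * 4 powr p"
  have C0: "C \<ge> 0" by (simp add: C_def)
  \<comment> \<open>After normalisation the lightest of J shells has mass at most 1/J; with this J
    its total cost stays below e/4.\<close>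
  obtain J :: nat where "4 * (C + ?H) / e < real J" using reals_Archimedean2 by blast
  then have J: "J > 0" "(C + ?H) / real J < e / 4"
  proof -
    have "0 \<le> 4 * (C + ?H) / e" using C0 H0 e by simp
    then show "J > 0" using \<open>4 * (C + ?H) / e < real J\<close> by (metis of_nat_0_less_iff le_less_trans)
    then show "(C + ?H) / real J < e / 4"
      using \<open>4 * (C + ?H) / e < real J\<close> e by (simp add: field_simps)
  qed
  have e8: "e / 8 > 0" using e by simp
  obtain \<beta> where \<beta>: "\<beta> > 0" "\<forall>\<^sub>F s in at_left p. \<forall>u\<in>test_functions \<Omega>. (\<forall>x. u x \<noteq> 0 \<longrightarrow> depth \<Omega> x \<le> \<beta>) \<longrightarrow>
    (?H - e / 8) * mass \<Omega> s u \<le> energy s u"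
    using boundary_hardy[OF C2 p e8] by blast
  \<comment> \<open>The outer part of a cut at scale at most b has depth at most 4b = \<beta>,
    inside the strip of \<open>boundary_hardy\<close>.\<close>
  define b where "b = \<beta> / 4"
  define A0 where "A0 = (1 - l) powr (1 - p) * ?H + C"
  \<comment> \<open>The shell selected later depends on v, but its scale never falls below b / 5^J.
    The interior estimate is therefore invoked once, at that depth, uniformly in v.\<close>
  have b: "b > 0" "b / 5 ^ J > 0" using \<beta>(1) by (auto simp: b_def)
  have A0: "A0 \<ge> 0" using H0 C0 by (simp add: A0_def)
  have "\<forall>\<^sub>F s in at_left p. 1 < s \<and> s < p"
    using p by (auto simp: eventually_at_left_field)
  then show ?thesis
    using \<beta>(2) interior_hardy[OF p b(2) A0 e8]
  proof eventually_elim
    case (elim s)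
    then have s: "s > 1" "s < p" by auto
    show ?case
    proof (rule hardy_constant_ge[OF s(1)])
      fix v0 assume v0: "v0 \<in> test_functions \<Omega>"
      note sm = test_functions_smooth[OF v0]
      let ?M = "mass \<Omega> s v0"
      \<comment> \<open>Only functions whose quotient at the exponent s lies below the constant at p
        need work. After normalisation their energy is at most that constant, the a priori bound
        behind \<open>A0\<close>.\<close>
      consider "?M = 0" | "?H * ?M \<le> energy s v0" | "?M > 0" "energy s v0 < ?H * ?M"
        using mass_nonneg[of \<Omega> s v0] by linarith
      then show "(?H - e) * ?M \<le> energy s v0"
      proof cases
        case 1
        then show ?thesis by (simp add: energy_nonneg)
      next
        case 2
        have "(?H - e) * ?M \<le> ?H * ?M" using e mass_nonneg by (intro mult_right_mono) auto
        then show ?thesis using 2 by linarith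
      next
        case 3
        define c where "c = ?M powr (- (1 / s))"
        define v where "v x = c * v0 x" for x
        have c: "\<bar>c\<bar> powr s = inverse ?M"
        proof -
          have "- (1 / s) * s = - 1" using s by simp
          then have "c powr s = ?M powr (- 1)" by (simp only: c_def powr_powr)
          moreover have "c \<ge> 0" by (simp add: c_def)
          ultimately show ?thesis using 3(1) by (simp add: powr_minus)
        qed
        have v: "v \<in> test_functions \<Omega>" unfolding v_def by (rule test_functions_mult[OF smooth_const v0])
        have M: "mass \<Omega> s v = 1" unfolding v_def mass_cmult c using 3(1) by simp
        have Ev: "energy s v = energy s v0 / ?M" unfolding v_def energy_cmult[OF sm] c by (simp add: divide_inverse mult.commute)
        have EH: "energy s v \<le> ?H" unfolding Ev using 3 by (simp add: pos_divide_le_eq)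
        have s0: "s > 0" using s by simp
        obtain j where j: "j < J" "real J * shell_mass (b / 5 ^ j) s v \<le> 1"
          using shell_pigeonhole[OF v s0 b(1) J(1)] M by auto
        define bj where "bj = b / 5 ^ j"
        define m where "m = shell_mass bj s v"
        have m: "m \<le> 1 / real J" "m \<le> 1" "m \<ge> 0"
        proof -
          show "m \<le> 1 / real J" using j(2) J(1) by (simp add: m_def bj_def field_simps)
          show "m \<le> 1" using shell_mass_le[OF v s0, of bj] M b(1) by (simp add: m_def bj_def)
          show "m \<ge> 0" unfolding m_def shell_mass_def by (rule Bochner_Integration.integral_nonneg) simp
        qed
        have bj: "bj > 0" "b / 5 ^ J \<le> bj" "bj \<le> b"
        proof -
          show "bj > 0" using b(1) by (simp add: bj_def)
          show "b / 5 ^ J \<le> bj"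
            unfolding bj_def using b(1) j(1) by (intro divide_left_mono power_increasing) auto
          show "bj \<le> b" unfolding bj_def using b(1) by (simp add: pos_divide_le_eq)
        qed
        obtain \<psi> where \<psi>: "smooth \<psi>" "\<And>x. 0 \<le> \<psi> x" "\<And>x. \<psi> x \<le> 1"
          "\<And>x. depth \<Omega> x \<le> bj \<Longrightarrow> \<psi> x = 0" "\<And>x. 4 * bj \<le> depth \<Omega> x \<Longrightarrow> \<psi> x = 1"
          "\<And>x. norm (grad \<psi> x) \<le> 1 / bj" "\<And>x. grad \<psi> x \<noteq> 0 \<Longrightarrow> bj \<le> depth \<Omega> x \<and> depth \<Omega> x \<le> 4 * bj"
          using cutoff[OF bj(1)] by blast
        define v1 where "v1 = (\<lambda>x. \<psi> x * v x)"
        define v2 where "v2 = (\<lambda>x. (1 - \<psi> x) * v x)"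
        note split = cutoff_split[OF \<psi> bj(1) s(1) l(2,3) v, folded v1_def v2_def m_def]
        have lp: "(1 - l) powr (1 - s) \<le> (1 - l) powr (1 - p)" "l powr (1 - s) \<le> l powr (1 - p)"
          using l s by (auto intro!: powr_mono')
        have "2 * (l powr (1 - s) * 4 powr s) \<le> 2 * (l powr (1 - p) * 4 powr p)"
          using s by (intro mult_left_mono mult_mono[OF lp(2)] powr_mono) auto
        then have Cs: "2 * l powr (1 - s) * 4 powr s \<le> C" by (simp add: C_def mult.assoc)
        have "(1 - l) powr (1 - s) * energy s v \<le> (1 - l) powr (1 - p) * energy s v"
          using lp(1) energy_nonneg by (intro mult_right_mono) auto
        moreover have "2 * l powr (1 - s) * 4 powr s * m \<le> C * m"
          using Cs m(3) by (intro mult_right_mono) auto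
        ultimately have E12: "energy s v1 + energy s v2 \<le> (1 - l) powr (1 - p) * energy s v + C * m"
          using split(3) by linarith
        have E1: "energy s v1 \<le> A0"
        proof -
          have "(1 - l) powr (1 - p) * energy s v \<le> (1 - l) powr (1 - p) * ?H"
            using EH by (intro mult_left_mono) auto
          moreover have "C * m \<le> C * 1" using m(2) C0 by (intro mult_left_mono) auto
          ultimately show ?thesis using E12 energy_nonneg[of s v2] by (simp add: A0_def)
        qed
        have "b / 5 ^ J \<le> depth \<Omega> x" if "v1 x \<noteq> 0" for x
        proof -
          have "\<not> depth \<Omega> x \<le> bj" using that \<psi>(4)[of x] by (auto simp: v1_def)
          then show ?thesis using bj(2) by linarith
        qed
        then have H1: "?H * mass \<Omega> s v1 \<le> energy s v1 + e / 8"
          using elim(3) split(1) E1 by blast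
        have "depth \<Omega> x \<le> \<beta>" if "v2 x \<noteq> 0" for x
        proof -
          have "\<not> 4 * bj \<le> depth \<Omega> x" using that \<psi>(5)[of x] by (auto simp: v2_def)
          then show ?thesis using bj(3) by (simp add: b_def)
        qed
        then have "(?H - e / 8) * mass \<Omega> s v2 \<le> energy s v2"
          using elim(2) split(2) by blast
        moreover have "e / 8 * mass \<Omega> s v2 \<le> e / 8 * 1"
          using split(5) M e by (intro mult_left_mono) auto
        ultimately have H2: "?H * mass \<Omega> s v2 \<le> energy s v2 + e / 8"
          by (simp add: left_diff_distrib)
        have "?H * 1 \<le> ?H * (mass \<Omega> s v1 + mass \<Omega> s v2 + m)"
          using split(4) M H0 by (intro mult_left_mono) auto
        also have "\<dots> = ?H * mass \<Omega> s v1 + ?H * mass \<Omega> s v2 + ?H * m" by (simp add: algebra_simps)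
        also have "\<dots> \<le> (1 - l) powr (1 - p) * energy s v + (C + ?H) * m + e / 4"
          using H1 H2 E12 by (simp add: distrib_right)
        finally have H12: "?H \<le> (1 - l) powr (1 - p) * energy s v + (C + ?H) * m + e / 4" by simp
        have "(C + ?H) * m \<le> (C + ?H) * (1 / real J)"
          using m(1) C0 H0 by (intro mult_left_mono) auto
        then have Jm: "(C + ?H) * m \<le> e / 4" using J(2) unfolding times_divide_eq_right mult_1_right by linarith
        \<comment> \<open>As the energy is at most the constant at p, the factor (1 - l)^(1 - p)
          costs less than an additive e/4. Together with e/4 for the shell and e/8 for each of the
          two Hardy inequalities the loss is below e.\<close>
        have "((1 - l) powr (1 - p) - 1) * energy s v \<le> ((1 - l) powr (1 - p) - 1) * ?H"
        proof (rule mult_left_mono[OF EH])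
          have "1 powr (1 - p) \<le> (1 - l) powr (1 - p)" using l p by (intro powr_mono2') auto
          then show "0 \<le> (1 - l) powr (1 - p) - 1" by simp
        qed
        then have "(1 - l) powr (1 - p) * energy s v \<le> energy s v + ((1 - l) powr (1 - p) - 1) * ?H"
          by (simp add: left_diff_distrib)
        then have "?H - e \<le> energy s v" using H12 Jm l(1) e by linarith
        then show ?thesis unfolding Ev using 3(1) by (simp add: pos_le_divide_eq)
      qed
    qed
  qed
qed

end

theorem theorem6:
  fixes \<Omega> :: "'a::euclidean_space set"
  assumes "open \<Omega>" and "connected \<Omega>" and "\<Omega> \<noteq> {}" and "bounded \<Omega>"
    and "C2_boundary \<Omega>"
  shows "continuous_on {1<..} (\<lambda>p. hardy_constant \<Omega> p)"
proof -
  interpret bounded_open \<Omega> by (intro bounded_open.intro assms)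
  have "((\<lambda>p. hardy_constant \<Omega> p) \<longlongrightarrow> hardy_constant \<Omega> p) (at p)" if p: "p > 1" for p
  proof (rule tendstoI)
    fix e :: real assume e: "e > 0"
    \<comment> \<open>The estimate from the left is not strict, hence half of e.\<close>
    then have e2: "e / 2 > 0" by simp
    have "\<forall>\<^sub>F s in at p. hardy_constant \<Omega> s < hardy_constant \<Omega> p + e"
      using hardy_constant_upper_semicontinuous[OF p e] at_within_open[of p "{1<..}"] p by simp
    moreover have "\<forall>\<^sub>F s in at p. hardy_constant \<Omega> p - e < hardy_constant \<Omega> s"
      unfolding eventually_at_split
    proof
      show "\<forall>\<^sub>F s in at_left p. hardy_constant \<Omega> p - e < hardy_constant \<Omega> s"
        using hardy_constant_left_lower_semicontinuous[OF assms(5) p e2]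
        by eventually_elim (use e in linarith)
      show "\<forall>\<^sub>F s in at_right p. hardy_constant \<Omega> p - e < hardy_constant \<Omega> s"
        by (rule hardy_constant_right_lower_semicontinuous[OF p e])
    qed
    ultimately show "\<forall>\<^sub>F s in at p. dist (hardy_constant \<Omega> s) (hardy_constant \<Omega> p) < e"
      by eventually_elim (auto simp: dist_real_def)
  qed
  then show ?thesis
    by (auto simp: continuous_on_def intro: tendsto_within_subset)
qed

end
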